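(* Let $\bar p>2$. Assume the following. (1) Exponential family. (a) There exist continuous functions $\phi:\Theta\to\mathbb{R}$, $\psi:\Theta\to\mathbb{R}^d$ and $S:\mathbb{X}\times\mathbb{X}\times\mathbb{Y}\to\mathbb{R}^d$ such that $\log m_\theta(x,x')+\log g_\theta(x',y)=\phi(\theta)+\langle S(x,x',y),\psi(\theta)\rangle$ for all $\theta,x,x',y$. (b) There is an open set $\mathcal{S}\subset\mathbb{R}^d$ containing the convex hull of $S(\mathbb{X}\times\mathbb{X}\times\mathbb{Y})$. (c) There is a continuous function $\bar\theta:\mathcal{S}\to\Theta$ such that for every $s\in\mathcal{S}$, $\bar\theta(s)$ is the unique maximizer over $\Theta$ of $\theta\mapsto\phi(\theta)+\langle s,\psi(\theta)\rangle$. (2) Strong mixing. There exist $\sigma_-,\sigma_+$ with $0<\sigma_-\le m_\theta(x,x')\le\sigma_+$ for all $(x,x')\in\mathbb{X}^2$, $\theta\in\Theta$; set $\rho:=1-\sigma_-/\sigma_+$. (3) Moments. $\mathbb{E}\big[\sup_{(x,x')\in\mathbb{X}^2}|S(x,x',Y_0)|^{\bar p}\big]<\infty$. (4) Observations. (a) $\mathbf{Y}$ is stationary and there exist $C_0\in[0,1)$ and $\beta\in(0,1)$ with $\beta^{\mathbf{Y}}(n)\le C_0\beta^n$ for all $n\ge0$. (b) $\mathbb{E}[|\log b_-(Y_0)|+|\log b_+(Y_0)|]<\infty$, where $b_-(y)=\inf_{\theta\in\Theta}\int g_\theta(x,y)\lambda(\mathrm{d}x)$ and $b_+(y)=\sup_{\theta\in\Theta}\int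 g_\theta(x,y)\lambda(\mathrm{d}x)$. Then: (i) There is a finite constant $C$ and, for any $\theta\in\Theta$, a random variable $\mathsf{S}(\theta,\mathbf{Y})$ such that $\mathbb{P}$-a.s., for every integer $\tau\ge1$, $$\sup_{\theta\in\Theta,\ \chi\in\mathcal{M}(\mathbb{X})}\left|\Phi^{\chi,-\tau-1}_{\theta,0,\tau}(S,\mathbf{Y})-\mathsf{S}(\theta,\mathbf{Y})\right|\le C\rho^{\tau}\sup_{(x,x')\in\mathbb{X}^2}|S(x,x',Y_0)|.$$ Define $\bar{\mathrm S}(\theta):=\mathbb{E}[\mathsf{S}(\theta,\mathbf{Y})]$ for $\theta\in\Theta$. (ii) $\theta\mapsto\bar{\mathrm S}(\theta)$ is continuous on $\Theta$, and for any integer $T>0$, any $\theta\in\Theta$ and any $\chi\in\mathcal{M}(\mathbb{X})$, $\bar S^{\chi,T}_\tau(\theta,\mathbf{Y})\to\bar{\mathrm S}(\theta)$ as $\tau\to+\infty$, $\mathbb{P}$-a.s. (iii) Assume in addition that there exist $c>0$ and $a>1$ with $\tau_n=\lfloor cn^a\rfloor$ for all $n\ge1$, and that there exists $b\ge(a+1)/(2a)$ such that $\|S_n-\widetilde S_n\|_{\bar p}=O(\tau_{n+1}^{-b})$. Then for any $p\in(2,\bar p)$ there exists a constant $C$ such that for any $n\ge1$, $$\left\|\widetilde S_n-\bar{\mathrm S}(\theta_n)\right\|_p\le\frac{C}{\sqrt{\tau_{n+1}}}.$$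
   Context: Model. $\Theta$ is a compact subset of $\mathbb{R}^{d_\theta}$; $(\mathbb{X},\mathcal{X})$ and $(\mathbb{Y},\mathcal{Y})$ are general state spaces with their $\sigma$-fields (and topologies, with respect to which continuity is understood); $\lambda$ is a finite measure on $(\mathbb{X},\mathcal{X})$ and $\mu$ a $\sigma$-finite measure on $(\mathbb{Y},\mathcal{Y})$. For $\theta\in\Theta$, $m_\theta(x,\cdot)$ is a Markov transition density with respect to $\lambda$ and $g_\theta(x,\cdot)$ is a transition density from $\mathbb{X}$ to $\mathbb{Y}$ with respect to $\mu$. $\mathcal{M}(\mathbb{X})$ is the set of probability distributions on $(\mathbb{X},\mathcal{X})$. Observations. $\mathbf{Y}=\{Y_k\}_{k\in\mathbb{Z}}$ is a $\mathbb{Y}$-valued process on a probability space $(\Omega,\mathcal{F},\mathbb{P})$, not necessarily the observation process of a hidden Markov model with state transition density $m_\theta$ and observation density $g_\theta$ for some $\theta\in\Theta$; $\mathbb{E}$ is expectation under $\mathbb{P}$ and $\|Z\|_p=(\mathbb{E}|Z|^p)^{1/p}$. With $\mathcal{F}^{\mathbf{Y}}_k=\sigma(Y_u,u\le k)$ and $\mathcal{G}^{\mathbf{Y}}_k=\sigma(Y_u,u\ge k)$, the $\beta$-mixing coefficients are $\beta^{\mathbf{Y}}(n)=\sup_{u\in\mathbb{Z}}\mathbb{E}\big[\operatorname{ess\,sup}_{B\in\mathcal{G}^{\mathbf{Y}}_{u+n}}|\mathbb{P}(B|\mathcal{F}^{\mathbf{Y}}_u)-\mathbb{P}(B)|\big]$.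 Smoothing. For $\chi\in\mathcal{M}(\mathbb{X})$, integers $r<s\le t$, $\mathbf{y}\in\mathbb{Y}^{\mathbb{Z}}$ and a function $h$ on $\mathbb{X}^2\times\mathbb{Y}$, $$\Phi^{\chi,r}_{\theta,s,t}(h,\mathbf{y})=\frac{\int\chi(\mathrm{d}x_r)\prod_{i=r}^{t-1}\{m_\theta(x_i,x_{i+1})g_\theta(x_{i+1},y_{i+1})\}\,h(x_{s-1},x_s,y_s)\,\lambda(\mathrm{d}x_{r+1:t})}{\int\chi(\mathrm{d}x_r)\prod_{i=r}^{t-1}\{m_\theta(x_i,x_{i+1})g_\theta(x_{i+1},y_{i+1})\}\,\lambda(\mathrm{d}x_{r+1:t})},$$ i.e. the conditional expectation of $h(X_{s-1},X_s,y_s)$ given observations $y_{r+1:t}$ when $X_r\sim\chi$. For integers $T\ge 0$, $\tau\ge1$: $\bar S^{\chi,T}_\tau(\theta,\mathbf{Y})=\frac1\tau\sum_{t=T+1}^{T+\tau}\Phi^{\chi,T}_{\theta,t,T+\tau}(S,\mathbf{Y})$. Block Online EM (BOEM) algorithm with Monte Carlo approximation. $\{\tau_n\}_{n\ge1}$ is a sequence of positive integers tending to $+\infty$, $T_0=0$, $T_n=\sum_{k=1}^n\tau_k$, $\{\chi_n\}_{n\ge0}\subset\mathcal{M}(\mathbb{X})$. Given $\theta_0\in\Theta$, for $n\ge0$: $S_n=\bar S^{\chi_n,T_n}_{\tau_{n+1}}(\theta_n,\mathbf{Y})$, $\widetilde S_n$ is an $\mathcal{S}$-valued Monte Carlo approximation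 of $S_n$, and $\theta_{n+1}=\bar\theta(\widetilde S_n)$. There is a nondecreasing family of $\sigma$-algebras $\mathcal{H}_{T_n}$ (generated by the simulation random variables), independent of $\mathbf{Y}$, such that with $\widetilde{\mathcal F}_{T_n}=\sigma(\mathcal{F}^{\mathbf{Y}}_{T_n},\mathcal{H}_{T_n})$, $\theta_n$ is $\widetilde{\mathcal F}_{T_n}$-measurable and $\widetilde S_n$ is $\widetilde{\mathcal F}_{T_{n+1}}$-measurable. *)

theory Defs
  imports "HOL-Probability.Probability" "HOL-Library.Landau_Symbols"
begin

section \<open>Transition densities and smoothing distributions\<close>

definition transition_density :: "'a measure \<Rightarrow> 'b measure \<Rightarrow> ('a \<Rightarrow> 'b \<Rightarrow> real) \<Rightarrow> bool" where
  "transition_density M N k \<longleftrightarrow>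
     (\<lambda>(a, b). k a b) \<in> borel_measurable (M \<Otimes>\<^sub>M N) \<and>
     (\<forall>a\<in>space M. \<forall>b\<in>space N. 0 \<le> k a b) \<and>
     (\<forall>a\<in>space M. (\<integral>\<^sup>+ b. ennreal (k a b) \<partial>N) = 1)"

text \<open>
  The measure \<open>chi(dx_r) lambda(dx_{r+1}) ... lambda(dx_t)\<close> on paths indexed by
  \<open>r, ..., t\<close>.
\<close>

definition path_measure :: "'x measure \<Rightarrow> 'x measure \<Rightarrow> int \<Rightarrow> int \<Rightarrow> (int \<Rightarrow> 'x) measure" where
  "path_measure lam chi r t = Pi\<^sub>M {r..t} (\<lambda>i. if i = r then chi else lam)"

definition path_lik ::
    "('p \<Rightarrow> 'x \<Rightarrow> 'x \<Rightarrow> real) \<Rightarrow> ('p \<Rightarrow> 'x \<Rightarrow> 'y \<Rightarrow> real) \<Rightarrow> 'p \<Rightarrow> int \<Rightarrow> int \<Rightarrow>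
     (int \<Rightarrow> 'y) \<Rightarrow> (int \<Rightarrow> 'x) \<Rightarrow> real" where
  "path_lik m g th r t y x =
     (\<Prod>i\<in>{r..<t}. m th (x i) (x (i + 1)) * g th (x (i + 1)) (y (i + 1)))"

definition Phi ::
    "'x measure \<Rightarrow> ('p \<Rightarrow> 'x \<Rightarrow> 'x \<Rightarrow> real) \<Rightarrow> ('p \<Rightarrow> 'x \<Rightarrow> 'y \<Rightarrow> real) \<Rightarrow>
     'x measure \<Rightarrow> int \<Rightarrow> 'p \<Rightarrow> int \<Rightarrow> int \<Rightarrow>
     ('x \<times> 'x \<times> 'y \<Rightarrow> 'e::{banach, second_countable_topology}) \<Rightarrow> (int \<Rightarrow> 'y) \<Rightarrow> 'e" where
  "Phi lam m g chi r th s t h y =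
     (\<integral>x. path_lik m g th r t y x *\<^sub>R h (x (s - 1), x s, y s) \<partial>path_measure lam chi r t)
       /\<^sub>R (\<integral>x. path_lik m g th r t y x \<partial>path_measure lam chi r t)"

definition Sbar ::
    "'x measure \<Rightarrow> ('p \<Rightarrow> 'x \<Rightarrow> 'x \<Rightarrow> real) \<Rightarrow> ('p \<Rightarrow> 'x \<Rightarrow> 'y \<Rightarrow> real) \<Rightarrow>
     ('x \<times> 'x \<times> 'y \<Rightarrow> 'e::{banach, second_countable_topology}) \<Rightarrow>
     'x measure \<Rightarrow> int \<Rightarrow> nat \<Rightarrow> 'p \<Rightarrow> (int \<Rightarrow> 'y) \<Rightarrow> 'e" where
  "Sbar lam m g S chi T tau th y =
     (\<Sum>t\<in>{T + 1..T + int tau}. Phi lam m g chi T th t (T + int tau) S y) /\<^sub>R real tau"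

text \<open>\<open>sup |S(x, x', y)|\<close> over all pairs of states, as an extended number.\<close>

definition sup_norm_at :: "('x \<times> 'x \<times> 'y \<Rightarrow> 'e::real_normed_vector) \<Rightarrow> 'y \<Rightarrow> ennreal" where
  "sup_norm_at S y = (SUP (x, x')\<in>UNIV. ennreal (norm (S (x, x', y))))"


section \<open>Extended-valued expectations\<close>

definition finite_expectation :: "'w measure \<Rightarrow> ('w \<Rightarrow> ennreal) \<Rightarrow> bool" where
  "finite_expectation P Z \<longleftrightarrow> Z \<in> borel_measurable P \<and> (\<integral>\<^sup>+ w. Z w \<partial>P) < \<infinity>"

text \<open>\<open>|log b|\<close> with \<open>|log 0| = |log \<infinity>| = \<infinity>\<close>; the library has \<open>ln 0 = 0\<close>.\<close>

definition abs_log :: "ennreal \<Rightarrow> ennreal" where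
  "abs_log b = (if b = 0 \<or> b = \<infinity> then \<infinity> else ennreal \<bar>ln (enn2real b)\<bar>)"

definition b_minus :: "'x measure \<Rightarrow> ('p \<Rightarrow> 'x \<Rightarrow> 'y \<Rightarrow> real) \<Rightarrow> 'p set \<Rightarrow> 'y \<Rightarrow> ennreal" where
  "b_minus lam g Theta y = (INF th\<in>Theta. \<integral>\<^sup>+ x. ennreal (g th x y) \<partial>lam)"

definition b_plus :: "'x measure \<Rightarrow> ('p \<Rightarrow> 'x \<Rightarrow> 'y \<Rightarrow> real) \<Rightarrow> 'p set \<Rightarrow> 'y \<Rightarrow> ennreal" where
  "b_plus lam g Theta y = (SUP th\<in>Theta. \<integral>\<^sup>+ x. ennreal (g th x y) \<partial>lam)"

text \<open>
  The norm \<open>(E |Z|^p)^{1/p}\<close>, with value \<open>\<infinity>\<close> when the moment is infinite.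
\<close>

definition Lp_norm :: "'w measure \<Rightarrow> real \<Rightarrow> ('w \<Rightarrow> 'e::real_normed_vector) \<Rightarrow> ennreal" where
  "Lp_norm P p Z =
     (let I = \<integral>\<^sup>+ w. ennreal (norm (Z w) powr p) \<partial>P
      in if I = \<infinity> then \<infinity> else ennreal (enn2real I powr (1 / p)))"


section \<open>Stationarity and mixing\<close>

definition stationary_process :: "'w measure \<Rightarrow> 'y measure \<Rightarrow> (int \<Rightarrow> 'w \<Rightarrow> 'y) \<Rightarrow> bool" where
  "stationary_process P N Y \<longleftrightarrow>
     (\<forall>k. distr P (Pi\<^sub>M UNIV (\<lambda>_. N)) (\<lambda>w i. Y (i + k) w) =
          distr P (Pi\<^sub>M UNIV (\<lambda>_. N)) (\<lambda>w i. Y i w))"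

text \<open>The \<open>\<sigma>\<close>-algebra generated by \<open>Y u\<close>, \<open>u \<in> I\<close>.\<close>

definition process_sigma ::
    "'w measure \<Rightarrow> 'y measure \<Rightarrow> (int \<Rightarrow> 'w \<Rightarrow> 'y) \<Rightarrow> int set \<Rightarrow> 'w measure" where
  "process_sigma P N Y I =
     sigma (space P) (\<Union>u\<in>I. {Y u -` A \<inter> space P | A. A \<in> sets N})"

text \<open>
  The essential supremum of a possibly uncountable family of random variables: the
  almost surely least random variable that dominates each member almost surely.
  (The library's \<open>esssup\<close> is the essential supremum of a single function.)
\<close>

definition is_ess_sup_family ::
    "'w measure \<Rightarrow> 'i set \<Rightarrow> ('i \<Rightarrow> 'w \<Rightarrow> ennreal) \<Rightarrow> ('w \<Rightarrow> ennreal) \<Rightarrow> bool" where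
  "is_ess_sup_family M I X Z \<longleftrightarrow>
     Z \<in> borel_measurable M \<and>
     (\<forall>i\<in>I. AE w in M. X i w \<le> Z w) \<and>
     (\<forall>W\<in>borel_measurable M. (\<forall>i\<in>I. AE w in M. X i w \<le> W w) \<longrightarrow> (AE w in M. Z w \<le> W w))"

definition ess_sup_family ::
    "'w measure \<Rightarrow> 'i set \<Rightarrow> ('i \<Rightarrow> 'w \<Rightarrow> ennreal) \<Rightarrow> 'w \<Rightarrow> ennreal" where
  "ess_sup_family M I X = (SOME Z. is_ess_sup_family M I X Z)"

lemma is_ess_sup_family_exists:
  fixes X :: "'i \<Rightarrow> 'w \<Rightarrow> ennreal"
  assumes "finite_measure M"
    and X: "\<And>i. i \<in> I \<Longrightarrow> X i \<in> borel_measurable M"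
    and bound: "\<And>i. i \<in> I \<Longrightarrow> AE w in M. X i w \<le> c" and c: "c < \<infinity>"
  shows "is_ess_sup_family M I X (ess_sup_family M I X)"
proof -
  interpret finite_measure M by fact
  define U where "U J w = (SUP i\<in>J. X i w)" for J w
  define CC where "CC = {J. J \<subseteq> I \<and> countable J}"
  have U_meas: "U J \<in> borel_measurable M" if "J \<in> CC" for J
    using that X unfolding U_def CC_def by (auto intro!: borel_measurable_SUP)
  have U_AE: "AE w in M. U J w \<le> W w" if "J \<in> CC" "\<And>i. i \<in> I \<Longrightarrow> AE w in M. X i w \<le> W w" for J W
  proof -
    have "AE w in M. \<forall>i\<in>J. X i w \<le> W w"
      using that unfolding CC_def by (subst AE_ball_countable) auto
    then show ?thesis
      unfolding U_def by eventually_elim (auto intro!: SUP_least)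
  qed
  define s where "s = (SUP J\<in>CC. \<integral>\<^sup>+ w. U J w \<partial>M)"
  have CC_ne: "CC \<noteq> {}" unfolding CC_def by auto
  have s_fin: "s < \<infinity>"
  proof -
    have "s \<le> c * emeasure M (space M)"
      unfolding s_def
    proof (rule SUP_least)
      fix J assume "J \<in> CC"
      then have "(\<integral>\<^sup>+ w. U J w \<partial>M) \<le> (\<integral>\<^sup>+ w. c \<partial>M)"
        by (intro nn_integral_mono_AE U_AE bound)
      then show "(\<integral>\<^sup>+ w. U J w \<partial>M) \<le> c * emeasure M (space M)" by simp
    qed
    also have "\<dots> < \<infinity>"
      using c emeasure_finite[of "space M"] by (auto simp: less_top[symmetric] ennreal_mult_eq_top_iff)
    finally show ?thesis .
  qed
  obtain f where f: "range f \<subseteq> (\<lambda>J. \<integral>\<^sup>+ w. U J w \<partial>M) ` CC" "s = (SUP n::nat. f n)"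
    unfolding s_def using ennreal_SUP_countable_SUP[OF CC_ne] by metis
  then have "\<forall>n. \<exists>J. J \<in> CC \<and> f n = (\<integral>\<^sup>+ w. U J w \<partial>M)" by (auto simp: image_iff subset_iff)
  then obtain J where J: "\<And>n. J n \<in> CC" "\<And>n. f n = (\<integral>\<^sup>+ w. U (J n) w \<partial>M)" by metis
  define K where "K = (\<Union>n. J n)"
  have K: "K \<in> CC" using J(1) unfolding K_def CC_def by auto
  have mono: "U A w \<le> U B w" if "A \<subseteq> B" for A B w
    using that unfolding U_def by (rule SUP_subset_mono) auto
  have le_s: "(\<integral>\<^sup>+ w. U A w \<partial>M) \<le> s" if "A \<in> CC" for A
    unfolding s_def using that by (rule SUP_upper)
  have s_le: "s \<le> (\<integral>\<^sup>+ w. U K w \<partial>M)"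
    unfolding f(2) J(2)
    by (rule SUP_least) (intro nn_integral_mono mono, auto simp: K_def)
  have "is_ess_sup_family M I X (U K)"
    unfolding is_ess_sup_family_def
  proof (intro conjI ballI impI)
    show "U K \<in> borel_measurable M" by (rule U_meas[OF K])
  next
    fix i assume i: "i \<in> I"
    have Ki: "insert i K \<in> CC" using K i by (auto simp: CC_def)
    have "(\<integral>\<^sup>+ w. U (insert i K) w \<partial>M) = (\<integral>\<^sup>+ w. U K w \<partial>M)"
      using order_trans[OF le_s[OF Ki] s_le] nn_integral_mono[OF mono[OF subset_insertI]]
      by (intro antisym)
    moreover have "(\<integral>\<^sup>+ w. U K w \<partial>M) \<noteq> \<infinity>" using le_s[OF K] s_fin by auto
    ultimately have "(\<integral>\<^sup>+ w. (U (insert i K) w - U K w) \<partial>M) = 0"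
      by (subst nn_integral_diff) (auto intro!: U_meas K Ki mono simp: subset_insertI)
    then have "AE w in M. U (insert i K) w - U K w = 0"
      using U_meas[OF K] U_meas[OF Ki] by (subst (asm) nn_integral_0_iff_AE) auto
    then show "AE w in M. X i w \<le> U K w"
    proof eventually_elim
      case (elim w)
      have "X i w \<le> U (insert i K) w" unfolding U_def by (rule SUP_upper) auto
      also have "\<dots> \<le> U K w" using elim by (simp add: diff_eq_0_iff_ennreal)
      finally show ?case .
    qed
  next
    fix W assume "\<forall>i\<in>I. AE w in M. X i w \<le> W w"
    then show "AE w in M. U K w \<le> W w" by (intro U_AE K) auto
  qed
  then show ?thesis unfolding ess_sup_family_def by (rule someI[of "is_ess_sup_family M I X"])
qed

definition beta_mixing ::
    "'w measure \<Rightarrow> 'y measure \<Rightarrow> (int \<Rightarrow> 'w \<Rightarrow> 'y) \<Rightarrow> nat \<Rightarrow> ennreal" where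
  "beta_mixing P N Y n =
     (SUP u. \<integral>\<^sup>+ w. ess_sup_family P (sets (process_sigma P N Y {u + int n..}))
        (\<lambda>B w'. ennreal \<bar>real_cond_exp P (process_sigma P N Y {..u}) (indicator B) w' - measure P B\<bar>) w
      \<partial>P)"


section \<open>The block online EM algorithm\<close>

definition block_time :: "(nat \<Rightarrow> nat) \<Rightarrow> nat \<Rightarrow> nat" where
  "block_time tau n = (\<Sum>k=1..n. tau k)"

definition block_stat ::
    "'x measure \<Rightarrow> ('p \<Rightarrow> 'x \<Rightarrow> 'x \<Rightarrow> real) \<Rightarrow> ('p \<Rightarrow> 'x \<Rightarrow> 'y \<Rightarrow> real) \<Rightarrow>
     ('x \<times> 'x \<times> 'y \<Rightarrow> 'e::{banach, second_countable_topology}) \<Rightarrow> (int \<Rightarrow> 'w \<Rightarrow> 'y) \<Rightarrow>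
     (nat \<Rightarrow> nat) \<Rightarrow> (nat \<Rightarrow> 'x measure) \<Rightarrow> (nat \<Rightarrow> 'w \<Rightarrow> 'p) \<Rightarrow> nat \<Rightarrow> 'w \<Rightarrow> 'e" where
  "block_stat lam m g S Y tau chi theta n w =
     Sbar lam m g S (chi n) (int (block_time tau n)) (tau (Suc n)) (theta n w) (\<lambda>k. Y k w)"

text \<open>
  The \<open>\<sigma>\<close>-algebra generated by \<open>F\<^sup>Y_{T_n}\<close> and \<open>H_{T_n}\<close>; here \<open>H n\<close> stands for
  \<open>H_{T_n}\<close>, and \<open>\<sigma>\<close>-algebras on the sample space are represented by measures, of which
  only the measurable sets matter.
\<close>

definition joint_sigma ::
    "'w measure \<Rightarrow> 'y measure \<Rightarrow> (int \<Rightarrow> 'w \<Rightarrow> 'y) \<Rightarrow> (nat \<Rightarrow> nat) \<Rightarrow> (nat \<Rightarrow> 'w measure) \<Rightarrow>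
     nat \<Rightarrow> 'w measure" where
  "joint_sigma P N Y tau H n =
     sigma (space P) (sets (process_sigma P N Y {..int (block_time tau n)}) \<union> sets (H n))"

text \<open>
  \<open>(theta n)\<close> and \<open>(Stil n)\<close> are the parameter and (Monte Carlo) statistic sequences of the
  block online EM algorithm with M-step map \<open>thbar\<close>. The value \<open>tau 0\<close> is never used.
\<close>

definition boem ::
    "'w measure \<Rightarrow> 'y measure \<Rightarrow> (int \<Rightarrow> 'w \<Rightarrow> 'y) \<Rightarrow> 'x measure \<Rightarrow>
     'p::topological_space set \<Rightarrow> 'e::topological_space set \<Rightarrow> ('e \<Rightarrow> 'p) \<Rightarrow>
     (nat \<Rightarrow> nat) \<Rightarrow> (nat \<Rightarrow> 'x measure) \<Rightarrow> (nat \<Rightarrow> 'w measure) \<Rightarrow>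
     (nat \<Rightarrow> 'w \<Rightarrow> 'p) \<Rightarrow> (nat \<Rightarrow> 'w \<Rightarrow> 'e) \<Rightarrow> bool" where
  "boem P N Y lam Theta D thbar tau chi H theta Stil \<longleftrightarrow>
     (\<forall>n\<ge>1. 0 < tau n) \<and> filterlim tau at_top sequentially \<and>
     (\<forall>n. chi n \<in> space (prob_algebra lam)) \<and>
     (\<forall>n. subalgebra P (H n)) \<and> (\<forall>n. sets (H n) \<subseteq> sets (H (Suc n))) \<and>
     (\<forall>n. prob_space.indep_set P (sets (H n)) (sets (process_sigma P N Y UNIV))) \<and>
     (\<forall>w\<in>space P. theta 0 w \<in> Theta) \<and>
     (\<forall>n. \<forall>w\<in>space P. Stil n w \<in> D \<and> theta (Suc n) w = thbar (Stil n w)) \<and>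
     (\<forall>n. theta n \<in> borel_measurable (joint_sigma P N Y tau H n)) \<and>
     (\<forall>n. Stil n \<in> borel_measurable (joint_sigma P N Y tau H (Suc n)))"

end

theory Submission
  imports Defs "HOL-Real_Asymp.Real_Asymp"
begin

text \<open>
  Under strong mixing the posterior state chain, run forwards or backwards, satisfies a Doeblin
  condition with constant \<open>sigma_minus / sigma_plus\<close>, so smoothing functionals forget their initial law
  and remote observations at rate \<open>rho\<close>; this gives the limit \<open>Slim\<close> and lets each smoothed statistic be
  replaced by a function of finitely many observations. For fixed parameters, \<open>\<beta>\<close>-mixing then makes
  the \<open>p\<close>-th moment of the centred sum over a block of length \<open>n\<close> of order \<open>n powr (p / 2)\<close>, by halving the
  block repeatedly. In the algorithm the parameter of a block depends on the past; leaving a gap and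
  applying \<open>\<beta>\<close>-mixing conditionally decouples it from the block, so that it can be treated as fixed.
  The smaller exponent \<open>p < pbar\<close> pays for the mixing error.
\<close>

text \<open>Three obstacles shape the details. \<open>S\<close> may be unbounded, and its supremum
  over the states need not be measurable in the observation, so essential suprema take its place.
  These are blind to an initial law that is singular to \<open>lam\<close>; hence the first time of
  a block carries an envelope of its own. Next, mixing controls bounded variables while only moments
  up to order \<open>q\<close> exist, so each use of mixing truncates at a level that its decay
  still beats and pays for the tail with the moment of order \<open>q\<close>. Finally, the
  parameter of a block is random, so constants must be fixed before the parameter, the initial law
  and the start of the block. The deviation of a block is split accordingly: \<open>main\<close>
  depends on the parameter but only on observations behind a gap, and \<open>remainder\<close> is a
  pathwise bound in which no parameter occurs. Only \<open>main\<close> has to be decoupled.\<close>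

section \<open>Elementary inequalities\<close>

text \<open>With \<open>e\<close> chosen so that (1 + e)^p = 1 + d, either y is at most e x, or x is
  less than y / e. The factor 1 + d close to one lets small errors be added without destroying a
  contraction.\<close>

lemma powr_add_le_eps:
  assumes p: "(0::real) < p" and d: "0 < d"
  obtains C where "0 \<le> C" "\<And>x y. 0 \<le> x \<Longrightarrow> 0 \<le> y \<Longrightarrow> (x + y) powr p \<le> (1 + d) * x powr p + C * y powr p"
proof -
  define e where "e = (1 + d) powr (1 / p) - 1"
  have e: "0 < e" unfolding e_def using assms by (simp add: gr_one_powr)
  show thesis
  proof (rule that[of "(1 + 1 / e) powr p"])
    fix x y :: real assume xy: "0 \<le> x" "0 \<le> y"
    show "(x + y) powr p \<le> (1 + d) * x powr p + (1 + 1 / e) powr p * y powr p"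
    proof (cases "y \<le> e * x")
      case True
      then have "(x + y) powr p \<le> ((1 + e) * x) powr p"
        using xy p by (intro powr_mono2) (auto simp: algebra_simps)
      also have "\<dots> = (1 + d) * x powr p" using xy e p d by (simp add: powr_mult e_def powr_powr)
      finally show ?thesis by (rule order_trans) simp
    next
      case False
      then have "(x + y) powr p \<le> ((1 + 1 / e) * y) powr p"
        using xy p e by (intro powr_mono2) (auto simp: field_simps)
      also have "\<dots> = (1 + 1 / e) powr p * y powr p" using xy e by (simp add: powr_mult)
      finally show ?thesis by (rule order_trans) (use d in simp)
    qed
  qed simp
qed

text \<open>If b is the smaller number, the mean value theorem writes (a + b)^p - a^p as b p z^(p-1)
  with z below 2 a. Both pure powers keep coefficient one: a convexity factor 2^(p-1) would ruin the
  doubling recursion.\<close>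

lemma powr_add_le_cross:
  assumes p: "(1::real) \<le> p" and ab: "0 \<le> a" "0 \<le> b"
  shows "(a + b) powr p \<le> a powr p + b powr p
    + p * 2 powr (p - 1) * (a powr (p - 1) * b + a * b powr (p - 1))"
proof -
  have *: "(a + b) powr p \<le> a powr p + p * 2 powr (p - 1) * (a powr (p - 1) * b)"
    if b: "0 \<le> b" "b \<le> a" for a b :: real
  proof (cases "b = 0")
    case False
    with b have a: "0 < a" "0 < b" by auto
    have "\<exists>z. a < z \<and> z < a + b \<and> (a + b) powr p - a powr p = (a + b - a) * (p * z powr (p - 1))"
      using a p by (intro MVT2 has_real_derivative_powr) auto
    then obtain z where z: "a < z" "z < a + b" "(a + b) powr p - a powr p = b * (p * z powr (p - 1))"
      by auto
    have "z powr (p - 1) \<le> (2 * a) powr (p - 1)" using z a b p by (intro powr_mono2) auto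
    then have "b * (p * z powr (p - 1)) \<le> b * (p * (2 powr (p - 1) * a powr (p - 1)))"
      using a p by (intro mult_left_mono) (auto simp: powr_mult)
    with z(3) show ?thesis by (simp add: mult_ac)
  qed simp
  have nn: "0 \<le> p * 2 powr (p - 1) * (a powr (p - 1) * b)" "0 \<le> p * 2 powr (p - 1) * (a * b powr (p - 1))"
    using ab p by auto
  have "(a + b) powr p \<le> a powr p + b powr p
    + (p * 2 powr (p - 1) * (a powr (p - 1) * b) + p * 2 powr (p - 1) * (a * b powr (p - 1)))"
  proof (cases "b \<le> a")
    case True
    with * ab have "(a + b) powr p \<le> a powr p + p * 2 powr (p - 1) * (a powr (p - 1) * b)" by blast
    moreover have "0 \<le> b powr p" by simp
    ultimately show ?thesis using nn by linarith
  next
    case False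
    with *[of a b] ab have "(a + b) powr p \<le> b powr p + p * 2 powr (p - 1) * (b powr (p - 1) * a)"
      by (simp add: add.commute)
    moreover have "0 \<le> a powr p" by simp
    ultimately show ?thesis using nn by (simp only: mult.commute[of a])
  qed
  then show ?thesis by (simp add: distrib_left)
qed

text \<open>The sum is at most the number of terms times the largest one. Convexity would give a
  smaller power of the number of terms for p at least 1, but a polynomial loss is harmless for the
  later applications.\<close>

lemma powr_sum_le:
  assumes p: "(0::real) < p" and v: "\<And>i. i \<in> I \<Longrightarrow> 0 \<le> v i"
  shows "(\<Sum>i\<in>I. v i) powr p \<le> real (card I) powr p * (\<Sum>i\<in>I. v i powr p)"
proof (cases "finite I \<and> I \<noteq> {}")
  case True
  then have fin: "finite I" "I \<noteq> {}" by auto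
  define m where "m = Max (v ` I)"
  have "m \<in> v ` I" unfolding m_def using fin by (intro Max_in) auto
  then obtain k where k: "k \<in> I" "m = v k" by blast
  have "(\<Sum>i\<in>I. v i) \<le> real (card I) * m"
    using sum_bounded_above[of I v m] fin by (auto simp: m_def)
  then have "(\<Sum>i\<in>I. v i) powr p \<le> (real (card I) * m) powr p"
    using p v by (intro powr_mono2 sum_nonneg) auto
  also have "\<dots> = real (card I) powr p * v k powr p" using v k by (simp add: powr_mult)
  also have "\<dots> \<le> real (card I) powr p * (\<Sum>i\<in>I. v i powr p)"
    using k fin by (intro mult_left_mono member_le_sum) auto
  finally show ?thesis .
qed auto

text \<open>An additive substitute for Lyapunov's inequality: beyond the free scale \<open>e\<close>
  the larger exponent dominates. It integrates without taking roots.\<close>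

lemma powr_le_scaled:
  assumes "0 \<le> z" "0 < e" "0 < p'" "p' \<le> (p::real)"
  shows "z powr p' \<le> e powr p' + e powr (p' - p) * z powr p"
proof (cases "z \<le> e")
  case True
  then have "z powr p' \<le> e powr p'" using assms by (intro powr_mono2) auto
  then show ?thesis by (rule order_trans) simp
next
  case False
  then have z: "0 < z" "1 \<le> z / e" using assms by auto
  have "z powr p' = e powr p' * (z / e) powr p'" using z assms by (simp add: powr_divide)
  also have "\<dots> \<le> e powr p' * (z / e) powr p" using z assms by (intro mult_left_mono powr_mono) auto
  also have "\<dots> = e powr (p' - p) * z powr p" using z assms by (simp add: powr_divide powr_diff)
  finally show ?thesis by (rule order_trans) simp
qed

text \<open>If one factor exceeds \<open>M\<close>, the product is at most x^(e + e') with x the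
  larger factor, and the missing power of x / M up to q is free because x / M is at least 1. The
  truncated product is bounded, which is what covariance inequalities need.\<close>

lemma powr_prod_truncate:
  assumes ab: "0 \<le> a" "0 \<le> b" "0 < M" and e: "0 < e" "0 < e'" "e + e' \<le> (q::real)"
  shows "a powr e * b powr e' \<le> min a M powr e * min b M powr e' + M powr (e + e' - q) * (a powr q + b powr q)"
proof (cases "a \<le> M \<and> b \<le> M")
  case True
  then show ?thesis using ab by (auto simp: min_def)
next
  case False
  define x where "x = max a b"
  have x: "M < x" "0 < x" using False ab by (auto simp: x_def)
  have "a powr e * b powr e' \<le> x powr e * x powr e'"
    using ab e by (intro mult_mono powr_mono2) (auto simp: x_def)
  also have "\<dots> = M powr (e + e') * (x / M) powr (e + e')"
    using x ab by (simp add: powr_add powr_divide)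
  also have "\<dots> \<le> M powr (e + e') * (x / M) powr q"
    using x ab e by (intro mult_left_mono powr_mono) auto
  also have "\<dots> = M powr (e + e' - q) * x powr q" using x ab by (simp add: powr_divide powr_diff)
  also have "\<dots> \<le> M powr (e + e' - q) * (a powr q + b powr q)"
    by (intro mult_left_mono) (auto simp: x_def max_def)
  finally show ?thesis by (rule order_trans) simp
qed

text \<open>The length of gaps. It is long enough for r^gap to beat every power of \<open>n\<close>,
  and short enough that (n^(1/4))^(p+1) is at most n^(p/2), so terms inside a gap can be estimated
  crudely.\<close>

definition quarter :: "nat \<Rightarrow> nat" where "quarter n = nat \<lfloor>real n powr (1/4)\<rfloor>"

lemma quarter_le: "real (quarter n) \<le> real n powr (1/4)"
  unfolding quarter_def by simp

lemma quarter_ge: "real n powr (1/4) - 1 \<le> real (quarter n)"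
  unfolding quarter_def by linarith

lemma quarter_pos: "1 \<le> n \<Longrightarrow> 1 \<le> quarter n"
proof -
  assume "1 \<le> n"
  then have "1 \<le> real n powr (1/4)" by (intro ge_one_powr_ge_zero) auto
  then show ?thesis unfolding quarter_def by linarith
qed

lemma poly_times_exp_bounded:
  assumes r: "0 < (r::real)" "r < 1"
  obtains C where "0 \<le> C" "\<And>n. 1 \<le> n \<Longrightarrow> real n powr e * r ^ quarter n \<le> C"
proof -
  define l where "l = - ln r"
  have l: "0 < l" "r = exp (- l)" using r by (auto simp: l_def)
  have "(\<lambda>n::nat. real n powr e * exp (- l * (real n powr (1/4) - 1))) \<longlonglongrightarrow> 0"
    using l(1) by real_asymp
  then have "Bseq (\<lambda>n::nat. real n powr e * exp (- l * (real n powr (1/4) - 1)))"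
    by (intro convergent_imp_Bseq) (rule convergentI)
  then obtain B where B: "\<And>n::nat. norm (real n powr e * exp (- l * (real n powr (1/4) - 1))) \<le> B"
    unfolding Bseq_def by metis
  show thesis
  proof (rule that[of B])
    show "0 \<le> B" using order_trans[OF norm_ge_zero B] .
    fix n :: nat assume "1 \<le> n"
    have "r ^ quarter n = exp (- l * real (quarter n))"
      by (subst l(2)) (rule exp_of_nat2_mult[symmetric])
    also have "\<dots> \<le> exp (- l * (real n powr (1/4) - 1))" using l(1) quarter_ge[of n] by simp
    finally have "real n powr e * r ^ quarter n \<le> real n powr e * exp (- l * (real n powr (1/4) - 1))"
      by (intro mult_left_mono) auto
    then show "real n powr e * r ^ quarter n \<le> B" using B[of n] by (simp only: real_norm_def)
  qed
qed

text \<open>The sum counts the j up to N x, so it is the integer part of N x. This discrete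
  layer-cake formula turns statements about events into statements about functions with values in
  [0, 1].\<close>

lemma unit_layer:
  assumes x: "0 \<le> x" "x \<le> (1::real)" and N: "0 < N"
  shows "(\<Sum>j=1..N. of_bool (real j \<le> real N * x)) / real N \<le> x"
    and "x \<le> (\<Sum>j=1..N. of_bool (real j \<le> real N * x)) / real N + 1 / real N"
proof -
  define k where "k = nat \<lfloor>real N * x\<rfloor>"
  have "real N * x \<le> real N * 1" using x by (intro mult_left_mono) auto
  then have kN: "k \<le> N" using x unfolding k_def by linarith
  have iff: "real j \<le> real N * x \<longleftrightarrow> j \<le> k" for j
    using x unfolding k_def by (simp add: le_nat_iff le_floor_iff)
  have "(\<Sum>j=1..N. of_bool (real j \<le> real N * x) :: real) = (\<Sum>j=1..N. of_bool (j \<le> k))"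
    by (simp add: iff)
  also have "\<dots> = real (card ({1..N} \<inter> {j. j \<le> k}))" by (simp add: of_bool_def sum.If_cases)
  also have "{1..N} \<inter> {j. j \<le> k} = {1..k}" using kN by auto
  finally have s: "(\<Sum>j=1..N. of_bool (real j \<le> real N * x) :: real) = real k" by simp
  have "real k = of_int \<lfloor>real N * x\<rfloor>" using x by (simp add: k_def)
  then have k: "real k \<le> real N * x" "real N * x \<le> real k + 1" by linarith+
  show "(\<Sum>j=1..N. of_bool (real j \<le> real N * x)) / real N \<le> x"
    unfolding s using N k(1) by (simp add: divide_le_eq mult.commute)
  show "x \<le> (\<Sum>j=1..N. of_bool (real j \<le> real N * x)) / real N + 1 / real N"
    unfolding s using N k(2) by (simp add: add_divide_distrib[symmetric] le_divide_eq mult.commute)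
qed

section \<open>Iterated kernels\<close>

locale finite_state = finite_measure lam for lam :: "'x measure" +
  assumes space_lam: "space lam = UNIV" and lam_pos: "emeasure lam UNIV \<noteq> 0"
begin

definition bounded_fun :: "('x \<Rightarrow> real) \<Rightarrow> bool" where
  "bounded_fun f \<longleftrightarrow> f \<in> borel_measurable lam \<and> (\<exists>B. \<forall>x. \<bar>f x\<bar> \<le> B)"

definition bounded_kernel :: "('x \<Rightarrow> 'x \<Rightarrow> real) \<Rightarrow> bool" where
  "bounded_kernel k \<longleftrightarrow>
     (\<lambda>(x, x'). k x x') \<in> borel_measurable (lam \<Otimes>\<^sub>M lam) \<and> (\<exists>B. \<forall>x x'. \<bar>k x x'\<bar> \<le> B)"

definition app :: "('x \<Rightarrow> 'x \<Rightarrow> real) \<Rightarrow> ('x \<Rightarrow> real) \<Rightarrow> 'x \<Rightarrow> real" where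
  "app k f x = (\<integral>x'. k x x' * f x' \<partial>lam)"

text \<open>When \<open>K i\<close> is the transition density times the likelihood of observation
  \<open>i + 1\<close>, \<open>iter K n u (\<lambda>_. 1) x\<close> is the likelihood of
  observations \<open>u + 1\<close> to \<open>u + n\<close> given state \<open>x\<close> at time
  \<open>u\<close>: the backward function of smoothing.\<close>

primrec iter :: "(int \<Rightarrow> 'x \<Rightarrow> 'x \<Rightarrow> real) \<Rightarrow> nat \<Rightarrow> int \<Rightarrow> ('x \<Rightarrow> real) \<Rightarrow> 'x \<Rightarrow> real" where
  "iter K 0 u f = f"
| "iter K (Suc n) u f = app (K u) (iter K n (u + 1) f)"

lemma bounded_fun_integrable: "bounded_fun f \<Longrightarrow> integrable lam f"
  unfolding bounded_fun_def by (elim conjE exE) (rule integrable_const_bound, auto)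

lemma bounded_fun_mult: "bounded_fun f \<Longrightarrow> bounded_fun h \<Longrightarrow> bounded_fun (\<lambda>x. f x * h x)"
  unfolding bounded_fun_def
proof (elim conjE exE, intro conjI exI allI)
  fix B B' x assume "\<forall>x. \<bar>f x\<bar> \<le> B" "\<forall>x. \<bar>h x\<bar> \<le> B'"
  then have "\<bar>f x\<bar> \<le> B" "\<bar>h x\<bar> \<le> B'" by auto
  then show "\<bar>f x * h x\<bar> \<le> B * B'" by (auto simp: abs_mult intro!: mult_mono)
qed auto

lemma bounded_fun_diff: "bounded_fun f \<Longrightarrow> bounded_fun h \<Longrightarrow> bounded_fun (\<lambda>x. f x - h x)"
  unfolding bounded_fun_def
proof (elim conjE exE, intro conjI exI allI)
  fix B B' x assume "\<forall>x. \<bar>f x\<bar> \<le> B" "\<forall>x. \<bar>h x\<bar> \<le> B'"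
  then have "\<bar>f x\<bar> \<le> B" "\<bar>h x\<bar> \<le> B'" by auto
  then show "\<bar>f x - h x\<bar> \<le> B + B'" by linarith
qed auto

lemma bounded_fun_scale: "bounded_fun f \<Longrightarrow> bounded_fun (\<lambda>x. c * f x)"
  by (rule bounded_fun_mult) (auto simp: bounded_fun_def)

lemma bounded_fun_abs: "bounded_fun f \<Longrightarrow> bounded_fun (\<lambda>x. \<bar>f x\<bar>)"
  unfolding bounded_fun_def by auto

lemma bounded_fun_const: "bounded_fun (\<lambda>_. c)"
  unfolding bounded_fun_def by auto

lemma bounded_kernel_section: "bounded_kernel k \<Longrightarrow> bounded_fun (k x)"
proof -
  assume "bounded_kernel k"
  then have "(\<lambda>(x, x'). k x x') \<in> borel_measurable (lam \<Otimes>\<^sub>M lam)" "\<exists>B. \<forall>x x'. \<bar>k x x'\<bar> \<le> B"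
    unfolding bounded_kernel_def by auto
  from measurable_compose[OF measurable_Pair1'[of x lam lam] this(1)] this(2)
  show ?thesis unfolding bounded_fun_def by (auto simp: space_lam)
qed

lemma bounded_fun_app:
  assumes k: "bounded_kernel k" and f: "bounded_fun f"
  shows "bounded_fun (app k f)"
proof -
  obtain B where B: "\<And>x x'. \<bar>k x x'\<bar> \<le> B" using k unfolding bounded_kernel_def by blast
  obtain B' where B': "\<And>x. \<bar>f x\<bar> \<le> B'" using f unfolding bounded_fun_def by blast
  have [measurable]: "(\<lambda>(x, x'). k x x') \<in> borel_measurable (lam \<Otimes>\<^sub>M lam)" "f \<in> borel_measurable lam"
    using k f unfolding bounded_kernel_def bounded_fun_def by auto
  have "(\<lambda>x. \<integral>x'. k x x' * f x' \<partial>lam) \<in> borel_measurable lam" by measurable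
  moreover have "\<bar>app k f x\<bar> \<le> (B * B') * measure lam UNIV" for x
  proof -
    have b: "\<bar>k x x' * f x'\<bar> \<le> B * B'" for x'
      using B[of x x'] B'[of x'] by (auto simp: abs_mult intro!: mult_mono)
    have "\<bar>app k f x\<bar> \<le> (\<integral>x'. \<bar>k x x' * f x'\<bar> \<partial>lam)"
      unfolding app_def by (rule integral_abs_bound)
    also have "\<dots> \<le> (\<integral>x'. B * B' \<partial>lam)"
      using b bounded_fun_integrable[OF bounded_fun_abs[OF bounded_fun_mult[OF bounded_kernel_section[OF k] f]]]
      by (intro integral_mono) auto
    finally show ?thesis by (simp add: space_lam mult_ac)
  qed
  ultimately show ?thesis unfolding bounded_fun_def app_def[abs_def] by blast
qed

lemma bounded_fun_iter:
  "(\<And>i. bounded_kernel (K i)) \<Longrightarrow> bounded_fun f \<Longrightarrow> bounded_fun (iter K n u f)"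
  by (induction n arbitrary: u) (auto intro: bounded_fun_app)

lemma integrable_app:
  "bounded_kernel k \<Longrightarrow> bounded_fun f \<Longrightarrow> integrable lam (\<lambda>x'. k x x' * f x')"
  using bounded_fun_integrable[OF bounded_fun_mult[OF bounded_kernel_section]] .

lemma app_mono:
  assumes "bounded_kernel k" "bounded_fun f" "bounded_fun h" "\<And>x x'. 0 \<le> k x x'" "\<And>x. f x \<le> h x"
  shows "app k f x \<le> app k h x"
  unfolding app_def using assms by (intro integral_mono integrable_app) (auto intro: mult_left_mono)

lemma app_scale: "app k (\<lambda>x. c * f x) x = c * app k f x"
  unfolding app_def by (simp add: mult.left_commute)

lemma app_diff:
  "bounded_kernel k \<Longrightarrow> bounded_fun f \<Longrightarrow> bounded_fun h \<Longrightarrow>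
   app k (\<lambda>x. f x - h x) x = app k f x - app k h x"
  unfolding app_def by (simp add: right_diff_distrib integrable_app)

lemma iter_mono:
  assumes "\<And>i. bounded_kernel (K i)" "bounded_fun f" "bounded_fun h" "\<And>i x x'. 0 \<le> K i x x'"
    "\<And>x. f x \<le> h x"
  shows "iter K n u f x \<le> iter K n u h x"
  by (induction n arbitrary: u x) (auto intro!: app_mono bounded_fun_iter assms)

lemma iter_scale: "iter K n u (\<lambda>x. c * f x) x = c * iter K n u f x"
proof (induction n arbitrary: u x)
  case (Suc n)
  then have "iter K n (u + 1) (\<lambda>x. c * f x) = (\<lambda>x. c * iter K n (u + 1) f x)" by (rule ext)
  then show ?case by (simp add: app_scale)
qed simp

lemma iter_diff:
  assumes "\<And>i. bounded_kernel (K i)" "bounded_fun f" "bounded_fun h"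
  shows "iter K n u (\<lambda>x. f x - h x) x = iter K n u f x - iter K n u h x"
proof (induction n arbitrary: u x)
  case (Suc n)
  then have "iter K n (u + 1) (\<lambda>x. f x - h x) = (\<lambda>x. iter K n (u + 1) f x - iter K n (u + 1) h x)"
    by (rule ext)
  then show ?case by (simp add: app_diff assms bounded_fun_iter)
qed simp

lemma iter_add: "iter K (n + n') u f = iter K n u (iter K n' (u + int n) f)"
  by (induction n arbitrary: u) (auto simp: algebra_simps)

lemma iter_cong:
  "(\<And>i. u \<le> i \<Longrightarrow> i < u + int n \<Longrightarrow> K i = L i) \<Longrightarrow> iter K n u f = iter L n u f"
  by (induction n arbitrary: u) auto

lemma iter_shift: "iter (\<lambda>i. K (i + j)) n u f = iter K n (u + j) f"
proof (induction n arbitrary: u)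
  case (Suc n)
  have "iter (\<lambda>i. K (i + j)) n (u + 1) f = iter K n (u + j + 1) f"
    using Suc[of "u + 1"] by (simp add: add_ac)
  then show ?case by simp
qed simp

lemma app_pos:
  assumes "bounded_kernel k" "bounded_fun f" "\<And>x x'. 0 < k x x'" "\<And>x. 0 < f x"
  shows "0 < app k f x"
proof -
  have "0 \<le> app k f x" unfolding app_def
    by (intro Bochner_Integration.integral_nonneg mult_nonneg_nonneg less_imp_le assms)
  moreover have "app k f x \<noteq> 0"
  proof
    assume "app k f x = 0"
    then have "AE x' in lam. k x x' * f x' = 0"
      unfolding app_def
      by (subst (asm) integral_nonneg_eq_0_iff_AE) (auto intro!: integrable_app mult_nonneg_nonneg[OF less_imp_le less_imp_le] assms)
    then have "AE x' in lam. False"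
      by eventually_elim (metis assms(3,4) less_numeral_extra(3) mult_pos_pos)
    then show False
      using lam_pos space_lam by (simp add: eventually_False ae_filter_eq_bot_iff)
  qed
  ultimately show ?thesis by simp
qed

lemma iter_pos:
  assumes "\<And>i. bounded_kernel (K i)" "bounded_fun f" "\<And>i x x'. 0 < K i x x'" "\<And>x. 0 < f x"
  shows "0 < iter K n u f x"
  by (induction n arbitrary: u x) (auto intro!: app_pos bounded_fun_iter assms)

lemma iter_one_pos:
  assumes "\<And>i. bounded_kernel (K i)" "\<And>i x x'. 0 < K i x x'"
  shows "0 < iter K n u (\<lambda>_. 1) x"
  by (intro iter_pos assms bounded_fun_const) auto

section \<open>Path integrals as iterated kernels\<close>

lemma finite_measure_PiM:
  assumes "\<And>i. finite_measure (M i)" "finite I"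
  shows "finite_measure (PiM I M)"
proof -
  interpret product_sigma_finite M
    using assms(1) unfolding product_sigma_finite_def finite_measure_def by auto
  have "emeasure (PiM I M) (space (PiM I M)) = (\<Prod>i\<in>I. emeasure (M i) (space (M i)))"
    unfolding space_PiM using assms by (intro emeasure_PiM) auto
  also have "\<dots> < \<infinity>"
    using finite_measure.emeasure_finite[OF assms(1)]
    by (auto simp: less_top[symmetric] ennreal_prod_eq_top)
  finally show ?thesis by (auto intro: finite_measureI)
qed

text \<open>Fubini, integrating out the last coordinate: this replaces the terminal function by its
  image under the last kernel, which is why the induction leaves \<open>f\<close> arbitrary.\<close>

lemma integral_path:
  assumes chi: "finite_measure chi" "sets chi = sets lam"
    and K: "\<And>i. bounded_kernel (K i)" and f: "bounded_fun f"
  shows "(\<integral>x. (\<Prod>i\<in>{u..<u + int n}. K i (x i) (x (i + 1))) * f (x (u + int n))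
            \<partial>path_measure lam chi u (u + int n))
       = (\<integral>x. iter K n u f x \<partial>chi)"
  using f
proof (induction n arbitrary: f)
  define M where "M i = (if i = u then chi else lam)" for i
  have fM: "finite_measure (M i)" for i using chi(1) finite_measure_axioms by (auto simp: M_def)
  interpret product_sigma_finite M
    using fM unfolding product_sigma_finite_def finite_measure_def by auto
  have sM [measurable_cong]: "sets (M i) = sets lam" for i using chi(2) by (simp add: M_def)
  have pm: "path_measure lam chi r t = Pi\<^sub>M {r..t} M" if "r = u" for r t
    using that unfolding path_measure_def M_def by simp
  {
    case (0 f)
    have [measurable]: "f \<in> borel_measurable (M u)" using 0 sM by (auto simp: bounded_fun_def)
    show ?case by (simp add: pm product_integral_singleton) (simp add: M_def)
  next
    case (Suc n f)
    let ?I = "{u..u + int n}" and ?t = "u + int n"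
    have I: "{u..?t + 1} = insert (?t + 1) ?I" by auto
    have J: "{u..<?t + 1} = insert ?t {u..<?t}" by auto
    obtain B where B: "\<And>i x x'. \<bar>K i x x'\<bar> \<le> B i"
      using K unfolding bounded_kernel_def by metis
    obtain B' where B': "\<And>x. \<bar>f x\<bar> \<le> B'" using Suc.prems unfolding bounded_fun_def by blast
    have Km: "(\<lambda>(x, x'). K i x x') \<in> borel_measurable (lam \<Otimes>\<^sub>M lam)" for i
      using K unfolding bounded_kernel_def by auto
    have fm: "f \<in> borel_measurable lam" using Suc.prems unfolding bounded_fun_def by auto
    have Kx: "(\<lambda>x. K i (x i) (x (i + 1))) \<in> borel_measurable (Pi\<^sub>M A M)" if "i \<in> A" "i + 1 \<in> A" for i A
    proof -
      have "(\<lambda>x. (x i, x (i + 1))) \<in> measurable (Pi\<^sub>M A M) (lam \<Otimes>\<^sub>M lam)"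
        using measurable_component_singleton[OF that(1), of M] measurable_component_singleton[OF that(2), of M]
        by (intro measurable_Pair) (simp_all cong: measurable_cong_sets add: measurable_cong_sets[OF refl sM])
      from measurable_compose[OF this Km[of i]] show ?thesis by simp
    qed
    have fx: "(\<lambda>x. f (x (?t + 1))) \<in> borel_measurable (Pi\<^sub>M {u..?t + 1} M)"
      by (rule measurable_compose[OF measurable_component_singleton])
        (auto simp: fm measurable_cong_sets[OF sM refl])
    let ?F = "\<lambda>x. (\<Prod>i\<in>{u..<?t + 1}. K i (x i) (x (i + 1))) * f (x (?t + 1))"
    have int: "integrable (Pi\<^sub>M {u..?t + 1} M) ?F"
    proof (rule finite_measure.integrable_const_bound[OF finite_measure_PiM[OF fM], where B = "(\<Prod>i\<in>{u..<?t + 1}. B i) * B'"])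
      show "AE x in Pi\<^sub>M {u..?t + 1} M. norm (?F x) \<le> (\<Prod>i\<in>{u..<?t + 1}. B i) * B'"
        by (rule AE_I2) (auto simp: abs_mult abs_prod intro!: mult_mono prod_mono B B' prod_nonneg
            intro: order_trans[OF abs_ge_zero B])
      show "?F \<in> borel_measurable (Pi\<^sub>M {u..?t + 1} M)"
        by (intro borel_measurable_times borel_measurable_prod Kx fx) auto
    qed auto
    have "(\<integral>x. ?F x \<partial>Pi\<^sub>M {u..?t + 1} M)
        = (\<integral>x. (\<integral>y. ?F (x(?t + 1 := y)) \<partial>M (?t + 1)) \<partial>Pi\<^sub>M ?I M)"
      using int unfolding I by (intro product_integral_insert) auto
    also have "\<dots> = (\<integral>x. (\<Prod>i\<in>{u..<?t}. K i (x i) (x (i + 1))) * app (K ?t) f (x ?t) \<partial>Pi\<^sub>M ?I M)"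
    proof (rule Bochner_Integration.integral_cong[OF refl])
      fix x
      have e: "?F (x(?t + 1 := y)) = (\<Prod>i\<in>{u..<?t}. K i (x i) (x (i + 1))) * (K ?t (x ?t) y * f y)" for y
      proof -
        have "(\<Prod>i\<in>{u..<?t}. K i ((x(?t + 1 := y)) i) ((x(?t + 1 := y)) (i + 1)))
            = (\<Prod>i\<in>{u..<?t}. K i (x i) (x (i + 1)))"
          by (rule prod.cong) auto
        then show ?thesis unfolding J by (simp add: mult_ac)
      qed
      have "(\<integral>y. ?F (x(?t + 1 := y)) \<partial>M (?t + 1))
          = (\<integral>y. (\<Prod>i\<in>{u..<?t}. K i (x i) (x (i + 1))) * (K ?t (x ?t) y * f y) \<partial>M (?t + 1))"
        by (rule Bochner_Integration.integral_cong[OF refl e])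
      also have "\<dots> = (\<Prod>i\<in>{u..<?t}. K i (x i) (x (i + 1))) * (\<integral>y. K ?t (x ?t) y * f y \<partial>lam)"
        by (simp add: M_def)
      finally show "(\<integral>y. ?F (x(?t + 1 := y)) \<partial>M (?t + 1))
          = (\<Prod>i\<in>{u..<?t}. K i (x i) (x (i + 1))) * app (K ?t) f (x ?t)"
        by (simp add: app_def)
    qed
    also have "\<dots> = (\<integral>x. iter K n u (app (K ?t) f) x \<partial>chi)"
      using Suc.IH[OF bounded_fun_app[OF K Suc.prems]] by (simp add: pm)
    also have "iter K n u (app (K ?t) f) = iter K (Suc n) u f"
      using iter_add[of K n 1 u f] by simp
    finally show ?case by (simp add: pm algebra_simps)
  }
qed

end

section \<open>Forgetting under strong mixing\<close>

text \<open>The kernels are not normalised. \<open>w i\<close> stands for the likelihood of the next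
  observation, which has no bound uniform in time; the constants comparing \<open>K i\<close> with
  it, from any starting state, are uniform.\<close>

locale mixing_kernels = finite_state lam for lam :: "'x measure" +
  fixes K :: "int \<Rightarrow> 'x \<Rightarrow> 'x \<Rightarrow> real" and w :: "int \<Rightarrow> 'x \<Rightarrow> real" and sm sp :: real
  assumes kernel: "\<And>i. bounded_kernel (K i)"
    and weight: "\<And>i. bounded_fun (w i)" "\<And>i x. 0 < w i x"
    and minor: "0 < sm" "sm \<le> sp"
    and lower: "\<And>i x x'. sm * w i x' \<le> K i x x'"
    and upper: "\<And>i x x'. K i x x' \<le> sp * w i x'"
begin

definition rate :: real where "rate = 1 - sm / sp"

lemma rate_bounds: "0 \<le> rate" "rate < 1"
  using minor by (auto simp: rate_def)

lemma kernel_pos: "0 < K i x x'"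
  using lower[of i x' x] minor(1) weight(2)[of i x'] by (meson less_le_trans mult_pos_pos)

lemma kernel_nonneg: "0 \<le> K i x x'"
  by (rule less_imp_le[OF kernel_pos])

section \<open>One-step contraction of ratios\<close>

lemma app_bounds:
  assumes f: "bounded_fun f" "\<And>x. 0 \<le> f x"
  shows "sm * (\<integral>x'. w i x' * f x' \<partial>lam) \<le> app (K i) f x"
    and "app (K i) f x \<le> sp * (\<integral>x'. w i x' * f x' \<partial>lam)"
proof -
  have int: "integrable lam (\<lambda>x'. w i x' * f x')"
    by (intro bounded_fun_integrable bounded_fun_mult weight f)
  have "sm * (\<integral>x'. w i x' * f x' \<partial>lam) = (\<integral>x'. sm * (w i x' * f x') \<partial>lam)" by simp
  also have "\<dots> \<le> app (K i) f x"
    unfolding app_def using mult_right_mono[OF lower f(2)] int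
    by (intro integral_mono[OF _ integrable_app[OF kernel f(1)]]) (auto simp: mult.assoc)
  finally show "sm * (\<integral>x'. w i x' * f x' \<partial>lam) \<le> app (K i) f x" .
  have "app (K i) f x \<le> (\<integral>x'. sp * (w i x' * f x') \<partial>lam)"
    unfolding app_def using mult_right_mono[OF upper f(2)] int
    by (intro integral_mono[OF integrable_app[OF kernel f(1)]]) (auto simp: mult.assoc)
  then show "app (K i) f x \<le> sp * (\<integral>x'. w i x' * f x' \<partial>lam)" by simp
qed

text \<open>The Doeblin step. Let \<open>c\<close> be the ratio of the weighted integrals of
  \<open>N\<close> and \<open>D\<close>. The lower kernel bound on \<open>N - a D\<close> and the
  upper one on \<open>D\<close> raise \<open>a\<close> by sm/sp (c - a); in the same way
  \<open>b\<close> drops by sm/sp (b - c). The two gains add up to sm/sp (b - a) whatever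
  \<open>c\<close> is. Working with ratios avoids normalising the kernels.\<close>

lemma app_contract:
  assumes D: "bounded_fun D" "\<And>x. 0 < D x" and N: "bounded_fun N"
    and ab: "\<And>x. a * D x \<le> N x" "\<And>x. N x \<le> b * D x"
  shows "\<exists>a' b'. a \<le> a' \<and> b' \<le> b \<and> b' - a' = rate * (b - a) \<and>
    (\<forall>x. a' * app (K i) D x \<le> app (K i) N x \<and> app (K i) N x \<le> b' * app (K i) D x)"
proof -
  define W where "W = (\<integral>x'. w i x' * D x' \<partial>lam)"
  define c where "c = (\<integral>x'. w i x' * N x' \<partial>lam) / W"
  have iD: "integrable lam (\<lambda>x'. w i x' * D x')" and iN: "integrable lam (\<lambda>x'. w i x' * N x')"
    by (intro bounded_fun_integrable bounded_fun_mult weight D N)+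
  have "0 < app (K i) D x" for x by (intro app_pos kernel kernel_pos D)
  moreover have DW: "app (K i) D x \<le> sp * W" for x
    unfolding W_def by (intro app_bounds D less_imp_le)
  ultimately have "0 < sp * W" by (meson less_le_trans)
  then have W: "0 < W" using minor by (simp add: zero_less_mult_iff)
  have lo: "c - a \<ge> 0"
  proof -
    have "a * W = (\<integral>x'. w i x' * (a * D x') \<partial>lam)" unfolding W_def by (simp add: mult.left_commute)
    also have "\<dots> \<le> (\<integral>x'. w i x' * N x' \<partial>lam)"
      using iD iN ab(1) weight(2) by (intro integral_mono) (auto simp: mult.left_commute[of _ a] less_imp_le intro!: mult_left_mono)
    finally show ?thesis using W by (simp add: c_def field_simps)
  qed
  have hi: "b - c \<ge> 0"
  proof -
    have "(\<integral>x'. w i x' * N x' \<partial>lam) \<le> (\<integral>x'. w i x' * (b * D x') \<partial>lam)"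
      using iD iN ab(2) weight(2) by (intro integral_mono) (auto simp: mult.left_commute[of _ b] less_imp_le intro!: mult_left_mono)
    also have "\<dots> = b * W" unfolding W_def by (simp add: mult.left_commute)
    finally show ?thesis using W by (simp add: c_def field_simps)
  qed
  have sD: "bounded_fun (\<lambda>x. e * D x)" for e by (rule bounded_fun_scale[OF D(1)])
  have e1: "app (K i) (\<lambda>x. N x - a * D x) x = app (K i) N x - a * app (K i) D x" for x
    by (simp add: app_diff kernel N sD app_scale)
  have e2: "app (K i) (\<lambda>x. b * D x - N x) x = b * app (K i) D x - app (K i) N x" for x
    by (simp add: app_diff kernel N sD app_scale)
  have i1: "(\<integral>x'. w i x' * (N x' - a * D x') \<partial>lam) = (c - a) * W"
    using iD iN W by (simp add: right_diff_distrib mult.left_commute[of _ a] c_def left_diff_distrib W_def)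
  have i2: "(\<integral>x'. w i x' * (b * D x' - N x') \<partial>lam) = (b - c) * W"
    using iD iN W by (simp add: right_diff_distrib mult.left_commute[of _ b] c_def left_diff_distrib W_def)
  have step: "sm / sp * e * app (K i) D x \<le> sm * (e * W)" if "0 \<le> e" for e x
  proof -
    have "sm / sp * e * app (K i) D x \<le> sm / sp * e * (sp * W)"
      using DW[of x] that minor by (intro mult_left_mono) auto
    then show ?thesis using minor by simp
  qed
  have L: "(a + sm / sp * (c - a)) * app (K i) D x \<le> app (K i) N x" for x
  proof -
    have "sm * ((c - a) * W) \<le> app (K i) N x - a * app (K i) D x"
      unfolding i1[symmetric] e1[symmetric]
      by (intro app_bounds bounded_fun_diff N sD) (use ab in auto)
    with step[OF lo, of x] show ?thesis by (simp add: algebra_simps)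
  qed
  have U: "app (K i) N x \<le> (b - sm / sp * (b - c)) * app (K i) D x" for x
  proof -
    have "sm * ((b - c) * W) \<le> b * app (K i) D x - app (K i) N x"
      unfolding i2[symmetric] e2[symmetric]
      by (intro app_bounds bounded_fun_diff N sD) (use ab in auto)
    with step[OF hi, of x] show ?thesis by (simp add: algebra_simps)
  qed
  have "b - sm / sp * (b - c) - (a + sm / sp * (c - a)) = rate * (b - a)"
    by (simp add: rate_def algebra_simps diff_divide_distrib)
  moreover have "a \<le> a + sm / sp * (c - a)" "b - sm / sp * (b - c) \<le> b"
    using lo hi minor by auto
  ultimately show ?thesis using L U by blast
qed

lemma iter_contract:
  assumes D: "bounded_fun D" "\<And>x. 0 < D x" and N: "bounded_fun N"
    and ab: "\<And>x. a * D x \<le> N x" "\<And>x. N x \<le> b * D x"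
  shows "\<exists>a' b'. a \<le> a' \<and> b' \<le> b \<and> b' - a' = rate ^ n * (b - a) \<and>
    (\<forall>x. a' * iter K n u D x \<le> iter K n u N x \<and> iter K n u N x \<le> b' * iter K n u D x)"
proof (induction n arbitrary: u)
  case 0
  then show ?case using ab by (intro exI[of _ a] exI[of _ b]) auto
next
  case (Suc n)
  from Suc.IH[of "u + 1"] obtain a' b' where 1: "a \<le> a'" "b' \<le> b" "b' - a' = rate ^ n * (b - a)"
    "\<And>x. a' * iter K n (u + 1) D x \<le> iter K n (u + 1) N x"
    "\<And>x. iter K n (u + 1) N x \<le> b' * iter K n (u + 1) D x" by blast
  have "\<exists>a'' b''. a' \<le> a'' \<and> b'' \<le> b' \<and> b'' - a'' = rate * (b' - a') \<and>
    (\<forall>x. a'' * app (K u) (iter K n (u + 1) D) x \<le> app (K u) (iter K n (u + 1) N) x \<and>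
         app (K u) (iter K n (u + 1) N) x \<le> b'' * app (K u) (iter K n (u + 1) D) x)"
    by (intro app_contract bounded_fun_iter kernel D N iter_pos kernel_pos 1)
  then obtain a'' b'' where 2: "a' \<le> a''" "b'' \<le> b'" "b'' - a'' = rate * (b' - a')"
    "\<forall>x. a'' * app (K u) (iter K n (u + 1) D) x \<le> app (K u) (iter K n (u + 1) N) x \<and>
         app (K u) (iter K n (u + 1) N) x \<le> b'' * app (K u) (iter K n (u + 1) D) x"
    by blast
  have "a \<le> a''" "b'' \<le> b" "b'' - a'' = rate ^ Suc n * (b - a)" using 1 2 by (auto simp: mult.assoc)
  then show ?case using 2(4) by (intro exI[of _ a''] exI[of _ b'']) auto
qed

section \<open>Numerators and denominators of smoothing\<close>

definition den :: "'x measure \<Rightarrow> int \<Rightarrow> nat \<Rightarrow> nat \<Rightarrow> real" where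
  "den chi s n l = (\<integral>x. iter K (n + 1 + l) (s - 1 - int n) (\<lambda>_. 1) x \<partial>chi)"

text \<open>\<open>n\<close> steps lead from the initial time \<open>s - 1 - n\<close> to \<open>s - 1\<close>, and \<open>l\<close> steps from \<open>s\<close> to the
  final time \<open>s + l\<close>.\<close>

definition mid :: "('x \<Rightarrow> 'x \<Rightarrow> real) \<Rightarrow> int \<Rightarrow> nat \<Rightarrow> 'x \<Rightarrow> real" where
  "mid h s l = app (\<lambda>x x'. K (s - 1) x x' * h x x') (iter K l s (\<lambda>_. 1))"

definition num :: "('x \<Rightarrow> 'x \<Rightarrow> real) \<Rightarrow> 'x measure \<Rightarrow> int \<Rightarrow> nat \<Rightarrow> nat \<Rightarrow> real" where
  "num h chi s n l = (\<integral>x. iter K n (s - 1 - int n) (mid h s l) x \<partial>chi)"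

lemma integrable_chi:
  "prob_space chi \<Longrightarrow> sets chi = sets lam \<Longrightarrow> bounded_fun f \<Longrightarrow> integrable chi f"
  unfolding bounded_fun_def
  by (elim conjE exE, rule finite_measure.integrable_const_bound[OF prob_space.finite_measure])
    (auto cong: measurable_cong_sets)

text \<open>Puts the denominator into the form of the numerator with \<open>h = 1\<close>, so that
  the contraction of ratios applies to the pair.\<close>

lemma den_alt: "den chi s n l = (\<integral>x. iter K n (s - 1 - int n) (mid (\<lambda>_ _. 1) s l) x \<partial>chi)"
  unfolding den_def mid_def by (subst add.assoc, subst iter_add) simp

context
  fixes h :: "'x \<Rightarrow> 'x \<Rightarrow> real" and V :: real
  assumes h: "(\<lambda>(x, x'). h x x') \<in> borel_measurable (lam \<Otimes>\<^sub>M lam)" "\<And>x x'. \<bar>h x x'\<bar> \<le> V"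
begin

lemma bounded_kernel_mult: "bounded_kernel (\<lambda>x x'. K i x x' * h x x')"
proof -
  obtain B where "\<And>x x'. \<bar>K i x x'\<bar> \<le> B" using kernel unfolding bounded_kernel_def by metis
  then have "\<bar>K i x x' * h x x'\<bar> \<le> B * V" for x x'
    using h(2)[of x x'] by (auto simp: abs_mult intro!: mult_mono intro: order_trans[OF abs_ge_zero])
  moreover have "(\<lambda>(x, x'). K i x x' * h x x') \<in> borel_measurable (lam \<Otimes>\<^sub>M lam)"
    using borel_measurable_times[OF _ h(1), of "\<lambda>(x, x'). K i x x'"] kernel[of i]
    unfolding bounded_kernel_def by (simp add: split_beta')
  ultimately show ?thesis unfolding bounded_kernel_def by blast
qed

lemma V_nonneg: "0 \<le> V" using h(2) order_trans[OF abs_ge_zero] by blast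

lemma bounded_fun_mid: "bounded_fun (mid h s l)"
  unfolding mid_def by (intro bounded_fun_app bounded_kernel_mult bounded_fun_iter kernel bounded_fun_const)

lemma app_mult_le:
  assumes f: "bounded_fun f"
  shows "\<bar>app (\<lambda>x x'. K i x x' * h x x') f x\<bar> \<le> V * app (K i) (\<lambda>x. \<bar>f x\<bar>) x"
proof -
  have "\<bar>app (\<lambda>x x'. K i x x' * h x x') f x\<bar> \<le> (\<integral>x'. \<bar>K i x x' * h x x' * f x'\<bar> \<partial>lam)"
    unfolding app_def by (rule integral_abs_bound)
  also have "\<dots> \<le> (\<integral>x'. V * (K i x x' * \<bar>f x'\<bar>) \<partial>lam)"
  proof (rule integral_mono)
    show "integrable lam (\<lambda>x'. \<bar>K i x x' * h x x' * f x'\<bar>)"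
      using integrable_app[OF bounded_kernel_mult f] by (intro integrable_abs)
    show "integrable lam (\<lambda>x'. V * (K i x x' * \<bar>f x'\<bar>))"
      by (intro integrable_mult_right integrable_app kernel bounded_fun_abs f)
    show "\<bar>K i x x' * h x x' * f x'\<bar> \<le> V * (K i x x' * \<bar>f x'\<bar>)" for x'
      using mult_right_mono[OF h(2), of "K i x x' * \<bar>f x'\<bar>" x x'] less_imp_le[OF kernel_pos[of i x x']]
      by (simp add: abs_mult mult_ac)
  qed
  finally show ?thesis by (simp add: app_def)
qed

lemma mid_le: "\<bar>mid h s l x\<bar> \<le> V * mid (\<lambda>_ _. 1) s l x"
proof -
  have "(\<lambda>x. \<bar>iter K l s (\<lambda>_. 1) x\<bar>) = iter K l s (\<lambda>_. 1)"
    by (rule ext) (auto intro!: abs_of_pos iter_one_pos kernel kernel_pos)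
  with app_mult_le[where i = "s - 1" and x = x and f = "iter K l s (\<lambda>_. 1)", OF bounded_fun_iter[OF kernel bounded_fun_const]]
  show ?thesis by (simp add: mid_def)
qed

end

lemma bounded_fun_mid_one: "bounded_fun (mid (\<lambda>_ _. 1) s l)"
  by (rule bounded_fun_mid[of _ 1]) auto

lemma mid_one_pos: "0 < mid (\<lambda>_ _. 1) s l x"
  unfolding mid_def by (auto intro!: app_pos iter_one_pos kernel kernel_pos bounded_fun_iter bounded_fun_const)

lemma integral_pos_chi:
  fixes f :: "'x \<Rightarrow> real"
  assumes "prob_space chi" "integrable chi f" "\<And>x. 0 < f x"
  shows "0 < (\<integral>x. f x \<partial>chi)"
proof -
  have "(\<integral>x. f x \<partial>chi) \<noteq> 0"
  proof
    assume "(\<integral>x. f x \<partial>chi) = 0"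
    then have "AE x in chi. f x = 0"
      using integral_nonneg_eq_0_iff_AE[OF assms(2)] assms(3) by (auto simp: less_imp_le)
    then have "AE x in chi. False" by eventually_elim (metis assms(3) less_irrefl)
    then show False
      using prob_space.emeasure_space_1[OF assms(1)] by (simp add: eventually_False ae_filter_eq_bot_iff)
  qed
  moreover have "0 \<le> (\<integral>x. f x \<partial>chi)"
    using assms(3) by (intro Bochner_Integration.integral_nonneg less_imp_le)
  ultimately show ?thesis by simp
qed

lemma den_pos: "prob_space chi \<Longrightarrow> sets chi = sets lam \<Longrightarrow> 0 < den chi s n l"
  unfolding den_def
  by (intro integral_pos_chi integrable_chi bounded_fun_iter kernel bounded_fun_const iter_one_pos kernel_pos)

section \<open>Forgetting of the initial law and of the final time\<close>

context
  fixes h :: "'x \<Rightarrow> 'x \<Rightarrow> real" and V :: real and s :: int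
  assumes h: "(\<lambda>(x, x'). h x x') \<in> borel_measurable (lam \<Otimes>\<^sub>M lam)" "\<And>x x'. \<bar>h x x'\<bar> \<le> V"
begin

lemma ratio_between:
  assumes chi: "prob_space chi" "sets chi = sets lam"
    and ab: "\<And>x. a * iter K n (s - 1 - int n) (mid (\<lambda>_ _. 1) s l) x \<le> iter K n (s - 1 - int n) (mid h s l) x"
      "\<And>x. iter K n (s - 1 - int n) (mid h s l) x \<le> b * iter K n (s - 1 - int n) (mid (\<lambda>_ _. 1) s l) x"
  shows "a \<le> num h chi s n l / den chi s n l" "num h chi s n l / den chi s n l \<le> b"
proof -
  have int: "integrable chi (iter K n (s - 1 - int n) (mid h s l))"
    "integrable chi (iter K n (s - 1 - int n) (mid (\<lambda>_ _. 1) s l))"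
    by (intro integrable_chi chi bounded_fun_iter kernel bounded_fun_mid[OF h] bounded_fun_mid_one)+
  have "a * den chi s n l = (\<integral>x. a * iter K n (s - 1 - int n) (mid (\<lambda>_ _. 1) s l) x \<partial>chi)"
    unfolding den_alt by simp
  also have "\<dots> \<le> num h chi s n l"
    unfolding num_def using int ab by (intro integral_mono) auto
  finally show "a \<le> num h chi s n l / den chi s n l"
    using den_pos[OF chi] by (simp add: field_simps)
  have "num h chi s n l \<le> (\<integral>x. b * iter K n (s - 1 - int n) (mid (\<lambda>_ _. 1) s l) x \<partial>chi)"
    unfolding num_def using int ab by (intro integral_mono) auto
  also have "\<dots> = b * den chi s n l" unfolding den_alt by simp
  finally show "num h chi s n l / den chi s n l \<le> b"
    using den_pos[OF chi] by (simp add: field_simps)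
qed

lemma ratio_bound:
  assumes chi: "prob_space chi" "sets chi = sets lam"
  shows "\<bar>num h chi s n l / den chi s n l\<bar> \<le> V"
proof -
  have "- V * mid (\<lambda>_ _. 1) s l x \<le> mid h s l x" "mid h s l x \<le> V * mid (\<lambda>_ _. 1) s l x" for x
    using mid_le[OF h, of s l x] by auto
  from iter_contract[of "mid (\<lambda>_ _. 1) s l" "mid h s l" "-V" V n "s - 1 - int n",
      OF bounded_fun_mid_one mid_one_pos bounded_fun_mid[OF h] this]
  obtain a b where "- V \<le> a" "b \<le> V"
    "\<And>x. a * iter K n (s - 1 - int n) (mid (\<lambda>_ _. 1) s l) x \<le> iter K n (s - 1 - int n) (mid h s l) x"
    "\<And>x. iter K n (s - 1 - int n) (mid h s l) x \<le> b * iter K n (s - 1 - int n) (mid (\<lambda>_ _. 1) s l) x"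
    by blast
  with ratio_between[OF chi this(3,4)] show ?thesis by auto
qed

text \<open>Seen from time \<open>s - 1 - n\<close>, the ratio of the two backward functions lies in
  an interval of length 2 V rate^n. Both smoothed values are weighted averages of that ratio: for
  \<open>chi'\<close> the extra \<open>n' - n\<close> steps only shrink the interval
  further.\<close>

lemma forget_initial:
  assumes chi: "prob_space chi" "sets chi = sets lam" "prob_space chi'" "sets chi' = sets lam"
    and nn: "n \<le> n'"
  shows "\<bar>num h chi s n l / den chi s n l - num h chi' s n' l / den chi' s n' l\<bar> \<le> 2 * V * rate ^ n"
proof -
  let ?D = "mid (\<lambda>_ _. 1) s l" and ?N = "mid h s l"
  have "- V * ?D x \<le> ?N x" "?N x \<le> V * ?D x" for x
    using mid_le[OF h, of s l x] by auto
  from iter_contract[of ?D ?N "-V" V n "s - 1 - int n", OF bounded_fun_mid_one mid_one_pos bounded_fun_mid[OF h] this]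
  obtain a b where ab: "b - a = rate ^ n * (2 * V)"
    "\<And>x. a * iter K n (s - 1 - int n) ?D x \<le> iter K n (s - 1 - int n) ?N x"
    "\<And>x. iter K n (s - 1 - int n) ?N x \<le> b * iter K n (s - 1 - int n) ?D x"
    by auto
  have *: "iter K n' (s - 1 - int n') f = iter K (n' - n) (s - 1 - int n') (iter K n (s - 1 - int n) f)" for f
  proof -
    have "s - 1 - int n' + int (n' - n) = s - 1 - int n" using nn by simp
    then have "iter K (n' - n + n) (s - 1 - int n') f = iter K (n' - n) (s - 1 - int n') (iter K n (s - 1 - int n) f)"
      by (simp only: iter_add)
    then show ?thesis using nn by (simp only: le_add_diff_inverse2)
  qed
  obtain a' b' where ab': "a \<le> a'" "b' \<le> b"
    "\<And>x. a' * iter K n' (s - 1 - int n') ?D x \<le> iter K n' (s - 1 - int n') ?N x"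
    "\<And>x. iter K n' (s - 1 - int n') ?N x \<le> b' * iter K n' (s - 1 - int n') ?D x"
    unfolding *
    using iter_contract[of "iter K n (s - 1 - int n) ?D" "iter K n (s - 1 - int n) ?N" a b "n' - n" "s - 1 - int n'",
        OF bounded_fun_iter[OF kernel bounded_fun_mid_one] iter_pos[OF kernel bounded_fun_mid_one kernel_pos mid_one_pos]
           bounded_fun_iter[OF kernel bounded_fun_mid[OF h]] ab(2,3)]
    by blast
  from ratio_between[OF chi(1,2) ab(2,3)] ratio_between[OF chi(3,4) ab'(3,4)] ab(1) ab'(1,2)
  show ?thesis by (simp add: mult_ac)
qed

text \<open>The ratio of two backward functions is nearly constant, since the contraction applies to it
  as well; its initial oscillation is controlled by the two-sided bound on the kernel.\<close>

lemma forget_final: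
  assumes chi: "prob_space chi" "sets chi = sets lam" and ll: "l \<le> l'"
  shows "\<bar>num h chi s n l / den chi s n l - num h chi s n l' / den chi s n l'\<bar> \<le> V * (sp / sm) * rate ^ l"
proof (cases "l = l'")
  case True
  then show ?thesis using V_nonneg[OF h] minor rate_bounds by simp
next
  case False
  with ll obtain j where j: "l' = l + Suc j" by (metis less_iff_Suc_add le_neq_implies_less add_Suc_right)
  let ?b = "\<lambda>l. iter K l s (\<lambda>_. 1)"
  let ?t = "s + int l"
  let ?f = "iter K j (?t + 1) (\<lambda>_. 1)"
  \<comment> \<open>One kernel step already makes the extra future nearly constant in the state: the
    function at time \<open>?t\<close> lies between \<open>sm * c\<close> and \<open>sp * c\<close>.
    These are the initial bounds for the contraction over the remaining \<open>l\<close>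
    steps.\<close>
  define c where "c = (\<integral>x'. w ?t x' * ?f x' \<partial>lam)"
  have bf: "bounded_fun ?f" "\<And>x. 0 < ?f x"
    by (auto intro!: bounded_fun_iter kernel bounded_fun_const iter_one_pos kernel_pos)
  have b0: "sm * c * 1 \<le> app (K ?t) ?f x" "app (K ?t) ?f x \<le> sp * c * 1" for x
    using app_bounds[OF bf(1) less_imp_le[OF bf(2)], of ?t x] by (auto simp: c_def)
  have "0 < app (K ?t) ?f undefined" by (intro app_pos kernel kernel_pos bf)
  then have "0 < sp * c" using b0(2)[of undefined] by linarith
  then have c: "0 < c" using minor by (auto simp: zero_less_mult_iff)
  obtain a b where ab: "sm * c \<le> a" "b - a = rate ^ l * (sp * c - sm * c)"
    "\<And>x. a * ?b l x \<le> ?b l' x" "\<And>x. ?b l' x \<le> b * ?b l x"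
    using iter_contract[of "\<lambda>_. 1" "app (K ?t) ?f" "sm * c" "sp * c" l s,
        OF bounded_fun_const _ bounded_fun_app[OF kernel bf(1)] b0]
    unfolding j iter_add by auto
  have a: "0 < a" using ab(1) c minor by (meson less_le_trans mult_pos_pos)
  have ab_le: "a \<le> b"
  proof -
    have "0 \<le> rate ^ l * (sp * c - sm * c)"
      using rate_bounds minor c by (intro mult_nonneg_nonneg) (auto intro: mult_right_mono)
    with ab(2) show ?thesis by simp
  qed
  let ?u = "s - 1 - int n"
  have bb: "bounded_fun (?b l)" for l by (intro bounded_fun_iter kernel bounded_fun_const)
  have den: "den chi s n l = (\<integral>x. iter K n ?u (app (K (s - 1)) (?b l)) x \<partial>chi)" for l
    unfolding den_alt mid_def by simp
  have iden: "integrable chi (iter K n ?u (app (K (s - 1)) (?b l)))" for l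
    by (intro integrable_chi chi bounded_fun_iter kernel bounded_fun_app bb)
  have "a * den chi s n l \<le> den chi s n l'" and le2: "den chi s n l' \<le> b * den chi s n l"
  proof -
    have m: "iter K n ?u (app (K (s - 1)) f) x \<le> iter K n ?u (app (K (s - 1)) g) x"
      if "bounded_fun f" "bounded_fun g" "\<And>x. f x \<le> g x" for f g x
      by (intro iter_mono app_mono kernel bounded_fun_app that less_imp_le kernel_pos)
    have sc: "iter K n ?u (app (K (s - 1)) (\<lambda>x. e * ?b l x)) x = e * iter K n ?u (app (K (s - 1)) (?b l)) x" for e x
      by (simp add: app_scale[abs_def] iter_scale)
    have 1: "a * iter K n ?u (app (K (s - 1)) (?b l)) x \<le> iter K n ?u (app (K (s - 1)) (?b l')) x" for x
      unfolding sc[symmetric] by (intro m bb bounded_fun_scale ab)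
    have 2: "iter K n ?u (app (K (s - 1)) (?b l')) x \<le> b * iter K n ?u (app (K (s - 1)) (?b l)) x" for x
      unfolding sc[symmetric] by (intro m bb bounded_fun_scale ab)
    have "(\<integral>x. a * iter K n ?u (app (K (s - 1)) (?b l)) x \<partial>chi) \<le> (\<integral>x. iter K n ?u (app (K (s - 1)) (?b l')) x \<partial>chi)"
      using iden 1 by (intro integral_mono) auto
    then show "a * den chi s n l \<le> den chi s n l'" by (simp add: den)
    have "(\<integral>x. iter K n ?u (app (K (s - 1)) (?b l')) x \<partial>chi) \<le> (\<integral>x. b * iter K n ?u (app (K (s - 1)) (?b l)) x \<partial>chi)"
      using iden 2 by (intro integral_mono) auto
    then show "den chi s n l' \<le> b * den chi s n l" by (simp add: den)
  qed
  note le1 = this(1)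
  \<comment> \<open>The ratio of total likelihoods is an average of the ratios of backward
    functions, so it lies in [a, b]. Subtracting \<open>e\<close> times the shorter backward
    function from the longer one leaves a relative remainder of size at most
    \<open>b - a\<close>.\<close>
  define e where "e = den chi s n l' / den chi s n l"
  have dpos: "0 < den chi s n l" "0 < den chi s n l'" using den_pos[OF chi] by auto
  have e: "a \<le> e" "e \<le> b" using le1 le2 dpos by (auto simp: e_def field_simps)
  let ?d = "\<lambda>x. ?b l' x - e * ?b l x"
  have bd: "bounded_fun ?d" by (intro bounded_fun_diff bounded_fun_scale bb)
  have d: "\<bar>?d x\<bar> \<le> (b - a) * ?b l x" for x
  proof -
    have "0 < ?b l x" by (intro iter_one_pos kernel kernel_pos)
    then have "a * ?b l x \<le> e * ?b l x" "e * ?b l x \<le> b * ?b l x" using e by auto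
    then show ?thesis using ab(3)[of x] ab(4)[of x] by (auto simp: abs_le_iff left_diff_distrib)
  qed
  have bm: "bounded_fun (mid h s l)" for l by (rule bounded_fun_mid[OF h])
  have md: "\<bar>mid h s l' x - e * mid h s l x\<bar> \<le> V * (b - a) * mid (\<lambda>_ _. 1) s l x" for x
  proof -
    have "mid h s l' x - e * mid h s l x = app (\<lambda>x x'. K (s - 1) x x' * h x x') ?d x"
      unfolding mid_def by (simp add: app_diff bounded_kernel_mult[OF h] bb bounded_fun_scale app_scale)
    also have "\<bar>\<dots>\<bar> \<le> V * app (K (s - 1)) (\<lambda>x. \<bar>?d x\<bar>) x" by (rule app_mult_le[OF h bd])
    also have "\<dots> \<le> V * app (K (s - 1)) (\<lambda>x. (b - a) * ?b l x) x"
      by (intro mult_left_mono app_mono kernel bounded_fun_abs bd bounded_fun_scale bb d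
          less_imp_le kernel_pos V_nonneg[OF h])
    finally show ?thesis by (simp add: app_scale mid_def)
  qed
  have idiff: "\<bar>iter K n ?u (mid h s l') x - e * iter K n ?u (mid h s l) x\<bar>
      \<le> V * (b - a) * iter K n ?u (mid (\<lambda>_ _. 1) s l) x" for x
  proof -
    let ?m = "\<lambda>x. mid h s l' x - e * mid h s l x" and ?M = "\<lambda>x. V * (b - a) * mid (\<lambda>_ _. 1) s l x"
    have bm': "bounded_fun ?m" "bounded_fun ?M"
      by (intro bounded_fun_diff bounded_fun_scale bm bounded_fun_mid_one)+
    have L: "- 1 * ?M x \<le> ?m x" for x using md[of x] by linarith
    have "iter K n ?u ?m x \<le> iter K n ?u ?M x"
      using md by (intro iter_mono kernel bm' kernel_nonneg) (auto simp: abs_le_iff)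
    moreover have "iter K n ?u (\<lambda>x. - 1 * ?M x) x \<le> iter K n ?u ?m x"
      by (intro iter_mono kernel bm' bounded_fun_scale kernel_nonneg L)
    moreover have "iter K n ?u ?m x = iter K n ?u (mid h s l') x - e * iter K n ?u (mid h s l) x"
      by (simp add: iter_diff kernel bm bounded_fun_scale iter_scale)
    ultimately show ?thesis by (simp only: iter_scale)
  qed
  have inum: "integrable chi (iter K n ?u (mid h s l))" for l
    by (intro integrable_chi chi bounded_fun_iter kernel bm)
  have "\<bar>num h chi s n l' - e * num h chi s n l\<bar>
      = \<bar>\<integral>x. iter K n ?u (mid h s l') x - e * iter K n ?u (mid h s l) x \<partial>chi\<bar>"
    unfolding num_def using inum by simp
  also have "\<dots> \<le> (\<integral>x. V * (b - a) * iter K n ?u (mid (\<lambda>_ _. 1) s l) x \<partial>chi)"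
  proof (rule order_trans[OF integral_abs_bound integral_mono])
    show "integrable chi (\<lambda>x. V * (b - a) * iter K n ?u (mid (\<lambda>_ _. 1) s l) x)"
      by (intro integrable_mult_right integrable_chi chi bounded_fun_iter kernel bounded_fun_mid_one)
  qed (use inum idiff in auto)
  also have "\<dots> = V * (b - a) * den chi s n l" unfolding den_alt by simp
  finally have main: "\<bar>num h chi s n l' - e * num h chi s n l\<bar> \<le> V * (b - a) * den chi s n l" .
  have "num h chi s n l / den chi s n l - num h chi s n l' / den chi s n l'
      = - (num h chi s n l' - e * num h chi s n l) / den chi s n l'"
    using dpos by (simp add: e_def field_simps)
  then have "\<bar>num h chi s n l / den chi s n l - num h chi s n l' / den chi s n l'\<bar>
      = \<bar>num h chi s n l' - e * num h chi s n l\<bar> / den chi s n l'"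
    using dpos by (simp add: abs_divide abs_minus_commute)
  also have "\<dots> \<le> V * (b - a) * den chi s n l / den chi s n l'"
    using main dpos by (intro divide_right_mono) auto
  also have "\<dots> \<le> V * (b - a) * den chi s n l / (a * den chi s n l)"
    using le1 dpos a ab_le V_nonneg[OF h] by (intro divide_left_mono mult_nonneg_nonneg mult_pos_pos) auto
  also have "\<dots> = V * (b - a) / a" using dpos a by simp
  \<comment> \<open>The unknown scale \<open>c\<close> of the extra future likelihood cancels now:
    \<open>b - a\<close> is rate^l (sp - sm) c, and \<open>a\<close> is at least
    \<open>sm * c\<close>.\<close>
  also have "\<dots> \<le> V * (b - a) / (sm * c)"
    using ab(1) ab_le V_nonneg[OF h] a c minor by (intro divide_left_mono mult_nonneg_nonneg mult_pos_pos) auto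
  also have "\<dots> = V * rate ^ l * ((sp - sm) / sm)"
    using c minor by (simp add: ab(2) field_simps)
  also have "\<dots> \<le> V * rate ^ l * (sp / sm)"
    using V_nonneg[OF h] rate_bounds minor by (intro mult_left_mono mult_nonneg_nonneg divide_right_mono) auto
  finally show ?thesis by (simp add: mult_ac)
qed

lemma forget:
  assumes chi: "prob_space chi" "sets chi = sets lam" "prob_space chi'" "sets chi' = sets lam"
    and nn: "n \<le> n'" and ll: "l \<le> l'"
  shows "\<bar>num h chi s n l / den chi s n l - num h chi' s n' l' / den chi' s n' l'\<bar>
    \<le> V * (2 * rate ^ n + sp / sm * rate ^ l)"
  using forget_initial[OF chi nn, of l] forget_final[OF chi(3,4) ll, of n']
  by (simp add: algebra_simps)

end

end

section \<open>Moments of sums of mixing variables\<close>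

text \<open>The moment is bounded, not its p-th root, so bounds add under the integral. The
  nonnegative integral makes finiteness part of the bound.\<close>

definition moment_le :: "'w measure \<Rightarrow> real \<Rightarrow> ('w \<Rightarrow> real) \<Rightarrow> real \<Rightarrow> bool" where
  "moment_le P p Z c \<longleftrightarrow> Z \<in> borel_measurable P \<and> (\<integral>\<^sup>+ w. ennreal (\<bar>Z w\<bar> powr p) \<partial>P) \<le> ennreal c"

lemma moment_leD [measurable_dest]: "moment_le P p Z c \<Longrightarrow> Z \<in> borel_measurable P"
  by (simp add: moment_le_def)

lemma moment_le_mono: "moment_le P p Z c \<Longrightarrow> c \<le> c' \<Longrightarrow> moment_le P p Z c'"
  by (auto simp: moment_le_def intro: order_trans ennreal_leI)

lemma moment_le_AE_mono:
  assumes "moment_le P p Z c" "Z' \<in> borel_measurable P" "AE w in P. \<bar>Z' w\<bar> \<le> \<bar>Z w\<bar>" "0 \<le> p"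
  shows "moment_le P p Z' c"
proof -
  have "(\<integral>\<^sup>+ w. ennreal (\<bar>Z' w\<bar> powr p) \<partial>P) \<le> (\<integral>\<^sup>+ w. ennreal (\<bar>Z w\<bar> powr p) \<partial>P)"
  proof (rule nn_integral_mono_AE)
    show "AE w in P. ennreal (\<bar>Z' w\<bar> powr p) \<le> ennreal (\<bar>Z w\<bar> powr p)"
      using assms(3) by eventually_elim (auto intro!: ennreal_leI powr_mono2 simp: assms(4))
  qed
  then show ?thesis using assms unfolding moment_le_def by auto
qed

lemma moment_le_integrable:
  assumes "moment_le P p Z c" shows "integrable P (\<lambda>w. \<bar>Z w\<bar> powr p)"
proof (rule integrableI_bounded)
  show "(\<integral>\<^sup>+ w. ennreal (norm (\<bar>Z w\<bar> powr p)) \<partial>P) < \<infinity>"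
    using assms by (auto simp: moment_le_def intro: le_less_trans)
qed (use assms in \<open>auto dest: moment_leD\<close>)

lemma moment_le_integral:
  assumes "moment_le P p Z c" "0 \<le> c" shows "(\<integral>w. \<bar>Z w\<bar> powr p \<partial>P) \<le> c"
  using assms nn_integral_eq_integral[OF moment_le_integrable[OF assms(1)]]
  by (simp add: moment_le_def)

lemma moment_le_linear:
  assumes X: "moment_le P p X a" and Y: "moment_le P p Y b" and nn: "0 \<le> a" "0 \<le> b" "0 \<le> d" "0 \<le> e" "0 \<le> p"
    and Z: "Z \<in> borel_measurable P"
    and le: "\<And>w. \<bar>Z w\<bar> powr p \<le> d * \<bar>X w\<bar> powr p + e * \<bar>Y w\<bar> powr p"
  shows "moment_le P p Z (d * a + e * b)"
proof -
  have [measurable]: "X \<in> borel_measurable P" "Y \<in> borel_measurable P" using X Y by (auto dest: moment_leD)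
  have "(\<integral>\<^sup>+ w. ennreal (\<bar>Z w\<bar> powr p) \<partial>P)
      \<le> (\<integral>\<^sup>+ w. ennreal d * ennreal (\<bar>X w\<bar> powr p) + ennreal e * ennreal (\<bar>Y w\<bar> powr p) \<partial>P)"
    using le nn by (intro nn_integral_mono) (simp add: ennreal_mult[symmetric] ennreal_plus[symmetric] del: ennreal_plus)
  also have "\<dots> = ennreal d * (\<integral>\<^sup>+ w. ennreal (\<bar>X w\<bar> powr p) \<partial>P) + ennreal e * (\<integral>\<^sup>+ w. ennreal (\<bar>Y w\<bar> powr p) \<partial>P)"
    by (subst nn_integral_add) (auto simp: nn_integral_cmult)
  also have "\<dots> \<le> ennreal d * ennreal a + ennreal e * ennreal b"
    using X Y by (intro add_mono mult_left_mono) (auto simp: moment_le_def)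
  also have "\<dots> = ennreal (d * a + e * b)"
    using nn by (simp add: ennreal_mult[symmetric] ennreal_plus[symmetric] del: ennreal_plus)
  finally show ?thesis using Z by (simp add: moment_le_def)
qed

lemma moment_le_add:
  assumes X: "moment_le P p X a" and Y: "moment_le P p Y b" and nn: "0 \<le> a" "0 \<le> b" "0 < p"
    and C: "0 \<le> d" "0 \<le> e" "\<And>x y. 0 \<le> x \<Longrightarrow> 0 \<le> y \<Longrightarrow> (x + y) powr p \<le> d * x powr p + e * y powr p"
  shows "moment_le P p (\<lambda>w. X w + Y w) (d * a + e * b)"
proof (rule moment_le_linear[OF X Y])
  show "(\<lambda>w. X w + Y w) \<in> borel_measurable P" using X Y by (auto dest: moment_leD)
  fix w
  have "\<bar>X w + Y w\<bar> powr p \<le> (\<bar>X w\<bar> + \<bar>Y w\<bar>) powr p" using nn by (intro powr_mono2) auto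
  also have "\<dots> \<le> d * \<bar>X w\<bar> powr p + e * \<bar>Y w\<bar> powr p" by (intro C) auto
  finally show "\<bar>X w + Y w\<bar> powr p \<le> d * \<bar>X w\<bar> powr p + e * \<bar>Y w\<bar> powr p" .
qed (use nn C in auto)

lemma powr_add_le_double:
  assumes "0 \<le> x" "0 \<le> y" "(0::real) < p"
  shows "(x + y) powr p \<le> 2 powr p * x powr p + 2 powr p * y powr p"
  using powr_sum_le[of p "{True, False}" "\<lambda>b. if b then x else y"] assms by (auto simp: distrib_left)

lemma moment_le_add_double:
  assumes X: "moment_le P p X a" and Y: "moment_le P p Y b" and nn: "0 \<le> a" "0 \<le> b" "0 < p"
  shows "moment_le P p (\<lambda>w. X w + Y w) (2 powr p * (a + b))"
  using moment_le_add[OF X Y nn, of "2 powr p" "2 powr p"] powr_add_le_double nn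
  by (simp add: distrib_left)

lemma moment_le_minus: "moment_le P p X a \<Longrightarrow> moment_le P p (\<lambda>w. - X w) a"
  by (auto simp: moment_le_def)

lemma moment_le_sum:
  assumes X: "\<And>i. i \<in> I \<Longrightarrow> moment_le P p (X i) c" and c: "0 \<le> c" "0 < p" and card: "real (card I) \<le> N" 
  shows "moment_le P p (\<lambda>w. \<Sum>i\<in>I. X i w) (N powr (p + 1) * c)"
proof -
  have [measurable]: "\<And>i. i \<in> I \<Longrightarrow> X i \<in> borel_measurable P" using X by (auto dest: moment_leD)
  have "(\<integral>\<^sup>+ w. ennreal (\<bar>\<Sum>i\<in>I. X i w\<bar> powr p) \<partial>P)
      \<le> (\<integral>\<^sup>+ w. ennreal (real (card I) powr p) * (\<Sum>i\<in>I. ennreal (\<bar>X i w\<bar> powr p)) \<partial>P)"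
  proof (intro nn_integral_mono)
    fix w
    have "\<bar>\<Sum>i\<in>I. X i w\<bar> powr p \<le> (\<Sum>i\<in>I. \<bar>X i w\<bar>) powr p"
      using c by (intro powr_mono2) auto
    also have "\<dots> \<le> real (card I) powr p * (\<Sum>i\<in>I. \<bar>X i w\<bar> powr p)" using c by (intro powr_sum_le) auto
    finally show "ennreal (\<bar>\<Sum>i\<in>I. X i w\<bar> powr p) \<le> ennreal (real (card I) powr p) * (\<Sum>i\<in>I. ennreal (\<bar>X i w\<bar> powr p))"
      by (simp add: sum_ennreal ennreal_mult[symmetric] sum_nonneg ennreal_leI)
  qed
  also have "\<dots> = ennreal (real (card I) powr p) * (\<Sum>i\<in>I. \<integral>\<^sup>+ w. ennreal (\<bar>X i w\<bar> powr p) \<partial>P)"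
    by (subst nn_integral_cmult) (auto simp: nn_integral_sum simp del: sum_ennreal)
  also have "\<dots> \<le> ennreal (real (card I) powr p) * (\<Sum>i\<in>I. ennreal c)"
    using X by (intro mult_left_mono sum_mono) (auto simp: moment_le_def)
  also have "\<dots> = ennreal (real (card I) powr p * (real (card I) * c))"
    using c by (simp add: ennreal_mult ennreal_of_nat_eq_real_of_nat)
  also have "\<dots> = ennreal (real (card I) powr (p + 1) * c)"
    by (cases "card I = 0") (auto simp: powr_add mult.assoc)
  also have "\<dots> \<le> ennreal (N powr (p + 1) * c)"
    using c card by (intro ennreal_leI mult_right_mono powr_mono2) auto
  finally show ?thesis by (simp add: moment_le_def)
qed

section \<open>Comparison of exponents, layers of functions, products\<close>

context prob_space
begin

lemma moment_le_lower:
  assumes X: "moment_le M p X c" and p: "0 < p'" "p' \<le> p" and e: "0 < e" "0 \<le> c"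
  shows "moment_le M p' X (e powr p' + e powr (p' - p) * c)"
proof -
  have [measurable]: "X \<in> borel_measurable M" using X by (auto dest: moment_leD)
  have "(\<integral>\<^sup>+ w. ennreal (\<bar>X w\<bar> powr p') \<partial>M)
      \<le> (\<integral>\<^sup>+ w. ennreal (e powr p') + ennreal (e powr (p' - p)) * ennreal (\<bar>X w\<bar> powr p) \<partial>M)"
    using powr_le_scaled[OF abs_ge_zero e(1) p]
    by (intro nn_integral_mono) (simp add: ennreal_mult[symmetric] ennreal_plus[symmetric] del: ennreal_plus)
  also have "\<dots> = ennreal (e powr p') + ennreal (e powr (p' - p)) * (\<integral>\<^sup>+ w. ennreal (\<bar>X w\<bar> powr p) \<partial>M)"
    by (subst nn_integral_add) (auto simp: nn_integral_cmult emeasure_space_1)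
  also have "\<dots> \<le> ennreal (e powr p') + ennreal (e powr (p' - p)) * ennreal c"
    using X by (intro add_mono mult_left_mono) (auto simp: moment_le_def)
  also have "\<dots> = ennreal (e powr p' + e powr (p' - p) * c)"
    using e by (simp add: ennreal_mult[symmetric] ennreal_plus[symmetric] del: ennreal_plus)
  finally show ?thesis by (simp add: moment_le_def)
qed

text \<open>The free scale is taken equal to the natural size \<open>e\<close> of the variable; the
  bound then keeps its homogeneous form at every smaller exponent.\<close>

lemma moment_le_lower_scaled:
  assumes X: "moment_le M p X (c * e powr p)" and p: "0 < p'" "p' \<le> p" and e: "0 < e" "0 \<le> c"
  shows "moment_le M p' X ((1 + c) * e powr p')"
proof -
  have "e powr p' + e powr (p' - p) * (c * e powr p) = (1 + c) * e powr p'"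
    using e by (simp add: powr_diff field_simps)
  with moment_le_lower[OF X p e(1)] e show ?thesis by simp
qed

lemma moment_le_lower_one:
  assumes X: "moment_le M p X c" and p: "0 < p'" "p' \<le> p" and c: "0 \<le> c"
  shows "moment_le M p' X (1 + c)"
  using moment_le_lower[OF X p zero_less_one c] by simp

text \<open>\<open>b\<close> is within 1 / N of an average of N indicators of its upper level sets,
  which belong to \<open>G\<close>. An inequality known for events therefore passes to functions
  with the same constant.\<close>

lemma layer_bound:
  fixes Z b :: "'a \<Rightarrow> real"
  assumes G: "subalgebra M G" and Z: "integrable M Z" and Z1: "\<And>w. \<bar>Z w\<bar> \<le> 1"
    and b: "b \<in> borel_measurable G" "\<And>w. 0 \<le> b w" "\<And>w. b w \<le> 1"
    and le: "\<And>B. B \<in> sets G \<Longrightarrow> (\<integral>w. Z w * indicator B w \<partial>M) \<le> e"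
  shows "(\<integral>w. Z w * b w \<partial>M) \<le> e"
proof (rule field_le_epsilon)
  fix eps :: real assume "0 < eps"
  then obtain N :: nat where N: "0 < N" "1 / real N < eps"
    using reals_Archimedean[of eps] by (auto simp: inverse_eq_divide) (metis zero_less_Suc of_nat_Suc)
  define B where "B j = {w \<in> space G. real j \<le> real N * b w}" for j
  define bN where "bN w = (\<Sum>j=1..N. indicator (B j) w) / real N" for w
  have [measurable]: "b \<in> borel_measurable G" by fact
  have B: "B j \<in> sets G" for j unfolding B_def by measurable
  have BM [measurable]: "B j \<in> sets M" for j using B G by (auto simp: subalgebra_def)
  have [measurable]: "b \<in> borel_measurable M" "Z \<in> borel_measurable M"
    using measurable_from_subalg[OF G b(1)] Z by auto
  have bN: "bN w \<le> b w" "b w \<le> bN w + 1 / real N" if "w \<in> space M" for w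
  proof -
    have "bN w = (\<Sum>j=1..N. of_bool (real j \<le> real N * b w)) / real N"
      using that G unfolding bN_def B_def by (auto simp: indicator_def subalgebra_def intro!: sum.cong)
    with unit_layer[OF b(2)[of w] b(3)[of w] N(1)] show "bN w \<le> b w" "b w \<le> bN w + 1 / real N" by auto
  qed
  have iZB: "integrable M (\<lambda>w. Z w * indicator (B j) w)" for j
    using Z1 by (intro integrable_const_bound[of _ 1]) (auto simp: abs_mult indicator_def)
  have "(\<integral>w. Z w * bN w \<partial>M) = (\<integral>w. (\<Sum>j=1..N. Z w * indicator (B j) w) / real N \<partial>M)"
    by (simp only: bN_def sum_distrib_left times_divide_eq_right)
  also have "\<dots> = (\<Sum>j=1..N. \<integral>w. Z w * indicator (B j) w \<partial>M) / real N"
    by (simp only: integral_divide_zero Bochner_Integration.integral_sum[OF iZB])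
  also have "\<dots> \<le> (\<Sum>j=1..N. e) / real N"
    by (intro divide_right_mono sum_mono le B) auto
  also have "\<dots> = e" using N by simp
  finally have 1: "(\<integral>w. Z w * bN w \<partial>M) \<le> e" .
  have "(\<integral>w. Z w * b w \<partial>M) \<le> (\<integral>w. Z w * bN w + 1 / real N \<partial>M)"
  proof (rule integral_mono)
    have bN1: "0 \<le> bN w" "bN w \<le> 1" if "w \<in> space M" for w
      using bN(1)[OF that] b(3)[of w] by (auto simp: bN_def intro!: divide_nonneg_nonneg sum_nonneg)
    have "AE w in M. norm (Z w * bN w) \<le> 1"
      using Z1 bN1 by (intro AE_I2) (auto simp: abs_mult intro!: mult_le_one)
    moreover have "(\<lambda>w. Z w * bN w) \<in> borel_measurable M" unfolding bN_def by measurable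
    ultimately have "integrable M (\<lambda>w. Z w * bN w)"
      by (intro integrable_const_bound[of _ 1]) auto
    then show "integrable M (\<lambda>w. Z w * bN w + 1 / real N)" by auto
    show "integrable M (\<lambda>w. Z w * b w)"
      using Z1 b by (intro integrable_const_bound[of _ 1]) (auto simp: abs_mult intro!: mult_le_one)
    fix w assume w: "w \<in> space M"
    have "Z w * (b w - bN w) \<le> \<bar>Z w\<bar> * (b w - bN w)"
      using bN[OF w] by (intro mult_right_mono) auto
    also have "\<dots> \<le> 1 * (1 / real N)" using Z1[of w] bN[OF w] by (intro mult_mono) auto
    finally have "Z w * (b w - bN w) \<le> 1 * (1 / real N)" .
    then show "Z w * b w \<le> Z w * bN w + 1 / real N" by (simp add: right_diff_distrib)
  qed
  also have "\<dots> = (\<integral>w. Z w * bN w \<partial>M) + 1 / real N"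
  proof -
    have "integrable M (\<lambda>w. Z w * bN w)"
      by (simp only: bN_def sum_distrib_left times_divide_eq_right)
        (intro integrable_divide_zero Bochner_Integration.integrable_sum iZB)
    then show ?thesis by (simp add: prob_space)
  qed
  finally show "(\<integral>w. Z w * b w \<partial>M) \<le> e + eps" using 1 N by linarith
qed

lemma moment_one_bound:
  assumes "moment_le M 1 X a" "0 \<le> a"
  shows "integrable M X" "\<bar>expectation X\<bar> \<le> a"
proof -
  have [measurable]: "X \<in> borel_measurable M" using assms by (auto dest: moment_leD)
  have "integrable M (\<lambda>w. \<bar>X w\<bar>)" using moment_le_integrable[OF assms(1)] by simp
  then show "integrable M X" by (subst (asm) integrable_abs_iff) auto
  have "\<bar>expectation X\<bar> \<le> (\<integral>w. \<bar>X w\<bar> \<partial>M)" by (rule integral_abs_bound)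
  also have "\<dots> \<le> a" using moment_le_integral[OF assms] by simp
  finally show "\<bar>expectation X\<bar> \<le> a" .
qed

text \<open>Young's inequality with a free weight \<open>t\<close> in place of Cauchy-Schwarz;
  choosing \<open>t\<close> later balances a small factor against a bounded one.\<close>

lemma moment_two_product:
  assumes X: "moment_le M 2 X a" and Y: "moment_le M 2 Y b" and nn: "0 \<le> a" "0 \<le> b" "0 < t"
  shows "integrable M (\<lambda>w. X w * Y w)" "\<bar>expectation (\<lambda>w. X w * Y w)\<bar> \<le> (t * a + b / t) / 2"
proof -
  have [measurable]: "X \<in> borel_measurable M" "Y \<in> borel_measurable M" using X Y by (auto dest: moment_leD)
  have i2: "integrable M (\<lambda>w. (X w)\<^sup>2)" "integrable M (\<lambda>w. (Y w)\<^sup>2)"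
    using moment_le_integrable[OF X] moment_le_integrable[OF Y] by (auto simp: powr_numeral)
  have b2: "(\<integral>w. (X w)\<^sup>2 \<partial>M) \<le> a" "(\<integral>w. (Y w)\<^sup>2 \<partial>M) \<le> b"
    using moment_le_integral[OF X nn(1)] moment_le_integral[OF Y nn(2)] by (auto simp: powr_numeral)
  have le: "\<bar>X w * Y w\<bar> \<le> (t * (X w)\<^sup>2 + (Y w)\<^sup>2 / t) / 2" for w
  proof -
    have "0 \<le> (t * \<bar>X w\<bar> - \<bar>Y w\<bar>)\<^sup>2 / t" using nn by simp
    then show ?thesis using nn by (simp add: power2_eq_square field_simps abs_mult)
  qed
  have i: "integrable M (\<lambda>w. (t * (X w)\<^sup>2 + (Y w)\<^sup>2 / t) / 2)" using i2 by auto
  show int: "integrable M (\<lambda>w. X w * Y w)"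
    by (rule Bochner_Integration.integrable_bound[OF i]) (use le in \<open>auto intro: order_trans[OF _ abs_ge_self]\<close>)
  have "\<bar>expectation (\<lambda>w. X w * Y w)\<bar> \<le> (\<integral>w. \<bar>X w * Y w\<bar> \<partial>M)" by (rule integral_abs_bound)
  also have "\<dots> \<le> (\<integral>w. (t * (X w)\<^sup>2 + (Y w)\<^sup>2 / t) / 2 \<partial>M)"
    using int i le by (intro integral_mono) auto
  also have "\<dots> = (t * (\<integral>w. (X w)\<^sup>2 \<partial>M) + (\<integral>w. (Y w)\<^sup>2 \<partial>M) / t) / 2" using i2 by simp
  also have "\<dots> \<le> (t * a + b / t) / 2"
    using b2 nn by (intro divide_right_mono add_mono mult_left_mono) auto
  finally show "\<bar>expectation (\<lambda>w. X w * Y w)\<bar> \<le> (t * a + b / t) / 2" .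
qed

end

text \<open>This weak form, a bound on pairs of events, is what covariances of fixed variables
  require. The conditional strength of beta-mixing returns when a random parameter has to be
  decoupled.\<close>

locale mixing_filtration = prob_space M for M :: "'w measure" +
  fixes F G :: "int \<Rightarrow> 'w measure" and r :: real
  assumes F: "\<And>u. subalgebra M (F u)" and G: "\<And>u. subalgebra M (G u)"
    and F_mono: "\<And>u v. u \<le> v \<Longrightarrow> sets (F u) \<subseteq> sets (F v)"
    and G_mono: "\<And>u v. u \<le> v \<Longrightarrow> sets (G v) \<subseteq> sets (G u)"
    and r: "0 < r" "r < 1"
    and alpha: "\<And>u n A B. A \<in> sets (F u) \<Longrightarrow> B \<in> sets (G (u + int n)) \<Longrightarrow>
      \<bar>prob (A \<inter> B) - prob A * prob B\<bar> \<le> r ^ n"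
begin

section \<open>Covariances across a gap\<close>

lemma F_measurable_mono: "X \<in> borel_measurable (F u) \<Longrightarrow> u \<le> v \<Longrightarrow> X \<in> borel_measurable (F v)"
  using F F_mono[of u v] by (intro measurable_from_subalg[of "F v" "F u"]) (auto simp: subalgebra_def)

lemma G_measurable_mono: "X \<in> borel_measurable (G v) \<Longrightarrow> u \<le> v \<Longrightarrow> X \<in> borel_measurable (G u)"
  using G G_mono[of u v] by (intro measurable_from_subalg[of "G u" "G v"]) (auto simp: subalgebra_def)

lemma F_measurable: "X \<in> borel_measurable (F u) \<Longrightarrow> X \<in> borel_measurable M"
  by (rule measurable_from_subalg[OF F])

lemma G_measurable: "X \<in> borel_measurable (G u) \<Longrightarrow> X \<in> borel_measurable M"
  by (rule measurable_from_subalg[OF G])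

text \<open>The layer bound is applied twice: first in \<open>a\<close> with an event of the future
  fixed, then in \<open>b\<close>. The sign \<open>c\<close> yields both halves of the absolute
  value, and no constant is lost.\<close>

lemma cov_unit:
  assumes a: "a \<in> borel_measurable (F u)" "\<And>w. 0 \<le> a w" "\<And>w. a w \<le> (1::real)"
    and b: "b \<in> borel_measurable (G (u + int n))" "\<And>w. 0 \<le> b w" "\<And>w. b w \<le> (1::real)"
  shows "\<bar>expectation (\<lambda>w. a w * b w) - expectation a * expectation b\<bar> \<le> r ^ n"
proof -
  have [measurable]: "a \<in> borel_measurable M" "b \<in> borel_measurable M"
    using F_measurable[OF a(1)] G_measurable[OF b(1)] by auto
  have ia: "integrable M a" by (rule integrable_const_bound[of _ 1]) (use a in auto)
  have ib: "integrable M b" by (rule integrable_const_bound[of _ 1]) (use b in auto)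
  have iab: "integrable M (\<lambda>w. a w * b w)"
    by (rule integrable_const_bound[of _ 1]) (use a b in \<open>auto simp: abs_mult intro!: mult_le_one\<close>)
  have Ea: "0 \<le> expectation a" "expectation a \<le> 1"
    using a integral_mono[OF ia, of "\<lambda>_. 1"] by (auto intro!: Bochner_Integration.integral_nonneg simp: prob_space)
  have 1: "\<bar>expectation (\<lambda>w. a w * indicator B w) - expectation a * prob B\<bar> \<le> r ^ n"
    if B: "B \<in> sets (G (u + int n))" for B
  proof -
    have [measurable]: "B \<in> sets M" using B G by (auto simp: subalgebra_def)
    have *: "(\<integral>w. (c * (indicator B w - prob B)) * a w \<partial>M) \<le> r ^ n" if c: "c = 1 \<or> c = - 1" for c :: real
    proof (rule layer_bound[OF F _ _ a])
      show "integrable M (\<lambda>w. c * (indicator B w - prob B))" by (auto simp: emeasure_eq_measure)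
      show "\<bar>c * (indicator B w - prob B)\<bar> \<le> 1" for w
        using c prob_le_1[of B] measure_nonneg[of M B] by (auto simp: indicator_def abs_mult)
      fix A assume A: "A \<in> sets (F u)"
      then have [measurable]: "A \<in> sets M" using F by (auto simp: subalgebra_def)
      have "(\<integral>w. c * (indicator B w - prob B) * indicator A w \<partial>M)
          = (\<integral>w. c * (indicator (A \<inter> B) w - prob B * indicator A w) \<partial>M)"
        by (intro Bochner_Integration.integral_cong) (auto simp: indicator_def)
      also have "\<dots> = c * (prob (A \<inter> B) - prob B * prob A)"
        by (simp add: emeasure_eq_measure)
      also have "\<dots> \<le> r ^ n" using alpha[OF A B] c by (auto simp: mult.commute)
      finally show "(\<integral>w. c * (indicator B w - prob B) * indicator A w \<partial>M) \<le> r ^ n" .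
    qed
    have "integrable M (\<lambda>w. a w * indicator B w)" using ia by (rule integrable_real_mult_indicator[rotated]) simp
    then have "(\<integral>w. c * (a w * indicator B w - prob B * a w) \<partial>M)
        = c * (expectation (\<lambda>w. a w * indicator B w) - expectation a * prob B)" for c
      using ia by (simp add: mult.commute)
    moreover have "(\<lambda>w. (c * (indicator B w - prob B)) * a w) = (\<lambda>w. c * (a w * indicator B w - prob B * a w))" for c
      by (auto simp: algebra_simps)
    ultimately have E: "(\<integral>w. (c * (indicator B w - prob B)) * a w \<partial>M)
        = c * (expectation (\<lambda>w. a w * indicator B w) - expectation a * prob B)" for c
      by simp
    show ?thesis using *[of 1, unfolded E] *[of "- 1", unfolded E] by (auto simp: abs_le_iff)
  qed
  have *: "(\<integral>w. (c * (a w - expectation a)) * b w \<partial>M) \<le> r ^ n" if c: "c = 1 \<or> c = - 1" for c :: real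
  proof (rule layer_bound[OF G _ _ b])
    show "integrable M (\<lambda>w. c * (a w - expectation a))" using ia by auto
    show "\<bar>c * (a w - expectation a)\<bar> \<le> 1" for w
      using c a(2,3)[of w] Ea by (auto simp: abs_mult)
    fix B assume B: "B \<in> sets (G (u + int n))"
    then have [measurable]: "B \<in> sets M" using G by (auto simp: subalgebra_def)
    have "integrable M (\<lambda>w. a w * indicator B w)" using ia by (rule integrable_real_mult_indicator[rotated]) simp
    then have "(\<integral>w. c * (a w - expectation a) * indicator B w \<partial>M)
        = c * (expectation (\<lambda>w. a w * indicator B w) - expectation a * prob B)"
      by (simp add: mult.assoc left_diff_distrib emeasure_eq_measure)
    then show "(\<integral>w. c * (a w - expectation a) * indicator B w \<partial>M) \<le> r ^ n"
      using 1[OF B] c by (auto simp: abs_le_iff)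
  qed
  have E: "(\<integral>w. (c * (a w - expectation a)) * b w \<partial>M)
      = c * (expectation (\<lambda>w. a w * b w) - expectation a * expectation b)" for c
    using iab ib by (simp add: mult.assoc left_diff_distrib)
  show ?thesis using *[of 1, unfolded E] *[of "- 1", unfolded E] by (auto simp: abs_le_iff)
qed

text \<open>The affine maps of [-K, K] and [-K', K'] onto [0, 1] scale the covariance by 1 / (4 K
  K').\<close>

lemma cov_bounded:
  assumes a: "a \<in> borel_measurable (F u)" "\<And>w. \<bar>a w\<bar> \<le> K" and K: "0 < K"
    and b: "b \<in> borel_measurable (G (u + int n))" "\<And>w. \<bar>b w\<bar> \<le> K'" and K': "0 < K'"
  shows "\<bar>expectation (\<lambda>w. a w * b w) - expectation a * expectation b\<bar> \<le> 4 * K * K' * r ^ n"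
proof -
  let ?a = "\<lambda>w. (a w + K) / (2 * K)" and ?b = "\<lambda>w. (b w + K') / (2 * K')"
  have [measurable]: "a \<in> borel_measurable M" "b \<in> borel_measurable M"
    using F_measurable[OF a(1)] G_measurable[OF b(1)] by auto
  have i: "integrable M a" "integrable M b"
    by (rule integrable_const_bound[of _ K], use a in auto) (rule integrable_const_bound[of _ K'], use b in auto)
  have i3: "integrable M (\<lambda>w. a w * b w)"
    by (rule integrable_const_bound[of _ "K * K'"]) (use a b K in \<open>auto simp: abs_mult intro!: mult_mono\<close>)
  note i = i i3
  have "\<bar>expectation (\<lambda>w. ?a w * ?b w) - expectation ?a * expectation ?b\<bar> \<le> r ^ n"
  proof (rule cov_unit[where u = u])
    show "0 \<le> ?a w" "?a w \<le> 1" for w using a(2)[of w] K by (auto simp: field_simps abs_le_iff)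
    show "0 \<le> ?b w" "?b w \<le> 1" for w using b(2)[of w] K' by (auto simp: field_simps abs_le_iff)
  qed (use a b in auto)
  moreover have "expectation (\<lambda>w. ?a w * ?b w) - expectation ?a * expectation ?b
      = (expectation (\<lambda>w. a w * b w) - expectation a * expectation b) / (4 * K * K')"
  proof -
    have "expectation (\<lambda>w. ?a w * ?b w) = expectation (\<lambda>w. (a w * b w + K * b w + K' * a w + K * K') / (4 * K * K'))"
      by (intro Bochner_Integration.integral_cong) (auto simp: field_simps)
    also have "\<dots> = (expectation (\<lambda>w. a w * b w) + K * expectation b + K' * expectation a + K * K') / (4 * K * K')"
      using i by (simp add: prob_space)
    moreover have "expectation ?a = (expectation a + K) / (2 * K)" "expectation ?b = (expectation b + K') / (2 * K')"
      using i by (auto simp: prob_space)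
    ultimately show ?thesis using K K' by (simp add: field_simps)
  qed
  ultimately show ?thesis using K K' by (simp add: abs_divide abs_mult field_simps)
qed

text \<open>The three terms are the value under independence, the mixing error of the variables
  truncated at \<open>K\<close>, and the tail beyond \<open>K\<close>, which is paid for by the
  moments of order \<open>q\<close>.\<close>

lemma mixed_moment:
  assumes A: "A \<in> borel_measurable (F u)" and B: "B \<in> borel_measurable (G (u + int n))"
    and m: "moment_le M d A x" "moment_le M e B y" "moment_le M q A x'" "moment_le M q B y'"
    and nn: "0 \<le> x" "0 \<le> y" "0 \<le> x'" "0 \<le> y'" and de: "0 < d" "0 < e" "d + e \<le> q" and K: "0 < K"
  shows "(\<integral>\<^sup>+ w. ennreal (\<bar>A w\<bar> powr d * \<bar>B w\<bar> powr e) \<partial>M)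
    \<le> ennreal (x * y + 4 * K powr (d + e) * r ^ n + K powr (d + e - q) * (x' + y'))"
proof -
  let ?a = "\<lambda>w. min \<bar>A w\<bar> K powr d" and ?b = "\<lambda>w. min \<bar>B w\<bar> K powr e"
  have [measurable]: "A \<in> borel_measurable M" "B \<in> borel_measurable M"
    using F_measurable[OF A] G_measurable[OF B] by auto
  have ba: "0 \<le> ?a w" "?a w \<le> K powr d" "?a w \<le> \<bar>A w\<bar> powr d" for w using K de by (auto intro!: powr_mono2)
  have bb: "0 \<le> ?b w" "?b w \<le> K powr e" "?b w \<le> \<bar>B w\<bar> powr e" for w using K de by (auto intro!: powr_mono2)
  have i1: "integrable M ?a" by (rule integrable_const_bound[of _ "K powr d"]) (use ba in auto)
  have i2: "integrable M ?b" by (rule integrable_const_bound[of _ "K powr e"]) (use bb in auto)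
  have i3: "integrable M (\<lambda>w. ?a w * ?b w)"
    by (rule integrable_const_bound[of _ "K powr d * K powr e"]) (use ba bb in \<open>auto intro!: mult_mono\<close>)
  note i = i1 i2 i3
  have "\<bar>expectation (\<lambda>w. ?a w * ?b w) - expectation ?a * expectation ?b\<bar> \<le> 4 * (K powr d) * (K powr e) * r ^ n"
    using A B ba bb K by (intro cov_bounded[where u = u]) auto
  moreover have "expectation ?a * expectation ?b \<le> x * y"
  proof (rule mult_mono)
    have "expectation ?a \<le> (\<integral>w. \<bar>A w\<bar> powr d \<partial>M)"
      using i ba moment_le_integrable[OF m(1)] by (intro integral_mono) auto
    then show "expectation ?a \<le> x" using moment_le_integral[OF m(1) nn(1)] by simp
    have "expectation ?b \<le> (\<integral>w. \<bar>B w\<bar> powr e \<partial>M)"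
      using i bb moment_le_integrable[OF m(2)] by (intro integral_mono) auto
    then show "expectation ?b \<le> y" using moment_le_integral[OF m(2) nn(2)] by simp
  qed (use nn in \<open>auto intro!: Bochner_Integration.integral_nonneg\<close>)
  ultimately have E: "expectation (\<lambda>w. ?a w * ?b w) \<le> x * y + 4 * K powr (d + e) * r ^ n"
    using K by (simp add: powr_add abs_le_iff mult.assoc)
  have "(\<integral>\<^sup>+ w. ennreal (\<bar>A w\<bar> powr d * \<bar>B w\<bar> powr e) \<partial>M)
      \<le> (\<integral>\<^sup>+ w. ennreal (?a w * ?b w) + ennreal (K powr (d + e - q)) * (ennreal (\<bar>A w\<bar> powr q) + ennreal (\<bar>B w\<bar> powr q)) \<partial>M)"
    using powr_prod_truncate[OF abs_ge_zero abs_ge_zero K de]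
    by (intro nn_integral_mono) (simp add: ennreal_mult[symmetric] ennreal_plus[symmetric] del: ennreal_plus)
  also have "\<dots> = (\<integral>\<^sup>+ w. ennreal (?a w * ?b w) \<partial>M) + ennreal (K powr (d + e - q)) *
      ((\<integral>\<^sup>+ w. ennreal (\<bar>A w\<bar> powr q) \<partial>M) + (\<integral>\<^sup>+ w. ennreal (\<bar>B w\<bar> powr q) \<partial>M))"
    by (simp add: nn_integral_add nn_integral_cmult)
  also have "\<dots> \<le> ennreal (x * y + 4 * K powr (d + e) * r ^ n) + ennreal (K powr (d + e - q)) * (ennreal x' + ennreal y')"
    using m(3,4) E nn_integral_eq_integral[OF i(3)]
    by (intro add_mono mult_left_mono) (auto simp: moment_le_def ennreal_leI)
  also have "\<dots> = ennreal (x * y + 4 * K powr (d + e) * r ^ n + K powr (d + e - q) * (x' + y'))"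
    using nn r by (simp add: ennreal_mult[symmetric] ennreal_plus[symmetric] del: ennreal_plus)
  finally show ?thesis .
qed

end

section \<open>Second moments of sums of variables with local approximations\<close>

context mixing_filtration
begin

text \<open>Near-epoch dependence. A stationary smoothing limit depends on the whole trajectory, so
  it is not measurable with respect to observations near \<open>t\<close>; it is only approximated
  by such variables, at the geometric rate that also governs mixing.\<close>

definition mixing_class :: "real \<Rightarrow> real \<Rightarrow> (int \<Rightarrow> 'w \<Rightarrow> real) \<Rightarrow> bool" where
  "mixing_class q c X \<longleftrightarrow>
     (\<forall>t. moment_le M q (X t) c) \<and> (\<forall>t. expectation (X t) = 0) \<and>
     (\<forall>t k. \<exists>Z. Z \<in> borel_measurable (F (t + int k)) \<and> Z \<in> borel_measurable (G (t - int k)) \<and>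
        moment_le M q (\<lambda>w. X t w - Z w) (c * r ^ k))"

lemma clip_expectations:
  assumes Z: "moment_le M q Z c" and q: "2 < q" and c: "0 \<le> c" and K: "0 < K"
  shows "\<bar>expectation (\<lambda>w. max (- K) (min K (Z w))) - expectation Z\<bar> \<le> K powr (1 - q) * c"
proof -
  have [measurable]: "Z \<in> borel_measurable M" using Z by (auto dest: moment_leD)
  have iZ: "integrable M Z"
    using moment_one_bound[OF moment_le_lower_one[OF Z, of 1]] q c by auto
  have iq: "integrable M (\<lambda>w. \<bar>Z w\<bar> powr q)" by (rule moment_le_integrable[OF Z])
  have ic: "integrable M (\<lambda>w. max (- K) (min K (Z w)))"
    by (rule integrable_const_bound[of _ K]) (use K in auto)
  have le: "\<bar>max (- K) (min K z) - z\<bar> \<le> K powr (1 - q) * \<bar>z\<bar> powr q" for z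
  proof (cases "\<bar>z\<bar> \<le> K")
    case True
    then have "max (- K) (min K z) = z" using K by auto
    then show ?thesis by simp
  next
    case False
    then have z: "0 < \<bar>z\<bar>" "1 \<le> \<bar>z\<bar> / K" using K by auto
    have "\<bar>max (- K) (min K z) - z\<bar> \<le> \<bar>z\<bar>" using False K by auto
    also have "\<dots> = K powr 1 * (\<bar>z\<bar> / K) powr 1" using K z by simp
    also have "\<dots> \<le> K powr 1 * (\<bar>z\<bar> / K) powr q" using z q K by (intro mult_left_mono powr_mono) auto
    also have "\<dots> = K powr (1 - q) * \<bar>z\<bar> powr q" using K z by (simp add: powr_divide powr_diff)
    finally show ?thesis .
  qed
  have "\<bar>expectation (\<lambda>w. max (- K) (min K (Z w))) - expectation Z\<bar>
      = \<bar>expectation (\<lambda>w. max (- K) (min K (Z w)) - Z w)\<bar>" using ic iZ by simp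
  also have "\<dots> \<le> expectation (\<lambda>w. \<bar>max (- K) (min K (Z w)) - Z w\<bar>)" by (rule integral_abs_bound)
  also have "\<dots> \<le> expectation (\<lambda>w. K powr (1 - q) * \<bar>Z w\<bar> powr q)"
    using ic iZ iq le by (intro integral_mono) auto
  also have "\<dots> \<le> K powr (1 - q) * c"
    using moment_le_integral[OF Z c] by (simp add: mult_left_mono)
  finally show ?thesis .
qed

text \<open>Replace each \<open>X\<close> by its approximant \<open>Z\<close>, with an error of
  order s^k in mean square norm, then truncate the \<open>Z\<close> at K = t^(-k), where t =
  r^(1/4). The covariance bound 4 K^2 r^k is 4 t^(2k), and the tail K^(2-q) is t^((q-2)k), geometric
  because q exceeds 2. The rate \<open>e\<close> is the slowest of the three.\<close>

lemma covariance_decay: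
  assumes q: "2 < q" and c: "0 \<le> c"
  obtains C e where "0 \<le> C" "0 < e" "e < 1"
    "\<And>X1 X2 Z1 Z2 k u. moment_le M q X1 c \<Longrightarrow> moment_le M q X2 c \<Longrightarrow> expectation X1 = 0 \<Longrightarrow>
       Z1 \<in> borel_measurable (F u) \<Longrightarrow> Z2 \<in> borel_measurable (G (u + int k)) \<Longrightarrow>
       moment_le M q (\<lambda>w. X1 w - Z1 w) (c * r ^ k) \<Longrightarrow> moment_le M q (\<lambda>w. X2 w - Z2 w) (c * r ^ k) \<Longrightarrow>
       \<bar>expectation (\<lambda>w. X1 w * X2 w)\<bar> \<le> C * e ^ k"
proof -
  define s where "s = r powr (1 / q)"
  define t where "t = r powr (1 / 4)"
  define e where "e = max (max s (t ^ 2)) (t powr (q - 2))"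
  define b where "b = 8 * (1 + c)"
  define d where "d = 2 powr q * (2 * c)"
  define C where "C = 20 * b + 4 + 4 * d + (b + d) * (1 + b)"
  have s: "0 < s" "s < 1" using r q by (auto simp: s_def powr01_less_one)
  have t: "0 < t" "t < 1" using r by (auto simp: t_def powr01_less_one)
  have tq: "0 < t powr (q - 2)" "t powr (q - 2) < 1" using t q by (auto simp: powr01_less_one)
  have t2: "t ^ 2 < 1" using t by (simp add: power_less_one_iff)
  have e: "0 < e" "e < 1" using s t t2 tq by (auto simp: e_def less_max_iff_disj)
  have sk: "s ^ k \<le> e ^ k" for k using s by (intro power_mono) (auto simp: e_def)
  have t2k: "(t ^ 2) ^ k \<le> e ^ k" for k using t by (intro power_mono) (auto simp: e_def)
  have tqk: "(t powr (q - 2)) ^ k \<le> e ^ k" for k by (intro power_mono) (auto simp: e_def)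
  have b: "0 \<le> b" and d: "0 \<le> d" using c by (auto simp: b_def d_def)
  show thesis
  proof (rule that[of C e])
    show "0 \<le> C" using b d by (auto simp: C_def)
    show "0 < e" "e < 1" by fact+
    fix X1 X2 Z1 Z2 k u
    assume X: "moment_le M q X1 c" "moment_le M q X2 c" and E0: "expectation X1 = 0"
      and Z: "Z1 \<in> borel_measurable (F u)" "Z2 \<in> borel_measurable (G (u + int k))"
      and XZ: "moment_le M q (\<lambda>w. X1 w - Z1 w) (c * r ^ k)" "moment_le M q (\<lambda>w. X2 w - Z2 w) (c * r ^ k)"
    have [measurable]: "Z1 \<in> borel_measurable M" "Z2 \<in> borel_measurable M"
      using F_measurable[OF Z(1)] G_measurable[OF Z(2)] by auto
    have sk1: "0 < s ^ k" "s ^ k \<le> 1" using s by (auto intro: power_le_one)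
    have r1: "r ^ k \<le> 1" using r by (auto intro: power_le_one)
    have skq: "c * (s ^ k) powr q = c * r ^ k"
    proof -
      have "(s ^ k) powr q = (s powr q) ^ k" using s by (simp add: powr_power powr_powr powr_realpow[symmetric] mult.commute)
      also have "s powr q = r" using r q by (simp add: s_def powr_powr)
      finally show ?thesis by simp
    qed
    have low: "moment_le M p (\<lambda>w. X w - Z w) ((1 + c) * (s ^ k) powr p)"
      if "moment_le M q (\<lambda>w. X w - Z w) (c * r ^ k)" "0 < p" "p \<le> q" for X Z p
      using that c sk1 by (intro moment_le_lower_scaled[where p = q]) (auto simp: skq)
    have X2: "moment_le M 2 X (1 + c)" if "moment_le M q X c" for X
      using that q c by (intro moment_le_lower_one[where p = q]) auto
    have D2: "moment_le M 2 (\<lambda>w. X w - Z w) ((1 + c) * (s ^ k)\<^sup>2)"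
      if "moment_le M q (\<lambda>w. X w - Z w) (c * r ^ k)" for X Z
      using low[OF that, of 2] q sk1 by (simp add: powr_numeral)
    have Z2: "moment_le M 2 Z b" if "moment_le M q X c" "moment_le M q (\<lambda>w. X w - Z w) (c * r ^ k)" for X Z
    proof -
      have "moment_le M 2 (\<lambda>w. X w - Z w) (1 + c)"
        by (rule moment_le_mono[OF D2[OF that(2)]]) (use sk1 c in \<open>auto intro!: mult_left_le power_le_one\<close>)
      from moment_le_add_double[OF X2[OF that(1)] moment_le_minus[OF this]] c
      show ?thesis by (simp add: b_def)
    qed
    have Zq: "moment_le M q Z d" if "moment_le M q X c" "moment_le M q (\<lambda>w. X w - Z w) (c * r ^ k)" for X Z
    proof -
      have "moment_le M q (\<lambda>w. X w - Z w) c"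
        by (rule moment_le_mono[OF that(2)]) (use r1 c in \<open>auto intro!: mult_left_le\<close>)
      from moment_le_add_double[OF that(1) moment_le_minus[OF this]] c q
      show ?thesis by (simp add: d_def)
    qed
    have m1: "\<bar>expectation (\<lambda>w. (X1 w - Z1 w) * X2 w)\<bar> \<le> b * s ^ k" and i1: "integrable M (\<lambda>w. (X1 w - Z1 w) * X2 w)"
    proof -
      \<comment> \<open>Here \<open>y\<close> stands for s^k. The weight 1 / y in Young's inequality
        balances a second moment of order y^2 against a bounded one, giving a product of order
        y.\<close>
      have "(1 / y * ((1 + c) * y\<^sup>2) + (1 + c) / (1 / y)) / 2 \<le> b * y" if "0 < y" for y
        using that c by (simp add: b_def power2_eq_square)
      note bnd = this[OF sk1(1)]
      have nn: "0 \<le> (1 + c) * (s ^ k)\<^sup>2" "0 \<le> 1 + c" "0 < 1 / s ^ k" using c sk1 by auto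
      note m = moment_two_product[OF D2[OF XZ(1)] X2[OF X(2)] nn]
      show "\<bar>expectation (\<lambda>w. (X1 w - Z1 w) * X2 w)\<bar> \<le> b * s ^ k" by (rule order_trans[OF m(2) bnd])
      show "integrable M (\<lambda>w. (X1 w - Z1 w) * X2 w)" by (rule m(1))
    qed
    have m2: "\<bar>expectation (\<lambda>w. (X2 w - Z2 w) * Z1 w)\<bar> \<le> b * s ^ k" and i2: "integrable M (\<lambda>w. (X2 w - Z2 w) * Z1 w)"
    proof -
      have "(1 / y * ((1 + c) * y\<^sup>2) + b / (1 / y)) / 2 \<le> b * y" if "0 < y" for y
      proof -
        have "(1 / y * ((1 + c) * y\<^sup>2) + b / (1 / y)) / 2 = ((1 + c + b) / 2) * y"
          using that by (simp add: power2_eq_square field_simps)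
        also have "\<dots> \<le> b * y" using that c by (intro mult_right_mono) (auto simp: b_def)
        finally show ?thesis .
      qed
      note bnd = this[OF sk1(1)]
      have nn: "0 \<le> (1 + c) * (s ^ k)\<^sup>2" "0 < 1 / s ^ k" using c sk1 by auto
      note m = moment_two_product[OF D2[OF XZ(2)] Z2[OF X(1) XZ(1)] nn(1) b nn(2)]
      show "\<bar>expectation (\<lambda>w. (X2 w - Z2 w) * Z1 w)\<bar> \<le> b * s ^ k" by (rule order_trans[OF m(2) bnd])
      show "integrable M (\<lambda>w. (X2 w - Z2 w) * Z1 w)" by (rule m(1))
    qed
    have i3: "integrable M (\<lambda>w. Z1 w * Z2 w)"
      using moment_two_product(1)[OF Z2[OF X(1) XZ(1)] Z2[OF X(2) XZ(2)] b b, of 1] by simp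
    have "expectation (\<lambda>w. X1 w * X2 w)
        = expectation (\<lambda>w. (X1 w - Z1 w) * X2 w + ((X2 w - Z2 w) * Z1 w + Z1 w * Z2 w))"
      by (intro Bochner_Integration.integral_cong) (auto simp: algebra_simps)
    also have "\<dots> = expectation (\<lambda>w. (X1 w - Z1 w) * X2 w) + (expectation (\<lambda>w. (X2 w - Z2 w) * Z1 w) + expectation (\<lambda>w. Z1 w * Z2 w))"
      using i1 i2 i3 by simp
    finally have split: "\<bar>expectation (\<lambda>w. X1 w * X2 w)\<bar> \<le> 2 * b * s ^ k + \<bar>expectation (\<lambda>w. Z1 w * Z2 w)\<bar>"
      using m1 m2 by linarith
    define K where "K = (1 / t) ^ k"
    have K: "0 < K" "1 \<le> K" using t by (auto simp: K_def intro!: one_le_power)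
    let ?z1 = "\<lambda>w. max (- K) (min K (Z1 w))" and ?z2 = "\<lambda>w. max (- K) (min K (Z2 w))"
    have K2: "K powr (2 - q) = (t powr (q - 2)) ^ k"
    proof -
      have "K = t powr (- real k)" using t by (simp add: K_def powr_minus powr_realpow power_one_over inverse_eq_divide)
      then have "K powr (2 - q) = t powr ((q - 2) * real k)" by (simp add: powr_powr algebra_simps)
      also have "\<dots> = (t powr (q - 2)) ^ k" using tq(1) by (simp add: powr_powr[symmetric] powr_realpow)
      finally show ?thesis .
    qed
    have K1: "K powr (1 - q) \<le> (t powr (q - 2)) ^ k"
      unfolding K2[symmetric] using K by (intro powr_mono) auto
    have KK: "4 * K * K * r ^ k = 4 * (t ^ 2) ^ k"
    proof -
      have "r = t ^ 4" using r by (simp add: t_def powr_powr powr_realpow[symmetric])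
      then have "K * K * r ^ k = (1 / t * (1 / t) * t ^ 4) ^ k" by (simp only: K_def power_mult_distrib)
      also have "1 / t * (1 / t) * t ^ 4 = t ^ 2" using t by (simp add: power4_eq_xxxx power2_eq_square)
      finally show ?thesis by simp
    qed
    have cov: "\<bar>expectation (\<lambda>w. ?z1 w * ?z2 w) - expectation ?z1 * expectation ?z2\<bar> \<le> 4 * (t ^ 2) ^ k"
      unfolding KK[symmetric] using Z K by (intro cov_bounded[where u = u]) auto
    have d1: "\<bar>expectation (\<lambda>w. X1 w - Z1 w)\<bar> \<le> (1 + c) * s ^ k" and iXZ: "integrable M (\<lambda>w. X1 w - Z1 w)"
      using moment_one_bound[OF low[OF XZ(1), of 1]] q c sk1 by auto
    have "integrable M X1"
      using moment_one_bound(1)[OF moment_le_lower_one[OF X(1), of 1]] q c by auto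
    then have "expectation (\<lambda>w. X1 w - (X1 w - Z1 w)) = expectation X1 - expectation (\<lambda>w. X1 w - Z1 w)"
      using iXZ by (rule Bochner_Integration.integral_diff)
    then have EZ1: "\<bar>expectation Z1\<bar> \<le> b * e ^ k"
      using d1 E0 mult_mono[of "1 + c" b "s ^ k" "e ^ k"] sk[of k] sk1 c by (auto simp: b_def)
    have Ez1: "\<bar>expectation ?z1\<bar> \<le> (b + d) * e ^ k"
    proof -
      have "\<bar>expectation ?z1 - expectation Z1\<bar> \<le> K powr (1 - q) * d"
        by (rule clip_expectations[OF Zq[OF X(1) XZ(1)] q d K(1)])
      also have "\<dots> \<le> e ^ k * d" using K1 tqk[of k] d by (intro mult_right_mono) auto
      finally show ?thesis using EZ1 by (simp add: algebra_simps)
    qed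
    \<comment> \<open>Only the first truncated mean is small, because \<open>X1\<close> is centred;
      for the product of the means it is enough that the second is bounded.\<close>
    have Ez2: "\<bar>expectation ?z2\<bar> \<le> 1 + b"
    proof -
      have m: "moment_le M 1 Z2 (1 + b)"
        using moment_le_lower_one[OF Z2[OF X(2) XZ(2)], of 1] b by simp
      have "moment_le M 1 ?z2 (1 + b)"
        by (rule moment_le_AE_mono[OF m]) (use K in auto)
      then show ?thesis using moment_one_bound(2) b by auto
    qed
    have prod: "\<bar>expectation ?z1 * expectation ?z2\<bar> \<le> (b + d) * e ^ k * (1 + b)"
      unfolding abs_mult using Ez1 Ez2 by (intro mult_mono) auto
    have iz: "integrable M (\<lambda>w. ?z1 w * ?z2 w)"
      by (rule integrable_const_bound[of _ "K * K"]) (use K in \<open>auto simp: abs_mult intro!: mult_mono\<close>)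
    have iq: "integrable M (\<lambda>w. \<bar>Z1 w\<bar> powr q)" "integrable M (\<lambda>w. \<bar>Z2 w\<bar> powr q)"
      using moment_le_integrable[OF Zq[OF X(1) XZ(1)]] moment_le_integrable[OF Zq[OF X(2) XZ(2)]] by auto
    have le: "\<bar>x * y - max (- K) (min K x) * max (- K) (min K y)\<bar>
        \<le> 2 * (K powr (2 - q) * (\<bar>x\<bar> powr q + \<bar>y\<bar> powr q))" for x y
    proof (cases "\<bar>x\<bar> \<le> K \<and> \<bar>y\<bar> \<le> K")
      case True
      then have "max (- K) (min K x) = x" "max (- K) (min K y) = y" by auto
      then show ?thesis by simp
    next
      case False
      define z where "z = max \<bar>x\<bar> \<bar>y\<bar>"
      have z: "1 \<le> z / K" "0 < z" using False K by (auto simp: z_def)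
      have clip: "\<bar>max (- K) (min K v)\<bar> \<le> \<bar>v\<bar>" for v using K by (auto simp: max_def min_def)
      have "\<bar>max (- K) (min K x) * max (- K) (min K y)\<bar> \<le> z * z"
        unfolding abs_mult using clip[of x] clip[of y] by (intro mult_mono) (auto simp: z_def le_max_iff_disj)
      moreover have "\<bar>x * y\<bar> \<le> z * z" unfolding abs_mult by (intro mult_mono) (auto simp: z_def)
      ultimately have "\<bar>x * y - max (- K) (min K x) * max (- K) (min K y)\<bar> \<le> 2 * z powr 2"
        using z abs_triangle_ineq4[of "x * y" "max (- K) (min K x) * max (- K) (min K y)"]
        by (simp add: powr_numeral power2_eq_square del: abs_mult)
      also have "z powr 2 = K powr 2 * (z / K) powr 2" using z K by (simp add: powr_divide)
      also have "\<dots> \<le> K powr 2 * (z / K) powr q" using z K q by (intro mult_left_mono powr_mono) auto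
      also have "\<dots> = K powr (2 - q) * z powr q" using z K by (simp add: powr_divide powr_diff)
      also have "\<dots> \<le> K powr (2 - q) * (\<bar>x\<bar> powr q + \<bar>y\<bar> powr q)"
        by (intro mult_left_mono) (auto simp: z_def max_def)
      finally show ?thesis by simp
    qed
    have "\<bar>expectation (\<lambda>w. Z1 w * Z2 w) - expectation (\<lambda>w. ?z1 w * ?z2 w)\<bar>
        = \<bar>expectation (\<lambda>w. Z1 w * Z2 w - ?z1 w * ?z2 w)\<bar>" using i3 iz by simp
    also have "\<dots> \<le> expectation (\<lambda>w. \<bar>Z1 w * Z2 w - ?z1 w * ?z2 w\<bar>)" by (rule integral_abs_bound)
    also have "\<dots> \<le> expectation (\<lambda>w. 2 * (K powr (2 - q) * (\<bar>Z1 w\<bar> powr q + \<bar>Z2 w\<bar> powr q)))"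
      using i3 iz iq le by (intro integral_mono) auto
    also have "\<dots> = 2 * (K powr (2 - q) * (expectation (\<lambda>w. \<bar>Z1 w\<bar> powr q) + expectation (\<lambda>w. \<bar>Z2 w\<bar> powr q)))"
      using iq by simp
    also have "\<dots> \<le> 2 * (K powr (2 - q) * (d + d))"
      using moment_le_integral[OF Zq[OF X(1) XZ(1)] d] moment_le_integral[OF Zq[OF X(2) XZ(2)] d]
      by (intro mult_left_mono add_mono) auto
    also have "\<dots> \<le> 2 * (e ^ k * (d + d))"
      unfolding K2 using tqk[of k] d by (intro mult_left_mono mult_right_mono) auto
    finally have "\<bar>expectation (\<lambda>w. Z1 w * Z2 w)\<bar> \<le> 4 * d * e ^ k + 4 * e ^ k + (b + d) * (1 + b) * e ^ k"
      using cov prod t2k[of k] by (simp add: algebra_simps)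
    moreover have "2 * b * s ^ k \<le> 20 * b * e ^ k" using sk[of k] b sk1 by (intro mult_mono) auto
    ultimately show "\<bar>expectation (\<lambda>w. X1 w * X2 w)\<bar> \<le> C * e ^ k"
      using split by (simp add: C_def algebra_simps)
  qed
qed

lemma sum_geometric_distance:
  assumes "0 \<le> x" "x < (1::real)"
  shows "(\<Sum>t\<in>{a..b}. x ^ nat \<bar>t - s\<bar>) \<le> 2 / (1 - x)"
proof -
  have geo: "(\<Sum>d\<in>A. x ^ d) \<le> 1 / (1 - x)" if "finite A" for A :: "nat set"
    using sum_le_suminf[OF summable_geometric that, of x] suminf_geometric[of x] assms by auto
  have half: "(\<Sum>t\<in>A. x ^ nat \<bar>t - s\<bar>) \<le> 1 / (1 - x)" if "finite A" "inj_on (\<lambda>t. nat \<bar>t - s\<bar>) A" for A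
    using geo[of "(\<lambda>t. nat \<bar>t - s\<bar>) ` A"] that by (simp add: sum.reindex)
  have eq: "{a..b} = {a..min b s} \<union> {max a (s + 1)..b}" by auto
  have "(\<Sum>t\<in>{a..b}. x ^ nat \<bar>t - s\<bar>)
      = (\<Sum>t\<in>{a..min b s}. x ^ nat \<bar>t - s\<bar>) + (\<Sum>t\<in>{max a (s + 1)..b}. x ^ nat \<bar>t - s\<bar>)"
    unfolding eq by (rule sum.union_disjoint) auto
  also have "\<dots> \<le> 1 / (1 - x) + 1 / (1 - x)"
    by (intro add_mono half) (auto simp: inj_on_def)
  finally show ?thesis by simp
qed

lemma sum_moment_two:
  assumes q: "2 < q" and c: "0 \<le> c"
  obtains C where "0 \<le> C"
    "\<And>X s n. mixing_class q c X \<Longrightarrow> moment_le M 2 (\<lambda>w. \<Sum>t\<in>{s + 1..s + int n}. X t w) (C * sqrt (real n) powr 2)"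
proof -
  obtain C e where Ce: "0 \<le> C" "0 < e" "e < 1" and
    cov: "\<And>X1 X2 Z1 Z2 k u. moment_le M q X1 c \<Longrightarrow> moment_le M q X2 c \<Longrightarrow> expectation X1 = 0 \<Longrightarrow>
       Z1 \<in> borel_measurable (F u) \<Longrightarrow> Z2 \<in> borel_measurable (G (u + int k)) \<Longrightarrow>
       moment_le M q (\<lambda>w. X1 w - Z1 w) (c * r ^ k) \<Longrightarrow> moment_le M q (\<lambda>w. X2 w - Z2 w) (c * r ^ k) \<Longrightarrow>
       \<bar>expectation (\<lambda>w. X1 w * X2 w)\<bar> \<le> C * e ^ k"
    using covariance_decay[OF q c] by blast
  \<comment> \<open>A lag is cut into thirds: k steps for each of the two approximants and k for the
    gap between them. With x^3 = e the bound e^k becomes x^(3k), and the division by x^2 in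
    \<open>B\<close> absorbs the rounding of the lag.\<close>
  define x where "x = e powr (1 / 3)"
  have x: "0 < x" "x < 1" using Ce by (auto simp: x_def powr01_less_one)
  have x3: "x ^ 3 = e" using Ce by (simp add: x_def powr_realpow[symmetric] powr_powr)
  define B where "B = C / x ^ 2"
  have B: "0 \<le> B" using Ce x by (simp add: B_def)
  show thesis
  proof (rule that[of "B * (2 / (1 - x))"])
    show "0 \<le> B * (2 / (1 - x))" using B x by simp
    fix X s n assume X: "mixing_class q c X"
    have Xm: "moment_le M q (X t) c" "expectation (X t) = 0" for t using X by (auto simp: mixing_class_def)
    have pair: "\<bar>expectation (\<lambda>w. X a w * X b w)\<bar> \<le> B * x ^ nat \<bar>b - a\<bar>" if "a \<le> b" for a b
    proof -
      define k where "k = nat (b - a) div 3"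
      have k3: "nat (b - a) \<le> 3 * k + 2" unfolding k_def by arith
      have kle: "a + int k + int k \<le> b - int k" using that unfolding k_def by linarith
      obtain Z1 where Z1: "Z1 \<in> borel_measurable (F (a + int k))" "moment_le M q (\<lambda>w. X a w - Z1 w) (c * r ^ k)"
        using X unfolding mixing_class_def by blast
      obtain Z2 where Z2: "Z2 \<in> borel_measurable (G (b - int k))" "moment_le M q (\<lambda>w. X b w - Z2 w) (c * r ^ k)"
        using X unfolding mixing_class_def by blast
      have "\<bar>expectation (\<lambda>w. X a w * X b w)\<bar> \<le> C * e ^ k"
        by (rule cov[OF Xm(1) Xm(1) Xm(2) Z1(1) G_measurable_mono[OF Z2(1) kle] Z1(2) Z2(2)])
      also have "e ^ k = x ^ (3 * k + 2) / x ^ 2" using x by (simp add: power_add power_mult x3 power2_eq_square)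
      also have "C * (x ^ (3 * k + 2) / x ^ 2) = B * x ^ (3 * k + 2)" by (simp add: B_def)
      also have "\<dots> \<le> B * x ^ nat \<bar>b - a\<bar>"
        using k3 that x B by (intro mult_left_mono power_decreasing) auto
      finally show ?thesis .
    qed
    have pair': "expectation (\<lambda>w. X a w * X b w) \<le> B * x ^ nat \<bar>b - a\<bar>" for a b
      using pair[of a b] pair[of b a] by (cases "a \<le> b") (auto simp: abs_minus_commute mult.commute)
    have X2: "moment_le M 2 (X t) (1 + c)" for t
      using moment_le_lower_one[OF Xm(1)[of t], of 2] q c by simp
    have int: "integrable M (\<lambda>w. X a w * X b w)" for a b
      using moment_two_product(1)[OF X2 X2, where t = 1] c by auto
    let ?I = "{s + 1..s + int n}"
    have [measurable]: "X t \<in> borel_measurable M" for t using Xm(1) by (auto dest: moment_leD)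
    have sq: "(\<Sum>t\<in>?I. X t w)\<^sup>2 = (\<Sum>a\<in>?I. \<Sum>b\<in>?I. X a w * X b w)" for w
      by (simp add: power2_eq_square sum_product)
    have isq: "integrable M (\<lambda>w. \<Sum>a\<in>?I. \<Sum>b\<in>?I. X a w * X b w)"
      by (intro Bochner_Integration.integrable_sum int)
    have "(\<integral>\<^sup>+ w. ennreal (\<bar>\<Sum>t\<in>?I. X t w\<bar> powr 2) \<partial>M) = (\<integral>\<^sup>+ w. ennreal (\<Sum>a\<in>?I. \<Sum>b\<in>?I. X a w * X b w) \<partial>M)"
      by (simp add: powr_numeral sq)
    also have "\<dots> = ennreal (expectation (\<lambda>w. \<Sum>a\<in>?I. \<Sum>b\<in>?I. X a w * X b w))"
      by (rule nn_integral_eq_integral[OF isq]) (simp add: sq[symmetric])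
    also have "expectation (\<lambda>w. \<Sum>a\<in>?I. \<Sum>b\<in>?I. X a w * X b w) = (\<Sum>a\<in>?I. \<Sum>b\<in>?I. expectation (\<lambda>w. X a w * X b w))"
      using int by (simp add: Bochner_Integration.integral_sum Bochner_Integration.integrable_sum)
    also have "\<dots> \<le> (\<Sum>a\<in>?I. \<Sum>b\<in>?I. B * x ^ nat \<bar>b - a\<bar>)" by (intro sum_mono pair')
    also have "\<dots> \<le> (\<Sum>a\<in>?I. B * (2 / (1 - x)))"
      unfolding sum_distrib_left[symmetric]
      using x B sum_geometric_distance[of x] by (intro sum_mono mult_left_mono) auto
    also have "\<dots> = B * (2 / (1 - x)) * sqrt (real n) powr 2" by (simp add: powr_numeral)
    finally show "moment_le M 2 (\<lambda>w. \<Sum>t\<in>?I. X t w) (B * (2 / (1 - x)) * sqrt (real n) powr 2)"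
      by (simp add: moment_le_def ennreal_leI)
  qed
qed

text \<open>The constant precedes the process \<open>X\<close>, so it will serve all parameters,
  directions and starting times at once.\<close>

definition sum_moment_bound :: "real \<Rightarrow> real \<Rightarrow> real \<Rightarrow> bool" where
  "sum_moment_bound q c p \<longleftrightarrow> (\<exists>C\<ge>0. \<forall>X s n. mixing_class q c X \<longrightarrow>
     moment_le M p (\<lambda>w. \<Sum>t\<in>{s + 1..s + int n}. X t w) (C * sqrt (real n) powr p))"

lemma moment_le_zero: "moment_le M p (\<lambda>_. 0) 0"
  by (simp add: moment_le_def)

end

section \<open>Higher moments by induction on the exponent\<close>

context mixing_filtration
begin

text \<open>At radius \<open>quarter n\<close> each error is of order exp(-const n^(1/4)), so the
  crude polynomial bound for a sum of \<open>n\<close> terms still leaves a constant.\<close>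

lemma approximation_sum:
  assumes p: "0 < p" "p \<le> q" and c: "0 \<le> c"
  obtains E where "0 \<le> E"
    "\<And>n I D. 1 \<le> n \<Longrightarrow> card I \<le> n \<Longrightarrow> (\<And>t. t \<in> I \<Longrightarrow> moment_le M q (D t) (c * r ^ quarter n)) \<Longrightarrow>
       moment_le M p (\<lambda>w. \<Sum>t\<in>I. D t w) E"
proof -
  define s where "s = r powr (1 / q)"
  have s: "0 < s" "s < 1" using r p by (auto simp: s_def powr01_less_one)
  have sp: "0 < s powr p" "s powr p < 1" using s p by (auto simp: powr01_less_one)
  obtain B where B: "0 \<le> B" "\<And>n. 1 \<le> n \<Longrightarrow> real n powr (p + 1) * (s powr p) ^ quarter n \<le> B"
    using poly_times_exp_bounded[OF sp] by blast
  show thesis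
  proof (rule that[of "(1 + c) * B"])
    show "0 \<le> (1 + c) * B" using B c by simp
    fix n I D assume n: "1 \<le> (n::nat)" and card: "card I \<le> n"
      and D: "\<And>t. t \<in> I \<Longrightarrow> moment_le M q (D t) (c * r ^ quarter n)"
    let ?j = "quarter n"
    have sj: "(s ^ ?j) powr e = (s powr e) ^ ?j" for e
      using s by (simp add: powr_power powr_powr powr_realpow[symmetric] mult.commute)
    have "s powr q = r" using r p by (simp add: s_def powr_powr)
    then have "moment_le M p (D t) ((1 + c) * (s ^ ?j) powr p)" if "t \<in> I" for t
      using D[OF that] p c s by (intro moment_le_lower_scaled[where p = q]) (auto simp: sj)
    then have "moment_le M p (\<lambda>w. \<Sum>t\<in>I. D t w) (real n powr (p + 1) * ((1 + c) * (s ^ ?j) powr p))"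
      using c p card by (intro moment_le_sum) auto
    then show "moment_le M p (\<lambda>w. \<Sum>t\<in>I. D t w) ((1 + c) * B)"
    proof (rule moment_le_mono)
      have "real n powr (p + 1) * ((1 + c) * (s ^ ?j) powr p) = (1 + c) * (real n powr (p + 1) * (s powr p) ^ ?j)"
        by (simp add: sj)
      also have "\<dots> \<le> (1 + c) * B" using B(2)[OF n] c by (intro mult_left_mono) auto
      finally show "real n powr (p + 1) * ((1 + c) * (s ^ ?j) powr p) \<le> (1 + c) * B" .
    qed
  qed
qed

lemma moment_le_add_cross:
  assumes A: "moment_le M p A a" and B: "moment_le M p B b" and p: "1 < p" and nn: "0 \<le> a" "0 \<le> b" "0 \<le> x" "0 \<le> y"
    and x: "(\<integral>\<^sup>+ w. ennreal (\<bar>A w\<bar> powr (p - 1) * \<bar>B w\<bar> powr 1) \<partial>M) \<le> ennreal x"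
    and y: "(\<integral>\<^sup>+ w. ennreal (\<bar>A w\<bar> powr 1 * \<bar>B w\<bar> powr (p - 1)) \<partial>M) \<le> ennreal y"
  shows "moment_le M p (\<lambda>w. A w + B w) (a + b + p * 2 powr (p - 1) * (x + y))"
proof -
  let ?C = "p * 2 powr (p - 1)"
  have [measurable]: "A \<in> borel_measurable M" "B \<in> borel_measurable M" using A B by (auto dest: moment_leD)
  have le: "\<bar>A w + B w\<bar> powr p \<le> \<bar>A w\<bar> powr p + \<bar>B w\<bar> powr p
      + ?C * (\<bar>A w\<bar> powr (p - 1) * \<bar>B w\<bar> powr 1 + \<bar>A w\<bar> powr 1 * \<bar>B w\<bar> powr (p - 1))" for w
  proof -
    have "\<bar>A w + B w\<bar> powr p \<le> (\<bar>A w\<bar> + \<bar>B w\<bar>) powr p" using p by (intro powr_mono2) auto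
    also have "\<dots> \<le> \<bar>A w\<bar> powr p + \<bar>B w\<bar> powr p
      + ?C * (\<bar>A w\<bar> powr (p - 1) * \<bar>B w\<bar> + \<bar>A w\<bar> * \<bar>B w\<bar> powr (p - 1))"
      using p by (intro powr_add_le_cross) auto
    finally show ?thesis by simp
  qed
  have "(\<integral>\<^sup>+ w. ennreal (\<bar>A w + B w\<bar> powr p) \<partial>M) \<le> (\<integral>\<^sup>+ w. (ennreal (\<bar>A w\<bar> powr p) + ennreal (\<bar>B w\<bar> powr p))
      + ennreal ?C * (ennreal (\<bar>A w\<bar> powr (p - 1) * \<bar>B w\<bar> powr 1) + ennreal (\<bar>A w\<bar> powr 1 * \<bar>B w\<bar> powr (p - 1))) \<partial>M)"
    using le p
    by (intro nn_integral_mono) (simp add: ennreal_mult[symmetric] ennreal_plus[symmetric] ennreal_leI del: ennreal_plus)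
  also have "\<dots> = ((\<integral>\<^sup>+ w. ennreal (\<bar>A w\<bar> powr p) \<partial>M) + (\<integral>\<^sup>+ w. ennreal (\<bar>B w\<bar> powr p) \<partial>M))
      + ennreal ?C * ((\<integral>\<^sup>+ w. ennreal (\<bar>A w\<bar> powr (p - 1) * \<bar>B w\<bar> powr 1) \<partial>M)
          + (\<integral>\<^sup>+ w. ennreal (\<bar>A w\<bar> powr 1 * \<bar>B w\<bar> powr (p - 1)) \<partial>M))"
    by (simp add: nn_integral_add nn_integral_cmult)
  also have "\<dots> \<le> (ennreal a + ennreal b) + ennreal ?C * (ennreal x + ennreal y)"
    using A B x y by (intro add_mono mult_left_mono) (auto simp: moment_le_def)
  also have "\<dots> = ennreal (a + b + ?C * (x + y))"
    using nn p by (simp add: ennreal_mult[symmetric] ennreal_plus[symmetric] del: ennreal_plus)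
  finally show ?thesis by (simp add: moment_le_def)
qed

text \<open>The interval is cut into two halves separated by a short gap, so that \<open>E |A + B|\<^sup>p\<close> is at most
  \<open>E |A|\<^sup>p + E |B|\<^sup>p\<close> plus cross terms controlled by lower moments; since \<open>p > 2\<close>, the doubling
  recursion \<open>c(n) \<le> 2 (1 + d) c(n/2) + C n\<^bsup>p/2\<^esup>\<close> closes.\<close>

lemma sum_moment_step:
  assumes p: "2 < p" "p < q" and c: "0 \<le> c" and prev: "sum_moment_bound q c (max 2 (p - 1))"
  shows "sum_moment_bound q c p"
proof -
  \<comment> \<open>The factors of the cross terms carry the exponents p - 1 and 1, both at most
    \<open>p'\<close>. The floor 2 connects the recursion to the variance bound.\<close>
  define p' where "p' = max 2 (p - 1)"
  have p': "2 \<le> p'" "p - 1 \<le> p'" "p' < p" using p by (auto simp: p'_def)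
  obtain C1 where C1: "0 \<le> C1" "\<And>X s n. mixing_class q c X \<Longrightarrow>
      moment_le M p' (\<lambda>w. \<Sum>t\<in>{s + 1..s + int n}. X t w) (C1 * sqrt (real n) powr p')"
    using prev unfolding sum_moment_bound_def p'_def by blast
  have pq: "0 < p" "p \<le> q" "0 < p'" "p' \<le> q" using p p' by auto
  obtain E where E: "0 \<le> E" "\<And>n (I :: int set) D. 1 \<le> n \<Longrightarrow> card I \<le> n \<Longrightarrow>
      (\<And>t. t \<in> I \<Longrightarrow> moment_le M q (D t) (c * r ^ quarter n)) \<Longrightarrow> moment_le M p (\<lambda>w. \<Sum>t\<in>I. D t w) E"
    using approximation_sum[OF pq(1,2) c] by blast
  obtain E' where E': "0 \<le> E'" "\<And>n (I :: int set) D. 1 \<le> n \<Longrightarrow> card I \<le> n \<Longrightarrow>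
      (\<And>t. t \<in> I \<Longrightarrow> moment_le M q (D t) (c * r ^ quarter n)) \<Longrightarrow> moment_le M p' (\<lambda>w. \<Sum>t\<in>I. D t w) E'"
    using approximation_sum[OF pq(3,4) c] by blast
  \<comment> \<open>The truncation level will be n^m. The crude moment of order \<open>q\<close> of
    a sum is of order n^(q+1), and m (p - q) = -(q + 1) makes the tail term bounded.\<close>
  define m where "m = (q + 1) / (q - p)"
  obtain B1 where B1: "0 \<le> B1" "\<And>n. 1 \<le> n \<Longrightarrow> real n powr (m * p) * r ^ quarter n \<le> B1"
    using poly_times_exp_bounded[OF r] by blast
  \<comment> \<open>This is 2 (1/2)^(p/2), the factor by which halving contracts. The factor 1 + d
    is paid twice, on passing from sums of \<open>X\<close> to sums of approximants and on putting
    gap and errors back; \<open>d\<close> is chosen so that (1 + d)^2 k0 = k0^(1/2), still below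
    one.\<close>
  define k0 where "k0 = 2 powr (1 - p / 2)"
  have k0: "0 < k0" "k0 < 1" using p by (auto simp: k0_def powr_less_one)
  define d where "d = k0 powr (- 1 / 4) - 1"
  define k where "k = k0 powr (1 / 2)"
  have k: "0 < k" "k < 1" using k0 by (auto simp: k_def powr01_less_one)
  have d: "0 < d"
  proof -
    have "1 / k0 powr (1 / 4) > 1" using k0 by (simp add: powr01_less_one)
    then show ?thesis by (simp add: d_def powr_minus_divide)
  qed
  have dk: "(1 + d) * (1 + d) * k0 = k"
  proof -
    have "(1 + d) * (1 + d) * k0 = k0 powr (- 1 / 4) * k0 powr (- 1 / 4) * k0 powr 1"
      using k0 by (simp add: d_def)
    also have "\<dots> = k0 powr (- 1 / 4 + - 1 / 4 + 1)" by (simp only: powr_add)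
    finally show ?thesis by (simp add: k_def)
  qed
  obtain Cd where Cd: "0 \<le> Cd" "\<And>x y. 0 \<le> x \<Longrightarrow> 0 \<le> y \<Longrightarrow> (x + y) powr p \<le> (1 + d) * x powr p + Cd * y powr p"
    using powr_add_le_eps[OF pq(1) d] by blast
  define C2 where "C2 = 2 powr p' * (C1 + E')"
  define dq where "dq = 2 powr q * (2 * c)"
  define C3 where "C3 = (1 + C2) * (1 + C2) + 4 * B1 + 2 * dq"
  define R where "R = 2 powr p * (3 powr (p + 1) * (1 + c) + 2 powr p * (2 * E))"
  define C4 where "C4 = (1 + d) * (2 * (Cd * E) + p * 2 powr (p - 1) * (2 * C3)) + Cd * R"
  \<comment> \<open>The fixed point of C = k C + C4, so the induction reproduces its own
    constant.\<close>
  define C where "C = C4 / (1 - k)"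
  have nn: "0 \<le> C2" "0 \<le> dq" "0 \<le> C3" "0 \<le> R" "0 \<le> C4" "0 \<le> C"
    using C1 E E' B1 c d Cd p k by (auto simp: C2_def dq_def C3_def R_def C4_def C_def intro!: add_nonneg_nonneg mult_nonneg_nonneg)
  have Ceq: "k * C + C4 = C" using k by (simp add: C_def field_simps)
  have main: "moment_le M p (\<lambda>w. \<Sum>t\<in>{s + 1..s + int n}. X t w) (C * sqrt (real n) powr p)"
    if X: "mixing_class q c X" for X s n
  proof (induction n arbitrary: s rule: less_induct)
    case (less n)
    show ?case
    proof (cases "n = 0")
      case True
      then show ?thesis using moment_le_zero by simp
    next
      case False
      then have n: "1 \<le> n" by simp
      define j where "j = quarter n"
      have j: "1 \<le> j" using quarter_pos[OF n] by (simp add: j_def)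
      define h where "h = n div 2"
      \<comment> \<open>Truncated subtraction: for small \<open>n\<close> the second half is empty,
        and everything after the first half belongs to the gap.\<close>
      define h' where "h' = n - h - 3 * j"
      have hs: "h < n" "h' < n" "2 * h \<le> n" "2 * h' \<le> n" using n j by (auto simp: h_def h'_def)
      define I1 where "I1 = {s + 1..s + int h}"
      \<comment> \<open>Three lengths \<open>j\<close>: one by which approximants of the first half
        reach forward, one by which those of the second half reach back, and one of true
        separation.\<close>
      define u where "u = s + int h + 3 * int j"
      define I2 where "I2 = {u + 1..u + int h'}"
      define I3 where "I3 = {s + int h + 1..s + int n} - I2"
      have I3sub: "I3 \<subseteq> {s + int h + 1..u}" unfolding I3_def I2_def u_def h'_def by auto
      have cards: "card I1 \<le> n" "card I2 \<le> n" "real (card I3) \<le> 3 * real j"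
        using hs card_mono[OF _ I3sub] by (auto simp: I1_def I2_def u_def)
      have fin: "finite I1" "finite I2" "finite I3" by (auto simp: I1_def I2_def I3_def)
      have I2sub: "I2 \<subseteq> {s + int h + 1..s + int n}" by (auto simp: I2_def u_def h'_def)
      have split: "{s + 1..s + int n} = I1 \<union> {s + int h + 1..s + int n}" using hs by (auto simp: I1_def)
      have sum_split: "(\<Sum>t\<in>{s + 1..s + int n}. f t) = (\<Sum>t\<in>I1. f t) + (\<Sum>t\<in>I2. f t) + (\<Sum>t\<in>I3. f t)" for f :: "int \<Rightarrow> real"
      proof -
        have "(\<Sum>t\<in>{s + 1..s + int n}. f t) = (\<Sum>t\<in>I1. f t) + (\<Sum>t\<in>{s + int h + 1..s + int n}. f t)"
          unfolding split by (rule sum.union_disjoint) (auto simp: I1_def)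
        also have "(\<Sum>t\<in>{s + int h + 1..s + int n}. f t) = (\<Sum>t\<in>I3. f t) + (\<Sum>t\<in>I2. f t)"
          unfolding I3_def by (rule sum.subset_diff[OF I2sub]) simp
        finally show ?thesis by simp
      qed
      have "\<forall>t. \<exists>Z. Z \<in> borel_measurable (F (t + int j)) \<and> Z \<in> borel_measurable (G (t - int j)) \<and>
          moment_le M q (\<lambda>w. X t w - Z w) (c * r ^ j)"
        using X unfolding mixing_class_def by blast
      then obtain Z where Z: "\<And>t. Z t \<in> borel_measurable (F (t + int j))" "\<And>t. Z t \<in> borel_measurable (G (t - int j))"
          "\<And>t. moment_le M q (\<lambda>w. X t w - Z t w) (c * r ^ j)"
        by metis
      have Xm: "moment_le M q (X t) c" for t using X by (auto simp: mixing_class_def)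
      have Zm: "moment_le M q (Z t) dq" for t
      proof -
        have "moment_le M q (\<lambda>w. X t w - Z t w) c"
          by (rule moment_le_mono[OF Z(3)]) (use r c in \<open>auto intro!: mult_left_le power_le_one\<close>)
        from moment_le_add_double[OF Xm[of t] moment_le_minus[OF this]] c p
        show ?thesis by (simp add: dq_def)
      qed
      define A where "A w = (\<Sum>t\<in>I1. Z t w)" for w
      define B where "B w = (\<Sum>t\<in>I2. Z t w)" for w
      define eA where "eA w = (\<Sum>t\<in>I1. X t w - Z t w)" for w
      define eB where "eB w = (\<Sum>t\<in>I2. X t w - Z t w)" for w
      define gap where "gap w = (\<Sum>t\<in>I3. X t w)" for w
      define y where "y = sqrt (real n)"
      have y: "1 \<le> y" using n by (simp add: y_def)
      have yp: "1 \<le> y powr e" if "0 \<le> e" for e using y that by (rule ge_one_powr_ge_zero)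
      have AF: "A \<in> borel_measurable (F (s + int h + int j))"
        unfolding A_def[abs_def] by (intro borel_measurable_sum F_measurable_mono[OF Z(1)]) (auto simp: I1_def)
      have BG: "B \<in> borel_measurable (G (s + int h + int j + int j))"
        unfolding B_def[abs_def] by (intro borel_measurable_sum G_measurable_mono[OF Z(2)]) (auto simp: I2_def u_def)
      have meA: "moment_le M p eA E" "moment_le M p' eA E'" and meB: "moment_le M p eB E" "moment_le M p' eB E'"
        unfolding eA_def[abs_def] eB_def[abs_def]
        using E(2)[OF n cards(1)] E'(2)[OF n cards(1)] E(2)[OF n cards(2)] E'(2)[OF n cards(2)] Z(3)
        by (simp_all add: j_def)
      have hn: "sqrt (real l) powr p \<le> k0 / 2 * y powr p" if "2 * l \<le> n" for l
      proof -
        have "real l \<le> real n / 2" using that by linarith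
        then have "sqrt (real l) powr p \<le> sqrt (real n / 2) powr p"
          using p by (intro powr_mono2 real_sqrt_le_mono) auto
        also have "\<dots> = (real n powr (1 / 2) / 2 powr (1 / 2)) powr p" by (simp add: powr_half_sqrt real_sqrt_divide)
        also have "\<dots> = k0 / 2 * y powr p"
          using n by (simp add: powr_divide powr_powr k0_def y_def powr_half_sqrt[symmetric] powr_diff)
        finally show ?thesis .
      qed
      have SA: "A w = (\<Sum>t\<in>I1. X t w) + - eA w" and SB: "B w = (\<Sum>t\<in>I2. X t w) + - eB w" for w
        by (auto simp: A_def B_def eA_def eB_def sum_subtractf)
      define a where "a = (1 + d) * (C * (k0 / 2 * y powr p)) + Cd * E"
      have a0: "0 \<le> a" using nn d Cd(1) E(1) k0 by (auto simp: a_def)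
      have mSA: "moment_le M p (\<lambda>w. \<Sum>t\<in>I1. X t w) (C * (k0 / 2 * y powr p))"
        using less.IH[OF hs(1), of s] mult_left_mono[OF hn[OF hs(3)] nn(6)] unfolding I1_def by (rule moment_le_mono)
      have mSB: "moment_le M p (\<lambda>w. \<Sum>t\<in>I2. X t w) (C * (k0 / 2 * y powr p))"
        using less.IH[OF hs(2), of u] mult_left_mono[OF hn[OF hs(4)] nn(6)] unfolding I2_def by (rule moment_le_mono)
      have mA: "moment_le M p A a" and mB: "moment_le M p B a"
      proof -
        have cp: "0 \<le> C * (k0 / 2 * y powr p)" "0 \<le> 1 + d" using nn k0 d by auto
        show "moment_le M p A a" unfolding SA[abs_def] a_def
          by (rule moment_le_add[OF mSA moment_le_minus[OF meA(1)] cp(1) E(1) pq(1) cp(2) Cd])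
        show "moment_le M p B a" unfolding SB[abs_def] a_def
          by (rule moment_le_add[OF mSB moment_le_minus[OF meB(1)] cp(1) E(1) pq(1) cp(2) Cd])
      qed
      have mA': "moment_le M p' A (C2 * y powr p')" and mB': "moment_le M p' B (C2 * y powr p')"
      proof -
        have *: "2 powr p' * (C1 * sqrt (real l) powr p' + E') \<le> C2 * y powr p'" if "l < n" for l
        proof -
          have "C1 * sqrt (real l) powr p' \<le> C1 * y powr p'"
            using that C1(1) p' unfolding y_def by (intro mult_left_mono powr_mono2) auto
          moreover have "E' \<le> E' * y powr p'" using yp[of p'] p' E'(1) by (simp add: mult_le_cancel_left1)
          ultimately have "C1 * sqrt (real l) powr p' + E' \<le> (C1 + E') * y powr p'" by (simp add: distrib_right)
          then show ?thesis unfolding C2_def mult.assoc by (intro mult_left_mono) auto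
        qed
        have "moment_le M p' A (2 powr p' * (C1 * sqrt (real h) powr p' + E'))"
          unfolding SA[abs_def] unfolding I1_def using C1(1) E'(1) p'
          by (intro moment_le_add_double moment_le_minus meA C1(2)[OF X]) auto
        then show "moment_le M p' A (C2 * y powr p')" by (rule moment_le_mono) (rule *[OF hs(1)])
        have "moment_le M p' B (2 powr p' * (C1 * sqrt (real h') powr p' + E'))"
          unfolding SB[abs_def] unfolding I2_def using C1(1) E'(1) p'
          by (intro moment_le_add_double moment_le_minus meB C1(2)[OF X]) auto
        then show "moment_le M p' B (C2 * y powr p')" by (rule moment_le_mono) (rule *[OF hs(2)])
      qed
      have low: "moment_le M e V ((1 + C2) * y powr e)" if "moment_le M p' V (C2 * y powr p')" "0 < e" "e \<le> p'" for e V
        using that nn y by (intro moment_le_lower_scaled[where p = p']) auto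
      have mqA: "moment_le M q A (real n powr (q + 1) * dq)" and mqB: "moment_le M q B (real n powr (q + 1) * dq)"
        unfolding A_def[abs_def] B_def[abs_def] using Zm nn p cards by (auto intro!: moment_le_sum)
      define K where "K = real n powr m"
      have K: "0 < K" using n by (simp add: K_def)
      have K1: "4 * K powr p * r ^ j \<le> 4 * B1"
        using B1(2)[OF n] by (simp add: K_def powr_powr j_def)
      have K2: "K powr (p - q) * (real n powr (q + 1) * dq + real n powr (q + 1) * dq) = 2 * dq"
      proof -
        have "K powr (p - q) = real n powr (- (q + 1))"
        proof -
          have "m * (p - q) = - (q + 1)" using p by (simp add: m_def field_simps)
          then show ?thesis by (simp add: K_def powr_powr)
        qed
        then have e: "K powr (p - q) * real n powr (q + 1) = 1" using n by (simp add: powr_add[symmetric])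
        have "K powr (p - q) * (real n powr (q + 1) * dq + real n powr (q + 1) * dq)
            = 2 * dq * (K powr (p - q) * real n powr (q + 1))" by (simp only: algebra_simps)
        then show ?thesis unfolding e by simp
      qed
      \<comment> \<open>The exponents of the two factors recombine to y^p = n^(p/2), the order of
        the inhomogeneous term that the recursion tolerates.\<close>
      have yy: "y powr (p - 1) * y powr 1 = y powr p"
        unfolding powr_add[symmetric] by simp
      have bnd: "z \<le> C3 * y powr p" if "z \<le> (1 + C2) * (1 + C2) * y powr p + 4 * B1 + 2 * dq" for z
      proof -
        have "1 \<le> y powr p" using yp[of p] p by simp
        then have "(4 * B1 + 2 * dq) * 1 \<le> (4 * B1 + 2 * dq) * y powr p"
          using B1(1) nn by (intro mult_left_mono) simp_all
        moreover have "C3 * y powr p = (1 + C2) * (1 + C2) * y powr p + (4 * B1 + 2 * dq) * y powr p"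
          by (simp only: C3_def distrib_right add.assoc)
        ultimately have "(1 + C2) * (1 + C2) * y powr p + 4 * B1 + 2 * dq \<le> C3 * y powr p"
          by (simp only: add.assoc mult_1_right add_left_mono)
        with that show ?thesis by (rule order_trans)
      qed
      have de: "0 < p - 1" "0 < (1::real)" "p - 1 + 1 \<le> q" "1 + (p - 1) \<le> q" "1 \<le> p'" using p p' by auto
      have z1: "0 \<le> (1 + C2) * y powr e" for e using nn(1) by simp
      have z2: "0 \<le> real n powr (q + 1) * dq" using nn(2) by simp
      note lA1 = low[OF mA' de(1) p'(2)] and lA2 = low[OF mA' de(2,5)]
        and lB1 = low[OF mB' de(1) p'(2)] and lB2 = low[OF mB' de(2,5)]
      have x1: "(\<integral>\<^sup>+ w. ennreal (\<bar>A w\<bar> powr (p - 1) * \<bar>B w\<bar> powr 1) \<partial>M) \<le> ennreal (C3 * y powr p)"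
      proof -
        have "(\<integral>\<^sup>+ w. ennreal (\<bar>A w\<bar> powr (p - 1) * \<bar>B w\<bar> powr 1) \<partial>M)
            \<le> ennreal ((1 + C2) * y powr (p - 1) * ((1 + C2) * y powr 1) + 4 * K powr (p - 1 + 1) * r ^ j
                + K powr (p - 1 + 1 - q) * (real n powr (q + 1) * dq + real n powr (q + 1) * dq))"
          by (rule mixed_moment[OF AF BG lA1 lB2 mqA mqB z1 z1 z2 z2 de(1,2,3) K])
        also have "\<dots> \<le> ennreal (C3 * y powr p)"
        proof (intro ennreal_leI bnd)
          have "(1 + C2) * y powr (p - 1) * ((1 + C2) * y powr 1) = (1 + C2) * (1 + C2) * (y powr (p - 1) * y powr 1)"
            by (simp only: mult_ac)
          then have "(1 + C2) * y powr (p - 1) * ((1 + C2) * y powr 1) = (1 + C2) * (1 + C2) * y powr p"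
            by (simp only: yy)
          moreover have "p - 1 + 1 = p" by simp
          ultimately show "(1 + C2) * y powr (p - 1) * ((1 + C2) * y powr 1) + 4 * K powr (p - 1 + 1) * r ^ j
                + K powr (p - 1 + 1 - q) * (real n powr (q + 1) * dq + real n powr (q + 1) * dq)
              \<le> (1 + C2) * (1 + C2) * y powr p + 4 * B1 + 2 * dq"
            using K1 K2 by (simp only:)
        qed
        finally show ?thesis .
      qed
      have x2: "(\<integral>\<^sup>+ w. ennreal (\<bar>A w\<bar> powr 1 * \<bar>B w\<bar> powr (p - 1)) \<partial>M) \<le> ennreal (C3 * y powr p)"
      proof -
        have "(\<integral>\<^sup>+ w. ennreal (\<bar>A w\<bar> powr 1 * \<bar>B w\<bar> powr (p - 1)) \<partial>M)
            \<le> ennreal ((1 + C2) * y powr 1 * ((1 + C2) * y powr (p - 1)) + 4 * K powr (1 + (p - 1)) * r ^ j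
                + K powr (1 + (p - 1) - q) * (real n powr (q + 1) * dq + real n powr (q + 1) * dq))"
          by (rule mixed_moment[OF AF BG lA2 lB1 mqA mqB z1 z1 z2 z2 de(2,1,4) K])
        also have "\<dots> \<le> ennreal (C3 * y powr p)"
        proof (intro ennreal_leI bnd)
          have "(1 + C2) * y powr 1 * ((1 + C2) * y powr (p - 1)) = (1 + C2) * (1 + C2) * (y powr (p - 1) * y powr 1)"
            by (simp only: mult_ac)
          then have "(1 + C2) * y powr 1 * ((1 + C2) * y powr (p - 1)) = (1 + C2) * (1 + C2) * y powr p"
            by (simp only: yy)
          moreover have "1 + (p - 1) = p" by simp
          ultimately show "(1 + C2) * y powr 1 * ((1 + C2) * y powr (p - 1)) + 4 * K powr (1 + (p - 1)) * r ^ j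
                + K powr (1 + (p - 1) - q) * (real n powr (q + 1) * dq + real n powr (q + 1) * dq)
              \<le> (1 + C2) * (1 + C2) * y powr p + 4 * B1 + 2 * dq"
            using K1 K2 by (simp only:)
        qed
        finally show ?thesis .
      qed
      have mAB: "moment_le M p (\<lambda>w. A w + B w) (a + a + p * 2 powr (p - 1) * (C3 * y powr p + C3 * y powr p))"
      proof -
        have "1 < p" "0 \<le> C3 * y powr p" using p nn(3) by auto
        from moment_le_add_cross[OF mA mB this(1) a0 a0 this(2) this(2) x1 x2] show ?thesis .
      qed
      have mgap: "moment_le M p gap (3 powr (p + 1) * (1 + c) * y powr p)"
      proof -
        have Xp: "moment_le M p (X t) (1 + c)" for t
          using p c by (intro moment_le_lower_one[OF Xm]) auto
        have "moment_le M p gap ((3 * real j) powr (p + 1) * (1 + c))"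
          unfolding gap_def[abs_def] using c p cards by (intro moment_le_sum Xp) auto
        then show ?thesis
        proof (rule moment_le_mono)
          \<comment> \<open>The gap has at most 3 j terms with j at most n^(1/4), so even the crude
            power p + 1 of their number is at most n^(p/2).\<close>
          have "real j powr (p + 1) \<le> (real n powr (1 / 4)) powr (p + 1)"
            using quarter_le[of n] p by (intro powr_mono2) (auto simp: j_def)
          also have "\<dots> \<le> real n powr (p / 2)"
            unfolding powr_powr using n p by (intro powr_mono) auto
          also have "\<dots> = y powr p" by (simp add: y_def powr_half_sqrt[symmetric] powr_powr)
          finally have "real j powr (p + 1) \<le> y powr p" .
          then have "3 powr (p + 1) * (1 + c) * real j powr (p + 1) \<le> 3 powr (p + 1) * (1 + c) * y powr p"
            using c by (intro mult_left_mono) auto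
          then show "(3 * real j) powr (p + 1) * (1 + c) \<le> 3 powr (p + 1) * (1 + c) * y powr p"
            by (simp add: powr_mult mult_ac)
        qed
      qed
      have mR: "moment_le M p (\<lambda>w. gap w + (eA w + eB w)) (R * y powr p)"
      proof -
        have "moment_le M p (\<lambda>w. gap w + (eA w + eB w))
            (2 powr p * (3 powr (p + 1) * (1 + c) * y powr p + 2 powr p * (E + E)))"
          using p c E(1) by (intro moment_le_add_double mgap meA meB) auto
        then show ?thesis
        proof (rule moment_le_mono)
          have "2 powr p * (E + E) * 1 \<le> 2 powr p * (E + E) * y powr p"
            using yp[of p] p E(1) by (intro mult_left_mono) auto
          then have "3 powr (p + 1) * (1 + c) * y powr p + 2 powr p * (E + E)
              \<le> (3 powr (p + 1) * (1 + c) + 2 powr p * (2 * E)) * y powr p"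
            by (simp add: algebra_simps)
          then show "2 powr p * (3 powr (p + 1) * (1 + c) * y powr p + 2 powr p * (E + E)) \<le> R * y powr p"
            unfolding R_def mult.assoc[of "2 powr p"] by (intro mult_left_mono) auto
        qed
      qed
      have eq: "(\<Sum>t\<in>{s + 1..s + int n}. X t w) = (A w + B w) + (gap w + (eA w + eB w))" for w
        unfolding sum_split by (simp add: SA SB gap_def)
      have "moment_le M p (\<lambda>w. \<Sum>t\<in>{s + 1..s + int n}. X t w)
          ((1 + d) * (a + a + p * 2 powr (p - 1) * (C3 * y powr p + C3 * y powr p)) + Cd * (R * y powr p))"
        unfolding eq using p a0 nn d Cd(1) by (intro moment_le_add[OF mAB mR _ _ _ _ _ Cd(2)]) auto
      then show ?thesis
      proof (rule moment_le_mono)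
        have "Cd * E * 1 \<le> Cd * E * y powr p"
          using yp[of p] p E(1) Cd(1) by (intro mult_left_mono mult_nonneg_nonneg) auto
        then have "a \<le> ((1 + d) * C * k0 / 2 + Cd * E) * y powr p" by (simp add: a_def algebra_simps)
        then have "(1 + d) * (a + a + p * 2 powr (p - 1) * (C3 * y powr p + C3 * y powr p)) + Cd * (R * y powr p)
            \<le> (1 + d) * (2 * (((1 + d) * C * k0 / 2 + Cd * E) * y powr p) + p * 2 powr (p - 1) * (C3 * y powr p + C3 * y powr p))
              + Cd * (R * y powr p)"
          using d by (intro add_right_mono mult_left_mono) linarith+
        also have "\<dots> = ((1 + d) * (1 + d) * k0 * C + C4) * y powr p"
        proof -
          have "(1 + d) * (2 * (((1 + d) * C * k0 / 2 + v1) * v) + v2 * (C3 * v + C3 * v)) + Cd * (R * v)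
              = ((1 + d) * (1 + d) * k0 * C + ((1 + d) * (2 * v1 + v2 * (2 * C3)) + Cd * R)) * v" for v1 v2 v
            by (simp add: field_simps)
          then show ?thesis unfolding C4_def .
        qed
        also have "\<dots> = C * sqrt (real n) powr p" unfolding dk Ceq y_def ..
        finally show "(1 + d) * (a + a + p * 2 powr (p - 1) * (C3 * y powr p + C3 * y powr p)) + Cd * (R * y powr p)
            \<le> C * sqrt (real n) powr p" .
      qed
    qed
  qed
  then show ?thesis unfolding sum_moment_bound_def using nn(6) by blast
qed

theorem sum_moment_bound_all:
  assumes p: "2 \<le> p" "p < q" and c: "0 \<le> c"
  shows "sum_moment_bound q c p"
proof -
  have two: "sum_moment_bound q c 2"
  proof -
    have "2 < q" using p by simp
    from sum_moment_two[OF this c] obtain C where C: "0 \<le> C" "\<And>X s n. mixing_class q c X \<Longrightarrow>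
        moment_le M 2 (\<lambda>w. \<Sum>t\<in>{s + 1..s + int n}. X t w) (C * sqrt (real n) powr 2)" by blast
    then show ?thesis unfolding sum_moment_bound_def by (intro exI[of _ C]) simp
  qed
  have step: "sum_moment_bound q c p" if "2 < p" "p < q" "sum_moment_bound q c (max 2 (p - 1))" for p
    using that(1,2) c that(3) by (rule sum_moment_step)
  have prev: "2 \<le> max 2 (p - 1)" "max 2 (p - 1) < q" "max 2 (p - 1) \<le> 2 + real k"
    if "2 < p" "p < q" "p \<le> 2 + real (Suc k)" for p k
    using that by auto
  \<comment> \<open>A step lowers the real exponent by one but not below 2, so the induction runs
    over an integer bound \<open>k\<close> on p - 2.\<close>
  have *: "\<forall>p. 2 \<le> p \<and> p < q \<and> p \<le> 2 + real k \<longrightarrow> sum_moment_bound q c p" for k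
  proof (induction k)
    case 0
    show ?case
    proof (intro allI impI, elim conjE)
      fix p :: real assume "2 \<le> p" "p \<le> 2 + real 0"
      then have "p = 2" by simp
      with two show "sum_moment_bound q c p" by simp
    qed
  next
    case (Suc k)
    show ?case
    proof (intro allI impI, elim conjE)
      fix p assume p: "2 \<le> p" "p < q" "p \<le> 2 + real (Suc k)"
      show "sum_moment_bound q c p"
      proof (cases "p = 2")
        case True
        with two show ?thesis by simp
      next
        case False
        then have "2 < p" using p by simp
        have "sum_moment_bound q c (max 2 (p - 1))"
          by (rule Suc.IH[rule_format]) (use prev[OF \<open>2 < p\<close> p(2,3)] in simp)
        with \<open>2 < p\<close> p(2) show ?thesis by (rule step)
      qed
    qed
  qed
  have "p \<le> 2 + real (nat \<lceil>p - 2\<rceil>)" by linarith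
  with *[rule_format, of p "nat \<lceil>p - 2\<rceil>"] p show ?thesis by simp
qed

end

section \<open>Smoothing distributions and the envelope of \<open>S\<close>\<close>

context product_sigma_finite
begin

lemma AE_PiM_component_finite:
  assumes I: "finite I" "i \<in> I" and P: "AE z in M i. P z"
  shows "AE x in Pi\<^sub>M I M. P (x i)"
proof -
  obtain N where N: "N \<in> null_sets (M i)" "{z \<in> space (M i). \<not> P z} \<subseteq> N"
    using P unfolding eventually_ae_filter by blast
  have [measurable]: "N \<in> sets (M i)" using N by auto
  have ins: "insert i (I - {i}) = I" using I by auto
  let ?N = "{x \<in> space (Pi\<^sub>M I M). x i \<in> N}"
  have m: "?N \<in> sets (Pi\<^sub>M I M)" using I(2) by measurable
  have "emeasure (Pi\<^sub>M I M) ?N = (\<integral>\<^sup>+ x. indicator N (x i) \<partial>Pi\<^sub>M I M)"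
    by (subst nn_integral_indicator[symmetric, OF m]) (intro nn_integral_cong, auto simp: indicator_def)
  also have "\<dots> = (\<integral>\<^sup>+ x. indicator N (x i) \<partial>Pi\<^sub>M (insert i (I - {i})) M)" by (simp only: ins)
  also have "\<dots> = (\<integral>\<^sup>+ x. (\<integral>\<^sup>+ z. indicator N ((x(i := z)) i) \<partial>M i) \<partial>Pi\<^sub>M (I - {i}) M)"
    using I by (intro product_nn_integral_insert) (auto simp: ins)
  also have "\<dots> = 0" using N(1) by (simp add: null_setsD1)
  finally have "?N \<in> null_sets (Pi\<^sub>M I M)" using m by auto
  then show ?thesis
    by (rule AE_I') (use N(2) I(2) in \<open>auto simp: space_PiM PiE_iff\<close>)
qed

lemma AE_PiM_pair_finite:
  assumes I: "finite I" "i \<in> I" "j \<in> I" "i \<noteq> j" and P: "AE z in M i \<Otimes>\<^sub>M M j. P z"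
  shows "AE x in Pi\<^sub>M I M. P (x i, x j)"
proof -
  interpret ij: pair_sigma_finite "M i" "M j" by standard
  obtain N where N: "N \<in> null_sets (M i \<Otimes>\<^sub>M M j)" "{z \<in> space (M i \<Otimes>\<^sub>M M j). \<not> P z} \<subseteq> N"
    using P unfolding eventually_ae_filter by blast
  have Nm [measurable]: "N \<in> sets (M i \<Otimes>\<^sub>M M j)" using N by auto
  define J where "J = I - {i} - {j}"
  have ins: "insert i (insert j J) = I" and J: "finite J" "j \<notin> J" "i \<notin> insert j J" using I by (auto simp: J_def)
  let ?N = "{x \<in> space (Pi\<^sub>M I M). (x i, x j) \<in> N}"
  have m: "?N \<in> sets (Pi\<^sub>M I M)" using I(2,3) by measurable
  have z: "(\<integral>\<^sup>+ v. (\<integral>\<^sup>+ u. indicator N (u, v) \<partial>M i) \<partial>M j) = 0"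
  proof -
    have "(\<integral>\<^sup>+ v. (\<integral>\<^sup>+ u. indicator N (u, v) \<partial>M i) \<partial>M j) = (\<integral>\<^sup>+ z. indicator N z \<partial>(M i \<Otimes>\<^sub>M M j))"
      by (rule ij.nn_integral_snd) simp
    also have "\<dots> = 0" using N(1) by (simp add: null_setsD1)
    finally show ?thesis .
  qed
  have "emeasure (Pi\<^sub>M I M) ?N = (\<integral>\<^sup>+ x. indicator N (x i, x j) \<partial>Pi\<^sub>M I M)"
    by (subst nn_integral_indicator[symmetric, OF m]) (intro nn_integral_cong, auto simp: indicator_def)
  also have "\<dots> = (\<integral>\<^sup>+ x. indicator N (x i, x j) \<partial>Pi\<^sub>M (insert i (insert j J)) M)" by (simp only: ins)
  also have "\<dots> = (\<integral>\<^sup>+ x. (\<integral>\<^sup>+ u. indicator N ((x(i := u)) i, (x(i := u)) j) \<partial>M i) \<partial>Pi\<^sub>M (insert j J) M)"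
    using I J by (intro product_nn_integral_insert) (auto simp: ins)
  also have "\<dots> = (\<integral>\<^sup>+ x. (\<integral>\<^sup>+ u. indicator N (u, x j) \<partial>M i) \<partial>Pi\<^sub>M (insert j J) M)"
    using I(4) by simp
  also have "\<dots> = (\<integral>\<^sup>+ x. (\<integral>\<^sup>+ v. (\<integral>\<^sup>+ u. indicator N (u, (x(j := v)) j) \<partial>M i) \<partial>M j) \<partial>Pi\<^sub>M J M)"
    using J(1,2)
  proof (rule product_nn_integral_insert)
    show "(\<lambda>x. \<integral>\<^sup>+ u. indicator N (u, x j) \<partial>M i) \<in> borel_measurable (Pi\<^sub>M (insert j J) M)"
      by (rule measurable_compose[OF measurable_component_singleton[of j]]) (simp, measurable)
  qed
  also have "\<dots> = 0" by (simp add: z)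
  finally have "?N \<in> null_sets (Pi\<^sub>M I M)" using m by auto
  then show ?thesis
    by (rule AE_I') (use N(2) I(2,3) in \<open>auto simp: space_PiM PiE_iff space_pair_measure\<close>)
qed

end

section \<open>The model, its envelope and its bounded kernels\<close>

locale smoothing_model = finite_state lam for lam :: "'x measure" +
  fixes mu :: "'y measure" and Theta :: "'p::euclidean_space set"
    and m :: "'p \<Rightarrow> 'x \<Rightarrow> 'x \<Rightarrow> real" and g :: "'p \<Rightarrow> 'x \<Rightarrow> 'y \<Rightarrow> real"
    and phi :: "'p \<Rightarrow> real" and psi :: "'p \<Rightarrow> 'e::euclidean_space"
    and S :: "'x \<times> 'x \<times> 'y \<Rightarrow> 'e" and sm sp cphi cpsi :: real
  assumes space_mu: "space mu = UNIV"
    and Theta: "compact Theta"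
    and m_meas: "\<And>th. th \<in> Theta \<Longrightarrow> (\<lambda>(x, x'). m th x x') \<in> borel_measurable (lam \<Otimes>\<^sub>M lam)"
    and g_meas: "\<And>th. th \<in> Theta \<Longrightarrow> (\<lambda>(x, y). g th x y) \<in> borel_measurable (lam \<Otimes>\<^sub>M mu)"
    and phi: "continuous_on Theta phi" and psi: "continuous_on Theta psi"
    and cphi: "\<And>th. th \<in> Theta \<Longrightarrow> phi th \<le> cphi" and cpsi: "\<And>th. th \<in> Theta \<Longrightarrow> norm (psi th) \<le> cpsi"
    and S_meas: "S \<in> borel_measurable (lam \<Otimes>\<^sub>M lam \<Otimes>\<^sub>M mu)"
    and mg_pos: "\<And>th x x' y. th \<in> Theta \<Longrightarrow> 0 < m th x x' \<and> 0 < g th x' y"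
    and exp_family: "\<And>th x x' y. th \<in> Theta \<Longrightarrow> ln (m th x x') + ln (g th x' y) = phi th + S (x, x', y) \<bullet> psi th"
    and sm: "0 < sm" "sm \<le> sp" 
    and mixing: "\<And>th x x'. th \<in> Theta \<Longrightarrow> sm \<le> m th x x' \<and> m th x x' \<le> sp"
begin

lemma mg_eq: "th \<in> Theta \<Longrightarrow> m th x x' * g th x' y = exp (phi th + S (x, x', y) \<bullet> psi th)"
  using mg_pos[of th x x' y] exp_family[of th x x' y] by (metis exp_add exp_ln)

lemma S_pair_meas: "(\<lambda>z. S (fst z, snd z, y)) \<in> borel_measurable (lam \<Otimes>\<^sub>M lam)"
proof -
  have "(\<lambda>z. (fst z, snd z, y)) \<in> measurable (lam \<Otimes>\<^sub>M lam) (lam \<Otimes>\<^sub>M lam \<Otimes>\<^sub>M mu)"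
    using space_mu by (intro measurable_Pair measurable_fst measurable_snd measurable_const) auto
  from measurable_compose[OF this S_meas] show ?thesis .
qed

lemma S_swap_meas: "(\<lambda>(y, z). S (fst z, snd z, y)) \<in> borel_measurable (mu \<Otimes>\<^sub>M (lam \<Otimes>\<^sub>M lam))"
proof -
  have "(\<lambda>w. (fst (snd w), snd (snd w), fst w)) \<in> measurable (mu \<Otimes>\<^sub>M (lam \<Otimes>\<^sub>M lam)) (lam \<Otimes>\<^sub>M lam \<Otimes>\<^sub>M mu)"
    by measurable
  from measurable_compose[OF this S_meas] show ?thesis by (simp add: split_beta')
qed

text \<open>An essential supremum over the states: unlike \<open>sup_norm_at\<close>, it is measurable in the observation,
  so that its moments at all times agree by stationarity.\<close>

definition envelope :: "('x \<times> 'x) measure \<Rightarrow> 'y \<Rightarrow> ennreal" where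
  "envelope nu y = (SUP c\<in>{c. c \<in> \<rat> \<and> 0 \<le> c}.
     if emeasure nu {z \<in> space nu. c < norm (S (fst z, snd z, y))} = 0 then 0 else ennreal c)"

lemma envelope_le: "envelope nu y \<le> sup_norm_at S y"
  unfolding envelope_def
proof (rule SUP_least)
  fix c :: real assume "c \<in> {c. c \<in> \<rat> \<and> 0 \<le> c}"
  show "(if emeasure nu {z \<in> space nu. c < norm (S (fst z, snd z, y))} = 0 then 0 else ennreal c) \<le> sup_norm_at S y"
  proof (cases "emeasure nu {z \<in> space nu. c < norm (S (fst z, snd z, y))} = 0")
    case False
    then have "{z \<in> space nu. c < norm (S (fst z, snd z, y))} \<noteq> {}" by (metis emeasure_empty)
    then obtain z where z: "c < norm (S (fst z, snd z, y))" by blast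
    then have "ennreal c \<le> ennreal (norm (S (fst z, snd z, y)))" by (intro ennreal_leI) simp
    also have "\<dots> \<le> sup_norm_at S y"
      unfolding sup_norm_at_def by (rule SUP_upper2[of z]) (auto simp: split_beta)
    finally show ?thesis by simp
  qed simp
qed

lemma envelope_AE:
  assumes sets: "sets nu = sets (lam \<Otimes>\<^sub>M lam)" and fin: "envelope nu y < \<infinity>"
  shows "AE z in nu. norm (S (fst z, snd z, y)) \<le> enn2real (envelope nu y)"
proof -
  have [measurable]: "(\<lambda>z. S (fst z, snd z, y)) \<in> borel_measurable nu"
    using S_pair_meas sets by (simp cong: measurable_cong_sets)
  have 1: "AE z in nu. norm (S (fst z, snd z, y)) \<le> c" if c: "c \<in> \<rat>" "enn2real (envelope nu y) < c" for c
  proof -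
    have c0: "0 < c" using c(2) enn2real_nonneg[of "envelope nu y"] by linarith
    have "emeasure nu {z \<in> space nu. c < norm (S (fst z, snd z, y))} = 0"
    proof (rule ccontr)
      assume "emeasure nu {z \<in> space nu. c < norm (S (fst z, snd z, y))} \<noteq> 0"
      then have "ennreal c \<le> envelope nu y"
        unfolding envelope_def using c c0 by (intro SUP_upper2[of c]) auto
      moreover have "envelope nu y = ennreal (enn2real (envelope nu y))" using fin by simp
      ultimately have "ennreal c \<le> ennreal (enn2real (envelope nu y))" by simp
      then show False using c c0 by (simp add: ennreal_le_iff)
    qed
    then have "AE z in nu. \<not> c < norm (S (fst z, snd z, y))"
      by (intro AE_I[where N = "{z \<in> space nu. c < norm (S (fst z, snd z, y))}"]) auto
    then show ?thesis by eventually_elim simp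
  qed
  let ?Q = "{c \<in> \<rat>. enn2real (envelope nu y) < c}"
  have "AE z in nu. \<forall>c\<in>?Q. norm (S (fst z, snd z, y)) \<le> c"
    using 1 countable_subset[OF _ countable_rat, of ?Q] by (subst AE_ball_countable) auto
  then show ?thesis
  proof eventually_elim
    case (elim z)
    show ?case
    proof (rule ccontr)
      assume "\<not> ?thesis"
      then obtain q where "q \<in> \<rat>" "enn2real (envelope nu y) < q" "q < norm (S (fst z, snd z, y))"
        using Rats_dense_in_real[of "enn2real (envelope nu y)" "norm (S (fst z, snd z, y))"] by auto
      with elim show False by force
    qed
  qed
qed

text \<open>The definition runs over rational levels only, so the envelope is a countable supremum;
  for each level the mass of the section is measurable in the observation by the argument behind
  Fubini's theorem.\<close>

lemma envelope_measurable:
  assumes sets: "sets nu = sets (lam \<Otimes>\<^sub>M lam)" and fin: "sigma_finite_measure nu"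
  shows "envelope nu \<in> borel_measurable mu"
proof -
  have "(\<lambda>y. emeasure nu {z \<in> space nu. c < norm (S (fst z, snd z, y))}) \<in> borel_measurable mu" for c
  proof -
    have sp: "space nu = UNIV" using sets_eq_imp_space_eq[OF sets] by (simp add: space_pair_measure space_lam)
    have "(\<lambda>(y, z). S (fst z, snd z, y)) \<in> borel_measurable (mu \<Otimes>\<^sub>M nu)"
      by (subst measurable_cong_sets[OF sets_pair_measure_cong[OF refl sets] refl]) (rule S_swap_meas)
    then have "{w \<in> space (mu \<Otimes>\<^sub>M nu). c < norm ((\<lambda>(y, z). S (fst z, snd z, y)) w)} \<in> sets (mu \<Otimes>\<^sub>M nu)"
      by measurable
    from sigma_finite_measure.measurable_emeasure_Pair[OF fin this]
    show ?thesis by (simp add: sp space_mu space_pair_measure vimage_def)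
  qed
  then have [measurable]: "Measurable.pred mu (\<lambda>y. emeasure nu {z \<in> space nu. c < norm (S (fst z, snd z, y))} = 0)" for c
    by (simp add: pred_def)
  have "countable {c::real. c \<in> \<rat> \<and> 0 \<le> c}" by (rule countable_subset[OF _ countable_rat]) auto
  then show ?thesis unfolding envelope_def[abs_def] by (intro borel_measurable_SUP) auto
qed

definition env :: "'y \<Rightarrow> real" where "env y = enn2real (envelope (lam \<Otimes>\<^sub>M lam) y)"

text \<open>One condition on a trajectory that serves all parameters, initial laws and times.
  Pathwise statements proved under it are automatically uniform, with a single exceptional null
  set.\<close>

definition good :: "(int \<Rightarrow> 'y) \<Rightarrow> bool" where
  "good y \<longleftrightarrow> (\<forall>i. envelope (lam \<Otimes>\<^sub>M lam) (y i) < \<infinity>)"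

text \<open>Since \<open>sm * g\<close> is at most m g = exp(phi + <S, psi>), Cauchy-Schwarz
  together with the bounds \<open>cphi\<close> and \<open>cpsi\<close> over the parameter set gives
  this level, which does not depend on the parameter.\<close>

definition g_bound :: "'y \<Rightarrow> real" where "g_bound y = exp (cphi + env y * cpsi) / sm"

text \<open>Truncating \<open>g\<close> at a level that it does not exceed almost everywhere makes all kernels bounded.\<close>

definition weight :: "'p \<Rightarrow> (int \<Rightarrow> 'y) \<Rightarrow> int \<Rightarrow> 'x \<Rightarrow> real" where
  "weight th y i x' = min (g th x' (y (i + 1))) (g_bound (y (i + 1)))"

definition kern :: "'p \<Rightarrow> (int \<Rightarrow> 'y) \<Rightarrow> int \<Rightarrow> 'x \<Rightarrow> 'x \<Rightarrow> real" where
  "kern th y i x x' = m th x x' * weight th y i x'"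

text \<open>Forgetting is proved for scalar test functions bounded everywhere. When \<open>V\<close>
  is an almost sure bound, the smoothing integral does not notice the cut.\<close>

definition trunc :: "real \<Rightarrow> 'e \<Rightarrow> 'y \<Rightarrow> 'x \<Rightarrow> 'x \<Rightarrow> real" where
  "trunc V e y x x' = (if norm (S (x, x', y)) \<le> V then S (x, x', y) \<bullet> e else 0)"

lemma sigma_finite_lam: "sigma_finite_measure lam"
  by (rule finite_measure.axioms) (rule finite_measure_axioms)

lemma sigma_finite_pair: "sigma_finite_measure (lam \<Otimes>\<^sub>M lam)"
  using sigma_finite_lam by (intro sigma_finite_pair_measure)

lemma env_nonneg: "0 \<le> env y"
  by (simp add: env_def)

lemma g_bound_pos: "0 < g_bound y"
  using sm by (simp add: g_bound_def)

lemma good_AE: "good y \<Longrightarrow> AE z in lam \<Otimes>\<^sub>M lam. norm (S (fst z, snd z, y i)) \<le> env (y i)"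
  unfolding good_def env_def by (intro envelope_AE) auto

text \<open>Because \<open>lam\<close> is not null, Fubini supplies one state \<open>x\<close> from
  which the envelope bounds \<open>S\<close> for almost every next state. At this \<open>x\<close>
  the exponential form bounds m g, and m is at least \<open>sm\<close>.\<close>

lemma g_AE:
  assumes th: "th \<in> Theta" and y: "good y"
  shows "AE x' in lam. g th x' (y i) \<le> g_bound (y i)"
proof -
  interpret pair_sigma_finite lam lam using sigma_finite_lam by (simp add: pair_sigma_finite_def)
  have "AE x in lam. AE x' in lam. norm (S (x, x', y i)) \<le> env (y i)"
    using AE_pair[OF good_AE[OF y, of i]] by simp
  moreover have "ae_filter lam \<noteq> bot" using lam_pos space_lam by (simp add: ae_filter_eq_bot_iff)
  ultimately obtain x where "AE x' in lam. norm (S (x, x', y i)) \<le> env (y i)"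
    using eventually_happens' by blast
  then show ?thesis
  proof eventually_elim
    case (elim x')
    have "S (x, x', y i) \<bullet> psi th \<le> norm (S (x, x', y i)) * norm (psi th)" by (rule norm_cauchy_schwarz)
    also have "\<dots> \<le> env (y i) * cpsi" using elim cpsi[OF th] by (intro mult_mono) (auto simp: env_nonneg)
    finally have "exp (phi th + S (x, x', y i) \<bullet> psi th) \<le> exp (cphi + env (y i) * cpsi)"
      using cphi[OF th] by simp
    moreover have "sm * g th x' (y i) \<le> m th x x' * g th x' (y i)"
      using mixing[OF th, of x x'] mg_pos[OF th, of x x' "y i"] by (intro mult_right_mono) auto
    ultimately have "sm * g th x' (y i) \<le> exp (cphi + env (y i) * cpsi)"
      unfolding mg_eq[OF th] by linarith
    then show ?case using sm by (simp add: g_bound_def pos_le_divide_eq mult.commute)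
  qed
qed

lemma mixing_kernels: "th \<in> Theta \<Longrightarrow> mixing_kernels lam (kern th y) (weight th y) sm sp"
proof unfold_locales
  assume th: "th \<in> Theta"
  have gm: "(\<lambda>x'. g th x' (y i)) \<in> borel_measurable lam" for i
    using measurable_compose[OF measurable_Pair2'[of "y i" mu lam] g_meas[OF th]] space_mu by simp
  have wm: "weight th y i \<in> borel_measurable lam" for i
    unfolding weight_def[abs_def] using gm by measurable
  have wpos: "0 < weight th y i x" for i x
    using mg_pos[OF th] g_bound_pos by (simp add: weight_def)
  have wle: "weight th y i x \<le> g_bound (y (i + 1))" for i x by (simp add: weight_def)
  show "bounded_fun (weight th y i)" for i
    unfolding bounded_fun_def using wm wle wpos by (auto intro!: exI[of _ "g_bound (y (i + 1))"] simp: less_imp_le)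
  show "0 < weight th y i x" for i x by (rule wpos)
  show "0 < sm" "sm \<le> sp" by (fact sm)+
  show "sm * weight th y i x' \<le> kern th y i x x'" for i x x'
    unfolding kern_def using mixing[OF th, of x x'] wpos[of i x'] by (intro mult_right_mono) auto
  show le: "kern th y i x x' \<le> sp * weight th y i x'" for i x x'
    unfolding kern_def using mixing[OF th, of x x'] wpos[of i x'] by (intro mult_right_mono) auto
  show "bounded_kernel (kern th y i)" for i
    unfolding bounded_kernel_def
  proof (intro conjI exI allI)
    have "(\<lambda>(x, x'). m th x x' * weight th y i x') \<in> borel_measurable (lam \<Otimes>\<^sub>M lam)"
      using m_meas[OF th] wm[of i] by measurable
    then show "(\<lambda>(x, x'). kern th y i x x') \<in> borel_measurable (lam \<Otimes>\<^sub>M lam)" by (simp add: kern_def)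
    fix x x'
    have "0 < m th x x'" using mg_pos[OF th] by blast
    then have "0 \<le> kern th y i x x'" using wpos[of i x'] by (simp add: kern_def less_imp_le)
    moreover have "sp * weight th y i x' \<le> sp * g_bound (y (i + 1))"
      using wle[of i x'] sm by (intro mult_left_mono) auto
    ultimately show "\<bar>kern th y i x x'\<bar> \<le> sp * g_bound (y (i + 1))" using le[of i x x'] by simp
  qed
qed

lemma trunc_meas: "(\<lambda>(x, x'). trunc V e y x x') \<in> borel_measurable (lam \<Otimes>\<^sub>M lam)"
proof -
  have [measurable]: "(\<lambda>z. S (fst z, snd z, y)) \<in> borel_measurable (lam \<Otimes>\<^sub>M lam)" by (rule S_pair_meas)
  have "(\<lambda>z. if norm (S (fst z, snd z, y)) \<le> V then S (fst z, snd z, y) \<bullet> e else 0) \<in> borel_measurable (lam \<Otimes>\<^sub>M lam)"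
    by measurable
  then show ?thesis by (simp add: trunc_def split_beta')
qed

lemma trunc_le: "norm e = 1 \<Longrightarrow> 0 \<le> V \<Longrightarrow> \<bar>trunc V e y x x'\<bar> \<le> V"
  using Cauchy_Schwarz_ineq2[of "S (x, x', y)" e] by (auto simp: trunc_def)

section \<open>Smoothing functionals as ratios of iterated kernels\<close>

definition ratio :: "'p \<Rightarrow> (int \<Rightarrow> 'y) \<Rightarrow> ('x \<Rightarrow> 'x \<Rightarrow> real) \<Rightarrow> 'x measure \<Rightarrow> int \<Rightarrow> nat \<Rightarrow> nat \<Rightarrow> real" where
  "ratio th y h chi s n l =
     mixing_kernels.num lam (kern th y) h chi s n l / mixing_kernels.den lam (kern th y) chi s n l"

text \<open>\<open>m\<close> and \<open>g\<close> are measurable only for each fixed parameter, but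
  their product has the exponential form, which is jointly measurable in parameter, observations and
  path. The value 0 outside \<open>Theta\<close> makes \<open>phi\<close> and \<open>psi\<close>
  Borel on the whole space.\<close>

definition lik :: "int \<Rightarrow> int \<Rightarrow> ('p \<times> (int \<Rightarrow> 'y)) \<times> (int \<Rightarrow> 'x) \<Rightarrow> real" where
  "lik r t = (\<lambda>((th, y), x). \<Prod>i\<in>{r..<t}. exp ((if th \<in> Theta then phi th else 0)
     + S (x i, x (i + 1), y (i + 1)) \<bullet> (if th \<in> Theta then psi th else 0)))"

lemma path_lik_eq: "th \<in> Theta \<Longrightarrow> path_lik m g th r t y x = lik r t ((th, y), x)"
  by (simp add: path_lik_def lik_def mg_eq)

context
  fixes chi :: "'x measure"
  assumes chi: "prob_space chi" "sets chi = sets lam"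
begin

abbreviation path_factor :: "int \<Rightarrow> int \<Rightarrow> 'x measure" where
  "path_factor r i \<equiv> (if i = r then chi else lam)"

lemma path_finite: "finite_measure (path_measure lam chi r t)"
  unfolding path_measure_def
  using prob_space.finite_measure[OF chi(1)] finite_measure_axioms by (intro finite_measure_PiM) auto

lemma path_product_sigma_finite: "product_sigma_finite (path_factor r)"
  using prob_space_imp_sigma_finite[OF chi(1)] sigma_finite_lam by (simp add: product_sigma_finite_def)

lemma path_component: "i \<in> {r..t} \<Longrightarrow> (\<lambda>x. x i) \<in> measurable (path_measure lam chi r t) lam"
proof -
  assume "i \<in> {r..t}"
  from measurable_component_singleton[OF this, of "path_factor r"]
  have "(\<lambda>x. x i) \<in> measurable (path_measure lam chi r t) (path_factor r i)" unfolding path_measure_def .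
  moreover have "sets (path_factor r i) = sets lam" using chi(2) by simp
  ultimately show ?thesis using measurable_cong_sets[OF refl, of "path_factor r i" lam] by blast
qed

lemma S_path_meas:
  assumes "i \<in> {r..t}" "j \<in> {r..t}"
  shows "(\<lambda>w. S (snd w i, snd w j, snd (fst w) k))
    \<in> borel_measurable ((N \<Otimes>\<^sub>M Pi\<^sub>M UNIV (\<lambda>_. mu)) \<Otimes>\<^sub>M path_measure lam chi r t)"
proof -
  let ?N = "(N \<Otimes>\<^sub>M Pi\<^sub>M UNIV (\<lambda>_. mu)) \<Otimes>\<^sub>M path_measure lam chi r t"
  have 1: "(\<lambda>w. snd w l) \<in> measurable ?N lam" if "l \<in> {r..t}" for l
    by (rule measurable_compose[OF measurable_snd path_component[OF that]])
  have 2: "(\<lambda>w. snd (fst w) k) \<in> measurable ?N mu"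
    by (rule measurable_compose[OF measurable_compose[OF measurable_fst measurable_snd] measurable_component_singleton]) simp
  have "(\<lambda>w. (snd w i, snd w j, snd (fst w) k)) \<in> measurable ?N (lam \<Otimes>\<^sub>M lam \<Otimes>\<^sub>M mu)"
    by (intro measurable_Pair 1 2 assms)
  from measurable_compose[OF this S_meas] show ?thesis .
qed

lemma lik_meas: "lik r t \<in> borel_measurable ((borel \<Otimes>\<^sub>M Pi\<^sub>M UNIV (\<lambda>_. mu)) \<Otimes>\<^sub>M path_measure lam chi r t)"
proof -
  have T: "Theta \<in> sets borel" using Theta by (simp add: compact_imp_closed)
  have [measurable]: "(\<lambda>th. if th \<in> Theta then phi th else 0) \<in> borel_measurable borel"
    "(\<lambda>th. if th \<in> Theta then psi th else 0) \<in> borel_measurable borel"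
    using T phi psi by (auto intro!: borel_measurable_continuous_on_if continuous_on_const)
  have "(\<lambda>w. \<Prod>i\<in>{r..<t}. exp ((\<lambda>th. if th \<in> Theta then phi th else 0) (fst (fst w))
     + S (snd w i, snd w (i + 1), snd (fst w) (i + 1)) \<bullet> (\<lambda>th. if th \<in> Theta then psi th else 0) (fst (fst w))))
     \<in> borel_measurable ((borel \<Otimes>\<^sub>M Pi\<^sub>M UNIV (\<lambda>_. mu)) \<Otimes>\<^sub>M path_measure lam chi r t)" (is "?f \<in> _")
  proof (intro borel_measurable_prod)
    fix i assume i: "i \<in> {r..<t}"
    have [measurable]: "(\<lambda>w. S (snd w i, snd w (i + 1), snd (fst w) (i + 1)))
      \<in> borel_measurable ((borel \<Otimes>\<^sub>M Pi\<^sub>M UNIV (\<lambda>_. mu)) \<Otimes>\<^sub>M path_measure lam chi r t)"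
      using i by (intro S_path_meas) auto
    show "(\<lambda>w. exp ((\<lambda>th. if th \<in> Theta then phi th else 0) (fst (fst w))
     + S (snd w i, snd w (i + 1), snd (fst w) (i + 1)) \<bullet> (\<lambda>th. if th \<in> Theta then psi th else 0) (fst (fst w))))
     \<in> borel_measurable ((borel \<Otimes>\<^sub>M Pi\<^sub>M UNIV (\<lambda>_. mu)) \<Otimes>\<^sub>M path_measure lam chi r t)"
      by measurable
  qed
  moreover have "?f = lik r t" by (auto simp: lik_def)
  ultimately show ?thesis by simp
qed

text \<open>Joint measurability in the parameter is what allows a random parameter to be inserted
  later.\<close>

lemma Phi_meas:
  assumes s: "r < s" "s \<le> t"
  obtains Q where "Q \<in> borel_measurable (borel \<Otimes>\<^sub>M Pi\<^sub>M UNIV (\<lambda>_. mu))"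
    "\<And>th y. th \<in> Theta \<Longrightarrow> Phi lam m g chi r th s t S y = Q (th, y)"
proof -
  let ?P = "path_measure lam chi r t"
  interpret path: finite_measure ?P by (rule path_finite)
  define Q where "Q w = (\<integral>x. lik r t (w, x) *\<^sub>R S (x (s - 1), x s, snd w s) \<partial>?P) /\<^sub>R (\<integral>x. lik r t (w, x) \<partial>?P)" for w
  have [measurable]: "lik r t \<in> borel_measurable ((borel \<Otimes>\<^sub>M Pi\<^sub>M UNIV (\<lambda>_. mu)) \<Otimes>\<^sub>M ?P)" by (rule lik_meas)
  have Sm: "(\<lambda>w. S (snd w (s - 1), snd w s, snd (fst w) s)) \<in> borel_measurable ((borel \<Otimes>\<^sub>M Pi\<^sub>M UNIV (\<lambda>_. mu)) \<Otimes>\<^sub>M ?P)"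
    using s by (intro S_path_meas) auto
  have 1: "(\<lambda>w. \<integral>x. lik r t (w, x) \<partial>?P) \<in> borel_measurable (borel \<Otimes>\<^sub>M Pi\<^sub>M UNIV (\<lambda>_. mu))"
    by measurable
  have "(\<lambda>w. lik r t w *\<^sub>R S (snd w (s - 1), snd w s, snd (fst w) s)) \<in> borel_measurable ((borel \<Otimes>\<^sub>M Pi\<^sub>M UNIV (\<lambda>_. mu)) \<Otimes>\<^sub>M ?P)"
    using Sm by measurable
  then have 2: "(\<lambda>w. \<integral>x. lik r t (w, x) *\<^sub>R S (x (s - 1), x s, snd w s) \<partial>?P) \<in> borel_measurable (borel \<Otimes>\<^sub>M Pi\<^sub>M UNIV (\<lambda>_. mu))"
    by (intro path.borel_measurable_lebesgue_integral) (simp add: split_beta')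
  show thesis
  proof (rule that[of Q])
    show "Q \<in> borel_measurable (borel \<Otimes>\<^sub>M Pi\<^sub>M UNIV (\<lambda>_. mu))"
      unfolding Q_def[abs_def] using 1 2 by measurable
    show "Phi lam m g chi r th s t S y = Q (th, y)" if "th \<in> Theta" for th y
    proof -
      have "path_lik m g th r t y = (\<lambda>x. lik r t ((th, y), x))" by (rule ext) (rule path_lik_eq[OF that])
      then show ?thesis unfolding Phi_def Q_def by simp
    qed
  qed
qed

lemma path_section_meas:
  assumes s: "r < s" "s \<le> t" and th: "th \<in> Theta"
  shows "path_lik m g th r t y \<in> borel_measurable (path_measure lam chi r t)"
    and "(\<lambda>x. S (x (s - 1), x s, y s)) \<in> borel_measurable (path_measure lam chi r t)"
proof -
  have yy: "(th, y) \<in> space (borel \<Otimes>\<^sub>M Pi\<^sub>M UNIV (\<lambda>_. mu))"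
    by (simp add: space_pair_measure space_PiM space_mu)
  have "path_lik m g th r t y = (\<lambda>x. lik r t ((th, y), x))" by (rule ext) (rule path_lik_eq[OF th])
  then show "path_lik m g th r t y \<in> borel_measurable (path_measure lam chi r t)"
    using measurable_compose[OF measurable_Pair1'[OF yy] lik_meas] by simp
  have "s - 1 \<in> {r..t}" "s \<in> {r..t}" using s by auto
  from measurable_compose[OF measurable_Pair1'[OF yy] S_path_meas[OF this, where N = borel and k = s]]
  show "(\<lambda>x. S (x (s - 1), x s, y s)) \<in> borel_measurable (path_measure lam chi r t)" by simp
qed

lemma path_g_AE:
  assumes th: "th \<in> Theta" and y: "good y"
  shows "AE x in path_measure lam chi r t. \<forall>i\<in>{r+1..t}. g th (x i) (y i) \<le> g_bound (y i)"
proof -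
  interpret product_sigma_finite "path_factor r" by (rule path_product_sigma_finite)
  have "AE x in path_measure lam chi r t. g th (x i) (y i) \<le> g_bound (y i)" if "i \<in> {r+1..t}" for i
    unfolding path_measure_def
    using that by (intro AE_PiM_component_finite) (auto intro!: g_AE th y)
  then show ?thesis by (intro AE_finite_allI) auto
qed

text \<open>If \<open>s - 1 = r\<close>, the first state has law \<open>chi\<close>, possibly
  singular to \<open>lam\<close>; an almost sure bound for pairs under \<open>lam\<close> says
  nothing there. Hence the case distinction in the assumption on \<open>V\<close>, here and
  below.\<close>

lemma path_S_AE:
  assumes s: "r < s" "s \<le> t"
    and V: "AE z in (if s - 1 = r then chi else lam) \<Otimes>\<^sub>M lam. norm (S (fst z, snd z, y s)) \<le> V"
  shows "AE x in path_measure lam chi r t. norm (S (x (s - 1), x s, y s)) \<le> V"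
proof -
  interpret product_sigma_finite "path_factor r" by (rule path_product_sigma_finite)
  have "AE x in Pi\<^sub>M {r..t} (path_factor r). norm (S (fst (x (s - 1), x s), snd (x (s - 1), x s), y s)) \<le> V"
    by (rule AE_PiM_pair_finite) (use s V in auto)
  then show ?thesis unfolding path_measure_def fst_conv snd_conv .
qed

lemma path_lik_bounds:
  assumes th: "th \<in> Theta" and x: "\<forall>i\<in>{r+1..t}. g th (x i) (y i) \<le> g_bound (y i)"
  shows "0 < path_lik m g th r t y x" "path_lik m g th r t y x \<le> (\<Prod>i\<in>{r..<t}. sp * g_bound (y (i + 1)))"
    and "path_lik m g th r t y x = (\<Prod>i\<in>{r..<t}. kern th y i (x i) (x (i + 1)))"
proof -
  have pos: "0 < m th u v" "0 < g th u v'" for u v v' using mg_pos[OF th] by auto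
  have x': "g th (x (i + 1)) (y (i + 1)) \<le> g_bound (y (i + 1))" if "i \<in> {r..<t}" for i
    using x that by auto
  show "0 < path_lik m g th r t y x" unfolding path_lik_def using pos by (intro prod_pos) auto
  show "path_lik m g th r t y x \<le> (\<Prod>i\<in>{r..<t}. sp * g_bound (y (i + 1)))"
    unfolding path_lik_def using pos x' mixing[OF th] sm
    by (intro prod_mono) (auto intro!: mult_mono mult_nonneg_nonneg simp: less_imp_le)
  show "path_lik m g th r t y x = (\<Prod>i\<in>{r..<t}. kern th y i (x i) (x (i + 1)))"
    unfolding path_lik_def kern_def weight_def using x' by (intro prod.cong) (auto simp: min_def)
qed

lemma path_integrable:
  assumes s: "r < s" "s \<le> t" and th: "th \<in> Theta" and y: "good y"
    and V: "AE z in (if s - 1 = r then chi else lam) \<Otimes>\<^sub>M lam. norm (S (fst z, snd z, y s)) \<le> V"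
  shows "integrable (path_measure lam chi r t) (\<lambda>x. path_lik m g th r t y x *\<^sub>R S (x (s - 1), x s, y s))"
proof (rule finite_measure.integrable_const_bound[OF path_finite, where B = "(\<Prod>i\<in>{r..<t}. sp * g_bound (y (i + 1))) * V"])
  show "AE x in path_measure lam chi r t. norm (path_lik m g th r t y x *\<^sub>R S (x (s - 1), x s, y s))
      \<le> (\<Prod>i\<in>{r..<t}. sp * g_bound (y (i + 1))) * V"
    using path_g_AE[OF th y, of r t] path_S_AE[where r = r and s = s and y = y, OF s V]
  proof eventually_elim
    case (elim x)
    show ?case using path_lik_bounds(1,2)[OF th elim(1)] elim(2)
      by (auto intro!: mult_mono)
  qed
  show "(\<lambda>x. path_lik m g th r t y x *\<^sub>R S (x (s - 1), x s, y s)) \<in> borel_measurable (path_measure lam chi r t)"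
    using path_section_meas[OF s th] by (intro borel_measurable_scaleR)
qed

text \<open>Almost everywhere on path space the truncations of \<open>g\<close> and \<open>S\<close>
  are invisible, so a scalar component of the smoothing functional is exactly a ratio of iterated
  bounded kernels, to which the forgetting bounds apply.\<close>

lemma Phi_inner:
  assumes th: "th \<in> Theta" and y: "good y"
    and V: "AE z in (if n = 0 then chi else lam) \<Otimes>\<^sub>M lam. norm (S (fst z, snd z, y s)) \<le> V" "0 \<le> V"
    and e: "norm e = 1"
  shows "Phi lam m g chi (s - 1 - int n) th s (s + int l) S y \<bullet> e = ratio th y (trunc V e (y s)) chi s n l"
proof -
  interpret mk: mixing_kernels lam "kern th y" "weight th y" sm sp by (rule mixing_kernels[OF th])
  let ?r = "s - 1 - int n" and ?t = "s + int l" and ?h = "trunc V e (y s)" and ?K = "kern th y"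
  let ?P = "path_measure lam chi ?r ?t"
  have st: "?r < s" "s \<le> ?t" by auto
  have tN: "?t = ?r + int (n + 1 + l)" by simp
  have V': "AE z in (if s - 1 = ?r then chi else lam) \<Otimes>\<^sub>M lam. norm (S (fst z, snd z, y s)) \<le> V"
  proof -
    have "(s - 1 = ?r) = (n = 0)" by auto
    then show ?thesis using V(1) by (simp only:)
  qed
  have chif: "finite_measure chi" using chi(1) by (rule prob_space.finite_measure)
  have den: "(\<integral>x. path_lik m g th ?r ?t y x \<partial>?P) = mk.den chi s n l"
  proof -
    have Kx: "(\<lambda>x. \<Prod>i\<in>{?r..<?t}. ?K i (x i) (x (i + 1))) \<in> borel_measurable ?P"
    proof (intro borel_measurable_prod)
      fix i assume i: "i \<in> {?r..<?t}"
      then have "(\<lambda>x. (x i, x (i + 1))) \<in> measurable ?P (lam \<Otimes>\<^sub>M lam)"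
        by (intro measurable_Pair path_component) auto
      from measurable_compose[OF this, of "\<lambda>(x, x'). ?K i x x'" borel] mk.kernel[of i]
      show "(\<lambda>x. ?K i (x i) (x (i + 1))) \<in> borel_measurable ?P" by (simp add: bounded_kernel_def)
    qed
    have "(\<integral>x. path_lik m g th ?r ?t y x \<partial>?P) = (\<integral>x. (\<Prod>i\<in>{?r..<?t}. ?K i (x i) (x (i + 1))) \<partial>?P)"
    proof (rule integral_cong_AE)
      show "AE x in ?P. path_lik m g th ?r ?t y x = (\<Prod>i\<in>{?r..<?t}. ?K i (x i) (x (i + 1)))"
        using path_g_AE[OF th y, of ?r ?t] by eventually_elim (rule path_lik_bounds(3)[OF th])
    qed (use Kx path_section_meas(1)[OF st th] in auto)
    also have "\<dots> = mk.den chi s n l"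
      using integral_path[OF chif chi(2), of ?K "\<lambda>_. 1" ?r "n + 1 + l"]
      unfolding tN mk.den_def by (simp add: mk.kernel bounded_fun_const)
    finally show ?thesis .
  qed
  \<comment> \<open>The test function is absorbed into the kernel leaving time \<open>s - 1\<close>;
    the numerator thus becomes an iterated kernel applied to 1, like the denominator.\<close>
  define L where "L i x x' = ?K i x x' * (if i = s - 1 then ?h x x' else 1)" for i x x'
  have L1: "L (s - 1) = (\<lambda>x x'. ?K (s - 1) x x' * ?h x x')" and L2: "\<And>i. i \<noteq> s - 1 \<Longrightarrow> L i = ?K i"
    by (simp_all add: L_def fun_eq_iff)
  have LK: "bounded_kernel (L i)" for i
    using mk.bounded_kernel_mult[OF trunc_meas trunc_le[OF e V(2)]] mk.kernel[of i]
    by (cases "i = s - 1") (auto simp: L1 L2)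
  have iterL: "iter L (n + 1 + l) ?r (\<lambda>_. 1) = iter ?K n ?r (mk.mid ?h s l)"
  proof -
    have "iter L (n + 1 + l) ?r (\<lambda>_. 1) = iter L n ?r (iter L 1 (s - 1) (iter L l s (\<lambda>_. 1)))"
      by (simp only: iter_add add.assoc) simp
    also have "iter L l s (\<lambda>_. 1) = iter ?K l s (\<lambda>_. 1)" by (rule iter_cong) (auto intro: L2)
    also have "iter L 1 (s - 1) (iter ?K l s (\<lambda>_. 1)) = mk.mid ?h s l" by (simp add: L1 mk.mid_def)
    also have "iter L n ?r (mk.mid ?h s l) = iter ?K n ?r (mk.mid ?h s l)" by (rule iter_cong) (auto intro: L2)
    finally show ?thesis .
  qed
  have prodL: "(\<Prod>i\<in>{?r..<?t}. L i (x i) (x (i + 1))) = (\<Prod>i\<in>{?r..<?t}. ?K i (x i) (x (i + 1))) * ?h (x (s - 1)) (x s)" for x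
  proof -
    have "(\<Prod>i\<in>{?r..<?t}. L i (x i) (x (i + 1)))
        = (\<Prod>i\<in>{?r..<?t}. ?K i (x i) (x (i + 1))) * (\<Prod>i\<in>{?r..<?t}. if i = s - 1 then ?h (x (s - 1)) (x s) else 1)"
      unfolding prod.distrib[symmetric] by (intro prod.cong) (auto simp: L_def)
    then show ?thesis by (simp add: prod.delta)
  qed
  have num: "(\<integral>x. path_lik m g th ?r ?t y x *\<^sub>R S (x (s - 1), x s, y s) \<partial>?P) \<bullet> e = mk.num ?h chi s n l"
  proof -
    have int: "integrable ?P (\<lambda>x. path_lik m g th ?r ?t y x *\<^sub>R S (x (s - 1), x s, y s))"
      by (rule path_integrable[where r = "?r" and s = s and y = y, OF st th y V'])
    have Lx: "(\<lambda>x. \<Prod>i\<in>{?r..<?t}. L i (x i) (x (i + 1))) \<in> borel_measurable ?P"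
    proof (intro borel_measurable_prod)
      fix i assume i: "i \<in> {?r..<?t}"
      then have "(\<lambda>x. (x i, x (i + 1))) \<in> measurable ?P (lam \<Otimes>\<^sub>M lam)"
        by (intro measurable_Pair path_component) auto
      from measurable_compose[OF this, of "\<lambda>(x, x'). L i x x'" borel] LK[of i]
      show "(\<lambda>x. L i (x i) (x (i + 1))) \<in> borel_measurable ?P" by (simp add: bounded_kernel_def)
    qed
    have "(\<integral>x. path_lik m g th ?r ?t y x *\<^sub>R S (x (s - 1), x s, y s) \<partial>?P) \<bullet> e
        = (\<integral>x. (path_lik m g th ?r ?t y x *\<^sub>R S (x (s - 1), x s, y s)) \<bullet> e \<partial>?P)"
      using int by (intro integral_inner_left[symmetric]) auto
    also have "\<dots> = (\<integral>x. (\<Prod>i\<in>{?r..<?t}. L i (x i) (x (i + 1))) \<partial>?P)"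
    proof (rule integral_cong_AE)
      show "AE x in ?P. (path_lik m g th ?r ?t y x *\<^sub>R S (x (s - 1), x s, y s)) \<bullet> e = (\<Prod>i\<in>{?r..<?t}. L i (x i) (x (i + 1)))"
        using path_g_AE[OF th y, of ?r ?t] path_S_AE[where r = "?r" and s = s and y = y, OF st V']
      proof eventually_elim
        case (elim x)
        show ?case unfolding prodL path_lik_bounds(3)[OF th elim(1)] using elim(2) by (simp add: trunc_def)
      qed
      show "(\<lambda>x. (path_lik m g th ?r ?t y x *\<^sub>R S (x (s - 1), x s, y s)) \<bullet> e) \<in> borel_measurable ?P"
        using borel_measurable_integrable[OF int] by (intro borel_measurable_inner) auto
    qed (rule Lx)
    also have "\<dots> = (\<integral>x. iter L (n + 1 + l) ?r (\<lambda>_. 1) x \<partial>chi)"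
      using integral_path[OF chif chi(2), of L "\<lambda>_. 1" ?r "n + 1 + l"]
      unfolding tN by (simp add: LK bounded_fun_const)
    also have "\<dots> = mk.num ?h chi s n l" unfolding iterL mk.num_def ..
    finally show ?thesis .
  qed
  show ?thesis unfolding Phi_def ratio_def den[symmetric] num[symmetric] by (simp add: divide_inverse mult.commute)
qed

lemma path_lik_integral_pos:
  assumes th: "th \<in> Theta" and y: "good y" and s: "r < s" "s \<le> t"
  shows "0 < (\<integral>x. path_lik m g th r t y x \<partial>path_measure lam chi r t)"
proof -
  let ?P = "path_measure lam chi r t"
  have int: "integrable ?P (path_lik m g th r t y)"
  proof (rule finite_measure.integrable_const_bound[OF path_finite])
    show "AE x in ?P. norm (path_lik m g th r t y x) \<le> (\<Prod>i\<in>{r..<t}. sp * g_bound (y (i + 1)))"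
      using path_g_AE[OF th y, of r t]
    proof eventually_elim
      case (elim x)
      then show ?case using path_lik_bounds(1,2)[OF th elim] by simp
    qed
  qed (rule path_section_meas(1)[OF s th])
  have pos: "0 < path_lik m g th r t y x" for x
    unfolding path_lik_def using mg_pos[OF th] by (intro prod_pos) auto
  interpret product_sigma_finite "path_factor r" by (rule path_product_sigma_finite)
  have "emeasure ?P (space ?P) = (\<Prod>i\<in>{r..t}. emeasure (path_factor r i) (space (path_factor r i)))"
    unfolding path_measure_def space_PiM by (rule emeasure_PiM) auto
  also have "\<dots> \<noteq> 0"
    using prob_space.emeasure_space_1[OF chi(1)] lam_pos space_lam by (auto simp: prod_zero_iff)
  finally have nz: "emeasure ?P (space ?P) \<noteq> 0" .
  have "(\<integral>x. path_lik m g th r t y x \<partial>?P) \<noteq> 0"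
  proof
    assume "(\<integral>x. path_lik m g th r t y x \<partial>?P) = 0"
    then have "AE x in ?P. path_lik m g th r t y x = 0"
      using integral_nonneg_eq_0_iff_AE[OF int] pos by (auto simp: less_imp_le)
    then have "AE x in ?P. False" by eventually_elim (metis pos less_irrefl)
    then show False using nz by (simp add: eventually_False ae_filter_eq_bot_iff)
  qed
  moreover have "0 \<le> (\<integral>x. path_lik m g th r t y x \<partial>?P)"
    using pos by (intro Bochner_Integration.integral_nonneg less_imp_le)
  ultimately show ?thesis by simp
qed

text \<open>Dominated convergence in numerator and denominator, with constants independent of the
  parameter. The condition \<open>r < s - 1\<close> keeps \<open>chi\<close> out of the
  envelope.\<close>

lemma Phi_continuous:
  assumes y: "good y" and s: "r < s - 1" "s \<le> t"
  shows "continuous_on Theta (\<lambda>th. Phi lam m g chi r th s t S y)"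
  unfolding continuous_on_sequentially
proof (intro allI ballI impI, elim conjE)
  fix u th assume th: "th \<in> Theta" and u: "\<forall>n::nat. u n \<in> Theta" and lim: "u \<longlonglongrightarrow> th"
  let ?P = "path_measure lam chi r t"
  have s': "r < s" using s by simp
  have V: "AE z in (if s - 1 = r then chi else lam) \<Otimes>\<^sub>M lam. norm (S (fst z, snd z, y s)) \<le> env (y s)"
    using good_AE[OF y] s by auto
  have limphi: "(\<lambda>n. phi (u n)) \<longlonglongrightarrow> phi th" and limpsi: "(\<lambda>n. psi (u n)) \<longlonglongrightarrow> psi th"
    using phi psi th u lim unfolding continuous_on_sequentially by (auto simp: o_def)
  have limlik: "(\<lambda>n. path_lik m g (u n) r t y x) \<longlonglongrightarrow> path_lik m g th r t y x" for x
    unfolding path_lik_def using u by (simp add: mg_eq th) (intro tendsto_intros limphi limpsi)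
  have fin: "integrable ?P (\<lambda>_. c)" for c :: real
    by (rule finite_measure.integrable_const[OF path_finite])
  have "(\<lambda>n. \<integral>x. path_lik m g (u n) r t y x *\<^sub>R S (x (s - 1), x s, y s) \<partial>?P)
      \<longlonglongrightarrow> (\<integral>x. path_lik m g th r t y x *\<^sub>R S (x (s - 1), x s, y s) \<partial>?P)"
  proof (rule integral_dominated_convergence[where w = "\<lambda>_. (\<Prod>i\<in>{r..<t}. sp * g_bound (y (i + 1))) * env (y s)"])
    show "AE x in ?P. norm (path_lik m g (u n) r t y x *\<^sub>R S (x (s - 1), x s, y s))
        \<le> (\<Prod>i\<in>{r..<t}. sp * g_bound (y (i + 1))) * env (y s)" for n
      using path_g_AE[OF u[rule_format, of n] y, of r t] path_S_AE[where r = r and s = s and y = y, OF s' s(2) V]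
    proof eventually_elim
      case (elim x)
      show ?case using path_lik_bounds(1,2)[OF u[rule_format] elim(1)] elim(2)
        by (auto intro!: mult_mono)
    qed
    show "AE x in ?P. (\<lambda>n. path_lik m g (u n) r t y x *\<^sub>R S (x (s - 1), x s, y s))
        \<longlonglongrightarrow> path_lik m g th r t y x *\<^sub>R S (x (s - 1), x s, y s)"
      by (intro AE_I2 tendsto_intros limlik)
    show "(\<lambda>x. path_lik m g th r t y x *\<^sub>R S (x (s - 1), x s, y s)) \<in> borel_measurable ?P"
      by (rule borel_measurable_integrable[OF path_integrable[where r = r and s = s and y = y, OF s' s(2) th y V]])
    show "(\<lambda>x. path_lik m g (u n) r t y x *\<^sub>R S (x (s - 1), x s, y s)) \<in> borel_measurable ?P" for n
      by (rule borel_measurable_integrable[OF path_integrable[where r = r and s = s and y = y, OF s' s(2) u[rule_format] y V]])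
  qed (rule fin)
  moreover have "(\<lambda>n. \<integral>x. path_lik m g (u n) r t y x \<partial>?P) \<longlonglongrightarrow> (\<integral>x. path_lik m g th r t y x \<partial>?P)"
  proof (rule integral_dominated_convergence[where w = "\<lambda>_. (\<Prod>i\<in>{r..<t}. sp * g_bound (y (i + 1)))"])
    show "AE x in ?P. norm (path_lik m g (u n) r t y x) \<le> (\<Prod>i\<in>{r..<t}. sp * g_bound (y (i + 1)))" for n
      using path_g_AE[OF u[rule_format, of n] y, of r t]
    proof eventually_elim
      case (elim x)
      show ?case using path_lik_bounds(1,2)[OF u[rule_format] elim] by simp
    qed
  qed (auto intro!: fin limlik path_section_meas(1)[OF s' s(2)] th u[rule_format])
  ultimately show "((\<lambda>th. Phi lam m g chi r th s t S y) \<circ> u) \<longlonglongrightarrow> Phi lam m g chi r th s t S y"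
    unfolding Phi_def o_def using path_lik_integral_pos[OF th y s' s(2)] by (intro tendsto_intros) auto
qed

end

section \<open>Forgetting for smoothing functionals and the stationary limit\<close>

lemma norm_le_inner:
  fixes x :: 'e
  assumes "\<And>e. norm e = 1 \<Longrightarrow> \<bar>x \<bullet> e\<bar> \<le> c" "0 \<le> c"
  shows "norm x \<le> c"
proof (cases "x = 0")
  case False
  have "x \<bullet> sgn x = norm x"
    using False by (simp add: sgn_div_norm power2_norm_eq_inner[symmetric] power2_eq_square)
  with assms(1)[of "sgn x"] False show ?thesis by (simp add: norm_sgn)
qed (use assms in simp)

definition rate :: real where "rate = 1 - sm / sp"

lemma rate_bounds: "0 \<le> rate" "rate < 1"
  using sm by (auto simp: rate_def)

lemma Phi_bound:
  assumes chi: "prob_space chi" "sets chi = sets lam" and th: "th \<in> Theta" and y: "good y"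
    and V: "AE z in (if n = 0 then chi else lam) \<Otimes>\<^sub>M lam. norm (S (fst z, snd z, y s)) \<le> V" "0 \<le> V"
  shows "norm (Phi lam m g chi (s - 1 - int n) th s (s + int l) S y) \<le> V"
proof (rule norm_le_inner[OF _ V(2)])
  fix e :: 'e assume e: "norm e = 1"
  show "\<bar>Phi lam m g chi (s - 1 - int n) th s (s + int l) S y \<bullet> e\<bar> \<le> V"
    unfolding Phi_inner[OF chi th y V e] ratio_def
    by (rule mixing_kernels.ratio_bound[OF mixing_kernels[OF th] trunc_meas trunc_le[OF e V(2)] chi])
qed

lemma Phi_forget:
  assumes chi: "prob_space chi" "sets chi = sets lam" "prob_space chi'" "sets chi' = sets lam"
    and th: "th \<in> Theta" and y: "good y" and nn: "n \<le> n'" "l \<le> l'"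
    and V: "AE z in (if n = 0 then chi else lam) \<Otimes>\<^sub>M lam. norm (S (fst z, snd z, y s)) \<le> V"
      "AE z in (if n' = 0 then chi' else lam) \<Otimes>\<^sub>M lam. norm (S (fst z, snd z, y s)) \<le> V" "0 \<le> V"
  shows "norm (Phi lam m g chi (s - 1 - int n) th s (s + int l) S y
      - Phi lam m g chi' (s - 1 - int n') th s (s + int l') S y) \<le> V * (2 * rate ^ n + sp / sm * rate ^ l)"
proof (rule norm_le_inner)
  show "0 \<le> V * (2 * rate ^ n + sp / sm * rate ^ l)"
    using V(3) rate_bounds sm by (intro mult_nonneg_nonneg add_nonneg_nonneg) auto
  fix e :: 'e assume e: "norm e = 1"
  have "mixing_kernels.rate sm sp = rate"
    using mixing_kernels.rate_def[OF mixing_kernels[OF th]] by (simp add: rate_def)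
  then show "\<bar>(Phi lam m g chi (s - 1 - int n) th s (s + int l) S y
      - Phi lam m g chi' (s - 1 - int n') th s (s + int l') S y) \<bullet> e\<bar> \<le> V * (2 * rate ^ n + sp / sm * rate ^ l)"
    unfolding inner_diff_left Phi_inner[OF chi(1,2) th y V(1,3) e] Phi_inner[OF chi(3,4) th y V(2,3) e] ratio_def
    using mixing_kernels.forget[OF mixing_kernels[OF th] trunc_meas trunc_le[OF e V(3)] chi nn] by simp
qed

lemma good_shift: "good y \<Longrightarrow> good (\<lambda>i. y (i + j))"
  by (simp add: good_def)

text \<open>Both sides are compared through inner products, where they are iterated kernels with
  shifted index; this replaces a change of variables between products over different time
  intervals.\<close>

lemma Phi_shift:
  assumes chi: "prob_space chi" "sets chi = sets lam" and th: "th \<in> Theta" and y: "good y" and n: "n \<noteq> 0"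
  shows "Phi lam m g chi (s - 1 - int n) th s (s + int l) S (\<lambda>i. y (i + j))
    = Phi lam m g chi (s + j - 1 - int n) th (s + j) (s + j + int l) S y" (is "?A = ?B")
proof -
  have V: "AE z in (if n = 0 then chi else lam) \<Otimes>\<^sub>M lam. norm (S (fst z, snd z, y (s + j))) \<le> env (y (s + j))"
    using good_AE[OF y] n by simp
  let ?y = "\<lambda>i. y (i + j)"
  have K: "kern th ?y = (\<lambda>i. kern th y (i + j))"
    by (intro ext) (simp add: kern_def weight_def add_ac)
  note mk = mixing_kernels[OF th]
  have "norm (?A - ?B) \<le> 0"
  proof (rule norm_le_inner)
    fix e :: 'e assume e: "norm e = 1"
    have "ratio th ?y (trunc (env (y (s + j))) e (?y s)) chi s n l
        = ratio th y (trunc (env (y (s + j))) e (y (s + j))) chi (s + j) n l"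
    proof -
      have num: "mixing_kernels.num lam (kern th ?y) h chi s n l = mixing_kernels.num lam (kern th y) h chi (s + j) n l" for h
        unfolding mixing_kernels.num_def[OF mk] mixing_kernels.mid_def[OF mk] unfolding K iter_shift
        by (simp add: algebra_simps)
      have den: "mixing_kernels.den lam (kern th ?y) chi s n l = mixing_kernels.den lam (kern th y) chi (s + j) n l"
        unfolding mixing_kernels.den_def[OF mk] unfolding K iter_shift by (simp add: algebra_simps)
      show ?thesis unfolding ratio_def num den ..
    qed
    then show "\<bar>(?A - ?B) \<bullet> e\<bar> \<le> 0"
      unfolding inner_diff_left Phi_inner[OF chi th good_shift[OF y] V env_nonneg e] Phi_inner[OF chi th y V env_nonneg e]
      by simp
  qed simp
  then show ?thesis by simp
qed

lemma Phi_cong: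
  assumes "r < s" "s \<le> t" "\<And>i. i \<in> {r + 1..t} \<Longrightarrow> y i = y' i"
  shows "Phi lam m g chi r th s t S y = Phi lam m g chi r th s t S y'"
proof -
  have "path_lik m g th r t y = path_lik m g th r t y'"
    unfolding path_lik_def using assms by (intro ext prod.cong) auto
  moreover have "y s = y' s" using assms by auto
  ultimately show ?thesis unfolding Phi_def by simp
qed

text \<open>A reference initial law for the windows below; by forgetting, the limit does not depend
  on it.\<close>

definition lam0 :: "'x measure" where "lam0 = uniform_measure lam UNIV"

lemma lam0: "prob_space lam0" "sets lam0 = sets lam"
proof -
  show "prob_space lam0" unfolding lam0_def
    using lam_pos emeasure_finite by (intro prob_space_uniform_measure) auto
qed (simp add: lam0_def)

text \<open>It depends on the observations \<open>s - k\<close> to \<open>s + k\<close> only. The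
  windows define the limit, approximate it locally for mixing, and carry its continuity in the
  parameter.\<close>

definition window :: "nat \<Rightarrow> 'p \<Rightarrow> int \<Rightarrow> (int \<Rightarrow> 'y) \<Rightarrow> 'e" where
  "window k th s y = Phi lam m g lam0 (s - 1 - int k) th s (s + int k) S y"

definition Slim :: "'p \<Rightarrow> (int \<Rightarrow> 'y) \<Rightarrow> 'e" where
  "Slim th y = lim (\<lambda>k. window k th 0 y)"

lemma window_shift: "th \<in> Theta \<Longrightarrow> good y \<Longrightarrow> k \<noteq> 0 \<Longrightarrow> window k th 0 (\<lambda>i. y (i + s)) = window k th s y"
  unfolding window_def using Phi_shift[OF lam0, of th y k 0 k s] by simp

lemma window_bound: "th \<in> Theta \<Longrightarrow> good y \<Longrightarrow> k \<noteq> 0 \<Longrightarrow> norm (window k th s y) \<le> env (y s)"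
  unfolding window_def using good_AE[of y s] env_nonneg by (intro Phi_bound lam0) auto

lemma window_LIMSEQ:
  assumes th: "th \<in> Theta" and y: "good y"
  shows "(\<lambda>k. window k th 0 y) \<longlonglongrightarrow> Slim th y"
proof -
  let ?c = "env (y 0) * (2 + sp / sm)"
  have c: "0 \<le> ?c" using env_nonneg sm by (intro mult_nonneg_nonneg) auto
  have le: "norm (window k th 0 y - window k' th 0 y) \<le> ?c * rate ^ k" if "1 \<le> k" "k \<le> k'" for k k'
  proof -
    have "norm (window k th 0 y - window k' th 0 y) \<le> env (y 0) * (2 * rate ^ k + sp / sm * rate ^ k)"
      unfolding window_def using that good_AE[OF y, of 0] env_nonneg by (intro Phi_forget lam0 th y) auto
    also have "\<dots> = ?c * rate ^ k" by (simp add: algebra_simps)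
    finally show ?thesis .
  qed
  have "(\<lambda>k. ?c * rate ^ k) \<longlonglongrightarrow> 0"
    using tendsto_mult_right_zero[OF LIMSEQ_power_zero[of rate], of ?c] rate_bounds by simp
  have "Cauchy (\<lambda>k. window k th 0 y)"
  proof (rule CauchyI')
    fix d :: real assume "0 < d"
    then have "\<forall>\<^sub>F k in sequentially. ?c * rate ^ k < d"
      using \<open>(\<lambda>k. ?c * rate ^ k) \<longlonglongrightarrow> 0\<close> by (rule order_tendstoD[rotated])
    then obtain N where N: "\<And>k. N \<le> k \<Longrightarrow> ?c * rate ^ k < d" unfolding eventually_sequentially by blast
    show "\<exists>M. \<forall>k\<ge>M. \<forall>k'>k. dist (window k th 0 y) (window k' th 0 y) < d"
    proof (intro exI[of _ "max N 1"] allI impI)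
      fix k k' assume "max N 1 \<le> k" "k < k'"
      then show "dist (window k th 0 y) (window k' th 0 y) < d" using le[of k k'] N[of k] by (auto simp: dist_norm)
    qed
  qed
  then show ?thesis unfolding Slim_def by (simp add: Cauchy_convergent_iff convergent_LIMSEQ_iff)
qed

lemma Phi_Slim:
  assumes chi: "prob_space chi" "sets chi = sets lam" and th: "th \<in> Theta" and y: "good y"
    and V: "AE z in (if n = 0 then chi else lam) \<Otimes>\<^sub>M lam. norm (S (fst z, snd z, y s)) \<le> V" "env (y s) \<le> V"
  shows "norm (Phi lam m g chi (s - 1 - int n) th s (s + int l) S y - Slim th (\<lambda>i. y (i + s)))
    \<le> V * (2 * rate ^ n + sp / sm * rate ^ l)"
proof (rule tendsto_upperbound)
  show "(\<lambda>k. norm (Phi lam m g chi (s - 1 - int n) th s (s + int l) S y - window k th 0 (\<lambda>i. y (i + s))))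
    \<longlonglongrightarrow> norm (Phi lam m g chi (s - 1 - int n) th s (s + int l) S y - Slim th (\<lambda>i. y (i + s)))"
    by (intro tendsto_intros window_LIMSEQ th good_shift y)
  have V0: "0 \<le> V" using V(2) env_nonneg[of "y s"] by linarith
  show "\<forall>\<^sub>F k in sequentially. norm (Phi lam m g chi (s - 1 - int n) th s (s + int l) S y - window k th 0 (\<lambda>i. y (i + s)))
      \<le> V * (2 * rate ^ n + sp / sm * rate ^ l)"
    using eventually_ge_at_top[of "n + l + 1"]
  proof eventually_elim
    case (elim k)
    have AE: "AE z in lam \<Otimes>\<^sub>M lam. norm (S (fst z, snd z, y s)) \<le> V"
      using good_AE[OF y, of s] by eventually_elim (use V(2) in linarith)
    have "norm (Phi lam m g chi (s - 1 - int n) th s (s + int l) S y - window k th s y)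
        \<le> V * (2 * rate ^ n + sp / sm * rate ^ l)"
      unfolding window_def using elim AE by (intro Phi_forget chi lam0 th y V0 V(1)) auto
    then show ?case using elim by (simp only: window_shift[OF th y])
  qed
qed simp

lemma Slim_bound: "th \<in> Theta \<Longrightarrow> good y \<Longrightarrow> norm (Slim th y) \<le> env (y 0)"
  by (rule tendsto_upperbound[OF tendsto_norm[OF window_LIMSEQ]])
    (auto intro!: eventually_mono[OF eventually_ge_at_top[of 1]] window_bound)

lemma Slim_measurable:
  assumes th: "th \<in> Theta"
  shows "Slim th \<in> borel_measurable (Pi\<^sub>M UNIV (\<lambda>_. mu))"
  unfolding Slim_def[abs_def]
proof (rule borel_measurable_lim_metric)
  fix k
  have "(0::int) - 1 - int k < 0" "(0::int) \<le> 0 + int k" by auto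
  from Phi_meas[OF lam0 this] obtain Q where Q: "Q \<in> borel_measurable (borel \<Otimes>\<^sub>M Pi\<^sub>M UNIV (\<lambda>_. mu))"
    "\<And>th y. th \<in> Theta \<Longrightarrow> window k th 0 y = Q (th, y)" unfolding window_def by metis
  have "(\<lambda>y. Q (th, y)) \<in> borel_measurable (Pi\<^sub>M UNIV (\<lambda>_. mu))"
    by (rule measurable_compose[OF measurable_Pair1' Q(1)]) simp
  then show "(\<lambda>y. window k th 0 y) \<in> borel_measurable (Pi\<^sub>M UNIV (\<lambda>_. mu))" by (simp add: Q(2)[OF th])
qed

lemma window_continuous: "good y \<Longrightarrow> k \<noteq> 0 \<Longrightarrow> continuous_on Theta (\<lambda>th. window k th s y)"
  unfolding window_def by (rule Phi_continuous[OF lam0]) auto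

lemma Slim_continuous:
  assumes y: "good y"
  shows "continuous_on Theta (\<lambda>th. Slim th y)"
proof (rule uniform_limit_theorem)
  show "\<forall>\<^sub>F k in sequentially. continuous_on Theta (\<lambda>th. window k th 0 y)"
    using eventually_ge_at_top[of 1] by eventually_elim (auto intro: window_continuous y)
  have lim: "(\<lambda>k. env (y 0) * (2 * rate ^ k + sp / sm * rate ^ k)) \<longlonglongrightarrow> env (y 0) * (2 * 0 + sp / sm * 0)"
    using rate_bounds by (intro tendsto_intros LIMSEQ_power_zero) auto
  show "uniform_limit Theta (\<lambda>k th. window k th 0 y) (\<lambda>th. Slim th y) sequentially"
    unfolding uniform_limit_iff
  proof (intro allI impI)
    fix d :: real assume "0 < d"
    then have "\<forall>\<^sub>F k in sequentially. env (y 0) * (2 * rate ^ k + sp / sm * rate ^ k) < d"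
      using lim by (intro order_tendstoD[OF lim]) auto
    then show "\<forall>\<^sub>F k in sequentially. \<forall>th\<in>Theta. dist (window k th 0 y) (Slim th y) < d"
      using eventually_ge_at_top[of 1]
    proof eventually_elim
      case (elim k)
      show ?case
      proof
        fix th assume th: "th \<in> Theta"
        have "norm (window k th 0 y - Slim th (\<lambda>i. y (i + 0))) \<le> env (y 0) * (2 * rate ^ k + sp / sm * rate ^ k)"
          unfolding window_def using elim good_AE[OF y, of 0] by (intro Phi_Slim lam0 th y) auto
        with elim show "dist (window k th 0 y) (Slim th y) < d" by (simp add: dist_norm)
      qed
    qed
  qed
qed simp

end

section \<open>Decoupling a parameter from the future of the observations\<close>

text \<open>Dynkin's argument; the whole space in \<open>G\<close> makes the total masses agree,
  which handles complements.\<close>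

lemma finite_measures_agree:
  assumes fin: "finite_measure N" "finite_measure N'" and sets: "sets N' = sets N"
    and G: "Int_stable G" "G \<subseteq> sets N" "space N \<in> G" and eq: "\<And>A. A \<in> G \<Longrightarrow> measure N A = measure N' A"
    and A: "A \<in> sigma_sets (space N) G"
  shows "measure N A = measure N' A"
proof -
  interpret N: finite_measure N by fact
  interpret N': finite_measure N' by fact
  have sp: "space N' = space N" by (rule sets_eq_imp_space_eq[OF sets])
  have sub: "sigma_sets (space N) G \<subseteq> sets N" by (rule sets.sigma_sets_subset[OF G(2)])
  have "G \<subseteq> Pow (space N)" using G(2) sets.sets_into_space by blast
  from G(1) this A show ?thesis
  proof (induction rule: sigma_sets_induct_disjoint)
    case (basic A) then show ?case by (rule eq)
  next
    case empty show ?case by simp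
  next
    case (compl A)
    then have "A \<in> sets N" using sub by auto
    with compl eq[OF G(3)] show ?case
      using N.finite_measure_compl[of A] N'.finite_measure_compl[of A] by (simp add: sets sp)
  next
    case (union A)
    have "range A \<subseteq> sets N" using union(2) sub by auto
    then have "(\<lambda>i. measure N (A i)) sums measure N (\<Union>i. A i)" "(\<lambda>i. measure N' (A i)) sums measure N' (\<Union>i. A i)"
      using union(1) by (auto intro!: N.finite_measure_UNION N'.finite_measure_UNION simp: sets)
    then show ?case using union(3) sums_unique2 by auto
  qed
qed

section \<open>Mixing in the presence of independent simulation variables\<close>

context prob_space
begin

lemma measure_density_bounded:
  assumes f: "f \<in> borel_measurable M" "\<And>w. 0 \<le> f w" "\<And>w. f w \<le> (1::real)"
  shows "finite_measure (density M (\<lambda>w. ennreal (f w)))"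
    and "A \<in> sets M \<Longrightarrow> measure (density M (\<lambda>w. ennreal (f w))) A = expectation (\<lambda>w. indicator A w * f w)"
proof -
  have em: "emeasure (density M (\<lambda>w. ennreal (f w))) A = ennreal (expectation (\<lambda>w. indicator A w * f w))"
    if A: "A \<in> sets M" for A
  proof -
    have int: "integrable M (\<lambda>w. indicator A w * f w)"
      by (rule integrable_const_bound[of _ 1]) (use f A in \<open>auto simp: indicator_def\<close>)
    have "emeasure (density M (\<lambda>w. ennreal (f w))) A = (\<integral>\<^sup>+ w. ennreal (indicator A w * f w) \<partial>M)"
      using f(1) A by (subst emeasure_density) (auto intro!: nn_integral_cong simp: indicator_def)
    also have "\<dots> = ennreal (expectation (\<lambda>w. indicator A w * f w))"
      using f by (intro nn_integral_eq_integral int) auto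
    finally show ?thesis .
  qed
  show "finite_measure (density M (\<lambda>w. ennreal (f w)))"
    by (rule finite_measureI) (simp add: em)
  show "measure (density M (\<lambda>w. ennreal (f w))) A = expectation (\<lambda>w. indicator A w * f w)" if "A \<in> sets M"
    using em[OF that] f by (simp add: measure_def Bochner_Integration.integral_nonneg)
qed

text \<open>Independence passes from events to bounded functions by the layer bound with error
  zero.\<close>

lemma independent_product:
  assumes N: "subalgebra M N" and A: "A \<in> sets M" and ind: "\<And>C. C \<in> sets N \<Longrightarrow> prob (A \<inter> C) = prob A * prob C"
    and b: "b \<in> borel_measurable N" "\<And>w. 0 \<le> b w" "\<And>w. b w \<le> (1::real)"
  shows "expectation (\<lambda>w. indicator A w * b w) = prob A * expectation b"
proof -
  have [measurable]: "b \<in> borel_measurable M" using measurable_from_subalg[OF N b(1)] .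
  have ib: "integrable M b" by (rule integrable_const_bound[of _ 1]) (use b in auto)
  have iAb: "integrable M (\<lambda>w. indicator A w * b w)"
    by (rule integrable_const_bound[of _ 1]) (use b A in \<open>auto simp: indicator_def\<close>)
  have *: "(\<integral>w. c * (indicator A w - prob A) * b w \<partial>M) \<le> 0" if c: "c = 1 \<or> c = - 1" for c :: real
  proof (rule layer_bound[OF N _ _ b])
    show "integrable M (\<lambda>w. c * (indicator A w - prob A))" using A by (auto simp: emeasure_eq_measure)
    show "\<bar>c * (indicator A w - prob A)\<bar> \<le> 1" for w
      using c prob_le_1[of A] measure_nonneg[of M A] by (auto simp: indicator_def abs_mult)
    fix C assume C: "C \<in> sets N"
    then have CM: "C \<in> sets M" using N by (auto simp: subalgebra_def)
    have "(\<integral>w. c * (indicator A w - prob A) * indicator C w \<partial>M)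
        = (\<integral>w. c * (indicator (A \<inter> C) w - prob A * indicator C w) \<partial>M)"
      by (intro Bochner_Integration.integral_cong) (auto simp: indicator_def)
    also have "\<dots> = c * (prob (A \<inter> C) - prob A * prob C)" using A CM by (simp add: emeasure_eq_measure)
    finally show "(\<integral>w. c * (indicator A w - prob A) * indicator C w \<partial>M) \<le> 0" using ind[OF C] by simp
  qed
  have E: "(\<integral>w. c * (indicator A w - prob A) * b w \<partial>M) = c * (expectation (\<lambda>w. indicator A w * b w) - prob A * expectation b)" for c
    using ib iAb by (simp add: mult.assoc left_diff_distrib)
  show ?thesis using *[of 1, unfolded E] *[of "- 1", unfolded E] by simp
qed

text \<open>Adding to the past a sigma-algebra independent of all observations does not change the
  conditional probability of \<open>B\<close>: the set functions A -> E[1_A P(B | F)] and A -> P(A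
  and B) agree on intersections of an event of \<open>F\<close> with one of \<open>H\<close>, hence
  on the joint sigma-algebra. The error keeps the indicator of \<open>A\<close>, so errors over
  disjoint events can be summed.\<close>

lemma conditional_mixing:
  assumes F: "subalgebra M F" and H: "subalgebra M H" and N: "subalgebra M N" and FN: "sets F \<subseteq> sets N" and B: "B \<in> sets N"
    and ind: "\<And>A C. A \<in> sets H \<Longrightarrow> C \<in> sets N \<Longrightarrow> prob (A \<inter> C) = prob A * prob C"
    and z: "integrable M z" "AE w in M. \<bar>real_cond_exp M F (indicator B) w - prob B\<bar> \<le> z w"
    and A: "A \<in> sigma_sets (space M) (sets F \<union> sets H)"
  shows "\<bar>prob (A \<inter> B) - prob A * prob B\<bar> \<le> expectation (\<lambda>w. indicator A w * z w)"
proof -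
  interpret FS: finite_measure_subalgebra M F by unfold_locales (rule F)
  \<comment> \<open>A version of the conditional probability with values in [0, 1] at every point,
    so that it can be a density and enter the layer argument.\<close>
  define b where "b w = min 1 (max 0 (real_cond_exp M F (indicator B) w))" for w
  have BM: "B \<in> sets M" using B N by (auto simp: subalgebra_def)
  have iB: "integrable M (indicator B :: _ \<Rightarrow> real)" using BM by (simp add: emeasure_eq_measure)
  have ceF: "real_cond_exp M F (indicator B) \<in> borel_measurable F" by (rule borel_measurable_cond_exp)
  have bF: "b \<in> borel_measurable F" unfolding b_def[abs_def] using ceF by measurable
  have b01: "0 \<le> b w" "b w \<le> 1" for w by (auto simp: b_def)
  have bM [measurable]: "b \<in> borel_measurable M" by (rule measurable_from_subalg[OF F bF])
  have be: "AE w in M. b w = real_cond_exp M F (indicator B) w"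
    using FS.real_cond_exp_ge_c[OF iB, of 0] FS.real_cond_exp_le_c[OF iB, of 1]
    by (auto simp: b_def indicator_def min_def max_def)
  define \<nu> where "\<nu> = density M (\<lambda>w. ennreal (b w))"
  define \<nu>' where "\<nu>' = density M (\<lambda>w. ennreal (indicator B w))"
  have fin: "finite_measure \<nu>" "finite_measure \<nu>'"
    unfolding \<nu>_def \<nu>'_def using b01 BM by (auto intro!: measure_density_bounded)
  have m\<nu>: "measure \<nu> A = expectation (\<lambda>w. indicator A w * b w)" if "A \<in> sets M" for A
    unfolding \<nu>_def using that b01 by (intro measure_density_bounded) auto
  have m\<nu>': "measure \<nu>' A = prob (A \<inter> B)" if A: "A \<in> sets M" for A
  proof -
    have "measure \<nu>' A = expectation (\<lambda>w. indicator A w * indicator B w)"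
      unfolding \<nu>'_def using A BM by (intro measure_density_bounded) auto
    also have "\<dots> = expectation (indicator (A \<inter> B))" by (simp add: indicator_inter_arith[symmetric])
    also have "\<dots> = prob (A \<inter> B)" using sets.Int[OF A BM] by simp
    finally show ?thesis .
  qed
  define GG where "GG = {A1 \<inter> A2 | A1 A2. A1 \<in> sets F \<and> A2 \<in> sets H}"
  have spF: "space M \<in> sets F" "space M \<in> sets H"
    using F H sets.top[of F] sets.top[of H] by (auto simp: subalgebra_def)
  have FM: "sets F \<subseteq> sets M" "sets H \<subseteq> sets M" using F H by (auto simp: subalgebra_def)
  have stable: "Int_stable GG" unfolding Int_stable_def GG_def
  proof (intro ballI, clarify)
    fix A1 A2 A1' A2' assume *: "A1 \<in> sets F" "A2 \<in> sets H" "A1' \<in> sets F" "A2' \<in> sets H"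
    show "\<exists>B1 B2. A1 \<inter> A2 \<inter> (A1' \<inter> A2') = B1 \<inter> B2 \<and> B1 \<in> sets F \<and> B2 \<in> sets H"
      by (rule exI[of _ "A1 \<inter> A1'"], rule exI[of _ "A2 \<inter> A2'"]) (use * in auto)
  qed
  have subGG: "sets F \<union> sets H \<subseteq> GG"
  proof
    fix A assume "A \<in> sets F \<union> sets H"
    then show "A \<in> GG"
    proof
      assume A: "A \<in> sets F"
      then have "A = A \<inter> space M" using FM sets.sets_into_space by blast
      then show ?thesis unfolding GG_def using A spF by blast
    next
      assume A: "A \<in> sets H"
      then have "A = space M \<inter> A" using FM sets.sets_into_space by blast
      then show ?thesis unfolding GG_def using A spF by blast
    qed
  qed
  have GM: "GG \<subseteq> sets M" unfolding GG_def using FM by auto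
  have AS: "A \<in> sigma_sets (space \<nu>) GG"
    using A sigma_sets_mono'[OF subGG, of "space M"] by (auto simp: \<nu>_def)
  have AM: "A \<in> sets M"
    using A sets.sigma_sets_subset[of "sets F \<union> sets H" M] FM by auto
  have "measure \<nu> A = measure \<nu>' A"
  proof (rule finite_measures_agree[OF fin _ stable _ _ _ AS])
    show "sets \<nu>' = sets \<nu>" by (simp add: \<nu>_def \<nu>'_def)
    show "GG \<subseteq> sets \<nu>" using GM by (simp add: \<nu>_def)
    have "space M = space M \<inter> space M" by simp
    then show "space \<nu> \<in> GG" unfolding GG_def \<nu>_def space_density using spF by blast
    fix A assume "A \<in> GG"
    then obtain A1 A2 where A12: "A = A1 \<inter> A2" "A1 \<in> sets F" "A2 \<in> sets H" unfolding GG_def by blast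
    have A12M: "A1 \<in> sets M" "A2 \<in> sets M" "A \<in> sets M" using A12 FM by auto
    have bN: "(\<lambda>w. indicator A1 w * b w) \<in> borel_measurable N"
    proof -
      have "subalgebra N F" using F N FN by (auto simp: subalgebra_def)
      moreover have "(\<lambda>w. indicator A1 w * b w) \<in> borel_measurable F" using bF A12(2) by measurable
      ultimately show ?thesis by (rule measurable_from_subalg)
    qed
    have "measure \<nu> A = expectation (\<lambda>w. indicator A w * b w)" by (rule m\<nu>[OF A12M(3)])
    also have "\<dots> = expectation (\<lambda>w. indicator A2 w * (indicator A1 w * b w))"
      by (intro Bochner_Integration.integral_cong) (auto simp: indicator_def A12(1))
    also have "\<dots> = prob A2 * expectation (\<lambda>w. indicator A1 w * b w)"
      using b01 by (intro independent_product[OF N A12M(2) ind[OF A12(3)] bN]) (auto simp: indicator_def)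
    also have "expectation (\<lambda>w. indicator A1 w * b w) = expectation (\<lambda>w. indicator A1 w * real_cond_exp M F (indicator B) w)"
      using be A12M(1) by (intro integral_cong_AE) auto
    also have "\<dots> = expectation (\<lambda>w. indicator A1 w * indicator B w)"
    proof (rule FS.real_cond_exp_intg(2))
      show "integrable M (\<lambda>w. indicator A1 w * (indicator B w :: real))"
        by (rule integrable_const_bound[of _ 1]) (use A12M BM in \<open>auto simp: indicator_def\<close>)
    qed (use A12 BM in auto)
    also have "\<dots> = expectation (indicator (A1 \<inter> B))" by (simp add: indicator_inter_arith[symmetric])
    also have "\<dots> = prob (A1 \<inter> B)" using sets.Int[OF A12M(1) BM] by simp
    also have "prob A2 * prob (A1 \<inter> B) = prob (A2 \<inter> (A1 \<inter> B))"
      using ind[OF A12(3), of "A1 \<inter> B"] A12(2) B FN by auto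
    also have "A2 \<inter> (A1 \<inter> B) = A \<inter> B" using A12 by auto
    also have "prob (A \<inter> B) = measure \<nu>' A" by (rule m\<nu>'[OF A12M(3), symmetric])
    finally show "measure \<nu> A = measure \<nu>' A" .
  qed
  then have eq: "prob (A \<inter> B) = expectation (\<lambda>w. indicator A w * b w)" using m\<nu>[OF AM] m\<nu>'[OF AM] by simp
  have ib: "integrable M (\<lambda>w. indicator A w * b w)"
    by (rule integrable_const_bound[of _ 1]) (use b01 AM in \<open>auto simp: indicator_def\<close>)
  have iA: "integrable M (\<lambda>w. indicator A w * prob B)" using AM by (auto simp: emeasure_eq_measure)
  have iz: "integrable M (\<lambda>w. indicator A w * z w)" using integrable_real_mult_indicator[OF AM z(1)] by (simp add: mult.commute)
  have pA: "expectation (\<lambda>w. indicator A w * prob B) = prob A * prob B" using AM by simp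
  have "\<bar>prob (A \<inter> B) - prob A * prob B\<bar> = \<bar>expectation (\<lambda>w. indicator A w * b w - indicator A w * prob B)\<bar>"
    by (simp only: Bochner_Integration.integral_diff[OF ib iA] pA eq)
  also have "\<dots> \<le> expectation (\<lambda>w. \<bar>indicator A w * b w - indicator A w * prob B\<bar>)" by (rule integral_abs_bound)
  also have "\<dots> \<le> expectation (\<lambda>w. indicator A w * z w)"
  proof (rule integral_mono_AE)
    show "AE w in M. \<bar>indicator A w * b w - indicator A w * prob B\<bar> \<le> indicator A w * z w"
      using be z(2) by eventually_elim (auto simp: indicator_def)
  qed (use ib iA iz in auto)
  finally show ?thesis .
qed

text \<open>On the event where the discretised parameter takes a given value, mixing applies to a fixed
  function of the future; the errors add up to at most \<open>E z\<close> because these events are disjoint.\<close>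

lemma decouple:
  fixes Theta :: "'p::euclidean_space set" and f :: "'p \<Rightarrow> 'a \<Rightarrow> real"
  assumes Theta: "compact Theta" and th: "th \<in> borel_measurable D" "\<And>w. w \<in> space M \<Longrightarrow> th w \<in> Theta"
    and D: "subalgebra M D" and G: "subalgebra M G"
    and z: "integrable M z" "\<And>w. 0 \<le> z w"
    and mix: "\<And>A B. A \<in> sets D \<Longrightarrow> B \<in> sets G \<Longrightarrow> \<bar>prob (A \<inter> B) - prob A * prob B\<bar> \<le> expectation (\<lambda>w. indicator A w * z w)"
    and f: "\<And>t. t \<in> Theta \<Longrightarrow> f t \<in> borel_measurable G" "\<And>t w. 0 \<le> f t w" "\<And>t w. f t w \<le> 1"
    and cont: "AE w in M. continuous_on Theta (\<lambda>t. f t w)"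
    and fth: "(\<lambda>w. f (th w) w) \<in> borel_measurable M"
    and b: "\<And>t. t \<in> Theta \<Longrightarrow> expectation (f t) \<le> b" "0 \<le> b"
  shows "expectation (\<lambda>w. f (th w) w) \<le> b + expectation z"
proof -
  have "\<exists>T. finite T \<and> T \<subseteq> Theta \<and> Theta \<subseteq> (\<Union>t\<in>T. ball t (1 / real (Suc N)))" for N
  proof -
    have "Theta \<subseteq> (\<Union>t\<in>Theta. ball t (1 / real (Suc N)))" by auto
    from compactE_image[OF Theta _ this] show ?thesis by (metis open_ball)
  qed
  then obtain T where T: "\<And>N. finite (T N)" "\<And>N. T N \<subseteq> Theta" "\<And>N. Theta \<subseteq> (\<Union>t\<in>T N. ball t (1 / real (Suc N)))"
    by metis
  have "\<exists>xs. set xs = T N \<and> distinct xs" for N using finite_distinct_list[OF T(1)] by blast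
  then obtain xs where xs: "\<And>N. set (xs N) = T N" "\<And>N. distinct (xs N)" by metis
  \<comment> \<open>Taking the first net point close to the parameter makes the choice measurable
    with respect to \<open>D\<close> and the cells \<open>A N i\<close> disjoint.\<close>
  define idx where "idx N w = (LEAST i. i < length (xs N) \<and> dist (xs N ! i) (th w) < 1 / real (Suc N))" for N w
  have ex: "\<exists>i. i < length (xs N) \<and> dist (xs N ! i) (th w) < 1 / real (Suc N)" if w: "w \<in> space M" for N w
  proof -
    obtain t where "t \<in> T N" "dist t (th w) < 1 / real (Suc N)" using T(3)[of N] th(2)[OF w] by (auto simp: ball_def)
    then show ?thesis using xs(1)[of N] by (metis in_set_conv_nth)
  qed
  have idx: "idx N w < length (xs N)" "dist (xs N ! idx N w) (th w) < 1 / real (Suc N)" if "w \<in> space M" for N w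
    using LeastI_ex[OF ex[OF that, of N]] by (auto simp: idx_def)
  define A where "A N i = {w \<in> space D. idx N w = i}" for N i
  have spD: "space D = space M" using D by (simp add: subalgebra_def)
  have AD: "A N i \<in> sets D" for N i
  proof -
    have [measurable]: "th \<in> borel_measurable D" by (rule th)
    have [measurable]: "Measurable.pred D (\<lambda>w. i < length (xs N) \<and> dist (xs N ! i) (th w) < 1 / real (Suc N))" for i
      by measurable
    have "idx N \<in> measurable D (count_space UNIV)" unfolding idx_def[abs_def] by measurable
    then show ?thesis unfolding A_def by measurable
  qed
  have AM: "A N i \<in> sets M" for N i using AD D by (auto simp: subalgebra_def)
  have inT: "xs N ! i \<in> Theta" if "i < length (xs N)" for N i using that xs(1)[of N] T(2)[of N] nth_mem by blast
  have fM [measurable]: "f t \<in> borel_measurable M" if "t \<in> Theta" for t using measurable_from_subalg[OF G f(1)[OF that]] .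
  let ?f = "\<lambda>N w. \<Sum>i<length (xs N). indicator (A N i) w * f (xs N ! i) w"
  have val: "?f N w = f (xs N ! idx N w) w" if w: "w \<in> space M" for N w
  proof -
    have "?f N w = (\<Sum>i<length (xs N). if i = idx N w then f (xs N ! i) w else 0)"
      using w by (intro sum.cong) (auto simp: A_def spD indicator_def)
    then show ?thesis using idx(1)[OF w] by simp
  qed
  have fm: "?f N \<in> borel_measurable M" for N
    using AM fM[OF inT] by (intro borel_measurable_sum borel_measurable_times borel_measurable_indicator) auto
  have le: "expectation (?f N) \<le> b + expectation z" for N
  proof -
    have int: "integrable M (\<lambda>w. indicator (A N i) w * f (xs N ! i) w)" if "i < length (xs N)" for i
      by (rule integrable_const_bound[of _ 1]) (use f AM fM[OF inT[OF that]] in \<open>auto simp: indicator_def\<close>)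
    have iz: "integrable M (\<lambda>w. indicator (A N i) w * z w)" for i
      using integrable_real_mult_indicator[OF AM z(1)] by (simp add: mult.commute)
    have one: "expectation (\<lambda>w. indicator (A N i) w * f (xs N ! i) w) \<le> prob (A N i) * b + expectation (\<lambda>w. indicator (A N i) w * z w)"
      if i: "i < length (xs N)" for i
    proof -
      let ?t = "xs N ! i"
      \<comment> \<open>The layer bound runs over the values of \<open>f\<close> at a fixed net
        point while the cell stays fixed, so the error remains localised on the cell.\<close>
      have "(\<integral>w. (indicator (A N i) w - prob (A N i)) * f ?t w \<partial>M) \<le> expectation (\<lambda>w. indicator (A N i) w * z w)"
      proof (rule layer_bound[OF G _ _ f(1)[OF inT[OF i]] f(2,3)])
        show "integrable M (\<lambda>w. indicator (A N i) w - prob (A N i))" using AM by (auto simp: emeasure_eq_measure)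
        show "\<bar>indicator (A N i) w - prob (A N i)\<bar> \<le> 1" for w
          using prob_le_1[of "A N i"] measure_nonneg[of M "A N i"] by (auto simp: indicator_def)
        fix B assume B: "B \<in> sets G"
        then have BM: "B \<in> sets M" using G by (auto simp: subalgebra_def)
        have "(\<integral>w. (indicator (A N i) w - prob (A N i)) * indicator B w \<partial>M)
            = (\<integral>w. indicator (A N i \<inter> B) w - prob (A N i) * indicator B w \<partial>M)"
          by (intro Bochner_Integration.integral_cong) (auto simp: indicator_def)
        also have "\<dots> = prob (A N i \<inter> B) - prob (A N i) * prob B" using AM BM by (simp add: emeasure_eq_measure)
        also have "\<dots> \<le> expectation (\<lambda>w. indicator (A N i) w * z w)" using mix[OF AD B, of N i] by linarith
        finally show "(\<integral>w. (indicator (A N i) w - prob (A N i)) * indicator B w \<partial>M) \<le> expectation (\<lambda>w. indicator (A N i) w * z w)" .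
      qed
      moreover have "integrable M (f ?t)"
        by (rule integrable_const_bound[of _ 1]) (use f fM[OF inT[OF i]] in auto)
      ultimately have "expectation (\<lambda>w. indicator (A N i) w * f ?t w) \<le> prob (A N i) * expectation (f ?t) + expectation (\<lambda>w. indicator (A N i) w * z w)"
        using int[OF i] by (simp add: left_diff_distrib)
      also have "\<dots> \<le> prob (A N i) * b + expectation (\<lambda>w. indicator (A N i) w * z w)"
        using b(1)[OF inT[OF i]] by (intro add_mono mult_left_mono) auto
      finally show ?thesis .
    qed
    have "expectation (?f N) = (\<Sum>i<length (xs N). expectation (\<lambda>w. indicator (A N i) w * f (xs N ! i) w))"
      using int by (intro Bochner_Integration.integral_sum) auto
    also have "\<dots> \<le> (\<Sum>i<length (xs N). prob (A N i) * b + expectation (\<lambda>w. indicator (A N i) w * z w))"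
      using one by (intro sum_mono) auto
    also have "\<dots> = (\<Sum>i<length (xs N). prob (A N i)) * b + expectation (\<lambda>w. \<Sum>i<length (xs N). indicator (A N i) w * z w)"
      by (simp only: sum.distrib sum_distrib_right Bochner_Integration.integral_sum[OF iz])
    also have "\<dots> \<le> 1 * b + expectation z"
    proof (intro add_mono mult_right_mono b(2))
      have "(\<Sum>i<length (xs N). prob (A N i)) = prob (\<Union>i<length (xs N). A N i)"
        using AM by (intro finite_measure_finite_Union[symmetric]) (auto simp: disjoint_family_on_def A_def)
      then show "(\<Sum>i<length (xs N). prob (A N i)) \<le> 1" by simp
      show "expectation (\<lambda>w. \<Sum>i<length (xs N). indicator (A N i) w * z w) \<le> expectation z"
      proof (rule integral_mono)
        fix w assume w: "w \<in> space M"
        have "(\<Sum>i<length (xs N). indicator (A N i) w * z w) = (\<Sum>i<length (xs N). if i = idx N w then z w else 0)"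
          using w by (intro sum.cong) (auto simp: A_def spD indicator_def)
        then show "(\<Sum>i<length (xs N). indicator (A N i) w * z w) \<le> z w" using z(2)[of w] by simp
      qed (intro Bochner_Integration.integrable_sum iz z(1))+
    qed
    finally show ?thesis by simp
  qed
  \<comment> \<open>As the nets refine, the chosen points converge to the random parameter, and
    continuity of \<open>f\<close> in it identifies the limit; 1 is a dominating function.\<close>
  have "(\<lambda>N. expectation (?f N)) \<longlonglongrightarrow> expectation (\<lambda>w. f (th w) w)"
  proof (rule integral_dominated_convergence[where w = "\<lambda>_. 1"])
    show "AE w in M. norm (?f N w) \<le> 1" for N using val f by (intro AE_I2) simp
    show "AE w in M. (\<lambda>N. ?f N w) \<longlonglongrightarrow> f (th w) w"
      using cont AE_space
    proof eventually_elim
      case (elim w)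
      have "(\<lambda>N. xs N ! idx N w) \<longlonglongrightarrow> th w"
        unfolding tendsto_iff
      proof (intro allI impI)
        fix e :: real assume "0 < e"
        then have "\<forall>\<^sub>F N in sequentially. 1 / real (Suc N) < e"
          using order_tendstoD(2)[OF LIMSEQ_inverse_real_of_nat, of e] by (simp add: inverse_eq_divide)
        then show "\<forall>\<^sub>F N in sequentially. dist (xs N ! idx N w) (th w) < e"
          by eventually_elim (use idx(2)[OF elim(2)] in \<open>force intro: less_trans\<close>)
      qed
      moreover have "th w \<in> Theta" "\<And>N. xs N ! idx N w \<in> Theta" using th(2) elim(2) inT idx(1) by auto
      ultimately have "(\<lambda>N. f (xs N ! idx N w) w) \<longlonglongrightarrow> f (th w) w"
        using elim(1) unfolding continuous_on_sequentially by (auto simp: o_def)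
      then show ?case by (simp add: val[OF elim(2)])
    qed
  qed (use fm fth in auto)
  then show ?thesis by (rule LIMSEQ_le_const2) (use le in auto)
qed

end

section \<open>Stationary mixing observations\<close>

lemma moment_le_scale:
  assumes "moment_le M p V c" "0 \<le> a" "0 \<le> c" "0 \<le> p"
  shows "moment_le M p (\<lambda>w. a * V w) (a powr p * c)"
proof -
  have "moment_le M p (\<lambda>w. a * V w) (a powr p * c + 0 * c)"
    by (rule moment_le_linear[OF assms(1) assms(1)]) (use assms in \<open>auto simp: abs_mult powr_mult dest: moment_leD\<close>)
  then show ?thesis by simp
qed

lemma (in prob_space) moment_le_const: "moment_le M p (\<lambda>_. a) (\<bar>a\<bar> powr p)"
  by (simp add: moment_le_def emeasure_space_1)

locale observed_model = smoothing_model lam mu Theta m g phi psi S sm sp cphi cpsi + P: prob_space P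
  for lam :: "'x measure" and mu :: "'y measure" and Theta :: "'p::euclidean_space set"
    and m :: "'p \<Rightarrow> 'x \<Rightarrow> 'x \<Rightarrow> real" and g :: "'p \<Rightarrow> 'x \<Rightarrow> 'y \<Rightarrow> real"
    and phi :: "'p \<Rightarrow> real" and psi :: "'p \<Rightarrow> 'e::euclidean_space"
    and S :: "'x \<times> 'x \<times> 'y \<Rightarrow> 'e" and sm sp cphi cpsi :: real and P :: "'w measure" +
  fixes Y :: "int \<Rightarrow> 'w \<Rightarrow> 'y" and q C0 beta :: real
  assumes Y_meas: "\<And>k. Y k \<in> measurable P mu"
    and q: "2 < q"
    and moments: "finite_expectation P (\<lambda>w. SUP (x, x')\<in>UNIV. ennreal (norm (S (x, x', Y 0 w)) powr q))"
    and stationary: "stationary_process P mu Y"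
    and beta: "0 \<le> C0" "C0 < 1" "0 < beta" "beta < 1"
    and beta_mix: "\<And>n. beta_mixing P mu Y n \<le> ennreal (C0 * beta ^ n)"
begin

section \<open>Stationarity and moments of the envelope\<close>

abbreviation obs :: "'w \<Rightarrow> int \<Rightarrow> 'y" where "obs w \<equiv> (\<lambda>i. Y i w)"

abbreviation obs_from :: "int \<Rightarrow> 'w \<Rightarrow> int \<Rightarrow> 'y" where "obs_from t w \<equiv> (\<lambda>i. Y (i + t) w)"

lemma obs_measurable: "obs_from t \<in> measurable P (Pi\<^sub>M UNIV (\<lambda>_. mu))"
  using Y_meas space_mu by (intro measurable_PiM_single') auto

lemma obs_measurable0: "obs \<in> measurable P (Pi\<^sub>M UNIV (\<lambda>_. mu))"
  using obs_measurable[of 0] by simp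

lemma distr_shift: "distr P (Pi\<^sub>M UNIV (\<lambda>_. mu)) (obs_from t) = distr P (Pi\<^sub>M UNIV (\<lambda>_. mu)) obs"
  using stationary unfolding stationary_process_def by blast

lemma stationary_nn_integral:
  assumes "f \<in> borel_measurable (Pi\<^sub>M UNIV (\<lambda>_. mu))"
  shows "(\<integral>\<^sup>+ w. f (obs_from t w) \<partial>P) = (\<integral>\<^sup>+ w. f (obs w) \<partial>P)"
proof -
  have "(\<integral>\<^sup>+ w. f (obs_from t w) \<partial>P) = integral\<^sup>N (distr P (Pi\<^sub>M UNIV (\<lambda>_. mu)) (obs_from t)) f"
    by (rule nn_integral_distr[symmetric, OF obs_measurable]) (simp add: assms)
  also have "\<dots> = (\<integral>\<^sup>+ w. f (obs w) \<partial>P)"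
    unfolding distr_shift by (rule nn_integral_distr[OF obs_measurable0]) (simp add: assms)
  finally show ?thesis .
qed

lemma stationary_integral:
  fixes f :: "_ \<Rightarrow> 'e"
  assumes "f \<in> borel_measurable (Pi\<^sub>M UNIV (\<lambda>_. mu))"
  shows "(\<integral>w. f (obs_from t w) \<partial>P) = (\<integral>w. f (obs w) \<partial>P)"
proof -
  have "(\<integral>w. f (obs_from t w) \<partial>P) = integral\<^sup>L (distr P (Pi\<^sub>M UNIV (\<lambda>_. mu)) (obs_from t)) f"
    by (rule integral_distr[symmetric, OF obs_measurable assms])
  also have "\<dots> = (\<integral>w. f (obs w) \<partial>P)"
    unfolding distr_shift by (rule integral_distr[OF obs_measurable0 assms])
  finally show ?thesis .
qed

definition sup_power :: "'y \<Rightarrow> ennreal" where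
  "sup_power y = (SUP (x, x')\<in>UNIV. ennreal (norm (S (x, x', y)) powr q))"

definition c_env :: real where "c_env = enn2real (\<integral>\<^sup>+ w. sup_power (Y 0 w) \<partial>P)"

lemma c_env_nonneg: "0 \<le> c_env"
  by (simp add: c_env_def)

lemma sup_power: "(\<lambda>w. sup_power (Y 0 w)) \<in> borel_measurable P" "(\<integral>\<^sup>+ w. sup_power (Y 0 w) \<partial>P) = ennreal c_env"
  using moments unfolding finite_expectation_def c_env_def sup_power_def by auto

lemma sup_norm_power:
  assumes "sup_power y < \<infinity>"
  obtains b where "sup_norm_at S y \<le> ennreal b" "0 \<le> b" "ennreal (b powr q) \<le> sup_power y"
proof -
  define a where "a = enn2real (sup_power y)"
  have a: "sup_power y = ennreal a" "0 \<le> a" using assms by (auto simp: a_def)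
  have "norm (S (x, x', y)) \<le> a powr (1 / q)" for x x'
  proof -
    have "ennreal (norm (S (x, x', y)) powr q) \<le> sup_power y"
      unfolding sup_power_def by (rule SUP_upper2[of "(x, x')"]) auto
    then have "norm (S (x, x', y)) powr q \<le> a" using a by simp
    then have "(norm (S (x, x', y)) powr q) powr (1 / q) \<le> a powr (1 / q)" using q by (intro powr_mono2) auto
    then show ?thesis using q by (simp add: powr_powr)
  qed
  then have "sup_norm_at S y \<le> ennreal (a powr (1 / q))"
    unfolding sup_norm_at_def by (auto intro!: SUP_least ennreal_leI)
  moreover have "(a powr (1 / q)) powr q = a" using a(2) q by (simp add: powr_powr)
  ultimately show thesis using a by (intro that[of "a powr (1 / q)"]) auto
qed

text \<open>The moment hypothesis concerns time 0 and a supremum known to be measurable only along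
  \<open>Y 0\<close>. It dominates \<open>h\<close>, the power of the envelope with infinity kept,
  and \<open>h\<close> is measurable in the observation, so stationarity carries the bound to time
  \<open>t\<close>. Allowing any \<open>nu\<close> covers the pair law starting from
  \<open>chi\<close>, with the same constant.\<close>

lemma envelope_moment:
  assumes nu: "sets nu = sets (lam \<Otimes>\<^sub>M lam)" "sigma_finite_measure nu"
  shows "AE w in P. envelope nu (Y t w) < \<infinity>"
    and "moment_le P q (\<lambda>w. enn2real (envelope nu (Y t w))) c_env"
proof -
  have [measurable]: "envelope nu \<in> borel_measurable mu" by (rule envelope_measurable[OF nu])
  define h where "h y = (if envelope nu y = \<infinity> then \<infinity> else ennreal (enn2real (envelope nu y) powr q))" for y
  have h [measurable]: "h \<in> borel_measurable mu" unfolding h_def[abs_def] by measurable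
  have hle: "h (Y 0 w) \<le> sup_power (Y 0 w)" for w
  proof (cases "sup_power (Y 0 w) = \<infinity>")
    case False
    then have "sup_power (Y 0 w) < \<infinity>" by (simp add: less_top)
    then obtain b where b: "sup_norm_at S (Y 0 w) \<le> ennreal b" "0 \<le> b" "ennreal (b powr q) \<le> sup_power (Y 0 w)"
      by (rule sup_norm_power)
    have e: "envelope nu (Y 0 w) \<le> ennreal b" by (rule order_trans[OF envelope_le b(1)])
    then have "envelope nu (Y 0 w) \<noteq> \<infinity>" by (metis ennreal_less_top infinity_ennreal_def le_less_trans less_irrefl)
    moreover have "enn2real (envelope nu (Y 0 w)) \<le> b" using enn2real_leI[OF b(2) e] .
    then have "enn2real (envelope nu (Y 0 w)) powr q \<le> b powr q" using q by (intro powr_mono2) auto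
    ultimately show ?thesis using b(3) by (auto simp: h_def intro: order_trans ennreal_leI)
  qed simp
  have comp: "(\<lambda>y. h (y 0)) \<in> borel_measurable (Pi\<^sub>M UNIV (\<lambda>_. mu))"
    using measurable_compose[OF measurable_component_singleton[of 0 UNIV "\<lambda>_. mu"] h] by simp
  have "(\<integral>\<^sup>+ w. h (Y t w) \<partial>P) = (\<integral>\<^sup>+ w. h (Y 0 w) \<partial>P)"
    using stationary_nn_integral[OF comp, of t] by simp
  also have "\<dots> \<le> (\<integral>\<^sup>+ w. sup_power (Y 0 w) \<partial>P)" by (intro nn_integral_mono hle)
  finally have int: "(\<integral>\<^sup>+ w. h (Y t w) \<partial>P) \<le> ennreal c_env" using sup_power by simp
  have hY: "(\<lambda>w. h (Y t w)) \<in> borel_measurable P" by (rule measurable_compose[OF Y_meas h])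
  have "AE w in P. h (Y t w) \<noteq> \<infinity>"
    using int by (intro nn_integral_noteq_infinite hY) (auto simp: top_unique)
  then have fin: "AE w in P. envelope nu (Y t w) \<noteq> \<infinity>" by eventually_elim (auto simp: h_def)
  then show "AE w in P. envelope nu (Y t w) < \<infinity>" by eventually_elim (simp add: less_top)
  have "(\<lambda>w. enn2real (envelope nu (Y t w))) \<in> borel_measurable P"
    using Y_meas[of t] by measurable
  moreover have "(\<integral>\<^sup>+ w. ennreal (\<bar>enn2real (envelope nu (Y t w))\<bar> powr q) \<partial>P) \<le> (\<integral>\<^sup>+ w. h (Y t w) \<partial>P)"
    by (intro nn_integral_mono) (auto simp: h_def)
  ultimately show "moment_le P q (\<lambda>w. enn2real (envelope nu (Y t w))) c_env"
    using int unfolding moment_le_def by (auto intro: order_trans)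
qed

lemma env_moment: "moment_le P q (\<lambda>w. env (Y t w)) c_env"
  unfolding env_def by (rule envelope_moment) (auto intro: sigma_finite_pair)

lemma obs_good: "AE w in P. good (obs w)"
  unfolding good_def by (subst AE_all_countable) (intro allI envelope_moment(1)[OF refl sigma_finite_pair])

lemma obs_from_good: "good (obs w) \<Longrightarrow> good (obs_from t w)"
  using good_shift[of "obs w" t] .

lemma env_integrable: "integrable P (\<lambda>w. env (Y t w))" "\<bar>\<integral>w. env (Y t w) \<partial>P\<bar> \<le> 1 + c_env"
  using P.moment_one_bound[OF P.moment_le_lower_one[OF env_moment, of 1]] q c_env_nonneg by auto

definition Smean :: "'p \<Rightarrow> 'e" where "Smean th = (\<integral>w. Slim th (obs w) \<partial>P)"

lemma Slim_obs_measurable: "th \<in> Theta \<Longrightarrow> (\<lambda>w. Slim th (obs_from t w)) \<in> borel_measurable P"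
  by (rule measurable_compose[OF obs_measurable Slim_measurable])

lemma Slim_obs_bound: "th \<in> Theta \<Longrightarrow> AE w in P. norm (Slim th (obs_from t w)) \<le> env (Y t w)"
  using obs_good
proof eventually_elim
  case (elim w)
  then show ?case using Slim_bound[OF elim(1) obs_from_good[OF elim(2), of t]] by simp
qed

lemma Slim_integrable: "th \<in> Theta \<Longrightarrow> integrable P (\<lambda>w. Slim th (obs_from t w))"
  using Slim_obs_bound[of th t] env_nonneg
  by (intro Bochner_Integration.integrable_bound[OF env_integrable(1)[of t]] Slim_obs_measurable) auto

lemma Smean_shift: "th \<in> Theta \<Longrightarrow> (\<integral>w. Slim th (obs_from t w) \<partial>P) = Smean th"
  unfolding Smean_def by (rule stationary_integral[OF Slim_measurable])

lemma Smean_bound: "th \<in> Theta \<Longrightarrow> norm (Smean th) \<le> 1 + c_env"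
proof -
  assume th: "th \<in> Theta"
  have "norm (Smean th) \<le> (\<integral>w. norm (Slim th (obs w)) \<partial>P)"
    unfolding Smean_def by (rule integral_norm_bound)
  also have "\<dots> \<le> (\<integral>w. env (Y 0 w) \<partial>P)"
    using Slim_obs_bound[OF th, of 0] Slim_integrable[OF th, of 0]
    by (intro integral_mono_AE env_integrable(1) integrable_norm) auto
  finally have "norm (Smean th) \<le> (\<integral>w. env (Y 0 w) \<partial>P)" .
  then show ?thesis using env_integrable(2)[of 0] by linarith
qed

lemma Smean_continuous: "continuous_on Theta Smean"
  unfolding continuous_on_sequentially
proof (intro allI ballI impI, elim conjE)
  fix u th assume th: "th \<in> Theta" and u: "\<forall>n::nat. u n \<in> Theta" and lim: "u \<longlonglongrightarrow> th"
  have "(\<lambda>n. \<integral>w. Slim (u n) (obs w) \<partial>P) \<longlonglongrightarrow> (\<integral>w. Slim th (obs w) \<partial>P)"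
  proof (rule integral_dominated_convergence[where w = "\<lambda>w. env (Y 0 w)"])
    show "AE w in P. (\<lambda>n. Slim (u n) (obs w)) \<longlonglongrightarrow> Slim th (obs w)"
      using obs_good
    proof eventually_elim
      case (elim w)
      show ?case using Slim_continuous[OF elim] th u lim unfolding continuous_on_sequentially by (auto simp: o_def)
    qed
    show "AE w in P. norm (Slim (u n) (obs w)) \<le> env (Y 0 w)" for n
      using Slim_obs_bound[of "u n" 0] u by simp
  qed (use Slim_obs_measurable[of _ 0] th u env_integrable(1)[of 0] in auto)
  then show "(Smean \<circ> u) \<longlonglongrightarrow> Smean th" by (simp add: o_def Smean_def)
qed

subsection \<open>Generated sigma-algebras and mixing\<close>

abbreviation gen :: "int set \<Rightarrow> 'w measure" where "gen I \<equiv> process_sigma P mu Y I"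

lemma gen_generator: "(\<Union>u\<in>I. {Y u -` A \<inter> space P | A. A \<in> sets mu}) \<subseteq> Pow (space P)"
  by auto

lemma space_gen: "space (gen I) = space P"
  unfolding process_sigma_def by (rule space_measure_of[OF gen_generator])

lemma sets_gen: "sets (gen I) = sigma_sets (space P) (\<Union>u\<in>I. {Y u -` A \<inter> space P | A. A \<in> sets mu})"
  unfolding process_sigma_def by (rule sets_measure_of[OF gen_generator])

lemma gen_subalgebra: "subalgebra P (gen I)"
proof -
  have "(\<Union>u\<in>I. {Y u -` A \<inter> space P | A. A \<in> sets mu}) \<subseteq> sets P"
    using measurable_sets[OF Y_meas] by auto
  then show ?thesis unfolding subalgebra_def space_gen sets_gen by (auto dest: sets.sigma_sets_subset)
qed

lemma gen_mono: "I \<subseteq> J \<Longrightarrow> sets (gen I) \<subseteq> sets (gen J)"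
  unfolding sets_gen by (intro sigma_sets_mono') auto

lemma gen_Y: "i \<in> I \<Longrightarrow> Y i \<in> measurable (gen I) mu"
proof (rule measurableI)
  show "Y i w \<in> space mu" for w using space_mu by simp
  fix A assume "i \<in> I" "A \<in> sets mu"
  then show "Y i -` A \<inter> space (gen I) \<in> sets (gen I)" unfolding space_gen sets_gen by (intro sigma_sets.Basic) auto
qed

lemma gen_fun:
  assumes f: "f \<in> borel_measurable (Pi\<^sub>M UNIV (\<lambda>_. mu))" and dep: "\<And>y y'. (\<And>i. i \<in> I \<Longrightarrow> y i = y' i) \<Longrightarrow> f y = f y'"
  shows "(\<lambda>w. f (obs w)) \<in> borel_measurable (gen I)"
proof -
  have Yi: "(\<lambda>w. if i \<in> I then Y i w else undefined) \<in> measurable (gen I) mu" for i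
    using gen_Y[of i I] space_mu by (cases "i \<in> I") auto
  have "(\<lambda>w i. if i \<in> I then Y i w else undefined) \<in> measurable (gen I) (Pi\<^sub>M UNIV (\<lambda>_. mu))"
    using Yi space_mu by (intro measurable_PiM_single') auto
  from measurable_compose[OF this f] have "(\<lambda>w. f (\<lambda>i. if i \<in> I then Y i w else undefined)) \<in> borel_measurable (gen I)" .
  moreover have "f (\<lambda>i. if i \<in> I then Y i w else undefined) = f (obs w)" for w by (rule dep) simp
  ultimately show ?thesis by simp
qed

text \<open>Extracts from the beta-mixing coefficient one integrable variable that dominates the
  deviations for every \<open>B\<close>, the null set depending on \<open>B\<close>. The essential
  supremum exists because the deviations are almost surely at most 1.\<close>

lemma conditional_variation:
  obtains z where "integrable P z" "\<And>w. 0 \<le> z w" "(\<integral>w. z w \<partial>P) \<le> beta ^ n"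
    "\<And>B. B \<in> sets (gen {u + int n..}) \<Longrightarrow>
       AE w in P. \<bar>real_cond_exp P (gen {..u}) (indicator B) w - measure P B\<bar> \<le> z w"
proof -
  let ?I = "sets (gen {u + int n..})"
  let ?X = "\<lambda>B w. ennreal \<bar>real_cond_exp P (gen {..u}) (indicator B) w - measure P B\<bar>"
  define Z where "Z = ess_sup_family P ?I ?X"
  interpret FS: finite_measure_subalgebra P "gen {..u}" by unfold_locales (rule gen_subalgebra)
  have IM: "B \<in> sets P" if "B \<in> ?I" for B using that gen_subalgebra by (auto simp: subalgebra_def)
  have X1: "AE w in P. ?X B w \<le> 1" if B: "B \<in> ?I" for B
  proof -
    have iB: "integrable P (indicator B :: _ \<Rightarrow> real)" using IM[OF B] by (simp add: P.emeasure_eq_measure)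
    have "AE w in P. 0 \<le> real_cond_exp P (gen {..u}) (indicator B) w"
      by (rule FS.real_cond_exp_ge_c[OF iB]) auto
    moreover have "AE w in P. real_cond_exp P (gen {..u}) (indicator B) w \<le> 1"
      by (rule FS.real_cond_exp_le_c[OF iB]) (auto simp: indicator_def)
    ultimately show ?thesis
    proof eventually_elim
      case (elim w)
      have "\<bar>real_cond_exp P (gen {..u}) (indicator B) w - measure P B\<bar> \<le> 1"
        using elim P.prob_le_1[of B] measure_nonneg[of P B] by linarith
      then show ?case by simp
    qed
  qed
  have ess: "is_ess_sup_family P ?I ?X Z" unfolding Z_def
  proof (rule is_ess_sup_family_exists)
    show "finite_measure P" by (rule P.finite_measure_axioms)
    show "?X B \<in> borel_measurable P" for B by measurable
    show "AE w in P. ?X B w \<le> 1" if "B \<in> ?I" for B by (rule X1[OF that])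
  qed simp
  have Zm [measurable]: "Z \<in> borel_measurable P" using ess by (simp add: is_ess_sup_family_def)
  have "(\<integral>\<^sup>+ w. Z w \<partial>P) \<le> beta_mixing P mu Y n"
    unfolding beta_mixing_def Z_def by (rule SUP_upper) simp
  also have "\<dots> \<le> ennreal (C0 * beta ^ n)" by (rule beta_mix)
  also have "\<dots> \<le> ennreal (beta ^ n)" using beta by (intro ennreal_leI) (auto intro!: mult_left_le_one_le)
  finally have EZ: "(\<integral>\<^sup>+ w. Z w \<partial>P) \<le> ennreal (beta ^ n)" .
  \<comment> \<open>The essential supremum has values in \<open>ennreal\<close>. Cutting it at 1
    preserves the domination and makes it real and integrable.\<close>
  define z where "z w = enn2real (min 1 (Z w))" for w
  have z1: "min 1 (Z w) = ennreal (z w)" "0 \<le> z w" "z w \<le> 1" for w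
  proof -
    have "min 1 (Z w) \<le> 1" by simp
    then have "min 1 (Z w) < \<infinity>" by (rule le_less_trans) simp
    then show "min 1 (Z w) = ennreal (z w)" by (simp add: z_def)
    show "0 \<le> z w" by (simp add: z_def)
    show "z w \<le> 1" unfolding z_def by (rule enn2real_leI) auto
  qed
  have zm: "z \<in> borel_measurable P" unfolding z_def[abs_def] by measurable
  have iz: "integrable P z" by (rule P.integrable_const_bound[of _ 1]) (use z1 zm in auto)
  show thesis
  proof (rule that[of z])
    show "integrable P z" by (rule iz)
    show "0 \<le> z w" for w by (rule z1)
    have "ennreal (\<integral>w. z w \<partial>P) = (\<integral>\<^sup>+ w. ennreal (z w) \<partial>P)"
      using nn_integral_eq_integral[OF iz] z1 by simp
    also have "\<dots> \<le> (\<integral>\<^sup>+ w. Z w \<partial>P)" unfolding z1(1)[symmetric] by (intro nn_integral_mono) simp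
    also note EZ
    finally show "(\<integral>w. z w \<partial>P) \<le> beta ^ n" using beta by simp
    fix B assume B: "B \<in> ?I"
    have "AE w in P. ?X B w \<le> Z w" using ess B by (auto simp: is_ess_sup_family_def)
    with X1[OF B] show "AE w in P. \<bar>real_cond_exp P (gen {..u}) (indicator B) w - measure P B\<bar> \<le> z w"
    proof eventually_elim
      case (elim w)
      then have "?X B w \<le> min 1 (Z w)" by simp
      then show ?case unfolding z1(1) using z1(2) by simp
    qed
  qed
qed

text \<open>A common rate for mixing of the observations and forgetting of the states. It is
  positive because \<open>beta\<close> is, even if \<open>rate\<close> is zero.\<close>

definition r_mix :: real where "r_mix = max beta rate"

lemma r_mix: "0 < r_mix" "r_mix < 1" "beta \<le> r_mix" "rate \<le> r_mix"
  using beta rate_bounds by (auto simp: r_mix_def)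

lemma joint_mixing:
  assumes H: "subalgebra P H"
      "\<And>A C. A \<in> sets H \<Longrightarrow> C \<in> sets (gen UNIV) \<Longrightarrow> measure P (A \<inter> C) = measure P A * measure P C"
    and z: "integrable P z" "\<And>B. B \<in> sets (gen {u + int n..}) \<Longrightarrow>
       AE w in P. \<bar>real_cond_exp P (gen {..u}) (indicator B) w - measure P B\<bar> \<le> z w"
    and A: "A \<in> sigma_sets (space P) (sets (gen {..u}) \<union> sets H)" and B: "B \<in> sets (gen {u + int n..})"
  shows "\<bar>measure P (A \<inter> B) - measure P A * measure P B\<bar> \<le> (\<integral>w. indicator A w * z w \<partial>P)"
proof (rule P.conditional_mixing[OF gen_subalgebra H(1) gen_subalgebra[of UNIV] _ _ _ z(1) z(2)[OF B] A])
  show "sets (gen {..u}) \<subseteq> sets (gen UNIV)" by (rule gen_mono) simp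
  show "B \<in> sets (gen UNIV)" using B gen_mono[of "{u + int n..}" UNIV] by auto
  show "measure P (A \<inter> C) = measure P A * measure P C" if "A \<in> sets H" "C \<in> sets (gen UNIV)" for A C
    by (rule H(2)[OF that])
qed

sublocale mix: mixing_filtration P "\<lambda>u. gen {..u}" "\<lambda>u. gen {u..}" r_mix
proof (unfold_locales)
  show "subalgebra P (gen {..u})" "subalgebra P (gen {u..})" for u by (rule gen_subalgebra)+
  show "sets (gen {..u}) \<subseteq> sets (gen {..v})" "sets (gen {v..}) \<subseteq> sets (gen {u..})" if "u \<le> v" for u v
    using that by (auto intro!: gen_mono)
  show "0 < r_mix" "r_mix < 1" by (fact r_mix)+
  fix u n A B assume A: "A \<in> sets (gen {..u})" and B: "B \<in> sets (gen {u + int n..})"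
  obtain z where z: "integrable P z" "\<And>w. 0 \<le> z w" "(\<integral>w. z w \<partial>P) \<le> beta ^ n"
    "\<And>B. B \<in> sets (gen {u + int n..}) \<Longrightarrow>
       AE w in P. \<bar>real_cond_exp P (gen {..u}) (indicator B) w - measure P B\<bar> \<le> z w"
    by (rule conditional_variation[where n = n and u = u]) blast
  \<comment> \<open>With the trivial sigma-algebra as simulation history, the plain mixing bound is
    an instance of the joint one.\<close>
  define H where "H = sigma (space P) ({} :: 'w set set)"
  have setsH: "sets H = {{}, space P}" by (simp add: H_def sigma_sets_empty_eq)
  have H: "subalgebra P H" by (auto simp: subalgebra_def setsH) (simp_all add: H_def)
  have indH: "measure P (A \<inter> C) = measure P A * measure P C" if "A \<in> sets H" "C \<in> sets (gen UNIV)" for A C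
    using that gen_subalgebra[of UNIV] by (auto simp: setsH P.prob_space subalgebra_def)
  have AP: "A \<in> sets P" using A gen_subalgebra by (auto simp: subalgebra_def)
  have "\<bar>measure P (A \<inter> B) - measure P A * measure P B\<bar> \<le> (\<integral>w. indicator A w * z w \<partial>P)"
    using A by (intro joint_mixing[OF H indH z(1,4) _ B]) auto
  also have "\<dots> \<le> (\<integral>w. z w \<partial>P)"
    using z integrable_real_mult_indicator[OF AP z(1)] by (intro integral_mono) (auto simp: indicator_def mult.commute)
  also have "\<dots> \<le> beta ^ n" by (rule z)
  also have "\<dots> \<le> r_mix ^ n" using r_mix beta by (intro power_mono) auto
  finally show "\<bar>measure P (A \<inter> B) - measure P A * measure P B\<bar> \<le> r_mix ^ n" .
qed

end

context observed_model
begin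

subsection \<open>Deviation of block averages\<close>

text \<open>The constants for forgetting the initial law and the final time added up, for use when
  both are at least \<open>k\<close> steps away.\<close>

definition C_forget :: real where "C_forget = 2 + sp / sm"

lemma C_forget_nonneg: "0 \<le> C_forget"
  using sm by (simp add: C_forget_def)

lemma window_measurable: "th \<in> Theta \<Longrightarrow> window k th t \<in> borel_measurable (Pi\<^sub>M UNIV (\<lambda>_. mu))"
proof -
  assume th: "th \<in> Theta"
  have "t - 1 - int k < t" "t \<le> t + int k" by auto
  from Phi_meas[OF lam0 this] obtain Q where Q: "Q \<in> borel_measurable (borel \<Otimes>\<^sub>M Pi\<^sub>M UNIV (\<lambda>_. mu))"
    "\<And>th y. th \<in> Theta \<Longrightarrow> window k th t y = Q (th, y)" unfolding window_def by metis
  have "(\<lambda>y. Q (th, y)) \<in> borel_measurable (Pi\<^sub>M UNIV (\<lambda>_. mu))"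
    by (rule measurable_compose[OF measurable_Pair1' Q(1)]) simp
  moreover have "window k th t = (\<lambda>y. Q (th, y))" using Q(2)[OF th] by (rule ext)
  ultimately show ?thesis by simp
qed

lemma window_gen:
  assumes "th \<in> Theta" "{t - int k..t + int k} \<subseteq> I"
  shows "(\<lambda>w. window k th t (obs w)) \<in> borel_measurable (gen I)"
proof (rule gen_fun[OF window_measurable[OF assms(1)]])
  fix y y' :: "int \<Rightarrow> 'y" assume eq: "\<And>i. i \<in> I \<Longrightarrow> y i = y' i"
  show "window k th t y = window k th t y'"
    unfolding window_def by (rule Phi_cong) (use assms(2) eq in auto)
qed

lemma window_obs_measurable: "th \<in> Theta \<Longrightarrow> (\<lambda>w. window k th t (obs w)) \<in> borel_measurable P"
  by (rule measurable_compose[OF obs_measurable0 window_measurable])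

lemma window_error:
  assumes "th \<in> Theta" "good (obs w)" "k \<noteq> 0"
  shows "norm (window k th t (obs w) - Slim th (obs_from t w)) \<le> (C_forget * rate ^ k) * env (Y t w)"
proof -
  have "norm (window k th t (obs w) - Slim th (obs_from t w)) \<le> env (Y t w) * (2 * rate ^ k + sp / sm * rate ^ k)"
    unfolding window_def using assms good_AE[OF assms(2), of t] by (intro Phi_Slim lam0) auto
  then show ?thesis by (simp add: C_forget_def algebra_simps)
qed

definition c_dev :: real where "c_dev = 2 powr q * (c_env + (1 + c_env) powr q)"

definition c_mix :: real where "c_mix = c_dev + C_forget powr q * c_env"

lemma c_dev_nonneg: "0 \<le> c_dev"
  using c_env_nonneg by (simp add: c_dev_def)

lemma c_mix_nonneg: "0 \<le> c_mix"
  using c_env_nonneg c_dev_nonneg by (simp add: c_mix_def)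

lemma env_plus_moment: "moment_le P q (\<lambda>w. env (Y t w) + (1 + c_env)) c_dev"
  using moment_le_add_double[OF env_moment[of t] P.moment_le_const[of q "1 + c_env"]] c_env_nonneg q
  by (simp add: c_dev_def)

lemma forget_moment: "moment_le P q (\<lambda>w. (C_forget * rate ^ k) * env (Y t w)) (C_forget powr q * c_env * r_mix ^ k)"
proof -
  define x where "x = rate ^ k"
  have x: "0 \<le> x" "x \<le> 1" "x \<le> r_mix ^ k"
    unfolding x_def using rate_bounds r_mix by (auto intro: power_le_one power_mono)
  have "x powr q \<le> x"
  proof (cases "x = 0")
    case False
    then show ?thesis using x q by (intro powr_le_one_le) linarith+
  qed simp
  then have le: "(C_forget powr q * c_env) * x powr q \<le> (C_forget powr q * c_env) * r_mix ^ k"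
    using c_env_nonneg x(3) by (intro mult_left_mono) auto
  have "0 \<le> C_forget * x" "0 \<le> q" using C_forget_nonneg x(1) q by simp_all
  from moment_le_scale[OF env_moment this(1) c_env_nonneg this(2)]
  have "moment_le P q (\<lambda>w. (C_forget * x) * env (Y t w)) ((C_forget * x) powr q * c_env)" .
  moreover have "(C_forget * x) powr q * c_env = (C_forget powr q * c_env) * x powr q"
    by (simp only: powr_mult mult_ac)
  ultimately show ?thesis unfolding x_def[symmetric] using le by (simp add: moment_le_mono)
qed

definition centred :: "'e \<Rightarrow> 'p \<Rightarrow> int \<Rightarrow> 'w \<Rightarrow> real" where
  "centred e th t w = (Slim th (obs_from t w) - Smean th) \<bullet> e"

lemma centred_measurable: "th \<in> Theta \<Longrightarrow> centred e th t \<in> borel_measurable P"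
  unfolding centred_def[abs_def]
  by (intro borel_measurable_inner borel_measurable_diff borel_measurable_const Slim_obs_measurable)

lemma inner_le_norm: "norm e = 1 \<Longrightarrow> \<bar>(x :: 'e) \<bullet> e\<bar> \<le> norm x"
  using Cauchy_Schwarz_ineq2[of x e] by simp

lemma centred_class:
  assumes th: "th \<in> Theta" and e: "norm e = 1"
  shows "mix.mixing_class q c_mix (centred e th)"
  unfolding mix.mixing_class_def
proof (intro conjI allI)
  fix t
  have "AE w in P. \<bar>centred e th t w\<bar> \<le> \<bar>env (Y t w) + (1 + c_env)\<bar>"
    using Slim_obs_bound[OF th, of t]
  proof eventually_elim
    case (elim w)
    have "\<bar>centred e th t w\<bar> \<le> norm (Slim th (obs_from t w) - Smean th)" unfolding centred_def by (rule inner_le_norm[OF e])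
    also have "\<dots> \<le> norm (Slim th (obs_from t w)) + norm (Smean th)" by (rule norm_triangle_ineq4)
    also have "\<dots> \<le> env (Y t w) + (1 + c_env)" using elim Smean_bound[OF th] by linarith
    finally show ?case by linarith
  qed
  then have dev: "moment_le P q (centred e th t) c_dev"
    using q by (intro moment_le_AE_mono[OF env_plus_moment centred_measurable[OF th]]) auto
  then show "moment_le P q (centred e th t) c_mix"
    using c_env_nonneg by (elim moment_le_mono) (simp add: c_mix_def)
  have i: "integrable P (\<lambda>w. Slim th (obs_from t w) - Smean th)" using Slim_integrable[OF th, of t] by simp
  show "P.expectation (centred e th t) = 0"
    unfolding centred_def[abs_def] using i Slim_integrable[OF th, of t] Smean_shift[OF th, of t]
    by (subst integral_inner_left) (auto simp: P.prob_space)
  fix k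
  show "\<exists>Z. Z \<in> borel_measurable (gen {..t + int k}) \<and> Z \<in> borel_measurable (gen {t - int k..}) \<and>
        moment_le P q (\<lambda>w. centred e th t w - Z w) (c_mix * r_mix ^ k)"
  proof (cases "k = 0")
    \<comment> \<open>At radius 0 the window would start at time \<open>t - 1\<close> and bring in
      the envelope of \<open>lam0\<close>. The zero approximant suffices, as the permitted error is
      then \<open>c_mix\<close> itself.\<close>
    case True
    show ?thesis
    proof (intro exI[of _ "\<lambda>_. 0"] conjI)
      show "moment_le P q (\<lambda>w. centred e th t w - 0) (c_mix * r_mix ^ k)"
        using \<open>moment_le P q (centred e th t) c_mix\<close> True by simp
    qed auto
  next
    case False
    let ?Z = "\<lambda>w. (window k th t (obs w) - Smean th) \<bullet> e"
    have Z: "?Z \<in> borel_measurable (gen I)" if "{t - int k..t + int k} \<subseteq> I" for I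
      using window_gen[OF th that] by measurable
    have "AE w in P. \<bar>centred e th t w - ?Z w\<bar> \<le> \<bar>(C_forget * rate ^ k) * env (Y t w)\<bar>"
      using obs_good
    proof eventually_elim
      case (elim w)
      have "centred e th t w - ?Z w = - ((window k th t (obs w) - Slim th (obs_from t w)) \<bullet> e)"
        by (simp add: centred_def inner_diff_left)
      then have "\<bar>centred e th t w - ?Z w\<bar> \<le> norm (window k th t (obs w) - Slim th (obs_from t w))"
        using inner_le_norm[OF e] by simp
      also have "\<dots> \<le> (C_forget * rate ^ k) * env (Y t w)" by (rule window_error[OF th elim False])
      finally show ?case by linarith
    qed
    then have "moment_le P q (\<lambda>w. centred e th t w - ?Z w) (C_forget powr q * c_env * r_mix ^ k)"
    proof (rule moment_le_AE_mono[OF forget_moment, rotated])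
      show "(\<lambda>w. centred e th t w - ?Z w) \<in> borel_measurable P"
        using centred_measurable[OF th, of e t] window_obs_measurable[OF th, of k t]
        by (intro borel_measurable_diff borel_measurable_inner) auto
    qed (use q in simp)
    then have "moment_le P q (\<lambda>w. centred e th t w - ?Z w) (c_mix * r_mix ^ k)"
      using c_dev_nonneg r_mix by (elim moment_le_mono) (auto simp: c_mix_def intro!: mult_right_mono)
    moreover have "{t - int k..t + int k} \<subseteq> {..t + int k}" "{t - int k..t + int k} \<subseteq> {t - int k..}" by auto
    ultimately show ?thesis using Z by blast
  qed
qed

text \<open>With k = \<open>quarter n\<close>, a core time is more than 3 k after \<open>T\<close>
  and at least k before the end of the block. Its window of radius k therefore stays inside the
  block and begins more than 2 k after \<open>T\<close>. Truncated subtraction makes the core empty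
  for short blocks.\<close>

definition core :: "int \<Rightarrow> nat \<Rightarrow> int set" where
  "core T n = {T + 3 * int (quarter n) + 1..T + 3 * int (quarter n) + int (n - 4 * quarter n)}"

definition edge :: "int \<Rightarrow> nat \<Rightarrow> int set" where
  "edge T n = {T + 1..T + int n} - core T n"

text \<open>This part is continuous in the parameter along good trajectories and, for a fixed
  parameter, measurable with respect to observations behind a gap: the two properties that
  decoupling requires.\<close>

definition main :: "int \<Rightarrow> nat \<Rightarrow> 'p \<Rightarrow> 'w \<Rightarrow> 'e" where
  "main T n th w = (\<Sum>t\<in>core T n. window (quarter n) th t (obs w) - Smean th)"

lemma card_core: "card (core T n) \<le> n"
  by (simp add: core_def)

lemma core_subset: "core T n \<subseteq> {T + 1..T + int n}"
  by (auto simp: core_def)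

lemma core_bounds:
  "t \<in> core T n \<Longrightarrow> T + 3 * int (quarter n) + 1 \<le> t \<and> t + int (quarter n) \<le> T + int n"
  by (auto simp: core_def)

lemma card_edge: "real (card (edge T n)) \<le> 4 * real (quarter n)"
proof -
  have "card (edge T n) = n - (n - 4 * quarter n)"
    unfolding edge_def using core_subset[of T n] by (subst card_Diff_subset) (auto simp: core_def)
  then show ?thesis by simp
qed

lemma sqrt_powr_ge_one: "1 \<le> n \<Longrightarrow> 0 \<le> p \<Longrightarrow> 1 \<le> sqrt (real n) powr p"
  by (rule ge_one_powr_ge_zero) auto

lemma quarter_powr: "1 \<le> n \<Longrightarrow> 2 \<le> p \<Longrightarrow> real (quarter n) powr (p + 1) \<le> sqrt (real n) powr p"
proof -
  assume n: "1 \<le> n" "2 \<le> p"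
  have "real (quarter n) powr (p + 1) \<le> (real n powr (1 / 4)) powr (p + 1)"
    using quarter_le[of n] n by (intro powr_mono2) auto
  also have "\<dots> \<le> real n powr (p / 2)" unfolding powr_powr using n by (intro powr_mono) auto
  also have "\<dots> = sqrt (real n) powr p" by (simp add: powr_half_sqrt[symmetric] powr_powr)
  finally show ?thesis .
qed

lemma main_measurable: "th \<in> Theta \<Longrightarrow> main T n th \<in> borel_measurable P"
  unfolding main_def[abs_def] using window_obs_measurable[of th "quarter n"]
  by (intro borel_measurable_sum borel_measurable_diff) auto

text \<open>In each coordinate the sum is a centred stationary sum, covered by the mixing moment
  bound, plus the errors of replacing the limit by windows, whose total has a bounded
  moment.\<close>

lemma main_moment:
  assumes p: "2 \<le> p" "p < q"
  obtains C where "0 \<le> C"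
    "\<And>th T n. th \<in> Theta \<Longrightarrow> 1 \<le> n \<Longrightarrow> moment_le P p (\<lambda>w. norm (main T n th w)) (C * sqrt (real n) powr p)"
proof -
  obtain C where C: "0 \<le> C" "\<And>X s n. mix.mixing_class q c_mix X \<Longrightarrow>
     moment_le P p (\<lambda>w. \<Sum>t\<in>{s + 1..s + int n}. X t w) (C * sqrt (real n) powr p)"
    using mix.sum_moment_bound_all[OF p c_mix_nonneg] unfolding mix.sum_moment_bound_def by blast
  have pq: "0 < p" "p \<le> q" "0 \<le> C_forget powr q * c_env" using p c_env_nonneg by auto
  obtain E where E: "0 \<le> E" "\<And>n (I :: int set) D. 1 \<le> n \<Longrightarrow> card I \<le> n \<Longrightarrow>
      (\<And>t. t \<in> I \<Longrightarrow> moment_le P q (D t) (C_forget powr q * c_env * r_mix ^ quarter n)) \<Longrightarrow>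
      moment_le P p (\<lambda>w. \<Sum>t\<in>I. D t w) E"
    using mix.approximation_sum[OF pq] by blast
  define C' where "C' = real DIM('e) powr (p + 1) * (2 powr p * (C + E))"
  show thesis
  proof (rule that[of C'])
    show "0 \<le> C'" using C(1) E(1) by (simp add: C'_def)
    fix th T n assume th: "th \<in> Theta" and n: "1 \<le> (n::nat)"
    let ?k = "quarter n" and ?y = "sqrt (real n) powr p"
    have k: "?k \<noteq> 0" using quarter_pos[OF n] by simp
    have y: "1 \<le> ?y" using sqrt_powr_ge_one[OF n] p by simp
    have comp: "moment_le P p (\<lambda>w. \<bar>main T n th w \<bullet> e\<bar>) (2 powr p * (C + E) * ?y)" if e: "e \<in> Basis" for e
    proof -
      have e1: "norm e = 1" using e by simp
      let ?D = "\<lambda>t w. (window ?k th t (obs w) - Slim th (obs_from t w)) \<bullet> e"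
      have D: "moment_le P q (?D t) (C_forget powr q * c_env * r_mix ^ ?k)" for t
      proof (rule moment_le_AE_mono[OF forget_moment])
        show "?D t \<in> borel_measurable P"
          using window_obs_measurable[OF th, of ?k t] Slim_obs_measurable[OF th, of t] by measurable
        show "AE w in P. \<bar>?D t w\<bar> \<le> \<bar>C_forget * rate ^ ?k * env (Y t w)\<bar>"
          using obs_good
        proof eventually_elim
          case (elim w)
          have "\<bar>?D t w\<bar> \<le> norm (window ?k th t (obs w) - Slim th (obs_from t w))" by (rule inner_le_norm[OF e1])
          with window_error[OF th elim k, of t] show ?case by linarith
        qed
      qed (use q in simp)
      have m1: "moment_le P p (\<lambda>w. \<Sum>t\<in>core T n. centred e th t w) (C * ?y)"
      proof -
        have "moment_le P p (\<lambda>w. \<Sum>t\<in>core T n. centred e th t w) (C * sqrt (real (n - 4 * ?k)) powr p)"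
          unfolding core_def by (rule C(2)[OF centred_class[OF th e1]])
        then show ?thesis
          by (rule moment_le_mono) (use C(1) p in \<open>auto intro!: mult_left_mono powr_mono2\<close>)
      qed
      have m2: "moment_le P p (\<lambda>w. \<Sum>t\<in>core T n. ?D t w) E"
        by (rule E(2)[OF n card_core D])
      have "moment_le P p (\<lambda>w. (\<Sum>t\<in>core T n. centred e th t w) + (\<Sum>t\<in>core T n. ?D t w)) (2 powr p * (C * ?y + E))"
        using C(1) E(1) p y by (intro moment_le_add_double m1 m2) auto
      moreover have "(\<Sum>t\<in>core T n. centred e th t w) + (\<Sum>t\<in>core T n. ?D t w) = main T n th w \<bullet> e" for w
        by (simp add: main_def centred_def inner_sum_left sum.distrib[symmetric] inner_diff_left)
      ultimately have "moment_le P p (\<lambda>w. main T n th w \<bullet> e) (2 powr p * (C * ?y + E))" by simp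
      then have "moment_le P p (\<lambda>w. main T n th w \<bullet> e) (2 powr p * (C + E) * ?y)"
      proof (rule moment_le_mono)
        have "E * 1 \<le> E * ?y" using E(1) y by (intro mult_left_mono) auto
        then have "C * ?y + E \<le> (C + E) * ?y" by (simp add: distrib_right)
        then show "2 powr p * (C * ?y + E) \<le> 2 powr p * (C + E) * ?y" by (simp add: mult.assoc)
      qed
      from moment_leD[OF this] have "(\<lambda>w. \<bar>main T n th w \<bullet> e\<bar>) \<in> borel_measurable P" by measurable
      with \<open>moment_le P p (\<lambda>w. main T n th w \<bullet> e) (2 powr p * (C + E) * ?y)\<close> show ?thesis
        by (simp add: moment_le_def)
    qed
    have "moment_le P p (\<lambda>w. \<Sum>e\<in>Basis. \<bar>main T n th w \<bullet> e\<bar>) (real DIM('e) powr (p + 1) * (2 powr p * (C + E) * ?y))"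
      using C(1) E(1) p by (intro moment_le_sum comp) auto
    then have "moment_le P p (\<lambda>w. norm (main T n th w)) (real DIM('e) powr (p + 1) * (2 powr p * (C + E) * ?y))"
    proof (rule moment_le_AE_mono)
      show "AE w in P. \<bar>norm (main T n th w)\<bar> \<le> \<bar>\<Sum>e\<in>Basis. \<bar>main T n th w \<bullet> e\<bar>\<bar>"
        unfolding abs_norm_cancel
        by (intro AE_I2 order_trans[OF norm_le_l1 abs_ge_self])
    qed (use main_measurable[OF th, of T n] p in auto)
    then show "moment_le P p (\<lambda>w. norm (main T n th w)) (C' * ?y)" by (simp add: C'_def mult.assoc)
  qed
qed

text \<open>At the first time of a block the preceding state has the law \<open>chi\<close>, so the
  envelope must be taken under \<open>chi\<close> instead of \<open>lam\<close>.\<close>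

definition edge_env :: "'x measure \<Rightarrow> int \<Rightarrow> int \<Rightarrow> 'w \<Rightarrow> real" where
  "edge_env chi T t w = (if t = T + 1 then enn2real (envelope (chi \<Otimes>\<^sub>M lam) (Y t w)) else env (Y t w))"

text \<open>No parameter occurs here. The moment bound for this part therefore applies unchanged
  when the parameter is random and depends on the past.\<close>

definition remainder :: "'x measure \<Rightarrow> int \<Rightarrow> nat \<Rightarrow> 'w \<Rightarrow> real" where
  "remainder chi T n w = (\<Sum>t\<in>core T n. (C_forget * rate ^ quarter n) * env (Y t w))
     + (\<Sum>t\<in>edge T n. edge_env chi T t w + (1 + c_env))"

lemma edge_env_nonneg: "0 \<le> edge_env chi T t w"
  by (simp add: edge_env_def env_nonneg)

lemma remainder_moment:
  assumes p: "2 \<le> p" "p < q"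
  obtains C where "0 \<le> C"
    "\<And>chi T n. prob_space chi \<Longrightarrow> sets chi = sets lam \<Longrightarrow> 1 \<le> n \<Longrightarrow>
       moment_le P p (remainder chi T n) (C * sqrt (real n) powr p)"
proof -
  have pq: "0 < p" "p \<le> q" "0 \<le> C_forget powr q * c_env" using p c_env_nonneg by auto
  obtain E where E: "0 \<le> E" "\<And>n (I :: int set) D. 1 \<le> n \<Longrightarrow> card I \<le> n \<Longrightarrow>
      (\<And>t. t \<in> I \<Longrightarrow> moment_le P q (D t) (C_forget powr q * c_env * r_mix ^ quarter n)) \<Longrightarrow>
      moment_le P p (\<lambda>w. \<Sum>t\<in>I. D t w) E"
    using mix.approximation_sum[OF pq] by blast
  define C where "C = 2 powr p * (E + 4 powr (p + 1) * (1 + c_dev))"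
  show thesis
  proof (rule that[of C])
    show "0 \<le> C" using E(1) c_dev_nonneg by (simp add: C_def)
    fix chi T n assume chi: "prob_space chi" "sets chi = sets lam" and n: "1 \<le> (n::nat)"
    let ?y = "sqrt (real n) powr p"
    have y: "1 \<le> ?y" using sqrt_powr_ge_one[OF n] p by simp
    have m1: "moment_le P p (\<lambda>w. \<Sum>t\<in>core T n. (C_forget * rate ^ quarter n) * env (Y t w)) E"
      by (rule E(2)[OF n card_core forget_moment])
    have sf: "sigma_finite_measure (chi \<Otimes>\<^sub>M lam)"
      using prob_space_imp_sigma_finite[OF chi(1)] sigma_finite_lam by (rule sigma_finite_pair_measure)
    have ms: "sets (chi \<Otimes>\<^sub>M lam) = sets (lam \<Otimes>\<^sub>M lam)" by (rule sets_pair_measure_cong[OF chi(2) refl])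
    have ee: "moment_le P q (\<lambda>w. edge_env chi T t w) c_env" for t
      unfolding edge_env_def using env_moment envelope_moment(2)[OF ms sf, of t] by (cases "t = T + 1") auto
    have "moment_le P q (\<lambda>w. edge_env chi T t w + (1 + c_env)) c_dev" for t
      using moment_le_add_double[OF ee[of t] P.moment_le_const[of q "1 + c_env"]] c_env_nonneg q
      by (simp add: c_dev_def)
    then have "moment_le P p (\<lambda>w. edge_env chi T t w + (1 + c_env)) (1 + c_dev)" for t
      using pq c_dev_nonneg by (intro P.moment_le_lower_one[where p = q]) auto
    then have m2: "moment_le P p (\<lambda>w. \<Sum>t\<in>edge T n. edge_env chi T t w + (1 + c_env)) ((4 * real (quarter n)) powr (p + 1) * (1 + c_dev))"
      using c_dev_nonneg pq card_edge by (intro moment_le_sum) auto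
    have "moment_le P p (remainder chi T n) (2 powr p * (E + (4 * real (quarter n)) powr (p + 1) * (1 + c_dev)))"
      unfolding remainder_def[abs_def] using E(1) c_dev_nonneg pq by (intro moment_le_add_double m1 m2) auto
    then show "moment_le P p (remainder chi T n) (C * ?y)"
    proof (rule moment_le_mono)
      have E1: "E \<le> E * ?y" using E(1) y mult_left_mono[of 1 ?y E] by simp
      have "4 powr (p + 1) * (1 + c_dev) * real (quarter n) powr (p + 1) \<le> 4 powr (p + 1) * (1 + c_dev) * ?y"
        using quarter_powr[OF n p(1)] c_dev_nonneg by (intro mult_left_mono) auto
      then have "(4 * real (quarter n)) powr (p + 1) * (1 + c_dev) \<le> 4 powr (p + 1) * (1 + c_dev) * ?y"
        by (simp add: powr_mult mult_ac)
      from add_mono[OF E1 this] have "E + (4 * real (quarter n)) powr (p + 1) * (1 + c_dev) \<le> (E + 4 powr (p + 1) * (1 + c_dev)) * ?y"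
        by (simp only: distrib_right[of E])
      then have "2 powr p * (E + (4 * real (quarter n)) powr (p + 1) * (1 + c_dev)) \<le> 2 powr p * ((E + 4 powr (p + 1) * (1 + c_dev)) * ?y)"
        by (intro mult_left_mono) auto
      then show "2 powr p * (E + (4 * real (quarter n)) powr (p + 1) * (1 + c_dev)) \<le> C * ?y"
        by (simp only: C_def mult.assoc)
    qed
  qed
qed

text \<open>Core times are compared with their windows by forgetting. At the few edge times there is
  too little room for that, and the term and its limit mean are bounded separately by the envelope
  and \<open>1 + c_env\<close>.\<close>

lemma block_bound:
  assumes chi: "prob_space chi" "sets chi = sets lam" and n: "1 \<le> n" and w: "good (obs w)"
    and fin: "envelope (chi \<Otimes>\<^sub>M lam) (Y (T + 1) w) < \<infinity>" and th: "th \<in> Theta"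
  shows "real n * norm (Sbar lam m g S chi T n th (obs w) - Smean th) \<le> norm (main T n th w) + remainder chi T n w"
proof -
  let ?k = "quarter n" and ?t = "T + int n"
  let ?Phi = "\<lambda>t. Phi lam m g chi T th t ?t S (obs w)" and ?W = "\<lambda>t. window (quarter n) th t (obs w)"
  have k: "1 \<le> ?k" by (rule quarter_pos[OF n])
  have ms: "sets (chi \<Otimes>\<^sub>M lam) = sets (lam \<Otimes>\<^sub>M lam)" by (rule sets_pair_measure_cong[OF chi(2) refl])
  have inner: "norm (?Phi t - ?W t) \<le> (C_forget * rate ^ ?k) * env (Y t w)" if t: "t \<in> core T n" for t
  proof -
    note b = core_bounds[OF t]
    define a where "a = nat (t - 1 - T)"
    define l where "l = nat (?t - t)"
    have al: "t - 1 - int a = T" "t + int l = ?t" "?k \<le> a" "?k \<le> l" using b k by (auto simp: a_def l_def)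
    have "norm (?W t - Phi lam m g chi (t - 1 - int a) th t (t + int l) S (obs w))
        \<le> env (Y t w) * (2 * rate ^ ?k + sp / sm * rate ^ ?k)"
      unfolding window_def using al k good_AE[OF w, of t] env_nonneg[of "Y t w"]
      by (intro Phi_forget lam0 chi th w) auto
    then show ?thesis unfolding al(1,2) by (simp add: norm_minus_commute C_forget_def algebra_simps)
  qed
  have outer: "norm (?Phi t - Smean th) \<le> edge_env chi T t w + (1 + c_env)" if t: "t \<in> edge T n" for t
  proof -
    have b: "T + 1 \<le> t" "t \<le> ?t" using t by (auto simp: edge_def)
    define a where "a = nat (t - 1 - T)"
    define l where "l = nat (?t - t)"
    have al: "t - 1 - int a = T" "t + int l = ?t" "a = 0 \<longleftrightarrow> t = T + 1" using b by (auto simp: a_def l_def)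
    have V: "AE z in (if a = 0 then chi else lam) \<Otimes>\<^sub>M lam. norm (S (fst z, snd z, obs w t)) \<le> edge_env chi T t w"
    proof (cases "t = T + 1")
      case True
      have "AE z in chi \<Otimes>\<^sub>M lam. norm (S (fst z, snd z, Y t w)) \<le> enn2real (envelope (chi \<Otimes>\<^sub>M lam) (Y t w))"
        using fin True by (intro envelope_AE ms) auto
      then show ?thesis using True al(3) by (simp only: edge_env_def if_True simp_thms)
    next
      case False
      then show ?thesis using good_AE[OF w, of t] al(3) by (simp only: edge_env_def if_False simp_thms)
    qed
    have "norm (Phi lam m g chi (t - 1 - int a) th t (t + int l) S (obs w)) \<le> edge_env chi T t w"
      by (rule Phi_bound[OF chi th w V edge_env_nonneg])
    then have "norm (?Phi t) \<le> edge_env chi T t w" unfolding al(1,2) .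
    then show ?thesis using norm_triangle_ineq4[of "?Phi t" "Smean th"] Smean_bound[OF th] by linarith
  qed
  have "real n *\<^sub>R (Sbar lam m g S chi T n th (obs w) - Smean th) = (\<Sum>t\<in>{T + 1..?t}. ?Phi t) - real n *\<^sub>R Smean th"
    using n by (simp add: Sbar_def scaleR_diff_right)
  also have "\<dots> = (\<Sum>t\<in>{T + 1..?t}. ?Phi t - Smean th)" by (simp add: sum_subtractf scaleR_conv_of_real sum_constant_scaleR)
  also have "\<dots> = (\<Sum>t\<in>edge T n. ?Phi t - Smean th) + (\<Sum>t\<in>core T n. ?Phi t - Smean th)"
    unfolding edge_def by (rule sum.subset_diff[OF core_subset]) simp
  also have "(\<Sum>t\<in>core T n. ?Phi t - Smean th) = (\<Sum>t\<in>core T n. ?Phi t - ?W t) + main T n th w"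
    unfolding main_def by (simp add: sum.distrib[symmetric])
  finally have eq: "real n *\<^sub>R (Sbar lam m g S chi T n th (obs w) - Smean th)
      = (\<Sum>t\<in>edge T n. ?Phi t - Smean th) + ((\<Sum>t\<in>core T n. ?Phi t - ?W t) + main T n th w)" .
  have "real n * norm (Sbar lam m g S chi T n th (obs w) - Smean th)
      = norm (real n *\<^sub>R (Sbar lam m g S chi T n th (obs w) - Smean th))" by simp
  also have "\<dots> \<le> norm (\<Sum>t\<in>edge T n. ?Phi t - Smean th) + (norm (\<Sum>t\<in>core T n. ?Phi t - ?W t) + norm (main T n th w))"
    unfolding eq by (intro order_trans[OF norm_triangle_ineq] add_left_mono norm_triangle_ineq)
  also have "\<dots> \<le> (\<Sum>t\<in>edge T n. edge_env chi T t w + (1 + c_env))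
      + ((\<Sum>t\<in>core T n. (C_forget * rate ^ ?k) * env (Y t w)) + norm (main T n th w))"
    by (intro add_mono sum_norm_le inner outer order_refl)
  finally show ?thesis by (simp add: remainder_def)
qed

lemma block_bound_AE:
  assumes chi: "prob_space chi" "sets chi = sets lam" and n: "1 \<le> n"
  shows "AE w in P. \<forall>th\<in>Theta. real n * norm (Sbar lam m g S chi T n th (obs w) - Smean th)
    \<le> norm (main T n th w) + remainder chi T n w"
proof -
  have sf: "sigma_finite_measure (chi \<Otimes>\<^sub>M lam)"
    using prob_space_imp_sigma_finite[OF chi(1)] sigma_finite_lam by (rule sigma_finite_pair_measure)
  have ms: "sets (chi \<Otimes>\<^sub>M lam) = sets (lam \<Otimes>\<^sub>M lam)" by (rule sets_pair_measure_cong[OF chi(2) refl])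
  show ?thesis using obs_good envelope_moment(1)[OF ms sf, of "T + 1"]
    by eventually_elim (intro ballI block_bound[OF chi n])
qed

lemma Sbar_joint:
  assumes chi: "prob_space chi" "sets chi = sets lam"
  obtains Q where "Q \<in> borel_measurable (borel \<Otimes>\<^sub>M Pi\<^sub>M UNIV (\<lambda>_. mu))"
    "\<And>th y. th \<in> Theta \<Longrightarrow> Sbar lam m g S chi T n th y = Q (th, y)"
proof -
  have "\<forall>t\<in>{T + 1..T + int n}. \<exists>Q. Q \<in> borel_measurable (borel \<Otimes>\<^sub>M Pi\<^sub>M UNIV (\<lambda>_. mu)) \<and>
      (\<forall>th y. th \<in> Theta \<longrightarrow> Phi lam m g chi T th t (T + int n) S y = Q (th, y))"
  proof
    fix t assume "t \<in> {T + 1..T + int n}"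
    then have "T < t" "t \<le> T + int n" by auto
    from Phi_meas[OF chi this] show "\<exists>Q. Q \<in> borel_measurable (borel \<Otimes>\<^sub>M Pi\<^sub>M UNIV (\<lambda>_. mu)) \<and>
      (\<forall>th y. th \<in> Theta \<longrightarrow> Phi lam m g chi T th t (T + int n) S y = Q (th, y))" by metis
  qed
  then obtain Q where Q: "\<And>t. t \<in> {T + 1..T + int n} \<Longrightarrow> Q t \<in> borel_measurable (borel \<Otimes>\<^sub>M Pi\<^sub>M UNIV (\<lambda>_. mu))"
    "\<And>t th y. t \<in> {T + 1..T + int n} \<Longrightarrow> th \<in> Theta \<Longrightarrow> Phi lam m g chi T th t (T + int n) S y = Q t (th, y)"
    by metis
  show thesis
  proof (rule that[of "\<lambda>x. (\<Sum>t\<in>{T + 1..T + int n}. Q t x) /\<^sub>R real n"])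
    show "(\<lambda>x. (\<Sum>t\<in>{T + 1..T + int n}. Q t x) /\<^sub>R real n) \<in> borel_measurable (borel \<Otimes>\<^sub>M Pi\<^sub>M UNIV (\<lambda>_. mu))"
      using Q(1) by (intro borel_measurable_scaleR borel_measurable_sum) auto
  qed (use Q(2) in \<open>simp add: Sbar_def\<close>)
qed

lemma Sbar_measurable:
  assumes chi: "prob_space chi" "sets chi = sets lam" and U: "U \<in> borel_measurable P" "\<And>w. w \<in> space P \<Longrightarrow> U w \<in> Theta"
  shows "(\<lambda>w. Sbar lam m g S chi T n (U w) (obs w)) \<in> borel_measurable P"
proof -
  obtain Q where Q: "Q \<in> borel_measurable (borel \<Otimes>\<^sub>M Pi\<^sub>M UNIV (\<lambda>_. mu))"
    "\<And>th y. th \<in> Theta \<Longrightarrow> Sbar lam m g S chi T n th y = Q (th, y)" by (rule Sbar_joint[OF chi]) blast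
  have "(\<lambda>w. Q (U w, obs w)) \<in> borel_measurable P"
    by (rule measurable_compose[OF measurable_Pair[OF U(1) obs_measurable0] Q(1)])
  then show ?thesis using U(2) Q(2) by (subst measurable_cong[where g = "\<lambda>w. Q (U w, obs w)"]) auto
qed

section \<open>Deviation and almost sure convergence at a fixed parameter\<close>

lemma scaled_deviation:
  assumes "moment_le P p V (C * sqrt (real n) powr p)" "1 \<le> n" "0 \<le> p" "0 \<le> C"
  shows "moment_le P p (\<lambda>w. 1 / real n * V w) (C * (1 / sqrt (real n)) powr p)"
proof -
  have "moment_le P p (\<lambda>w. 1 / real n * V w) ((1 / real n) powr p * (C * sqrt (real n) powr p))"
    using assms by (intro moment_le_scale) auto
  moreover have "(1 / real n) powr p * (C * sqrt (real n) powr p) = C * (1 / sqrt (real n)) powr p"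
  proof -
    have "1 / real n * sqrt (real n) = 1 / sqrt (real n)" using assms(2) by (simp add: real_div_sqrt field_simps)
    then show ?thesis using powr_mult[of "1 / real n" "sqrt (real n)" p] by simp
  qed
  ultimately show ?thesis by simp
qed

lemma fixed_deviation:
  assumes p: "2 \<le> p" "p < q"
  obtains C where "0 \<le> C" "\<And>chi T n th. prob_space chi \<Longrightarrow> sets chi = sets lam \<Longrightarrow> 1 \<le> n \<Longrightarrow> th \<in> Theta \<Longrightarrow>
    moment_le P p (\<lambda>w. norm (Sbar lam m g S chi T n th (obs w) - Smean th)) (C * (1 / sqrt (real n)) powr p)"
proof -
  obtain C1 where C1: "0 \<le> C1"
    "\<And>th T n. th \<in> Theta \<Longrightarrow> 1 \<le> n \<Longrightarrow> moment_le P p (\<lambda>w. norm (main T n th w)) (C1 * sqrt (real n) powr p)"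
    using main_moment[OF p] by blast
  obtain C2 where C2: "0 \<le> C2"
    "\<And>chi T n. prob_space chi \<Longrightarrow> sets chi = sets lam \<Longrightarrow> 1 \<le> n \<Longrightarrow>
       moment_le P p (remainder chi T n) (C2 * sqrt (real n) powr p)"
    using remainder_moment[OF p] by blast
  show thesis
  proof (rule that[of "2 powr p * (C1 + C2)"])
    show "0 \<le> 2 powr p * (C1 + C2)" using C1 C2 by simp
    fix chi T n th assume chi: "prob_space chi" "sets chi = sets lam" and n: "1 \<le> (n::nat)" and th: "th \<in> Theta"
    have "moment_le P p (\<lambda>w. norm (main T n th w) + remainder chi T n w)
        (2 powr p * (C1 * sqrt (real n) powr p + C2 * sqrt (real n) powr p))"
      using C1 C2 p n th chi by (intro moment_le_add_double) auto
    then have "moment_le P p (\<lambda>w. norm (main T n th w) + remainder chi T n w) (2 powr p * (C1 + C2) * sqrt (real n) powr p)"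
      by (simp add: algebra_simps)
    from scaled_deviation[OF this n] have
      "moment_le P p (\<lambda>w. 1 / real n * (norm (main T n th w) + remainder chi T n w)) (2 powr p * (C1 + C2) * (1 / sqrt (real n)) powr p)"
      using p C1 C2 by simp
    then show "moment_le P p (\<lambda>w. norm (Sbar lam m g S chi T n th (obs w) - Smean th)) (2 powr p * (C1 + C2) * (1 / sqrt (real n)) powr p)"
    proof (rule moment_le_AE_mono)
      show "(\<lambda>w. norm (Sbar lam m g S chi T n th (obs w) - Smean th)) \<in> borel_measurable P"
        using Sbar_measurable[OF chi, of "\<lambda>_. th" T n] th by measurable
      show "AE w in P. \<bar>norm (Sbar lam m g S chi T n th (obs w) - Smean th)\<bar>
          \<le> \<bar>1 / real n * (norm (main T n th w) + remainder chi T n w)\<bar>"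
        using block_bound_AE[OF chi n, of T]
      proof eventually_elim
        case (elim w)
        then have "real n * norm (Sbar lam m g S chi T n th (obs w) - Smean th) \<le> norm (main T n th w) + remainder chi T n w"
          using th by blast
        then have "norm (Sbar lam m g S chi T n th (obs w) - Smean th) \<le> 1 / real n * (norm (main T n th w) + remainder chi T n w)"
          using n by (simp add: field_simps)
        then show ?case unfolding abs_norm_cancel by (rule order_trans[OF _ abs_ge_self])
      qed
    qed (use p in simp)
  qed
qed

text \<open>Since \<open>q\<close> exceeds 2, an exponent \<open>p\<close> strictly between 2 and
  \<open>q\<close> exists. The moments of the deviations are of order n^(-p/2), which is summable,
  so the p-th powers of the deviations form an almost surely convergent series.\<close>

theorem Sbar_convergence:
  assumes chi: "prob_space chi" "sets chi = sets lam" and th: "th \<in> Theta"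
  shows "AE w in P. (\<lambda>n. Sbar lam m g S chi T n th (obs w)) \<longlonglongrightarrow> Smean th"
proof -
  define p where "p = (2 + q) / 2"
  have p: "2 < p" "2 \<le> p" "p < q" using q by (auto simp: p_def)
  obtain C where C: "0 \<le> C" "\<And>chi T n th. prob_space chi \<Longrightarrow> sets chi = sets lam \<Longrightarrow> 1 \<le> n \<Longrightarrow> th \<in> Theta \<Longrightarrow>
    moment_le P p (\<lambda>w. norm (Sbar lam m g S chi T n th (obs w) - Smean th)) (C * (1 / sqrt (real n)) powr p)"
    using fixed_deviation[OF p(2,3)] by blast
  define dev where "dev n w = norm (Sbar lam m g S chi (T::int) (Suc n) th (obs w) - Smean th)" for n w
  have dm [measurable]: "dev n \<in> borel_measurable P" for n
    unfolding dev_def[abs_def] using Sbar_measurable[OF chi, of "\<lambda>_. th" T "Suc n"] th by measurable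
  have d: "(\<integral>\<^sup>+ w. ennreal (dev n w powr p) \<partial>P) \<le> ennreal (C * real (Suc n) powr (- p / 2))" for n
  proof -
    have "(1 / sqrt (real (Suc n))) powr p = real (Suc n) powr (- p / 2)"
      by (simp add: powr_half_sqrt[symmetric] powr_divide powr_powr powr_minus inverse_eq_divide)
    with C(2)[OF chi _ th, of "Suc n" T] show ?thesis by (simp add: moment_le_def dev_def)
  qed
  have sm: "summable (\<lambda>n. C * real (Suc n) powr (- p / 2))"
  proof (intro summable_mult)
    have "summable (\<lambda>n. real n powr (- p / 2))" using p summable_real_powr_iff[of "- p / 2"] by simp
    then show "summable (\<lambda>n. real (Suc n) powr (- p / 2))" by (subst summable_Suc_iff)
  qed
  have "(\<integral>\<^sup>+ w. (\<Sum>n. ennreal (dev n w powr p)) \<partial>P) = (\<Sum>n. \<integral>\<^sup>+ w. ennreal (dev n w powr p) \<partial>P)"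
    by (intro nn_integral_suminf) measurable
  also have "\<dots> \<le> (\<Sum>n. ennreal (C * real (Suc n) powr (- p / 2)))" by (intro suminf_le d) auto
  also have "\<dots> = ennreal (\<Sum>n. C * real (Suc n) powr (- p / 2))"
    using C(1) sm by (intro suminf_ennreal2) auto
  finally have fin: "(\<integral>\<^sup>+ w. (\<Sum>n. ennreal (dev n w powr p)) \<partial>P) \<noteq> \<infinity>" by (auto simp: top_unique)
  have "AE w in P. (\<Sum>n. ennreal (dev n w powr p)) \<noteq> \<infinity>"
    using fin by (intro nn_integral_noteq_infinite) measurable
  then show ?thesis
  proof eventually_elim
    case (elim w)
    then have "summable (\<lambda>n. dev n w powr p)" by (intro summable_suminf_not_top) auto
    then have "(\<lambda>n. dev n w powr p) \<longlonglongrightarrow> 0" by (rule summable_LIMSEQ_zero)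
    then have "(\<lambda>n. (dev n w powr p) powr (1 / p)) \<longlonglongrightarrow> 0 powr (1 / p)"
      using p by (intro tendsto_powr') auto
    then have "(\<lambda>n. dev n w) \<longlonglongrightarrow> 0" using p by (simp add: powr_powr dev_def)
    then have "(\<lambda>n. Sbar lam m g S chi T (Suc n) th (obs w) - Smean th) \<longlonglongrightarrow> 0"
      unfolding dev_def by (rule tendsto_norm_zero_cancel)
    then have "(\<lambda>n. Sbar lam m g S chi T (Suc n) th (obs w)) \<longlonglongrightarrow> Smean th" by (rule Lim_null[THEN iffD2])
    then show ?case by (rule LIMSEQ_imp_Suc)
  qed
qed

end

section \<open>Deviation at an adaptive parameter\<close>

lemma powr_le_truncate:
  assumes "0 \<le> v" "v \<le> W" "0 < M" "0 < p" "p \<le> (q::real)"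
  shows "v powr p \<le> min (v powr p) (M powr p) + M powr (p - q) * W powr q"
proof (cases "v \<le> M")
  case True
  then have "v powr p \<le> M powr p" using assms by (intro powr_mono2) auto
  then show ?thesis by simp
next
  case False
  then have v: "0 < v" "1 \<le> v / M" using assms by auto
  have "v powr p = M powr p * (v / M) powr p" using v assms by (simp add: powr_divide)
  also have "\<dots> \<le> M powr p * (v / M) powr q" using v assms by (intro mult_left_mono powr_mono) auto
  also have "\<dots> = M powr (p - q) * v powr q" using v assms by (simp add: powr_divide powr_diff)
  also have "\<dots> \<le> M powr (p - q) * W powr q" using v assms by (intro mult_left_mono powr_mono2) auto
  finally show ?thesis by (rule order_trans) simp
qed

lemma Lp_norm_le:
  assumes "moment_le P p (\<lambda>w. norm (Z w)) (c * e powr p)" "0 \<le> c" "0 < e" "0 < p"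
  shows "Lp_norm P p Z \<le> ennreal (c powr (1 / p) * e)"
proof -
  let ?I = "\<integral>\<^sup>+ w. ennreal (norm (Z w) powr p) \<partial>P"
  have I: "?I \<le> ennreal (c * e powr p)" using assms(1) by (simp add: moment_le_def)
  then have fin: "?I \<noteq> \<infinity>" by (auto simp: top_unique)
  have "enn2real ?I \<le> c * e powr p" using I assms by (intro enn2real_leI) auto
  then have "enn2real ?I powr (1 / p) \<le> (c * e powr p) powr (1 / p)"
    using assms by (intro powr_mono2) auto
  also have "\<dots> = c powr (1 / p) * e" using assms by (simp add: powr_mult powr_powr)
  finally show ?thesis using fin by (simp add: Lp_norm_def Let_def ennreal_leI)
qed

lemma Lp_norm_moment:
  assumes Z: "(\<lambda>w. norm (Z w)) \<in> borel_measurable P" and L: "Lp_norm P p Z \<le> ennreal L" "0 \<le> L" "0 < p"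
  shows "moment_le P p (\<lambda>w. norm (Z w)) (L powr p)"
proof -
  let ?I = "\<integral>\<^sup>+ w. ennreal (norm (Z w) powr p) \<partial>P"
  have fin: "?I \<noteq> \<infinity>"
  proof
    assume "?I = \<infinity>"
    then have "Lp_norm P p Z = \<infinity>" by (simp add: Lp_norm_def)
    with L(1) show False by (simp add: top_unique)
  qed
  then have "ennreal (enn2real ?I powr (1 / p)) \<le> ennreal L" using L(1) by (simp add: Lp_norm_def Let_def)
  then have "enn2real ?I powr (1 / p) \<le> L" using L(2) by simp
  then have "(enn2real ?I powr (1 / p)) powr p \<le> L powr p" using L by (intro powr_mono2) auto
  then have "enn2real ?I \<le> L powr p" using L by (simp add: powr_powr)
  then have "ennreal (enn2real ?I) \<le> ennreal (L powr p)" by (rule ennreal_leI)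
  then have "?I \<le> ennreal (L powr p)" using fin by (simp add: ennreal_enn2real_if)
  then show ?thesis using Z by (simp add: moment_le_def)
qed

context observed_model
begin

lemma Smean_param_measurable:
  assumes U: "U \<in> borel_measurable N" "\<And>w. w \<in> space N \<Longrightarrow> U w \<in> Theta"
  shows "(\<lambda>w. Smean (U w)) \<in> borel_measurable N"
proof -
  have T: "Theta \<in> sets borel" using Theta by (simp add: compact_imp_closed)
  have "(\<lambda>th. if th \<in> Theta then Smean th else 0) \<in> borel_measurable borel"
    using T Smean_continuous by (intro borel_measurable_continuous_on_if continuous_on_const)
  from measurable_compose[OF U(1) this] have "(\<lambda>w. if U w \<in> Theta then Smean (U w) else 0) \<in> borel_measurable N" .
  then show ?thesis using U(2) by (subst measurable_cong[where g = "\<lambda>w. if U w \<in> Theta then Smean (U w) else 0"]) auto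
qed

lemma main_param_measurable:
  assumes U: "U \<in> borel_measurable P" "\<And>w. w \<in> space P \<Longrightarrow> U w \<in> Theta"
  shows "(\<lambda>w. main T n (U w) w) \<in> borel_measurable P"
  unfolding main_def
proof (intro borel_measurable_sum borel_measurable_diff Smean_param_measurable U)
  fix t
  have "t - 1 - int (quarter n) < t" "t \<le> t + int (quarter n)" by auto
  from Phi_meas[OF lam0 this] obtain Q where Q: "Q \<in> borel_measurable (borel \<Otimes>\<^sub>M Pi\<^sub>M UNIV (\<lambda>_. mu))"
    "\<And>th y. th \<in> Theta \<Longrightarrow> window (quarter n) th t y = Q (th, y)" unfolding window_def by metis
  have "(\<lambda>w. Q (U w, obs w)) \<in> borel_measurable P"
    by (rule measurable_compose[OF measurable_Pair[OF U(1) obs_measurable0] Q(1)])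
  then show "(\<lambda>w. window (quarter n) (U w) t (obs w)) \<in> borel_measurable P"
    using U(2) Q(2) by (subst measurable_cong[where g = "\<lambda>w. Q (U w, obs w)"]) auto
qed

lemma main_le:
  assumes th: "th \<in> Theta" and w: "good (obs w)" and n: "1 \<le> n"
  shows "norm (main T n th w) \<le> (\<Sum>t\<in>core T n. env (Y t w) + (1 + c_env))"
  unfolding main_def
proof (rule sum_norm_le)
  fix t
  have "quarter n \<noteq> 0" using quarter_pos[OF n] by simp
  from window_bound[OF th w this, of t] Smean_bound[OF th] norm_triangle_ineq4[of "window (quarter n) th t (obs w)" "Smean th"]
  show "norm (window (quarter n) th t (obs w) - Smean th) \<le> env (Y t w) + (1 + c_env)" by linarith
qed

definition history :: "'w measure \<Rightarrow> int \<Rightarrow> 'w measure" where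
  "history H T = sigma (space P) (sets (gen {..T}) \<union> sets H)"

lemma history:
  assumes H: "subalgebra P H"
  shows "sets (history H T) = sigma_sets (space P) (sets (gen {..T}) \<union> sets H)" "subalgebra P (history H T)"
proof -
  have sub: "sets (gen {..T}) \<union> sets H \<subseteq> sets P" using H gen_subalgebra by (auto simp: subalgebra_def)
  then have pow: "sets (gen {..T}) \<union> sets H \<subseteq> Pow (space P)" using sets.sets_into_space by blast
  show s: "sets (history H T) = sigma_sets (space P) (sets (gen {..T}) \<union> sets H)"
    unfolding history_def by (rule sets_measure_of[OF pow])
  show "subalgebra P (history H T)"
    unfolding subalgebra_def s using space_measure_of[OF pow] sets.sigma_sets_subset[OF sub]
    by (simp add: history_def)
qed

text \<open>The p-th power is truncated at a polynomial level and rescaled to [0, 1], then decoupled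
  across the gap between \<open>T\<close> and the windows of the core. Undoing the scaling
  multiplies the mixing error beta^gap by that level, which leaves it bounded. Beyond the level, the
  parameter-free bound \<open>W\<close> is used with its moment of order \<open>q\<close>.\<close>

lemma adaptive_main_moment:
  assumes p: "2 \<le> p" "p < q"
  obtains C where "0 \<le> C" "\<And>H U T n. subalgebra P H \<Longrightarrow>
    (\<And>A C. A \<in> sets H \<Longrightarrow> C \<in> sets (gen UNIV) \<Longrightarrow> measure P (A \<inter> C) = measure P A * measure P C) \<Longrightarrow>
    U \<in> borel_measurable (history H T) \<Longrightarrow> (\<And>w. w \<in> space P \<Longrightarrow> U w \<in> Theta) \<Longrightarrow> 1 \<le> n \<Longrightarrow>
    moment_le P p (\<lambda>w. norm (main T n (U w) w)) (C * sqrt (real n) powr p)"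
proof -
  obtain C1 where C1: "0 \<le> C1"
    "\<And>th T n. th \<in> Theta \<Longrightarrow> 1 \<le> n \<Longrightarrow> moment_le P p (\<lambda>w. norm (main T n th w)) (C1 * sqrt (real n) powr p)"
    using main_moment[OF p] by blast
  \<comment> \<open>As in the recursion for fixed parameters: with the level M = n^e, the factor
    M^(p-q) cancels the crude order n^(q+1) of the moment of \<open>W\<close>.\<close>
  define e where "e = (q + 1) / (q - p)"
  obtain B where B: "0 \<le> B" "\<And>n. 1 \<le> n \<Longrightarrow> real n powr (e * p) * beta ^ quarter n \<le> B"
    using poly_times_exp_bounded[OF beta(3,4)] by blast
  show thesis
  proof (rule that[of "C1 + B + c_dev"])
    show "0 \<le> C1 + B + c_dev" using C1(1) B(1) c_dev_nonneg by simp
    fix H U T n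
    assume H: "subalgebra P H"
      "\<And>A C. A \<in> sets H \<Longrightarrow> C \<in> sets (gen UNIV) \<Longrightarrow> measure P (A \<inter> C) = measure P A * measure P C"
      and U: "U \<in> borel_measurable (history H T)" "\<And>w. w \<in> space P \<Longrightarrow> U w \<in> Theta" and n: "1 \<le> (n::nat)"
    let ?k = "quarter n" and ?y = "sqrt (real n) powr p"
    have y: "1 \<le> ?y" using sqrt_powr_ge_one[OF n] p by simp
    define M where "M = real n powr e"
    define K where "K = M powr p"
    have M: "0 < M" and K: "0 < K" using n by (auto simp: M_def K_def)
    obtain z where z: "integrable P z" "\<And>w. 0 \<le> z w" "(\<integral>w. z w \<partial>P) \<le> beta ^ ?k"
      "\<And>B. B \<in> sets (gen {T + int ?k..}) \<Longrightarrow>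
         AE w in P. \<bar>real_cond_exp P (gen {..T}) (indicator B) w - measure P B\<bar> \<le> z w"
      by (rule conditional_variation[where n = ?k and u = T]) blast
    have UP: "U \<in> borel_measurable P" by (rule measurable_from_subalg[OF history(2)[OF H(1)] U(1)])
    define f where "f th w = min (norm (main T n th w) powr p) K / K" for th w
    have mU: "(\<lambda>w. main T n (U w) w) \<in> borel_measurable P" by (rule main_param_measurable[OF UP U(2)])
    have fU: "(\<lambda>w. f (U w) w) \<in> borel_measurable P" unfolding f_def using mU by measurable
    have f01: "0 \<le> f th w" "f th w \<le> 1" for th w using K by (auto simp: f_def divide_le_eq)
    have "(\<integral>w. f (U w) w \<partial>P) \<le> C1 * ?y / K + (\<integral>w. z w \<partial>P)"
    proof (rule P.decouple[OF Theta U(1) U(2) history(2)[OF H(1)] gen_subalgebra z(1,2)])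
      show "\<bar>measure P (A \<inter> B) - measure P A * measure P B\<bar> \<le> (\<integral>w. indicator A w * z w \<partial>P)"
        if "A \<in> sets (history H T)" "B \<in> sets (gen {T + int ?k..})" for A B
        using that(1) unfolding history(1)[OF H(1)] by (intro joint_mixing[OF H z(1,4) _ that(2)])
      fix th assume th: "th \<in> Theta"
      have "main T n th \<in> borel_measurable (gen {T + int ?k..})"
        unfolding main_def[abs_def]
      proof (intro borel_measurable_sum borel_measurable_diff borel_measurable_const window_gen[OF th])
        fix t assume "t \<in> core T n"
        from core_bounds[OF this] show "{t - int ?k..t + int ?k} \<subseteq> {T + int ?k..}" by auto
      qed
      then show "f th \<in> borel_measurable (gen {T + int ?k..})" unfolding f_def[abs_def] by measurable
      have i1: "integrable P (\<lambda>w. \<bar>norm (main T n th w)\<bar> powr p)" by (rule moment_le_integrable[OF C1(2)[OF th n]])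
      have "(\<integral>w. f th w \<partial>P) \<le> (\<integral>w. \<bar>norm (main T n th w)\<bar> powr p / K \<partial>P)"
      proof (rule integral_mono)
        show "integrable P (f th)"
        proof (rule P.integrable_const_bound[of _ 1])
          show "f th \<in> borel_measurable P"
            unfolding f_def[abs_def] using main_measurable[OF th, of T n] by measurable
        qed (use f01 in auto)
      qed (use i1 K in \<open>auto simp: f_def intro!: divide_right_mono\<close>)
      also have "\<dots> = (\<integral>w. \<bar>norm (main T n th w)\<bar> powr p \<partial>P) / K" by simp
      also have "\<dots> \<le> C1 * ?y / K"
        using moment_le_integral[OF C1(2)[OF th n]] C1(1) K by (intro divide_right_mono) auto
      finally show "(\<integral>w. f th w \<partial>P) \<le> C1 * ?y / K" .
    next
      show "AE w in P. continuous_on Theta (\<lambda>th. f th w)"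
        using obs_good
      proof eventually_elim
        case (elim w)
        have "?k \<noteq> 0" using quarter_pos[OF n] by simp
        then have "continuous_on Theta (\<lambda>th. main T n th w)"
          unfolding main_def by (intro continuous_intros window_continuous[OF elim] Smean_continuous)
        then show ?case unfolding f_def using p K
          by (intro continuous_on_divide continuous_on_min continuous_on_powr' continuous_on_norm continuous_on_const) auto
      qed
      show "0 \<le> C1 * ?y / K" using C1(1) K by simp
    qed (use f01 fU in auto)
    then have Ef: "(\<integral>w. K * f (U w) w \<partial>P) \<le> C1 * ?y + B"
    proof -
      assume "(\<integral>w. f (U w) w \<partial>P) \<le> C1 * ?y / K + (\<integral>w. z w \<partial>P)"
      then have "(\<integral>w. f (U w) w \<partial>P) \<le> C1 * ?y / K + beta ^ ?k" using z(3) by linarith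
      then have "K * (\<integral>w. f (U w) w \<partial>P) \<le> K * (C1 * ?y / K + beta ^ ?k)" using K by (intro mult_left_mono) auto
      also have "\<dots> = C1 * ?y + K * beta ^ ?k" using K by (simp add: distrib_left)
      also have "K * beta ^ ?k \<le> B" using B(2)[OF n] by (simp add: K_def M_def powr_powr)
      finally show ?thesis by simp
    qed
    define W where "W w = (\<Sum>t\<in>core T n. env (Y t w) + (1 + c_env))" for w
    have W: "moment_le P q W (real n powr (q + 1) * c_dev)"
      unfolding W_def[abs_def] using env_plus_moment c_dev_nonneg q card_core[of T n]
      by (intro moment_le_sum) auto
    have W0: "0 \<le> W w" for w
      unfolding W_def using env_nonneg c_env_nonneg by (intro sum_nonneg add_nonneg_nonneg) auto
    have Wm [measurable]: "W \<in> borel_measurable P" by (rule moment_leD[OF W])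
    have Me: "M powr (p - q) * (real n powr (q + 1) * c_dev) = c_dev"
    proof -
      have "e * (p - q) = - (q + 1)" using p by (simp add: e_def field_simps)
      then have "M powr (p - q) = real n powr (- (q + 1))" by (simp add: M_def powr_powr)
      then have "M powr (p - q) * real n powr (q + 1) = 1" using n by (simp add: powr_add[symmetric])
      then show ?thesis by (simp add: mult.assoc[symmetric])
    qed
    have "(\<integral>\<^sup>+ w. ennreal (\<bar>norm (main T n (U w) w)\<bar> powr p) \<partial>P)
        \<le> (\<integral>\<^sup>+ w. ennreal (K * f (U w) w) + ennreal (M powr (p - q)) * ennreal (\<bar>W w\<bar> powr q) \<partial>P)"
    proof (rule nn_integral_mono_AE)
      show "AE w in P. ennreal (\<bar>norm (main T n (U w) w)\<bar> powr p)
          \<le> ennreal (K * f (U w) w) + ennreal (M powr (p - q)) * ennreal (\<bar>W w\<bar> powr q)"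
        using obs_good AE_space
      proof eventually_elim
        case (elim w)
        have "norm (main T n (U w) w) \<le> W w" unfolding W_def by (rule main_le[OF U(2)[OF elim(2)] elim(1) n])
        from powr_le_truncate[OF norm_ge_zero this M, of p q]
        have "norm (main T n (U w) w) powr p \<le> K * f (U w) w + M powr (p - q) * \<bar>W w\<bar> powr q"
          using p K W0[of w] by (simp add: f_def K_def)
        then show ?case using K f01[of "U w" w]
          by (simp add: ennreal_mult[symmetric] ennreal_plus[symmetric] ennreal_leI del: ennreal_plus)
      qed
    qed
    also have "\<dots> = (\<integral>\<^sup>+ w. ennreal (K * f (U w) w) \<partial>P) + ennreal (M powr (p - q)) * (\<integral>\<^sup>+ w. ennreal (\<bar>W w\<bar> powr q) \<partial>P)"
      using fU by (subst nn_integral_add) (auto simp: nn_integral_cmult)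
    also have "\<dots> \<le> ennreal (C1 * ?y + B) + ennreal (M powr (p - q)) * ennreal (real n powr (q + 1) * c_dev)"
    proof (intro add_mono mult_left_mono)
      have "integrable P (\<lambda>w. K * f (U w) w)"
        by (rule P.integrable_const_bound[of _ K]) (use f01 fU K in \<open>auto simp: abs_mult intro!: mult_left_le\<close>)
      then have "(\<integral>\<^sup>+ w. ennreal (K * f (U w) w) \<partial>P) = ennreal (\<integral>w. K * f (U w) w \<partial>P)"
        using K f01 by (intro nn_integral_eq_integral) auto
      then show "(\<integral>\<^sup>+ w. ennreal (K * f (U w) w) \<partial>P) \<le> ennreal (C1 * ?y + B)" using Ef by (simp add: ennreal_leI)
      show "(\<integral>\<^sup>+ w. ennreal (\<bar>W w\<bar> powr q) \<partial>P) \<le> ennreal (real n powr (q + 1) * c_dev)"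
        using W by (simp add: moment_le_def)
    qed auto
    also have "\<dots> = ennreal (C1 * ?y + B + c_dev)"
    proof -
      have "ennreal (M powr (p - q)) * ennreal (real n powr (q + 1) * c_dev) = ennreal c_dev"
        using c_dev_nonneg Me by (simp only: ennreal_mult[symmetric] powr_ge_zero mult_nonneg_nonneg)
      then show ?thesis using C1(1) B(1) c_dev_nonneg by (simp add: ennreal_plus)
    qed
    also have "\<dots> \<le> ennreal ((C1 + B + c_dev) * ?y)"
    proof (rule ennreal_leI)
      have "B \<le> B * ?y" "c_dev \<le> c_dev * ?y"
        using mult_left_mono[OF y B(1)] mult_left_mono[OF y c_dev_nonneg] by simp_all
      then show "C1 * ?y + B + c_dev \<le> (C1 + B + c_dev) * ?y" by (simp add: distrib_right)
    qed
    finally show "moment_le P p (\<lambda>w. norm (main T n (U w) w)) ((C1 + B + c_dev) * ?y)"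
      using mU by (simp add: moment_le_def)
  qed
qed

theorem adaptive_deviation:
  assumes p: "2 \<le> p" "p < q"
  obtains C where "0 \<le> C" "\<And>chi H U T n. prob_space chi \<Longrightarrow> sets chi = sets lam \<Longrightarrow> subalgebra P H \<Longrightarrow>
    (\<And>A C. A \<in> sets H \<Longrightarrow> C \<in> sets (gen UNIV) \<Longrightarrow> measure P (A \<inter> C) = measure P A * measure P C) \<Longrightarrow>
    U \<in> borel_measurable (history H T) \<Longrightarrow> (\<And>w. w \<in> space P \<Longrightarrow> U w \<in> Theta) \<Longrightarrow> 1 \<le> n \<Longrightarrow>
    moment_le P p (\<lambda>w. norm (Sbar lam m g S chi T n (U w) (obs w) - Smean (U w))) (C * (1 / sqrt (real n)) powr p)"
proof -
  obtain C1 where C1: "0 \<le> C1" "\<And>H U T n. subalgebra P H \<Longrightarrow>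
    (\<And>A C. A \<in> sets H \<Longrightarrow> C \<in> sets (gen UNIV) \<Longrightarrow> measure P (A \<inter> C) = measure P A * measure P C) \<Longrightarrow>
    U \<in> borel_measurable (history H T) \<Longrightarrow> (\<And>w. w \<in> space P \<Longrightarrow> U w \<in> Theta) \<Longrightarrow> 1 \<le> n \<Longrightarrow>
    moment_le P p (\<lambda>w. norm (main T n (U w) w)) (C1 * sqrt (real n) powr p)"
    by (rule adaptive_main_moment[OF p]) blast
  obtain C2 where C2: "0 \<le> C2"
    "\<And>chi T n. prob_space chi \<Longrightarrow> sets chi = sets lam \<Longrightarrow> 1 \<le> n \<Longrightarrow>
       moment_le P p (remainder chi T n) (C2 * sqrt (real n) powr p)"
    using remainder_moment[OF p] by blast
  show thesis
  proof (rule that[of "2 powr p * (C1 + C2)"])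
    show "0 \<le> 2 powr p * (C1 + C2)" using C1(1) C2(1) by simp
    fix chi H U T n
    assume chi: "prob_space chi" "sets chi = sets lam" and H: "subalgebra P H"
      "\<And>A C. A \<in> sets H \<Longrightarrow> C \<in> sets (gen UNIV) \<Longrightarrow> measure P (A \<inter> C) = measure P A * measure P C"
      and U: "U \<in> borel_measurable (history H T)" "\<And>w. w \<in> space P \<Longrightarrow> U w \<in> Theta" and n: "1 \<le> (n::nat)"
    have UP: "U \<in> borel_measurable P" by (rule measurable_from_subalg[OF history(2)[OF H(1)] U(1)])
    have p0: "0 < p" "0 \<le> p" using p by auto
    let ?y = "sqrt (real n) powr p"
    have "moment_le P p (\<lambda>w. norm (main T n (U w) w) + remainder chi T n w) (2 powr p * (C1 * ?y + C2 * ?y))"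
      by (rule moment_le_add_double[OF C1(2)[OF H U n] C2(2)[OF chi n]]) (use C1(1) C2(1) p0 in auto)
    then have "moment_le P p (\<lambda>w. norm (main T n (U w) w) + remainder chi T n w) (2 powr p * (C1 + C2) * ?y)"
      by (simp add: algebra_simps)
    from scaled_deviation[OF this n p0(2)] have
      "moment_le P p (\<lambda>w. 1 / real n * (norm (main T n (U w) w) + remainder chi T n w)) (2 powr p * (C1 + C2) * (1 / sqrt (real n)) powr p)"
      using C1(1) C2(1) by simp
    then show "moment_le P p (\<lambda>w. norm (Sbar lam m g S chi T n (U w) (obs w) - Smean (U w)))
        (2 powr p * (C1 + C2) * (1 / sqrt (real n)) powr p)"
    proof (rule moment_le_AE_mono)
      show "(\<lambda>w. norm (Sbar lam m g S chi T n (U w) (obs w) - Smean (U w))) \<in> borel_measurable P"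
        by (intro measurable_compose[OF _ borel_measurable_norm] borel_measurable_diff Sbar_measurable[OF chi UP U(2)] Smean_param_measurable[OF UP U(2)])
      show "AE w in P. \<bar>norm (Sbar lam m g S chi T n (U w) (obs w) - Smean (U w))\<bar>
          \<le> \<bar>1 / real n * (norm (main T n (U w) w) + remainder chi T n w)\<bar>"
        using block_bound_AE[OF chi n, of T] AE_space
      proof eventually_elim
        case (elim w)
        then have "real n * norm (Sbar lam m g S chi T n (U w) (obs w) - Smean (U w)) \<le> norm (main T n (U w) w) + remainder chi T n w"
          using U(2) by blast
        then have "norm (Sbar lam m g S chi T n (U w) (obs w) - Smean (U w)) \<le> 1 / real n * (norm (main T n (U w) w) + remainder chi T n w)"
          using n by (simp add: field_simps)
        then show ?case unfolding abs_norm_cancel by (rule order_trans[OF _ abs_ge_self])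
      qed
    qed (rule p0)
  qed
qed

text \<open>The triangle inequality through the exact block statistic. The approximation error is
  given at exponent \<open>q\<close>; it is lowered to \<open>p\<close> at the scale 1 / sqrt(N), so
  that the rate is kept.\<close>

theorem adaptive_Lp_bound:
  assumes p: "2 < p" "p < q"
    and chi: "\<And>n. prob_space (chi n)" "\<And>n. sets (chi n) = sets lam"
    and H: "\<And>n. subalgebra P (H n)" "\<And>n. P.indep_set (sets (H n)) (sets (gen UNIV))"
    and U: "\<And>n. U n \<in> borel_measurable (history (H n) (T n))" "\<And>n w. w \<in> space P \<Longrightarrow> U n w \<in> Theta"
    and N: "\<And>n::nat. 1 \<le> N n" and Z: "\<And>n. Z n \<in> borel_measurable P"
    and L: "0 \<le> L" "\<And>n. 1 \<le> n \<Longrightarrow> Lp_norm P q (\<lambda>w. Sbar lam m g S (chi n) (T n) (N n) (U n w) (obs w) - Z n w) \<le> ennreal (L / sqrt (real (N n)))"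
  obtains C where "\<And>n. 1 \<le> n \<Longrightarrow> Lp_norm P p (\<lambda>w. Z n w - Smean (U n w)) \<le> ennreal (C / sqrt (real (N n)))"
proof -
  have p2: "2 \<le> p" "0 < p" using p by auto
  obtain C where C: "0 \<le> C" "\<And>chi H U T n. prob_space chi \<Longrightarrow> sets chi = sets lam \<Longrightarrow> subalgebra P H \<Longrightarrow>
    (\<And>A C. A \<in> sets H \<Longrightarrow> C \<in> sets (gen UNIV) \<Longrightarrow> measure P (A \<inter> C) = measure P A * measure P C) \<Longrightarrow>
    U \<in> borel_measurable (history H T) \<Longrightarrow> (\<And>w. w \<in> space P \<Longrightarrow> U w \<in> Theta) \<Longrightarrow> 1 \<le> n \<Longrightarrow>
    moment_le P p (\<lambda>w. norm (Sbar lam m g S chi T n (U w) (obs w) - Smean (U w))) (C * (1 / sqrt (real n)) powr p)"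
    by (rule adaptive_deviation[OF p2(1) p(2)]) blast
  define K where "K = 2 powr p * ((1 + L powr q) + C)"
  have K: "0 \<le> K" using C(1) by (auto simp: K_def intro!: mult_nonneg_nonneg add_nonneg_nonneg)
  show thesis
  proof (rule that[of "K powr (1 / p)"])
    fix n :: nat assume n: "1 \<le> n"
    define s where "s = 1 / sqrt (real (N n))"
    have s: "0 < s" using N[of n] by (simp add: s_def)
    let ?B = "\<lambda>w. Sbar lam m g S (chi n) (T n) (N n) (U n w) (obs w)"
    have UP: "U n \<in> borel_measurable P" by (rule measurable_from_subalg[OF history(2)[OF H(1)] U(1)])
    have Bm: "?B \<in> borel_measurable P" by (rule Sbar_measurable[OF chi UP U(2)])
    have ind: "measure P (A \<inter> C) = measure P A * measure P C" if "A \<in> sets (H n)" "C \<in> sets (gen UNIV)" for A C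
      by (rule P.indep_setD[OF H(2) that])
    have m1: "moment_le P p (\<lambda>w. norm (?B w - Smean (U n w))) (C * s powr p)"
      unfolding s_def by (rule C(2)[OF chi H(1) ind U(1) U(2) N])
    have "moment_le P q (\<lambda>w. norm (?B w - Z n w)) ((L * s) powr q)"
    proof (rule Lp_norm_moment)
      show "(\<lambda>w. norm (?B w - Z n w)) \<in> borel_measurable P"
        by (intro measurable_compose[OF _ borel_measurable_norm] borel_measurable_diff Bm Z)
      show "Lp_norm P q (\<lambda>w. ?B w - Z n w) \<le> ennreal (L * s)" using L(2)[OF n] by (simp add: s_def)
    qed (use L(1) s q in auto)
    then have "moment_le P q (\<lambda>w. norm (?B w - Z n w)) (L powr q * s powr q)" by (simp add: powr_mult)
    from P.moment_le_lower_scaled[OF this p2(2) less_imp_le[OF p(2)] s]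
    have m2: "moment_le P p (\<lambda>w. norm (?B w - Z n w)) ((1 + L powr q) * s powr p)" by simp
    have "moment_le P p (\<lambda>w. norm (?B w - Z n w) + norm (?B w - Smean (U n w))) (2 powr p * ((1 + L powr q) * s powr p + C * s powr p))"
      by (rule moment_le_add_double[OF m2 m1]) (use C(1) p2 in \<open>auto intro!: mult_nonneg_nonneg add_nonneg_nonneg\<close>)
    then have "moment_le P p (\<lambda>w. norm (?B w - Z n w) + norm (?B w - Smean (U n w))) (K * s powr p)"
      by (simp add: K_def algebra_simps)
    then have "moment_le P p (\<lambda>w. norm (Z n w - Smean (U n w))) (K * s powr p)"
    proof (rule moment_le_AE_mono)
      show "(\<lambda>w. norm (Z n w - Smean (U n w))) \<in> borel_measurable P"
        by (intro measurable_compose[OF _ borel_measurable_norm] borel_measurable_diff Z Smean_param_measurable[OF UP U(2)])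
      have "norm (Z n w - Smean (U n w)) \<le> norm (?B w - Z n w) + norm (?B w - Smean (U n w))" for w
        using norm_triangle_ineq4[of "?B w - Smean (U n w)" "?B w - Z n w"] by simp
      then show "AE w in P. \<bar>norm (Z n w - Smean (U n w))\<bar> \<le> \<bar>norm (?B w - Z n w) + norm (?B w - Smean (U n w))\<bar>"
        unfolding abs_norm_cancel by (intro AE_I2 order_trans[OF _ abs_ge_self])
    qed (use p2 in simp)
    from Lp_norm_le[OF this K s p2(2)]
    show "Lp_norm P p (\<lambda>w. Z n w - Smean (U n w)) \<le> ennreal (K powr (1 / p) / sqrt (real (N n)))"
      by (simp add: s_def)
  qed
qed

text \<open>The argument is pathwise on good trajectories, so one null set serves all times,
  parameters and initial laws. The bound by the essential envelope is relaxed to the pointwise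
  supremum at the end.\<close>

theorem forgetting_limit:
  "AE w in P. \<forall>t::nat\<ge>1.
     (SUP (th, ch)\<in>Theta \<times> space (prob_algebra lam).
        ennreal (norm (Phi lam m g ch (- int t - 1) th 0 (int t) S (obs w) - Slim th (obs w))))
     \<le> ennreal (C_forget * rate ^ t) * sup_norm_at S (Y 0 w)"
  using obs_good
proof eventually_elim
  case (elim w)
  show ?case
  proof (intro allI impI SUP_least, clarify)
    fix t :: nat and th ch assume t: "1 \<le> t" and th: "th \<in> Theta" and ch: "ch \<in> space (prob_algebra lam)"
    have ch': "prob_space ch" "sets ch = sets lam" using ch by (auto simp: space_prob_algebra)
    have "norm (Phi lam m g ch (0 - 1 - int t) th 0 (0 + int t) S (obs w) - Slim th (obs_from 0 w))
        \<le> env (Y 0 w) * (2 * rate ^ t + sp / sm * rate ^ t)"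
      using t good_AE[OF elim, of 0] by (intro Phi_Slim ch' th elim) auto
    also have "\<dots> = (C_forget * rate ^ t) * env (Y 0 w)" by (simp add: C_forget_def algebra_simps)
    finally have "norm (Phi lam m g ch (0 - 1 - int t) th 0 (0 + int t) S (obs w) - Slim th (obs_from 0 w)) \<le> (C_forget * rate ^ t) * env (Y 0 w)" .
    then have "ennreal (norm (Phi lam m g ch (- int t - 1) th 0 (int t) S (obs w) - Slim th (obs w)))
        \<le> ennreal ((C_forget * rate ^ t) * env (Y 0 w))"
    proof (intro ennreal_leI)
      have "0 - 1 - int t = - int t - 1" by simp
      then show "norm (Phi lam m g ch (- int t - 1) th 0 (int t) S (obs w) - Slim th (obs w)) \<le> (C_forget * rate ^ t) * env (Y 0 w)"
        using \<open>norm (Phi lam m g ch (0 - 1 - int t) th 0 (0 + int t) S (obs w) - Slim th (obs_from 0 w)) \<le> (C_forget * rate ^ t) * env (Y 0 w)\<close>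
        by (simp only: add_0_left add_0_right)
    qed
    also have "\<dots> = ennreal (C_forget * rate ^ t) * ennreal (env (Y 0 w))"
      using env_nonneg C_forget_nonneg rate_bounds by (intro ennreal_mult) auto
    also have "ennreal (env (Y 0 w)) = envelope (lam \<Otimes>\<^sub>M lam) (Y 0 w)"
      using elim by (simp add: env_def good_def)
    also have "ennreal (C_forget * rate ^ t) * envelope (lam \<Otimes>\<^sub>M lam) (Y 0 w)
        \<le> ennreal (C_forget * rate ^ t) * sup_norm_at S (Y 0 w)"
      by (intro mult_left_mono envelope_le) simp
    finally show "ennreal (norm (Phi lam m g ch (- int t - 1) th 0 (int t) S (obs w) - Slim th (obs w)))
        \<le> ennreal (C_forget * rate ^ t) * sup_norm_at S (Y 0 w)" .
  qed
qed

end

text \<open>The finitely many ratios before the threshold are added to the constant.\<close>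

lemma bigo_pointwise:
  fixes f g :: "nat \<Rightarrow> real"
  assumes "f \<in> O(g)" "\<And>n. 0 \<le> f n" "\<And>n. 0 < g n"
  obtains c where "0 \<le> c" "\<And>n. f n \<le> c * g n"
proof -
  obtain c where c: "0 < c" "\<forall>\<^sub>F n in sequentially. norm (f n) \<le> c * norm (g n)"
    using assms(1) by (elim landau_o.bigE) auto
  then obtain N where N: "\<And>n. N \<le> n \<Longrightarrow> norm (f n) \<le> c * norm (g n)" unfolding eventually_sequentially by blast
  define d where "d = c + (\<Sum>k<N. f k / g k)"
  have nn: "0 \<le> f k / g k" for k using assms(2)[of k] assms(3)[of k] by simp
  show thesis
  proof (rule that[of d])
    show "0 \<le> d" unfolding d_def using c(1) nn by (intro add_nonneg_nonneg sum_nonneg) auto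
    fix n
    show "f n \<le> d * g n"
    proof (cases "N \<le> n")
      case True
      then have "f n \<le> c * g n" using N[of n] assms(2)[of n] assms(3)[of n] by simp
      also have "\<dots> \<le> d * g n"
        using assms(3)[of n] nn by (intro mult_right_mono) (auto simp: d_def intro!: sum_nonneg)
      finally show ?thesis .
    next
      case False
      then have "f n / g n \<le> (\<Sum>k<N. f k / g k)" using nn by (intro member_le_sum) auto
      then have "f n / g n \<le> d" using c(1) by (simp add: d_def)
      then show ?thesis using assms(3)[of n] by (simp add: divide_le_eq)
    qed
  qed
qed

theorem theorem4p1:
  fixes Theta :: "(real ^ 'q) set"
    and lam :: "'x::topological_space measure" and mu :: "'y::topological_space measure"
    and m :: "real ^ 'q \<Rightarrow> 'x \<Rightarrow> 'x \<Rightarrow> real" and g :: "real ^ 'q \<Rightarrow> 'x \<Rightarrow> 'y \<Rightarrow> real"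
    and P :: "'w measure" and Y :: "int \<Rightarrow> 'w \<Rightarrow> 'y"
    and phi :: "real ^ 'q \<Rightarrow> real" and psi :: "real ^ 'q \<Rightarrow> real ^ 'd"
    and S :: "'x \<times> 'x \<times> 'y \<Rightarrow> real ^ 'd"
    and D :: "(real ^ 'd) set" and thbar :: "real ^ 'd \<Rightarrow> real ^ 'q"
    and sigma_minus sigma_plus rho C0 beta pbar :: real
    and tau :: "nat \<Rightarrow> nat" and chi :: "nat \<Rightarrow> 'x measure" and H :: "nat \<Rightarrow> 'w measure"
    and theta :: "nat \<Rightarrow> 'w \<Rightarrow> real ^ 'q" and Stil :: "nat \<Rightarrow> 'w \<Rightarrow> real ^ 'd"
  assumes pbar: "pbar > 2"
    \<comment> \<open>model\<close>
    and Theta: "compact Theta"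
    and spaces: "space lam = UNIV" "space mu = UNIV"
    and lam: "finite_measure lam" and mu: "sigma_finite_measure mu"
    and m_dens: "\<And>th. th \<in> Theta \<Longrightarrow> transition_density lam lam (m th)"
    and g_dens: "\<And>th. th \<in> Theta \<Longrightarrow> transition_density lam mu (g th)"
    \<comment> \<open>observations\<close>
    and P: "prob_space P"
    and Y_meas: "\<And>k. Y k \<in> measurable P mu"
    \<comment> \<open>(1) exponential family\<close>
    and phi: "continuous_on Theta phi" and psi: "continuous_on Theta psi"
    and S_cont: "continuous_on UNIV S"
    and S_meas: "S \<in> borel_measurable (lam \<Otimes>\<^sub>M lam \<Otimes>\<^sub>M mu)"
    and mg_pos: "\<And>th x x' y. th \<in> Theta \<Longrightarrow> 0 < m th x x' \<and> 0 < g th x' y"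
    and exp_family: "\<And>th x x' y. th \<in> Theta \<Longrightarrow>
           ln (m th x x') + ln (g th x' y) = phi th + S (x, x', y) \<bullet> psi th"
    and D: "open D" "convex hull (range S) \<subseteq> D"
    and thbar_cont: "continuous_on D thbar"
    and thbar_max: "\<And>s th. s \<in> D \<Longrightarrow>
           is_arg_max (\<lambda>t. phi t + s \<bullet> psi t) (\<lambda>t. t \<in> Theta) th \<longleftrightarrow> th = thbar s"
    \<comment> \<open>(2) strong mixing\<close>
    and sigma_minus: "0 < sigma_minus"
    and mixing: "\<And>th x x'. th \<in> Theta \<Longrightarrow> sigma_minus \<le> m th x x' \<and> m th x x' \<le> sigma_plus"
    and rho: "rho = 1 - sigma_minus / sigma_plus"
    \<comment> \<open>(3) moments\<close>
    and moments: "finite_expectation P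
           (\<lambda>w. SUP (x, x')\<in>UNIV. ennreal (norm (S (x, x', Y 0 w)) powr pbar))"
    \<comment> \<open>(4) observations\<close>
    and stationary: "stationary_process P mu Y"
    and beta_range: "0 \<le> C0" "C0 < 1" "0 < beta" "beta < 1"
    and beta_mix: "\<And>n. beta_mixing P mu Y n \<le> ennreal (C0 * beta ^ n)"
    and log_b: "finite_expectation P
           (\<lambda>w. abs_log (b_minus lam g Theta (Y 0 w)) + abs_log (b_plus lam g Theta (Y 0 w)))"
  shows "\<exists>(C::real) (Slim :: real ^ 'q \<Rightarrow> (int \<Rightarrow> 'y) \<Rightarrow> real ^ 'd).
      \<comment> \<open>(i)\<close>
      (\<forall>th\<in>Theta. Slim th \<in> borel_measurable (Pi\<^sub>M UNIV (\<lambda>_. mu))) \<and>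
      (AE w in P. \<forall>t::nat\<ge>1.
         (SUP (th, ch)\<in>Theta \<times> space (prob_algebra lam).
            ennreal (norm (Phi lam m g ch (- int t - 1) th 0 (int t) S (\<lambda>k. Y k w)
                           - Slim th (\<lambda>k. Y k w))))
         \<le> ennreal (C * rho ^ t) * sup_norm_at S (Y 0 w)) \<and>
      (\<forall>th\<in>Theta. integrable P (\<lambda>w. Slim th (\<lambda>k. Y k w))) \<and>
      (let Sbar_lim = (\<lambda>th. \<integral>w. Slim th (\<lambda>k. Y k w) \<partial>P) in
        \<comment> \<open>(ii)\<close>
        continuous_on Theta Sbar_lim \<and>
        (\<forall>T>0::int. \<forall>th\<in>Theta. \<forall>ch\<in>space (prob_algebra lam).
           AE w in P. (\<lambda>t. Sbar lam m g S ch T t th (\<lambda>k. Y k w)) \<longlonglongrightarrow> Sbar_lim th) \<and>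
        \<comment> \<open>(iii)\<close>
        (boem P mu Y lam Theta D thbar tau chi H theta Stil \<longrightarrow>
         (\<exists>c a. c > 0 \<and> a > 1 \<and> (\<forall>n\<ge>1. int (tau n) = \<lfloor>c * real n powr a\<rfloor>) \<and>
           (\<exists>b\<ge>(a + 1) / (2 * a).
              (\<forall>n\<ge>1. Lp_norm P pbar (\<lambda>w. block_stat lam m g S Y tau chi theta n w - Stil n w) < \<infinity>) \<and>
              (\<lambda>n. enn2real (Lp_norm P pbar
                     (\<lambda>w. block_stat lam m g S Y tau chi theta n w - Stil n w)))
                \<in> O(\<lambda>n. real (tau (Suc n)) powr (- b)))) \<longrightarrow>
         (\<forall>p. 2 < p \<and> p < pbar \<longrightarrow>
           (\<exists>C'::real. \<forall>n\<ge>1.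
              Lp_norm P p (\<lambda>w. Stil n w - Sbar_lim (theta n w))
                \<le> ennreal (C' / sqrt (real (tau (Suc n))))))))"
proof -
  \<comment> \<open>\<open>D\<close> contains a value of \<open>S\<close>, and the maximiser
    attached to that point lies in \<open>Theta\<close>. A parameter is needed to compare the two
    mixing constants and to see that \<open>lam\<close> is not null.\<close>
  have "Theta \<noteq> {}"
  proof -
    have "S undefined \<in> D" using D(2) hull_subset[of "range S" convex] by blast
    then have "is_arg_max (\<lambda>t. phi t + S undefined \<bullet> psi t) (\<lambda>t. t \<in> Theta) (thbar (S undefined))"
      using thbar_max by blast
    then show ?thesis by (auto simp: is_arg_max_def)
  qed
  then obtain th0 where th0: "th0 \<in> Theta" by blast
  have thbar_in: "thbar s \<in> Theta" if "s \<in> D" for s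
    using thbar_max[OF that, of "thbar s"] by (simp add: is_arg_max_def)
  have sm: "sigma_minus \<le> sigma_plus" using mixing[OF th0, of undefined undefined] by linarith
  obtain cphi where cphi: "\<And>th. th \<in> Theta \<Longrightarrow> phi th \<le> cphi"
  proof -
    have "bounded (phi ` Theta)" by (rule compact_imp_bounded[OF compact_continuous_image[OF phi Theta]])
    then obtain B where "\<forall>x\<in>phi ` Theta. norm x \<le> B" unfolding bounded_iff by blast
    then show thesis by (intro that[of B]) (auto simp: abs_le_iff)
  qed
  obtain cpsi where cpsi: "\<And>th. th \<in> Theta \<Longrightarrow> norm (psi th) \<le> cpsi"
  proof -
    have "bounded (psi ` Theta)" by (rule compact_imp_bounded[OF compact_continuous_image[OF psi Theta]])
    then show thesis unfolding bounded_iff using that by blast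
  qed
  \<comment> \<open>A bounded density that integrates to one cannot live on a null measure.\<close>
  have lam_pos: "emeasure lam UNIV \<noteq> 0"
  proof
    assume "emeasure lam UNIV = 0"
    moreover have "(\<integral>\<^sup>+ b. ennreal (m th0 undefined b) \<partial>lam) \<le> (\<integral>\<^sup>+ b. ennreal sigma_plus \<partial>lam)"
      using mixing[OF th0] by (intro nn_integral_mono ennreal_leI) auto
    ultimately have "(\<integral>\<^sup>+ b. ennreal (m th0 undefined b) \<partial>lam) = 0"
      using spaces(1) by simp
    moreover have "(\<integral>\<^sup>+ b. ennreal (m th0 undefined b) \<partial>lam) = 1"
      using m_dens[OF th0] spaces(1) by (simp add: transition_density_def)
    ultimately show False by simp
  qed
  interpret prob_space P by (rule P)
  interpret O: observed_model lam mu Theta m g phi psi S sigma_minus sigma_plus cphi cpsi P Y pbar C0 beta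
  proof (intro observed_model.intro smoothing_model.intro finite_state.intro finite_state_axioms.intro
      smoothing_model_axioms.intro observed_model_axioms.intro)
    show "finite_measure lam" "space lam = UNIV" "emeasure lam UNIV \<noteq> 0" "space mu = UNIV" by fact+
    show "prob_space P" by (rule P)
    show "(\<lambda>(x, x'). m th x x') \<in> borel_measurable (lam \<Otimes>\<^sub>M lam)" if "th \<in> Theta" for th
      using m_dens[OF that] by (simp add: transition_density_def)
    show "(\<lambda>(x, y). g th x y) \<in> borel_measurable (lam \<Otimes>\<^sub>M mu)" if "th \<in> Theta" for th
      using g_dens[OF that] by (simp add: transition_density_def)
  qed (use Theta phi psi cphi cpsi S_meas mg_pos exp_family sigma_minus sm mixing Y_meas pbar moments stationary beta_range beta_mix in auto)
  have rate: "O.rate = rho" by (simp add: O.rate_def rho)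
  show ?thesis
  proof (intro exI[of _ O.C_forget] exI[of _ O.Slim] conjI ballI)
    show "O.Slim th \<in> borel_measurable (Pi\<^sub>M UNIV (\<lambda>_. mu))" if "th \<in> Theta" for th
      by (rule O.Slim_measurable[OF that])
    show "AE w in P. \<forall>t::nat\<ge>1.
         (SUP (th, ch)\<in>Theta \<times> space (prob_algebra lam).
            ennreal (norm (Phi lam m g ch (- int t - 1) th 0 (int t) S (\<lambda>k. Y k w)
                           - O.Slim th (\<lambda>k. Y k w))))
         \<le> ennreal (O.C_forget * rho ^ t) * sup_norm_at S (Y 0 w)"
      using O.forgetting_limit unfolding rate .
    show "integrable P (\<lambda>w. O.Slim th (\<lambda>k. Y k w))" if "th \<in> Theta" for th
      using O.Slim_integrable[OF that, of 0] by simp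
    show "let Sbar_lim = (\<lambda>th. \<integral>w. O.Slim th (\<lambda>k. Y k w) \<partial>P) in
        continuous_on Theta Sbar_lim \<and>
        (\<forall>T>0::int. \<forall>th\<in>Theta. \<forall>ch\<in>space (prob_algebra lam).
           AE w in P. (\<lambda>t. Sbar lam m g S ch T t th (\<lambda>k. Y k w)) \<longlonglongrightarrow> Sbar_lim th) \<and>
        (boem P mu Y lam Theta D thbar tau chi H theta Stil \<longrightarrow>
         (\<exists>c a. c > 0 \<and> a > 1 \<and> (\<forall>n\<ge>1. int (tau n) = \<lfloor>c * real n powr a\<rfloor>) \<and>
           (\<exists>b\<ge>(a + 1) / (2 * a).
              (\<forall>n\<ge>1. Lp_norm P pbar (\<lambda>w. block_stat lam m g S Y tau chi theta n w - Stil n w) < \<infinity>) \<and>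
              (\<lambda>n. enn2real (Lp_norm P pbar
                     (\<lambda>w. block_stat lam m g S Y tau chi theta n w - Stil n w)))
                \<in> O(\<lambda>n. real (tau (Suc n)) powr (- b)))) \<longrightarrow>
         (\<forall>p. 2 < p \<and> p < pbar \<longrightarrow>
           (\<exists>C'::real. \<forall>n\<ge>1.
              Lp_norm P p (\<lambda>w. Stil n w - Sbar_lim (theta n w))
                \<le> ennreal (C' / sqrt (real (tau (Suc n)))))))"
      unfolding Let_def O.Smean_def[symmetric]
    proof (intro conjI allI ballI impI)
      show "continuous_on Theta O.Smean" by (rule O.Smean_continuous)
      show "AE w in P. (\<lambda>t. Sbar lam m g S ch T t th (\<lambda>k. Y k w)) \<longlonglongrightarrow> O.Smean th"
        if "th \<in> Theta" "ch \<in> space (prob_algebra lam)" for T th ch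
        using that by (intro O.Sbar_convergence) (auto simp: space_prob_algebra)
      fix p
      assume boem: "boem P mu Y lam Theta D thbar tau chi H theta Stil" and p: "2 < p \<and> p < pbar"
        and "\<exists>c a. c > 0 \<and> a > 1 \<and> (\<forall>n\<ge>1. int (tau n) = \<lfloor>c * real n powr a\<rfloor>) \<and>
           (\<exists>b\<ge>(a + 1) / (2 * a).
              (\<forall>n\<ge>1. Lp_norm P pbar (\<lambda>w. block_stat lam m g S Y tau chi theta n w - Stil n w) < \<infinity>) \<and>
              (\<lambda>n. enn2real (Lp_norm P pbar
                     (\<lambda>w. block_stat lam m g S Y tau chi theta n w - Stil n w)))
                \<in> O(\<lambda>n. real (tau (Suc n)) powr (- b)))"
      then obtain a b :: real where ab: "a > 1" "b \<ge> (a + 1) / (2 * a)"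
        and fin: "\<And>n. n \<ge> 1 \<Longrightarrow> Lp_norm P pbar (\<lambda>w. block_stat lam m g S Y tau chi theta n w - Stil n w) < \<infinity>"
        and bigo: "(\<lambda>n. enn2real (Lp_norm P pbar (\<lambda>w. block_stat lam m g S Y tau chi theta n w - Stil n w)))
                \<in> O(\<lambda>n. real (tau (Suc n)) powr (- b))"
        by blast
      have tau: "1 \<le> tau (Suc n)" for n
      proof -
        have "0 < tau (Suc n)" using boem unfolding boem_def by simp
        then show ?thesis by simp
      qed
      have chi: "prob_space (chi n)" "sets (chi n) = sets lam" for n
      proof -
        have "chi n \<in> space (prob_algebra lam)" using boem unfolding boem_def by blast
        then show "prob_space (chi n)" "sets (chi n) = sets lam" by (auto simp: space_prob_algebra)
      qed
      have Hsub: "subalgebra P (H n)" and Hind: "indep_set (sets (H n)) (sets (process_sigma P mu Y UNIV))" for n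
        using boem unfolding boem_def by blast+
      have joint: "joint_sigma P mu Y tau H n = O.history (H n) (int (block_time tau n))" for n
        by (simp add: joint_sigma_def O.history_def)
      have theta_meas: "theta n \<in> borel_measurable (O.history (H n) (int (block_time tau n)))" for n
        using boem unfolding boem_def joint by blast
      have Stil_D: "Stil n w \<in> D" "theta (Suc n) w = thbar (Stil n w)" if "w \<in> space P" for n w
        using boem that unfolding boem_def by blast+
      have theta0: "theta 0 w \<in> Theta" if "w \<in> space P" for w
        using boem that unfolding boem_def by blast
      have theta_in: "theta n w \<in> Theta" if "w \<in> space P" for n w
        using theta0[OF that] thbar_in Stil_D[OF that] by (cases n) auto
      have Stil_meas: "Stil n \<in> borel_measurable P" for n
      proof (rule measurable_from_subalg[OF O.history(2)[OF Hsub]])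
        show "Stil n \<in> borel_measurable (O.history (H (Suc n)) (int (block_time tau (Suc n))))"
          using boem unfolding boem_def joint by blast
      qed
      have stat: "block_stat lam m g S Y tau chi theta n w
          = Sbar lam m g S (chi n) (int (block_time tau n)) (tau (Suc n)) (theta n w) (\<lambda>k. Y k w)" for n w
        by (simp add: block_stat_def)
      have tau_pos: "0 < real (tau (Suc n)) powr (- b)" for n using tau[of n] by simp
      obtain L where L: "0 \<le> L"
        "\<And>n. enn2real (Lp_norm P pbar (\<lambda>w. block_stat lam m g S Y tau chi theta n w - Stil n w)) \<le> L * real (tau (Suc n)) powr (- b)"
        using bigo_pointwise[OF bigo enn2real_nonneg tau_pos] by blast
      \<comment> \<open>(a + 1) / (2 a) is 1/2 + 1 / (2 a), so the Monte Carlo error is at most of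
        the order tau^(-1/2) of the statistical error.\<close>
      have "1 / 2 \<le> (a + 1) / (2 * a)" using ab(1) by (simp add: field_simps)
      then have b: "1 / 2 \<le> b" using ab(2) by linarith
      have approx: "Lp_norm P pbar (\<lambda>w. Sbar lam m g S (chi n) (int (block_time tau n)) (tau (Suc n)) (theta n w) (\<lambda>k. Y k w) - Stil n w)
          \<le> ennreal (L / sqrt (real (tau (Suc n))))" if n: "1 \<le> n" for n
      proof -
        have "real (tau (Suc n)) powr (- b) \<le> real (tau (Suc n)) powr (- (1 / 2))"
          using b tau[of n] by (intro powr_mono) auto
        also have "\<dots> = 1 / sqrt (real (tau (Suc n)))"
          by (simp add: powr_minus powr_half_sqrt inverse_eq_divide)
        finally have "L * real (tau (Suc n)) powr (- b) \<le> L * (1 / sqrt (real (tau (Suc n))))"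
          using L(1) by (rule mult_left_mono)
        then have "enn2real (Lp_norm P pbar (\<lambda>w. block_stat lam m g S Y tau chi theta n w - Stil n w)) \<le> L / sqrt (real (tau (Suc n)))"
          using L(2)[of n] by simp
        then have "ennreal (enn2real (Lp_norm P pbar (\<lambda>w. block_stat lam m g S Y tau chi theta n w - Stil n w)))
            \<le> ennreal (L / sqrt (real (tau (Suc n))))" by (rule ennreal_leI)
        then show ?thesis using fin[OF n] unfolding stat by simp
      qed
      obtain C where "\<And>n. 1 \<le> n \<Longrightarrow> Lp_norm P p (\<lambda>w. Stil n w - O.Smean (theta n w)) \<le> ennreal (C / sqrt (real (tau (Suc n))))"
        by (rule O.adaptive_Lp_bound[OF conjunct1[OF p] conjunct2[OF p], where chi = chi and H = H and U = theta
              and T = "\<lambda>n. int (block_time tau n)" and N = "\<lambda>n. tau (Suc n)" and Z = Stil and L = L])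
          (use chi Hsub Hind theta_meas theta_in tau Stil_meas L(1) approx in blast)+
      then show "\<exists>C'::real. \<forall>n\<ge>1. Lp_norm P p (\<lambda>w. Stil n w - O.Smean (theta n w)) \<le> ennreal (C' / sqrt (real (tau (Suc n))))"
        by blast
    qed
  qed
qed

end
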